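(* Let $W=(W(x))_{x\in\mathbb{R}}$ be a two-sided Brownian motion and let $B=(B(t))_{t\ge0}$ be a Brownian motion independent of $W$. Let $$X(t)=S_W^{-1}\big(B(T_{W,B}^{-1}(t))\big),\qquad t\ge0,$$ and let $\int_0^t\dot W(X(s))\,ds$ be defined by $$\int_0^t\dot W(X(s))\,ds=\int_{-\infty}^\infty e^{-W(x)}L_B(\xi,S_W(x))\,W(d^ox)\Big|_{\xi=T_{W,B}^{-1}(t)}.$$ Then there is a Brownian motion $\mathcal{B}$, determined by $$\mathcal{B}(t)=\int_0^t e^{-W\circ S_W^{-1}\circ B\circ T_{W,B}^{-1}(s)}\,dB\circ T_{W,B}^{-1}(s),\qquad t\ge 0,$$ which is independent of $W$, such that $(X,\mathcal{B})$ is a weak solution (in the sense defined in the context) to the equation $X(t)=-\frac12\int_0^t\dot W(X(s))\,ds+\mathcal{B}(t)$, $X(0)=0$.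
   Context: **Basic objects.** $W(0)=0$; $S_W(x)=\int_0^x e^{W(z)}\,dz$, $x\in\mathbb{R}$; $T_{W,B}(t)=\int_0^t e^{-2W(S_W^{-1}(B(s)))}\,ds$. $L_B(t,x)$ is the (jointly continuous) local time of $B$: $\int_0^t f(B(s))\,ds=\int_{\mathbb{R}}f(x)L_B(t,x)\,dx$ for all bounded continuous $f$. The integral $\int\cdots dB\circ T_{W,B}^{-1}(s)$ is the stochastic integral with respect to the time-changed Brownian motion $s\mapsto B(T_{W,B}^{-1}(s))$, a semimartingale for the time-changed filtration $(\mathcal{F}^{B,W}_{T^{-1}_{W,B}(t)})_{t\ge0}$, where $\mathcal{F}^{B,W}_t=\mathcal{F}^B_t\vee\sigma(W(x),x\in\mathbb{R})$ (with usual augmentation) and $\mathcal{F}^B$ is the filtration generated by $B$. **Stratonovich integral.** Let $g:\mathbb{R}\times\mathbb{R}\to\mathbb{R}$ be deterministic and continuous, with $u\mapsto g(x,u)$ continuously differentiable for each $x$, and such that for some $\lambda>1/2$, $\theta>0$ and, for each compact interval $K$, constants $c_1(K),c_2(K)>0$, one has for all $u\in\mathbb{R}$: $\sup_{x\in K}|g(x,u)|\le c_1(K)e^{\theta|u|}$ and $\sup_{x\ne y\in K}\frac{|g(x,u)-g(y,u)|}{|x-y|^\lambda}+\sup_{x\ne y\in K}\frac{|\partial_u g(x,u)-\partial_u g(y,u)|}{|x-y|^\lambda}\le c_2(K)e^{\theta|u|}$. Put $\widetilde W(x)=W(-x)$, $x\ge0$. For fixed $\xi\ge0$ define $\int_a^b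 g(x,W(x))L_B(\xi,S_W(x))\,W(dx)$ as the usual Itô integral if $0\le a\le b$ (with respect to the filtration $\sigma(W(z):0\le z\le x)\vee\sigma(B)$), as $-\int_{|b|}^{|a|}g(-x,W(-x))L_B(\xi,S_W(-x))\,\widetilde W(dx)$ (Itô integral with respect to $\widetilde W$) if $a\le b\le0$, and as $\int_a^0+\int_0^b$ if $a\le0\le b$. Then $$\int_a^b g(x,W(x))L_B(\xi,S_W(x))\,W(d^ox):=\int_a^b g(x,W(x))L_B(\xi,S_W(x))\,W(dx)+\frac12\int_a^b \mathrm{sgn}(x)\,\partial_u g(x,W(x))L_B(\xi,S_W(x))\,dx,$$ and $\int_{-\infty}^\infty:=\lim_{a\to\infty}\int_{-a}^a$ (almost sure limit; taken in a version continuous in $\xi$). In the claim, $g(x,u)=e^{-u}$. **Weak solution.** A pair $(X,\mathcal{B})$ is a weak solution on a filtered probability space $(\Omega,\mathcal{F},(\mathcal{F}_t)_{t\ge0},P)$ carrying $W$ if: (i) $X$ is a continuous process adapted to $(\mathcal{F}_t)$ and $\mathcal{B}$ is an $(\mathcal{F}_t)$-Brownian motion independent of $W$; (ii) there exists a Brownian motion $B$ independent of $W$ such that $X(t)=S_W^{-1}(B(T_{W,B}^{-1}(t)))$ for all $t\ge0$; (iii) for every $t\ge0$ the integral $\int_0^t\dot W(X(s))\,ds$ is well defined by the formula in the claim; (iv) for every $t\ge0$, $X(t)=\mathcal{B}(t)-\frac12\int_0^t\dot W(X(s))\,ds$ almost surely. When no filtration is mentioned, "weak solution" means weak solution with respect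 to some filtration. *)

theory Defs
  imports "HOL-Probability.Probability"
begin

text \<open>
  Processes are functions \<open>X :: real \<Rightarrow> 'a \<Rightarrow> real\<close>; one-parameter processes and filtrations are only
  looked at for times \<open>t \<ge> 0\<close>, two-sided ones on the whole line. Path properties are required almost
  surely. All notions below are meant for a complete probability space.
\<close>

section \<open>Sigma-algebras and filtrations\<close>

definition process_sigma :: "'a measure \<Rightarrow> 'i set \<Rightarrow> ('i \<Rightarrow> 'a \<Rightarrow> real) \<Rightarrow> 'a measure" where
  "process_sigma M I X =
     sigma (space M) (\<Union>i\<in>I. sets (vimage_algebra (space M) (X i) borel))"

definition sigma_join :: "'a measure \<Rightarrow> 'a measure \<Rightarrow> 'a measure \<Rightarrow> 'a measure" where
  "sigma_join M G H = sigma (space M) (sets G \<union> sets H)"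

definition natural_filtration :: "'a measure \<Rightarrow> (real \<Rightarrow> 'a \<Rightarrow> real) \<Rightarrow> real \<Rightarrow> 'a measure" where
  "natural_filtration M X t = process_sigma M {0..t} X"

definition usual_augmentation :: "'a measure \<Rightarrow> (real \<Rightarrow> 'a measure) \<Rightarrow> real \<Rightarrow> 'a measure" where
  "usual_augmentation M F t =
     sigma (space M) (\<Inter>s\<in>{t<..}. sets (sigma (space M) (sets (F s) \<union> null_sets M)))"

definition is_filtration :: "'a measure \<Rightarrow> (real \<Rightarrow> 'a measure) \<Rightarrow> bool" where
  "is_filtration M F \<longleftrightarrow> (\<forall>t\<ge>0. subalgebra M (F t)) \<and>
     (\<forall>s t. 0 \<le> s \<longrightarrow> s \<le> t \<longrightarrow> sets (F s) \<subseteq> sets (F t))"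

definition continuous_adapted ::
    "'a measure \<Rightarrow> (real \<Rightarrow> 'a measure) \<Rightarrow> (real \<Rightarrow> 'a \<Rightarrow> real) \<Rightarrow> bool" where
  "continuous_adapted M F X \<longleftrightarrow> (\<forall>t\<ge>0. X t \<in> borel_measurable (F t)) \<and>
     (AE \<omega> in M. continuous_on {0..} (\<lambda>t. X t \<omega>))"

definition independent_processes ::
    "'a measure \<Rightarrow> 'i set \<Rightarrow> ('i \<Rightarrow> 'a \<Rightarrow> real) \<Rightarrow> 'j set \<Rightarrow> ('j \<Rightarrow> 'a \<Rightarrow> real) \<Rightarrow> bool" where
  "independent_processes M I X J Y \<longleftrightarrow>
     prob_space.indep_set M (sets (process_sigma M I X)) (sets (process_sigma M J Y))"

section \<open>Brownian motion\<close>

definition brownian_motion_wrt ::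
    "'a measure \<Rightarrow> (real \<Rightarrow> 'a measure) \<Rightarrow> (real \<Rightarrow> 'a \<Rightarrow> real) \<Rightarrow> bool" where
  "brownian_motion_wrt M F B \<longleftrightarrow> is_filtration M F \<and> continuous_adapted M F B \<and>
     (AE \<omega> in M. B 0 \<omega> = 0) \<and>
     (\<forall>s t. 0 \<le> s \<longrightarrow> s < t \<longrightarrow>
        prob_space.indep_set M (sets (F s))
          (sets (vimage_algebra (space M) (\<lambda>\<omega>. B t \<omega> - B s \<omega>) borel)) \<and>
        distributed M lborel (\<lambda>\<omega>. B t \<omega> - B s \<omega>) (normal_density 0 (sqrt (t - s))))"

definition brownian_motion :: "'a measure \<Rightarrow> (real \<Rightarrow> 'a \<Rightarrow> real) \<Rightarrow> bool" where
  "brownian_motion M B \<longleftrightarrow> brownian_motion_wrt M (natural_filtration M B) B"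

definition two_sided_brownian_motion :: "'a measure \<Rightarrow> (real \<Rightarrow> 'a \<Rightarrow> real) \<Rightarrow> bool" where
  "two_sided_brownian_motion M W \<longleftrightarrow>
     brownian_motion M W \<and> brownian_motion M (\<lambda>x. W (- x)) \<and>
     independent_processes M {0..} W {0..} (\<lambda>x. W (- x))"

section \<open>Stochastic integrals\<close>

text \<open>
  An elementary predictable process is
  \<open>\<zeta> 1\<^bsub>{0}\<^esub> + (\<Sum>i<n. \<eta> i 1\<^bsub>(\<tau> i, \<tau> (i+1)]\<^esub>)\<close> with deterministic \<open>0 \<le> \<tau> 0 \<le> \<dots> \<le> \<tau> n\<close>.
\<close>

datatype 'a elementary_data =
  Elementary (init: "'a \<Rightarrow> real") (steps: nat) (grid: "nat \<Rightarrow> real") (coef: "nat \<Rightarrow> 'a \<Rightarrow> real")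

definition elementary_predictable ::
    "'a measure \<Rightarrow> (real \<Rightarrow> 'a measure) \<Rightarrow> 'a elementary_data \<Rightarrow> bool" where
  "elementary_predictable M F e \<longleftrightarrow>
     init e \<in> borel_measurable (F 0) \<and> bounded (init e ` space M) \<and> 0 \<le> grid e 0 \<and>
     (\<forall>i<steps e. grid e i \<le> grid e (Suc i) \<and>
        coef e i \<in> borel_measurable (F (grid e i)) \<and> bounded (coef e i ` space M))"

definition elementary_process :: "'a elementary_data \<Rightarrow> real \<Rightarrow> 'a \<Rightarrow> real" where
  "elementary_process e t \<omega> = init e \<omega> * indicator {0} t +
     (\<Sum>i<steps e. coef e i \<omega> * indicator {grid e i<..grid e (Suc i)} t)"

definition elementary_integral ::
    "'a elementary_data \<Rightarrow> (real \<Rightarrow> 'a \<Rightarrow> real) \<Rightarrow> real \<Rightarrow> 'a \<Rightarrow> real" where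
  "elementary_integral e X t \<omega> =
     (\<Sum>i<steps e. coef e i \<omega> * (X (min (grid e (Suc i)) t) \<omega> - X (min (grid e i) t) \<omega>))"

text \<open>Uniform convergence on compact time intervals in probability.\<close>

definition ucp_converges ::
    "'a measure \<Rightarrow> (nat \<Rightarrow> real \<Rightarrow> 'a \<Rightarrow> real) \<Rightarrow> (real \<Rightarrow> 'a \<Rightarrow> real) \<Rightarrow> bool" where
  "ucp_converges M Y Z \<longleftrightarrow>
     (\<forall>t\<ge>0. \<forall>\<epsilon>>0.
        (\<lambda>n. measure M {\<omega> \<in> space M. \<exists>s\<in>{0..t}. \<bar>Y n s \<omega> - Z s \<omega>\<bar> > \<epsilon>}) \<longlonglongrightarrow> 0)"

text \<open>
  \<open>I\<close> is a version of \<open>(\<integral>\<^sub>0\<^sup>t H dX)\<^bsub>t\<ge>0\<^esub>\<close>, for continuous adapted \<open>H\<close> and \<open>X\<close>: the integral is the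
  continuous extension, in the ucp topology, of the elementary integral. Since elementary processes
  converging to \<open>0\<close> may be added to any approximating sequence, the last clause also says that
  \<open>X\<close> is a good integrator, i.e. a semimartingale, for \<open>F\<close>.
\<close>

definition stochastic_integral ::
    "'a measure \<Rightarrow> (real \<Rightarrow> 'a measure) \<Rightarrow> (real \<Rightarrow> 'a \<Rightarrow> real) \<Rightarrow> (real \<Rightarrow> 'a \<Rightarrow> real) \<Rightarrow>
      (real \<Rightarrow> 'a \<Rightarrow> real) \<Rightarrow> bool" where
  "stochastic_integral M F X H I \<longleftrightarrow>
     is_filtration M F \<and>
     continuous_adapted M F X \<and> continuous_adapted M F H \<and> continuous_adapted M F I \<and>
     (\<exists>e. (\<forall>n. elementary_predictable M F (e n)) \<and>
        ucp_converges M (\<lambda>n. elementary_process (e n)) H) \<and>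
     (\<forall>e. (\<forall>n. elementary_predictable M F (e n)) \<longrightarrow>
        ucp_converges M (\<lambda>n. elementary_process (e n)) H \<longrightarrow>
        ucp_converges M (\<lambda>n. elementary_integral (e n) X) I)"

section \<open>Pathwise objects: local time, scale function, clock\<close>

text \<open>On paths without a jointly continuous occupation density (a null event for Brownian paths)
  the value of \<open>local_time\<close> is arbitrary.\<close>

definition continuous_occupation_density :: "(real \<Rightarrow> real) \<Rightarrow> (real \<Rightarrow> real \<Rightarrow> real) \<Rightarrow> bool" where
  "continuous_occupation_density b l \<longleftrightarrow>
     continuous_on ({0..} \<times> UNIV) (\<lambda>(t, x). l t x) \<and>
     (\<forall>t\<ge>0. \<forall>f :: real \<Rightarrow> real. continuous_on UNIV f \<longrightarrow> bounded (range f) \<longrightarrow>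
        (LBINT s=0..ereal t. f (b s)) = (\<integral>x. f x * l t x \<partial>lborel))"

definition local_time :: "(real \<Rightarrow> real) \<Rightarrow> real \<Rightarrow> real \<Rightarrow> real" where
  "local_time b = (SOME l. continuous_occupation_density b l)"

definition scale :: "(real \<Rightarrow> real) \<Rightarrow> real \<Rightarrow> real" where
  "scale w x = (LBINT z=0..ereal x. exp (w z))"

definition clock :: "(real \<Rightarrow> real) \<Rightarrow> (real \<Rightarrow> real) \<Rightarrow> real \<Rightarrow> real" where
  "clock w b t = (LBINT s=0..ereal t. exp (- 2 * w (inv (scale w) (b s))))"

text \<open>For almost every Brownian environment and path, \<open>scale w\<close> is a bijection of the line and
  \<open>clock w b\<close> one of \<open>[0,\<infinity>)\<close>; otherwise the inverses are arbitrary off the range.\<close>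

definition clock_inv :: "(real \<Rightarrow> real) \<Rightarrow> (real \<Rightarrow> real) \<Rightarrow> real \<Rightarrow> real" where
  "clock_inv w b = inv_into {0..} (clock w b)"

text \<open>The same objects for random paths, i.e. \<open>S\<^sub>W\<close>, \<open>T\<^bsub>W,B\<^esub>\<^sup>-\<^sup>1\<close> and \<open>L\<^sub>B\<close>.\<close>

abbreviation scale_of :: "(real \<Rightarrow> 'a \<Rightarrow> real) \<Rightarrow> 'a \<Rightarrow> real \<Rightarrow> real" where
  "scale_of W \<omega> \<equiv> scale (\<lambda>x. W x \<omega>)"

abbreviation clock_inv_of ::
    "(real \<Rightarrow> 'a \<Rightarrow> real) \<Rightarrow> (real \<Rightarrow> 'a \<Rightarrow> real) \<Rightarrow> real \<Rightarrow> 'a \<Rightarrow> real" where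
  "clock_inv_of W B t \<omega> \<equiv> clock_inv (\<lambda>x. W x \<omega>) (\<lambda>s. B s \<omega>) t"

abbreviation local_time_of :: "(real \<Rightarrow> 'a \<Rightarrow> real) \<Rightarrow> 'a \<Rightarrow> real \<Rightarrow> real \<Rightarrow> real" where
  "local_time_of B \<omega> \<equiv> local_time (\<lambda>s. B s \<omega>)"

definition time_changed ::
    "(real \<Rightarrow> 'a \<Rightarrow> real) \<Rightarrow> (real \<Rightarrow> 'a \<Rightarrow> real) \<Rightarrow> real \<Rightarrow> 'a \<Rightarrow> real" where
  "time_changed W B t \<omega> = B (clock_inv_of W B t \<omega>) \<omega>"

definition brox_diffusion ::
    "(real \<Rightarrow> 'a \<Rightarrow> real) \<Rightarrow> (real \<Rightarrow> 'a \<Rightarrow> real) \<Rightarrow> real \<Rightarrow> 'a \<Rightarrow> real" where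
  "brox_diffusion W B t \<omega> = inv (scale_of W \<omega>) (B (clock_inv_of W B t \<omega>) \<omega>)"

definition driving_filtration ::
    "'a measure \<Rightarrow> (real \<Rightarrow> 'a \<Rightarrow> real) \<Rightarrow> (real \<Rightarrow> 'a \<Rightarrow> real) \<Rightarrow> real \<Rightarrow> 'a measure" where
  "driving_filtration M W B = usual_augmentation M
     (\<lambda>t. sigma_join M (natural_filtration M B t) (process_sigma M UNIV W))"

definition time_changed_filtration ::
    "'a measure \<Rightarrow> (real \<Rightarrow> 'a \<Rightarrow> real) \<Rightarrow> (real \<Rightarrow> 'a \<Rightarrow> real) \<Rightarrow> real \<Rightarrow> 'a measure" where
  "time_changed_filtration M W B t =
     filtration.pre_sigma (space M) (driving_filtration M W B) (clock_inv_of W B t)"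

section \<open>The Stratonovich integral with respect to the environment\<close>

definition strat_integrand :: "(real \<Rightarrow> real \<Rightarrow> real) \<Rightarrow> bool" where
  "strat_integrand g \<longleftrightarrow>
     continuous_on UNIV (\<lambda>(x, u). g x u) \<and>
     (\<forall>x. (\<forall>u. g x differentiable (at u)) \<and> continuous_on UNIV (deriv (g x))) \<and>
     (\<exists>\<mu>>1/2. \<exists>\<theta>>0. \<forall>\<alpha> \<beta>. \<exists>c1>0. \<exists>c2>0. \<forall>u.
        (\<forall>x\<in>{\<alpha>..\<beta>}. \<bar>g x u\<bar> \<le> c1 * exp (\<theta> * \<bar>u\<bar>)) \<and>
        (\<forall>x\<in>{\<alpha>..\<beta>}. \<forall>y\<in>{\<alpha>..\<beta>}. \<forall>x'\<in>{\<alpha>..\<beta>}. \<forall>y'\<in>{\<alpha>..\<beta>}. x \<noteq> y \<longrightarrow> x' \<noteq> y' \<longrightarrow>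
           \<bar>g x u - g y u\<bar> / \<bar>x - y\<bar> powr \<mu> +
           \<bar>deriv (g x') u - deriv (g y') u\<bar> / \<bar>x' - y'\<bar> powr \<mu> \<le> c2 * exp (\<theta> * \<bar>u\<bar>)))"

text \<open>
  \<open>Iplus\<close> and \<open>Iminus\<close> are the Ito integral processes over \<open>[0,x]\<close> with respect to \<open>W\<close> and to its
  reflection \<open>x \<mapsto> W (- x)\<close>, for the fixed local-time parameter \<open>\<xi>\<close>. The filtration for the
  reflected integral is the one generated by the reflected environment and all of \<open>B\<close>.
\<close>

definition environment_filtration ::
    "'a measure \<Rightarrow> (real \<Rightarrow> 'a \<Rightarrow> real) \<Rightarrow> (real \<Rightarrow> 'a \<Rightarrow> real) \<Rightarrow> real \<Rightarrow> 'a measure" where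
  "environment_filtration M V B = usual_augmentation M
     (\<lambda>x. sigma_join M (natural_filtration M V x) (process_sigma M {0..} B))"

definition ito_halves ::
    "'a measure \<Rightarrow> (real \<Rightarrow> 'a \<Rightarrow> real) \<Rightarrow> (real \<Rightarrow> 'a \<Rightarrow> real) \<Rightarrow> (real \<Rightarrow> real \<Rightarrow> real) \<Rightarrow> real \<Rightarrow>
      (real \<Rightarrow> 'a \<Rightarrow> real) \<Rightarrow> (real \<Rightarrow> 'a \<Rightarrow> real) \<Rightarrow> bool" where
  "ito_halves M W B g \<xi> Iplus Iminus \<longleftrightarrow>
     stochastic_integral M (environment_filtration M W B) W
       (\<lambda>x \<omega>. g x (W x \<omega>) * local_time_of B \<omega> \<xi> (scale_of W \<omega> x)) Iplus \<and>
     stochastic_integral M (environment_filtration M (\<lambda>x. W (- x)) B) (\<lambda>x. W (- x))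
       (\<lambda>x \<omega>. g (- x) (W (- x) \<omega>) * local_time_of B \<omega> \<xi> (scale_of W \<omega> (- x))) Iminus"

text \<open>The Ito integral over \<open>[a,b]\<close>, \<open>a \<le> b\<close>, assembled from its two halves.\<close>

definition two_sided_ito ::
    "(real \<Rightarrow> 'a \<Rightarrow> real) \<Rightarrow> (real \<Rightarrow> 'a \<Rightarrow> real) \<Rightarrow> real \<Rightarrow> real \<Rightarrow> 'a \<Rightarrow> real" where
  "two_sided_ito Iplus Iminus a b \<omega> =
     (if 0 \<le> a then Iplus b \<omega> - Iplus a \<omega>
      else if b \<le> 0 then - (Iminus \<bar>a\<bar> \<omega> - Iminus \<bar>b\<bar> \<omega>)
      else - (Iminus \<bar>a\<bar> \<omega> - Iminus 0 \<omega>) + (Iplus b \<omega> - Iplus 0 \<omega>))"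

definition strat_integral ::
    "(real \<Rightarrow> 'a \<Rightarrow> real) \<Rightarrow> (real \<Rightarrow> 'a \<Rightarrow> real) \<Rightarrow> (real \<Rightarrow> real \<Rightarrow> real) \<Rightarrow> real \<Rightarrow>
      (real \<Rightarrow> 'a \<Rightarrow> real) \<Rightarrow> (real \<Rightarrow> 'a \<Rightarrow> real) \<Rightarrow> real \<Rightarrow> real \<Rightarrow> 'a \<Rightarrow> real" where
  "strat_integral W B g \<xi> Iplus Iminus a b \<omega> =
     two_sided_ito Iplus Iminus a b \<omega> +
     1 / 2 * (LBINT x=ereal a..ereal b.
       sgn x * deriv (g x) (W x \<omega>) * local_time_of B \<omega> \<xi> (scale_of W \<omega> x))"

text \<open>\<open>J \<xi>\<close> is the integral over the whole line, in a version continuous in \<open>\<xi> \<ge> 0\<close>; continuity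
  makes it meaningful to insert a random \<open>\<xi>\<close>.\<close>

definition strat_line_integral ::
    "'a measure \<Rightarrow> (real \<Rightarrow> 'a \<Rightarrow> real) \<Rightarrow> (real \<Rightarrow> 'a \<Rightarrow> real) \<Rightarrow> (real \<Rightarrow> real \<Rightarrow> real) \<Rightarrow>
      (real \<Rightarrow> 'a \<Rightarrow> real) \<Rightarrow> bool" where
  "strat_line_integral M W B g J \<longleftrightarrow> strat_integrand g \<and>
     (\<forall>\<xi>\<ge>0. \<exists>Iplus Iminus. ito_halves M W B g \<xi> Iplus Iminus \<and>
        (AE \<omega> in M. ((\<lambda>a. strat_integral W B g \<xi> Iplus Iminus (- a) a \<omega>) \<longlongrightarrow> J \<xi> \<omega>) at_top)) \<and>
     (AE \<omega> in M. continuous_on {0..} (\<lambda>\<xi>. J \<xi> \<omega>))"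

text \<open>\<open>D t\<close> is the integral over \<open>[0,t]\<close> of the white noise \<open>dW/dx\<close> along \<open>X = brox_diffusion W B\<close>.\<close>

definition noise_integral ::
    "'a measure \<Rightarrow> (real \<Rightarrow> 'a \<Rightarrow> real) \<Rightarrow> (real \<Rightarrow> 'a \<Rightarrow> real) \<Rightarrow> (real \<Rightarrow> 'a \<Rightarrow> real) \<Rightarrow> bool" where
  "noise_integral M W B D \<longleftrightarrow>
     (\<exists>J. strat_line_integral M W B (\<lambda>x u. exp (- u)) J \<and>
        (\<forall>t\<ge>0. \<forall>\<omega>\<in>space M. D t \<omega> = J (clock_inv_of W B t \<omega>) \<omega>))"

section \<open>Weak solutions\<close>

definition weak_solution ::
    "'a measure \<Rightarrow> (real \<Rightarrow> 'a measure) \<Rightarrow> (real \<Rightarrow> 'a \<Rightarrow> real) \<Rightarrow> (real \<Rightarrow> 'a \<Rightarrow> real) \<Rightarrow>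
      (real \<Rightarrow> 'a \<Rightarrow> real) \<Rightarrow> bool" where
  "weak_solution M F W X \<B> \<longleftrightarrow>
     is_filtration M F \<and> continuous_adapted M F X \<and>
     brownian_motion_wrt M F \<B> \<and> independent_processes M {0..} \<B> UNIV W \<and>
     (\<exists>B. brownian_motion M B \<and> independent_processes M {0..} B UNIV W \<and>
        (AE \<omega> in M. \<forall>t\<ge>0. X t \<omega> = brox_diffusion W B t \<omega>) \<and>
        (\<exists>D. noise_integral M W B D \<and>
           (\<forall>t\<ge>0. AE \<omega> in M. X t \<omega> = \<B> t \<omega> - 1 / 2 * D t \<omega>)))"

end

theory Submission
  imports Defs
begin

text \<open>For a fixed environment the process is a time change of \<open>B\<close> in the scale \<open>S\<^sub>W\<close>; recurrence of \<open>B\<close>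
  makes scale and clock bijective. The integral \<open>\<B>\<close> satisfies the exponential martingale identity with bracket
  \<open>t\<close>, first for elementary integrands and then in the limit. Hence \<open>\<B>\<close> is a Brownian motion for the
  time-changed filtration, and it is independent of \<open>W\<close> because \<open>W\<close> is measurable at time \<open>0\<close>. To identify the
  drift, \<open>h = exp (- W \<circ> S\<^sub>W\<inverse>)\<close> is smoothed along the dyadic nodes \<open>S\<^sub>W (k 2\<^sup>-\<^sup>n)\<close>. The correction in Ito's
  formula for the primitive of the smoothed \<open>h\<close> at \<open>B\<close> is then a sum of local times at the nodes, weighted by
  increments of \<open>exp (- W)\<close>; the Ito formula in the space variable turns its limit into the
  Stratonovich integral.\<close>

text \<open>The obstacle is that \<open>h\<close> has no derivative: Brownian paths are nowhere
  smooth, so Ito's formula does not apply to \<open>inv S\<close> at \<open>B\<close>, and the drift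
  exists only as a limit. The candidate for the whole-line integral is therefore defined by solving
  the equation for it, which makes the equation and the continuity in \<xi> immediate; the work lies
  in recognising this candidate as the Stratonovich integral. To this end the same node sums are
  expanded twice, along the diffusion and along the environment. Unbounded clocks and integrands are
  handled by holding \<open>B\<close> at a deterministic time \<open>K\<close> and by truncation,
  never by optional stopping. Convergence in probability is carried as almost sure convergence along
  subsequences, so limits can be combined path by path. One abstract theory of a Brownian motion run
  through a random clock serves four instances: \<open>B\<close> with the clock of the diffusion,
  and \<open>B\<close>, \<open>W\<close> and the reflected \<open>W\<close> with the trivial clock.
  The jointly continuous local time and recurrence are themselves derived from the instances with
  the trivial clock.\<close>

abbreviation bor :: "'a measure \<Rightarrow> ('a \<Rightarrow> 'b::topological_space) set" where "bor \<equiv> borel_measurable"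

abbreviation (input) LIMSEQ' (infixr "--->" 60) where "X ---> L \<equiv> X \<longlonglongrightarrow> L"

abbreviation eventually_nat (binder "EV " 10) where "eventually_nat P \<equiv> eventually P sequentially"

abbreviation cont0 :: "(real \<Rightarrow> 'a::topological_space) \<Rightarrow> bool" where "cont0 \<equiv> continuous_on {0..}"

abbreviation acont :: "'a measure \<Rightarrow> (real \<Rightarrow> 'a \<Rightarrow> real) \<Rightarrow> bool" where "acont M X \<equiv> AE w in M. cont0 (\<lambda>t. X t w)"

abbreviation exc :: "'a measure \<Rightarrow> real \<Rightarrow> real \<Rightarrow> (real \<Rightarrow> 'a \<Rightarrow> real) \<Rightarrow> 'a set" where
 "exc M t e Y \<equiv> {w \<in> space M. \<exists>s\<in>{0..t}. e < \<bar>Y s w\<bar>}"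

abbreviation "eint \<equiv> elementary_integral"
abbreviation "eproc \<equiv> elementary_process"

lemmas cont_intros = continuous_intros
lemmas b_cong = Bochner_Integration.integral_cong
lemmas b_add = Bochner_Integration.integral_add
lemmas b_diff = Bochner_Integration.integral_diff
lemmas b_int_add = Bochner_Integration.integrable_add
lemmas b_int_diff = Bochner_Integration.integrable_diff
lemmas b_int_bound = Bochner_Integration.integrable_bound

abbreviation (input) dy :: "nat \<Rightarrow> nat \<Rightarrow> real" where "dy n i \<equiv> real i / 2^n"

abbreviation (input) inc :: "('c::ord \<Rightarrow> 'a::minus) \<Rightarrow> (nat \<Rightarrow> 'c) \<Rightarrow> nat \<Rightarrow> 'c \<Rightarrow> 'a" where
 "inc f p i t \<equiv> f (min (p (Suc i)) t) - f (min (p i) t)"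

abbreviation "epred \<equiv> elementary_predictable"
abbreviation "SI \<equiv> stochastic_integral"
abbreviation "cadapt \<equiv> continuous_adapted"
abbreviation "psigma \<equiv> process_sigma"

abbreviation hasD :: "(real \<Rightarrow> real) \<Rightarrow> real \<Rightarrow> real filter \<Rightarrow> bool" (infix "hasD" 50)
 where "f hasD y \<equiv> (f has_field_derivative y)"

lemmas ca_def = continuous_adapted_def
lemmas cont_comp2 = continuous_on_compose2
lemmas cont_subset = continuous_on_subset
lemmas int_cont = integrable_continuous_interval
lemmas SI_def = stochastic_integral_def
lemmas epred_def = elementary_predictable_def
lemmas eint_def = elementary_integral_def
lemmas dom_conv = integral_dominated_convergence
lemmas sq_eq = power2_eq_square
lemmas isCont_cont = continuous_at_imp_continuous_on
lemmas meas_subalg = measurable_from_subalg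
lemmas ev_seq = eventually_sequentially
lemmas compact_image = compact_continuous_image

section \<open>Sub-sigma-algebras that contain all null sets\<close>

definition full_alg :: "'a measure => 'a measure => bool" where
 "full_alg M G = (subalgebra M G & null_sets M <= sets G)"

lemma full_algD:
 assumes "full_alg M G"
 shows "space G = space M" "sets G <= sets M" "null_sets M <= sets G" "subalgebra M G" using assms by (auto simp: full_alg_def subalgebra_def)

locale cps = prob_space M + complete_measure M for M :: "'a measure"
begin

lemma AE_null_diff:
 assumes "AE x in M. P x \<longleftrightarrow> Q x"
 shows "{x : space M. P x ~= Q x} : null_sets M"
proof -
 obtain N where N: "N : null_sets M" "{x : space M. ~ (P x \<longleftrightarrow> Q x)} <= N" using assms by (auto elim!: AE_E simp: null_sets_def)
 show ?thesis by (rule complete2[OF _ N(1)]) (use N(2) in auto)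
qed

text \<open>The two sets differ by a null set, and completeness puts every subset of it into
  \<open>G\<close>. This is how path properties known only almost surely enter measurability
  arguments throughout.\<close>

lemma full_sets_AE:
 assumes G: "full_alg M G" and "{x : space M. P x} : sets G" "AE x in M. P x \<longleftrightarrow> Q x"
 shows "{x : space M. Q x} : sets G"
proof -
 let ?D = "{x : space M. P x ~= Q x}"
 have D: "?D : null_sets M" by (rule AE_null_diff[OF assms(3)])
 have "?D Int {x : space M. Q x} : null_sets M" by (rule complete2[OF _ D]) auto
 hence "({x : space M. P x} - ?D) Un (?D Int {x : space M. Q x}) : sets G" using D full_algD(3)[OF G] assms(2) by blast
 also have "({x : space M. P x} - ?D) Un (?D Int {x : space M. Q x}) = {x : space M. Q x}" by auto
 finally show ?thesis .
qed

lemma full_meas_AE: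
 assumes G: "full_alg M G" and f: "f : measurable G N" and ae: "AE x in M. f x = g x" and g: "!!x. x : space M ==> g x : space N"
 shows "g : measurable G N"
proof (rule measurableI)
 have sp: "space G = space M" using full_algD[OF G] by simp
 show "x : space G ==> g x : space N" for x using g sp by simp
 fix A assume A: "A : sets N"
 have "{x : space M. f x : A} : sets G" using measurable_sets[OF f A] by (simp add: vimage_def Int_def conj_commute sp)
 hence "{x : space M. g x : A} : sets G" by (rule full_sets_AE[OF G]) (use ae in auto)
 thus "g -` A Int space G : sets G" by (simp add: vimage_def Int_def conj_commute sp)
qed

lemma full_limit:
 fixes f :: "nat => 'a => real"
 assumes G: "full_alg M G" and f: "!!n. f n : bor G" and ae: "AE x in M. (%n. f n x) ---> g x"
 shows "g : bor G"
proof (rule full_meas_AE[OF G])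
 show "(%x. lim (%n. f n x)) : bor G" by (intro borel_measurable_lim_metric f)
 show "AE x in M. lim (%n. f n x) = g x" using ae by eventually_elim (rule limI)
qed auto

lemma full_self: "full_alg M M" by (auto simp: full_alg_def subalgebra_def null_sets_def)

lemma full_subset_null:
 assumes "full_alg M G" "AE x in M. ~ P x"
 shows "{x : space M. P x} : sets G"
proof -
 have "{x : space M. False} : sets G" by simp
 thus ?thesis by (rule full_sets_AE[OF assms(1)]) (use assms(2) in auto)
qed

lemma dyadic_approx: "(%n. (of_int \<lfloor>2^n * x\<rfloor> + 1)/2^n) ---> (x::real)"
proof -
 have l: "(%n. x + 1/2^n) ---> x + 0" by (intro tendsto_intros LIMSEQ_divide_realpow_zero) auto
 show ?thesis proof (rule tendsto_sandwich[OF _ _ tendsto_const])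
  show "EV n. x <= (of_int \<lfloor>2^n * x\<rfloor> + 1)/2^n" proof (intro always_eventually allI)
  fix n show "x <= (of_int \<lfloor>2^n * x\<rfloor> + 1)/2^n" by (simp add: field_simps) linarith
  qed
  show "EV n. (of_int \<lfloor>2^n * x\<rfloor> + 1)/2^n <= x + 1/2^n" proof (intro always_eventually allI)
  fix n show "(of_int \<lfloor>2^n * x\<rfloor> + 1)/2^n <= x + 1/2^n" by (simp add: field_simps)
  qed
  show "(%n. x + 1/2^n) ---> x" using l by simp
 qed qed

lemma dyadic_ge: "x <= (of_int \<lfloor>2^n * x\<rfloor> + 1)/2^n" for x :: real by (simp add: field_simps) linarith

text \<open>The random index is rounded up to a dyadic value, which leaves countably many cases;
  continuity then removes the rounding. Rounding goes up so that the index stays inside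
  \<open>S\<close> when \<open>S\<close> is the half-line.\<close>

lemma full_compose:
 fixes Y :: "real => 'a => real"
 assumes G: "full_alg M G" and Y: "!!s. s : S ==> Y s : bor G" and ae: "AE x in M. continuous_on S (%s. Y s x)" and Z: "Z : bor G"
  and S: "S = UNIV \<or> S = {0..}" and ZS: "AE x in M. Z x : S"
 shows "(%x. Y (Z x) x) : bor G"
proof -
 define d where "d n i = (real_of_int i + 1)/2^n" for n i
 \<comment> \<open>The countable composition ranges over all integers, so grid values outside
   \<open>S\<close> need a measurable default.\<close>
 define Y' where "Y' s = (if s : S then Y s else (%_. 0))" for s
 have Y'm: "Y' s : bor G" for s by (simp add: Y'_def Y)
 have m: "(%x. Y' (d n \<lfloor>2^n * Z x\<rfloor>) x) : bor G" for n
  by (rule measurable_compose_countable'[where I=UNIV and f="%i. Y' (d n i)" and g="%x. \<lfloor>2^n * Z x\<rfloor>"]) (use Z Y'm in auto)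
 show ?thesis proof (rule full_limit[OF G m])
  show "AE x in M. (%n. Y' (d n \<lfloor>2^n * Z x\<rfloor>) x) ---> Y (Z x) x" using ae ZS
  proof eventually_elim case (elim x)
  have dS: "d n \<lfloor>2^n * Z x\<rfloor> : S" for n using S elim(2) dyadic_ge[of "Z x" n] by (auto simp: d_def)
  have "(%n. Y (d n \<lfloor>2^n * Z x\<rfloor>) x) ---> Y (Z x) x" by (rule continuous_on_tendsto_compose[OF elim(1)])
  (use dS elim(2) dyadic_approx[of "Z x"] in "auto simp: d_def")
  thus ?case using dS by (simp add: Y'_def)
  qed qed qed

end

section \<open>Convergence in probability along subsequences\<close>

text \<open>The subsequence itself is the argument of \<open>P\<close>: convergence of
  \<open>S (s n) w\<close> can then be combined with other limits along a common subsequence and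
  used path by path. For real random variables this is convergence in probability.\<close>

definition subseq_ae :: "'a measure => ((nat => nat) => 'a => bool) => bool" where
 "subseq_ae M P = ((ALL r::nat => nat. strict_mono r --> (EX q. strict_mono q & (AE w in M. P (r o q) w))))"

abbreviation pconv :: "'a measure => (nat => 'a => 'b::topological_space) => ('a => 'b) => bool" where
 "pconv M S L \<equiv> subseq_ae M (%s w. (%n. S (s n) w) ---> L w)"

definition upath :: "(nat => real => real) => (real => real) => bool" where
 "upath y z = ((ALL t>=0. uniform_limit {0..t} y z sequentially))"

abbreviation uconv :: "'a measure => (nat => real => 'a => real) => (real => 'a => real) => bool" where
 "uconv M Y Z \<equiv> subseq_ae M (%s w. upath (%n u. Y (s n) u w) (%u. Z u w))"

lemma subseq_ae_mono:
 assumes "subseq_ae M P" "AE w in M. ALL s. strict_mono s --> P s w --> R s w"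
 shows "subseq_ae M R" unfolding subseq_ae_def
proof (intro allI impI)
 fix r :: "nat => nat" assume r: "strict_mono r"
 then obtain q where q: "strict_mono q" "AE w in M. P (r o q) w" using assms(1) by (auto simp: subseq_ae_def)
 have "AE w in M. R (r o q) w" using q(2) assms(2) by eventually_elim (use r q(1) strict_mono_o in blast)
 thus "EX q. strict_mono q & (AE w in M. R (r o q) w)" using q by blast
qed

text \<open>Two extractions in a row. The second one thins out the subsequence found for
  \<open>P\<close>, hence it is \<open>P\<close> that has to be inherited by further
  subsequences.\<close>

lemma subseq_ae_conj:
 assumes P: "subseq_ae M P" and Q: "subseq_ae M Q" and her: "!!s w q. strict_mono q ==> P s w ==> P (s o q) w"
 shows "subseq_ae M (%s w. P s w & Q s w)" unfolding subseq_ae_def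
proof (intro allI impI)
 fix r :: "nat => nat" assume r: "strict_mono r"
 then obtain q where q: "strict_mono q" "AE w in M. P (r o q) w" using P by (auto simp: subseq_ae_def)
 have "strict_mono (r o q)" using r q strict_mono_o by blast
 then obtain q' where q': "strict_mono q'" "AE w in M. Q ((r o q) o q') w" using Q unfolding subseq_ae_def by blast
 have "AE w in M. P (r o (q o q')) w & Q (r o (q o q')) w" using q(2) q'(2) by eventually_elim (simp add: her[OF q'(1)] comp_assoc[symmetric])
 thus "EX q. strict_mono q & (AE w in M. P (r o q) w & Q (r o q) w)" using strict_mono_o[OF q(1) q'(1)] by blast
qed

lemma subseq_ae_AE: "AE w in M. ALL s. strict_mono s --> P s w ==> subseq_ae M P"
 by (rule subseq_ae_mono[of M "%_ _. True"]) (auto simp: subseq_ae_def intro: exI[of _ id] strict_mono_id)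

lemma tendsto_subseq: "strict_mono q ==> (%n. f (s n)) ---> l ==> (%n. f ((s o q) n)) ---> l" using LIMSEQ_subseq_LIMSEQ[of "%n. f (s n)" l q] by (simp add: o_def)

lemma upath_subseq:
 assumes "strict_mono q" "upath (%n. f (s n)) l"
 shows "upath (%n. f ((s o q) n)) l" unfolding upath_def uniform_limit_iff
proof (intro allI impI)
 fix t e :: real assume "0 <= t" "0 < e"
 hence "EV n. ALL x:{0..t}. dist (f (s n) x) (l x) < e" using assms(2) unfolding upath_def uniform_limit_iff by blast
 from eventually_subseq[OF assms(1) this]
 show "EV n. ALL x:{0..t}. dist (f ((s o q) n) x) (l x) < e" by simp
qed

lemma upathD: "upath y z ==> 0 <= t ==> (%n. y n t) ---> z t" unfolding upath_def by (rule tendsto_uniform_limitI[where S="{0..t}"]) auto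

lemma upath_add: "upath y z ==> upath y' z' ==> upath (%n u. y n u + y' n u) (%u. z u + z' u)"
 unfolding upath_def by (auto intro: uniform_limit_add)

lemma upath_diff: "upath y z ==> upath y' z' ==> upath (%n u. y n u - y' n u) (%u. z u - z' u)"
 unfolding upath_def by (auto intro: uniform_limit_minus)

lemma upath_unique: "upath y z ==> upath y z' ==> 0 <= t ==> z t = z' t" by (rule LIMSEQ_unique[OF upathD upathD])

lemma uconv_pconv: "uconv M Y Z ==> 0 <= t ==> pconv M (%n. Y n t) (Z t)" by (erule subseq_ae_mono) (auto dest: upathD)

lemma upath_cont:
 assumes "upath y z" "!!n. cont0 (y n)"
 shows "cont0 z"
proof -
 have "continuous_on {0..t} z" if "t >= 0" for t using assms(1) that unfolding upath_def by (intro uniform_limit_theorem[where f=y and F=sequentially])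
  (auto intro!: always_eventually cont_subset[OF assms(2)])
 hence c: "continuous_on {0..t} z" for t by (cases "t >= 0") auto
 show ?thesis unfolding continuous_on_eq_continuous_within proof
  fix x :: real assume "x : {0..}"
  hence "continuous (at x within {0..x+1}) z" using c[of "x+1"] by (auto simp: continuous_on_eq_continuous_within)
  moreover have "at x within {0..x+1} = at x within {0..}" by (rule at_within_nhd[of _ "{..<x+1}"]) auto
  ultimately show "continuous (at x within {0..}) z" by simp
 qed qed

lemma pconv_unique:
 fixes L :: "'a => 'b::t2_space"
 assumes "pconv M S L" "pconv M S L'"
 shows "AE w in M. L w = L' w"
proof -
 have "subseq_ae M (%s w. (%n. S (s n) w) ---> L w & (%n. S (s n) w) ---> L' w)"
 proof (rule subseq_ae_conj[OF assms])
  show "strict_mono q ==> (%n. S (s n) w) ---> L w ==> (%n. S ((s o q) n) w) ---> L w" for s w q by (rule tendsto_subseq[where f="%n. S n w"])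
 qed
 then obtain q where "strict_mono q" "AE w in M. (%n. S ((id o q) n) w) ---> L w & (%n. S ((id o q) n) w) ---> L' w"
  unfolding subseq_ae_def using strict_mono_id by blast
 from this(2) show ?thesis by eventually_elim (auto intro: LIMSEQ_unique)
qed

lemma fast_subseq:
 assumes "!!k::nat. EX N. ALL n>=N. P k n"
 shows "EX q::nat=>nat. strict_mono q & (ALL k. P k (q k))"
proof -
 obtain N where N: "!!k n. n >= N k ==> P k n" using assms by metis
 define q where "q = rec_nat (N 0) (%k v. max (N (Suc k)) (Suc v))"
 have "strict_mono q" by (rule strict_monoI_Suc) (simp add: q_def less_max_iff_disj)
 moreover have "P k (q k)" for k by (cases k) (auto simp: q_def intro!: N)
 ultimately show ?thesis by blast
qed

text \<open>Left continuity is what elementary processes and continuous ones have in common; it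
  allows a point of exceedance to be moved slightly to the left onto a rational time.\<close>

lemma exists_rational_iff:
 fixes y :: "real => real"
 assumes "!!s. s > 0 ==> continuous (at_left s) y"
 shows "(EX s:{0..t}. abs (y s) > eps) \<longleftrightarrow> (EX s:insert 0 \<rat> Int {0..t}. abs (y s) > eps)"
proof
 assume "EX s:{0..t}. abs (y s) > eps"
 then obtain s where s: "0 <= s" "s <= t" "abs (y s) > eps" by auto
 show "EX s:insert 0 \<rat> Int {0..t}. abs (y s) > eps" proof (cases "s = 0") case False
  hence "((%s. abs (y s)) \<longlongrightarrow> abs (y s)) (at_left s)" using assms s by (intro tendsto_rabs) (auto simp: continuous_within)
  hence "\<forall>\<^sub>F u in at_left s. abs (y u) > eps" using s(3) by (rule order_tendstoD)
  then obtain b where b: "b < s" "!!u. b < u ==> u < s ==> abs (y u) > eps" by (auto simp: eventually_at_left_field)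
  obtain q where q: "q : \<rat>" "max b 0 < q" "q < s" using Rats_dense_in_real[of "max b 0" s] b s False by auto
  thus ?thesis using b s by (intro bexI[of _ q]) auto
 qed (use s in auto)
qed auto

context cps
begin

lemma exists_measurable:
 fixes Y :: "real => 'a => real"
 assumes m: "!!s. 0 <= s ==> Y s : bor M" and lc: "AE w in M. ALL s>0. continuous (at_left s) (%s. Y s w)"
 shows "exc M t eps Y : sets M"
proof -
 let ?Q = "insert 0 \<rat> Int {0..t}"
 have cnt: "countable ?Q" using countable_rat by auto
 have "{w : space M. EX s:?Q. abs (Y s w) > eps} = (UN s:?Q. {w : space M. abs (Y s w) > eps})" by auto
 also have "... : sets M" proof (rule sets.countable_UN''[OF cnt])
  fix s assume "s : ?Q"
  hence [measurable]: "Y s : bor M" by (auto intro: m)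
  show "{w : space M. abs (Y s w) > eps} : sets M" by measurable
 qed
 finally have *: "{w : space M. EX s:?Q. abs (Y s w) > eps} : sets M" .
 show ?thesis proof (rule full_sets_AE[OF full_self *])
  show "AE w in M. (EX s:?Q. abs (Y s w) > eps) \<longleftrightarrow> (EX s:{0..t}. abs (Y s w) > eps)" using lc
  by eventually_elim (rule exists_rational_iff[symmetric], blast)
 qed qed

text \<open>At stage \<open>k\<close> the horizon is \<open>k\<close> and the tolerance
  \<open>2^-k\<close>; Borel-Cantelli along a fast subsequence then gives uniform convergence on
  every compact interval.\<close>

lemma ucp_imp_uconv:
 assumes m: "!!n t eps. exc M t eps (%s w. Y n s w - Z s w) : sets M" and ucp: "ucp_converges M Y Z"
 shows "uconv M Y Z" unfolding subseq_ae_def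
proof (intro allI impI)
 fix r :: "nat => nat" assume r: "strict_mono r"
 define A where "A k n = exc M (real k) ((1/2)^k) (%s w. Y n s w - Z s w)" for k n
 have Am: "A k n : sets M" for k n unfolding A_def by (rule m)
 have "EX N. ALL n>=N. measure M (A k (r n)) < (1/2)^k" for k proof -
  have "(%n. measure M (A k n)) ---> 0" using ucp unfolding ucp_converges_def A_def by simp
  hence "(%n. measure M (A k (r n))) ---> 0" using r LIMSEQ_subseq_LIMSEQ[of _ 0 r] by (auto simp: o_def)
  hence "EV n. measure M (A k (r n)) < (1/2)^k" by (rule order_tendstoD) simp
  thus ?thesis by (auto simp: ev_seq)
 qed
 from fast_subseq[where P="%k n. measure M (A k (r n)) < (1/2)^k", OF this]
 obtain q where q: "strict_mono q" "!!k. measure M (A k (r (q k))) < (1/2)^k" by auto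
 have "AE w in M. \<forall>\<^sub>F k in sequentially. w : space M - A k (r (q k))"
 proof (rule borel_cantelli_AE1)
  show "summable (%k. measure M (A k (r (q k))))" by (rule summable_comparison_test[of _ "%k. (1/2)^k"]) (use q(2) in "auto intro!: exI[of _ 0] less_imp_le")
 qed (use Am in "auto simp: emeasure_eq_measure")
 hence "AE w in M. upath (%n u. Y ((r o q) n) u w) (%u. Z u w)" proof eventually_elim case (elim w)
  show ?case unfolding upath_def uniform_limit_iff proof (intro allI impI)
  fix t e :: real assume te: "0 <= t" "0 < e"
  have "\<forall>\<^sub>F k in sequentially. t <= real k" by real_asymp
  moreover have "\<forall>\<^sub>F k in sequentially. (1/2::real)^k < e" by (rule order_tendstoD[OF LIMSEQ_realpow_zero]) (use te in auto)
  ultimately show "EV n. ALL x:{0..t}. dist (Y ((r o q) n) x w) (Z x w) < e" using elim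
  proof eventually_elim case (elim k)
  show ?case proof
  fix x assume "x : {0..t}"
  hence "abs (Y (r (q k)) x w - Z x w) <= (1/2)^k" using elim by (force simp: A_def)
  thus "dist (Y ((r o q) k) x w) (Z x w) < e" using elim by (simp add: dist_real_def)
  qed qed qed qed
 thus "EX q. strict_mono q & (AE w in M. upath (%n u. Y ((r o q) n) u w) (%u. Z u w))" using q by blast
qed

text \<open>If the probabilities stayed above some \<open>e\<close> along a subsequence, a further
  subsequence would make the indicators vanish in the limit, against dominated convergence.\<close>

lemma meas_to_0:
 assumes m: "!!n. A n : sets M" and A: "subseq_ae M (%s w. EV n. w ~: A (s n))"
 shows "(%n. measure M (A n)) ---> 0"
proof (rule ccontr)
 assume "~ ?thesis"
 then obtain e where e: "e > 0" "~ (EV n. measure M (A n) < e)" by (auto simp: tendsto_iff dist_real_def)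
 hence inf: "infinite {n. measure M (A n) >= e}" by (auto simp: cofinite_eq_sequentially[symmetric] eventually_cofinite not_less)
 define r where "r = enumerate {n. measure M (A n) >= e}"
 have r: "strict_mono r" "!!n. measure M (A (r n)) >= e" using strict_mono_enumerate[OF inf] enumerate_in_set[OF inf] by (auto simp: r_def)
 obtain q where q: "strict_mono q" "AE w in M. EV n. w ~: A ((r o q) n)" using A r(1) by (auto simp: subseq_ae_def)
 have "(%n. LINT w|M. indicator (A (r (q n))) w) ---> (LINT w|M. (0::real))"
 proof (rule dom_conv[where w="%_. 1"])
  show "AE w in M. (%n. indicator (A (r (q n))) w) ---> (0::real)" using q(2) by eventually_elim (auto intro!: tendsto_eventually elim: eventually_mono)
 qed (use m in "auto simp: indicator_def")
 hence "(%n. measure M (A (r (q n)))) ---> 0" using m by simp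
 hence "EV n. measure M (A (r (q n))) < e" by (rule order_tendstoD) (use e in auto)
 thus False using r(2) by (auto simp: ev_seq not_less[symmetric])
qed

lemma uconv_imp_ucp:
 assumes m: "!!n t eps. exc M t eps (%s w. Y n s w - Z s w) : sets M" and u: "uconv M Y Z"
 shows "ucp_converges M Y Z" unfolding ucp_converges_def
proof (intro allI impI)
 fix t eps :: real assume te: "0 <= t" "0 < eps"
 show "(%n. measure M (exc M t eps (%s w. Y n s w - Z s w))) ---> 0" proof (rule meas_to_0[OF m])
  show "subseq_ae M (%s w. EV n. w ~: {w : space M. EX u:{0..t}. eps < abs (Y (s n) u w - Z u w)})"
  proof (rule subseq_ae_mono[OF u], intro AE_I2 allI impI)
  fix w s assume "upath (%n u. Y (s n) u w) (%u. Z u w)"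
  hence "EV n. ALL x:{0..t}. dist (Y (s n) x w) (Z x w) < eps" using te unfolding upath_def uniform_limit_iff by blast
  thus "EV n. w ~: {w : space M. EX u:{0..t}. eps < abs (Y (s n) u w - Z u w)}" by eventually_elim (force simp: dist_real_def)
  qed qed qed

lemma measure_imp_pconv0:
 fixes S :: "nat => 'a => real"
 assumes m: "!!n. S n : bor M" and S: "!!eps. eps > 0 ==> (%n. measure M {w : space M. abs (S n w) > eps}) ---> 0"
 shows "pconv M S (%_. 0)"
proof -
 have "uconv M (%n _. S n) (%_ _. 0)" proof (rule ucp_imp_uconv)
  show "exc M t eps (%s w. S n w - 0) : sets M" for n and t eps :: real by (cases "t >= 0") (use m in auto)
  show "ucp_converges M (%n _. S n) (%_ _. 0)" unfolding ucp_converges_def proof (intro allI impI)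
  fix t eps :: real assume te: "0 <= t" "0 < eps"
  hence "exc M t eps (%s w. S n w - 0) = {w : space M. abs (S n w) > eps}" for n by auto
  thus "(%n. measure M (exc M t eps (%s w. S n w - 0))) ---> 0" using S[OF te(2)] by simp
  qed qed
 from uconv_pconv[OF this order_refl] show ?thesis .
qed

end

section \<open>Independence and Gaussian increments\<close>

context prob_space
begin

text \<open>Independence makes the joint law a product, so Fubini freezes the
  \<open>G\<close>-measurable variable while the independent one is integrated out.\<close>

lemma indep_integral:
 fixes f :: "'b \<times> 'c => 'd::{banach, second_countable_topology}"
 assumes G: "subalgebra M G" and ind: "indep_set (sets G) (sets (vimage_algebra (space M) D N'))" and XG: "X : measurable G N" and D[measurable]: "D : measurable M N'"
  and f[measurable]: "f : bor (N \<Otimes>\<^sub>M N')" and bnd: "!!z. norm (f z) <= C"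
 shows "(LINT w|M. f (X w, D w)) = (LINT w|M. (LINT d|distr M N' D. f (X w, d)))"
proof -
 have X[measurable]: "X : measurable M N" by (rule meas_subalg[OF G XG])
 interpret X: prob_space "distr M N X" by (rule prob_space_distr) measurable
 interpret D: prob_space "distr M N' D" by (rule prob_space_distr) measurable
 interpret XD: pair_prob_space "distr M N X" "distr M N' D" ..
 have eq: "distr M N X \<Otimes>\<^sub>M distr M N' D = distr M (N \<Otimes>\<^sub>M N') (%x. (X x, D x))"
 proof (rule pair_measure_eqI)
  fix A B assume "A : sets (distr M N X)" "B : sets (distr M N' D)"
  hence [measurable]: "A : sets N" "B : sets N'" by auto
  have "X -` A Int space M : sets G" using measurable_sets[OF XG, of A] G by (simp add: subalgebra_def)
  moreover have "D -` B Int space M : sets (vimage_algebra (space M) D N')" by (rule in_vimage_algebra) simp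
  ultimately have "prob ((X -` A Int space M) Int (D -` B Int space M)) = prob (X -` A Int space M) * prob (D -` B Int space M)" by (rule indep_setD[OF ind])
  moreover have "(%x. (X x, D x)) -` (A \<times> B) Int space M = (X -` A Int space M) Int (D -` B Int space M)" by auto
  ultimately show "emeasure (distr M N X) A * emeasure (distr M N' D) B = emeasure (distr M (N \<Otimes>\<^sub>M N') (%x. (X x, D x))) (A \<times> B)"
  by (simp add: emeasure_distr emeasure_eq_measure ennreal_mult')
 qed (auto intro: X.sigma_finite_measure D.sigma_finite_measure X.sigma_finite_measure_axioms D.sigma_finite_measure_axioms)
 have int: "integrable (distr M N X \<Otimes>\<^sub>M distr M N' D) f" by (rule XD.P.integrable_const_bound[where B=C]) (auto intro: bnd)
 have "(LINT w|M. f (X w, D w)) = integral\<^sup>L (distr M (N \<Otimes>\<^sub>M N') (%x. (X x, D x))) f" by (subst integral_distr) auto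
 also have "... = (LINT x|distr M N X. (LINT y|distr M N' D. f (x, y)))" unfolding eq[symmetric] by (rule XD.integral_fst'[OF int, symmetric])
 also have "... = (LINT w|M. (LINT d|distr M N' D. f (X w, d)))" by (rule integral_distr) measurable
 finally show ?thesis .
qed

lemma normal_moments:
 assumes D: "distributed M lborel X (normal_density 0 sg)" and s: "sg > 0"
 shows "integrable M (%w. X w^k)" and "(LINT w|M. X w) = 0" "(LINT w|M. (X w)^2) = sg^2" "(LINT w|M. (X w)^4) = 3 * sg^4"
  and "(CLINT w|M. iexp (th * X w)) = exp (- (th^2 * sg^2/2))"
proof -
 have i: "integrable M (%w. X w^k)" for k by (subst distributed_integrable[OF D, symmetric]) (use integrable_normal_moment[OF s, where \<mu>=0 and k=k] in auto)
 show "integrable M (%w. X w^k)" by (rule i)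
 have e: "(LINT w|M. X w^k) = (LINT x|lborel. normal_density 0 sg x * x^k)" for k using distributed_integral[OF D, of "%x. x^k"] by simp
 have od: "(LINT w|M. X w^(2*k+1)) = 0" for k
  unfolding e using has_bochner_integral_integral_eq[OF normal_moment_odd[OF s, where \<mu>=0 and k=k]] by (simp only: diff_0_right)
 have ev: "(LINT w|M. X w^(2*k)) = fact (2 * k)/((2/sg^2)^k * fact k)" for k
  unfolding e using has_bochner_integral_integral_eq[OF normal_moment_even[OF s, where \<mu>=0 and k=k]] by (simp only: diff_0_right)
 show "(LINT w|M. X w) = 0" using od[of 0] by simp
 show "(LINT w|M. (X w)^2) = sg^2" using ev[of 1] s by (simp add: fact_numeral)
 show "(LINT w|M. (X w)^4) = 3 * sg^4" using ev[of 2] s by (simp add: fact_numeral power_divide field_simps)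
 have [measurable]: "X : bor M" using distributed_measurable[OF D] by simp
 have std: "distributed M lborel (%x. X x/sg) std_normal_density" using D normal_standard_normal_convert[OF s, of X 0] by simp
 have "(CLINT w|M. iexp (th * X w)) = (CLINT w|M. iexp ((th * sg)*(X w/sg)))" using s by simp
 also have "... = (CLINT y|distr M lborel (%x. X x/sg). iexp ((th * sg) * y))" by (subst integral_distr) auto
 also have "... = char std_normal_distribution (th * sg)" using distributed_distr_eq_density[OF std] by (simp add: char_def)
 finally show "(CLINT w|M. iexp (th * X w)) = exp (- (th^2 * sg^2/2))" by (simp add: char_std_normal_distribution power_mult_distrib exp_of_real[symmetric])
qed

text \<open>The hypothesis says that under \<open>M\<close> conditioned on \<open>A\<close> the
  variable has a Gaussian characteristic function. Levy uniqueness identifies its law for each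
  \<open>A\<close>, and a law that does not depend on \<open>A\<close> means independence.\<close>

lemma char_imp_indep_normal:
 assumes G: "subalgebra M G" and Z[measurable]: "Z : bor M" and v: "v > 0" and ch: "!!A th. A : sets G ==>
  (CLINT w|M. indicator A w *\<^sub>R iexp (th * Z w)) = prob A *\<^sub>R exp (- (th^2 * v/2))"
 shows "indep_set (sets G) (sets (vimage_algebra (space M) Z borel))" and "distributed M lborel Z (normal_density 0 (sqrt v))"
proof -
 define nm where "nm = density lborel (normal_density 0 (sqrt v))"
 interpret nm: prob_space nm unfolding nm_def by (rule prob_space_normal_density) (use v in auto)
 have rd: "real_distribution nm" by (auto simp: real_distribution_def real_distribution_axioms_def nm_def intro: nm.prob_space_axioms[unfolded nm_def])
 have "distributed nm lborel (%x. x) (normal_density 0 (sqrt v))" unfolding distributed_def nm_def by (auto intro!: distr_id2)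
 from nm.normal_moments(5)[OF this] have cn: "char nm th = exp (- (th^2 * v/2))" for th using v by (simp add: char_def)
 have eqA: "prob (A Int (Z -` C Int space M)) = prob A * measure nm C" if A: "A : sets G" and C[measurable]: "C : sets borel" for A C
 \<comment> \<open>\<open>uniform_measure\<close> is a probability only when \<open>A\<close> has
   positive measure.\<close>
 proof (cases "prob A = 0") case True
  have [measurable]: "A : sets M" using A G by (auto simp: subalgebra_def)
  have "prob (A Int (Z -` C Int space M)) <= prob A" by (intro finite_measure_mono) auto
  thus ?thesis using True by (simp add: measure_le_0_iff)
 next case False
  have [measurable]: "A : sets M" using A G by (auto simp: subalgebra_def)
  have eA: "emeasure M A ~= 0" "emeasure M A ~= \<infinity>" using False by (auto simp: emeasure_eq_measure)
  let ?U = "uniform_measure M A"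
  interpret U: prob_space ?U by (rule prob_space_uniform_measure[OF eA])
  have U: "?U = density M (%x. ennreal (indicator A x/prob A))" unfolding uniform_measure_def using False
  by (intro arg_cong2[where f=density] ext) (auto simp: emeasure_eq_measure indicator_def divide_ennreal ennreal_1[symmetric] zero_less_measure_iff simp del: ennreal_1)
  have Zu[measurable]: "Z : bor ?U" by (simp add: uniform_measure_def)
  interpret d: prob_space "distr ?U borel Z" by (rule U.prob_space_distr) measurable
  have "distr ?U borel Z = nm" proof (rule Levy_uniqueness[OF _ rd])
  show "real_distribution (distr ?U borel Z)" by (auto simp: real_distribution_def real_distribution_axioms_def intro: d.prob_space_axioms)
  show "char (distr ?U borel Z) = char nm" proof
  fix th
  have "char (distr ?U borel Z) th = (CLINT x|?U. iexp (th * Z x))" unfolding char_def by (subst integral_distr) auto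
  also have "... = (CLINT x|M. (indicator A x/prob A) *\<^sub>R iexp (th * Z x))" unfolding U by (subst integral_density) (auto simp: indicator_def)
  also have "... = (CLINT x|M. (1/prob A) *\<^sub>R (indicator A x *\<^sub>R iexp (th * Z x)))" by (intro b_cong) auto
  also have "... = (1/prob A) *\<^sub>R (CLINT x|M. (indicator A x *\<^sub>R iexp (th * Z x)))" by (rule integral_scaleR_right)
  also have "... = char nm th" unfolding ch[OF A] cn using False by (simp add: scaleR_conv_of_real)
  finally show "char (distr ?U borel Z) th = char nm th" .
  qed qed
  hence "measure nm C = measure (distr ?U borel Z) C" by simp
  also have "... = measure ?U (Z -` C Int space M)" by (subst measure_distr) auto
  also have "... = prob (A Int (Z -` C Int space M))/prob A" using eA by (intro measure_uniform_measure) auto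
  finally show ?thesis using False by simp
 qed
 have sp: "space M : sets G" using G by (metis sets.top subalgebra_def)
 have pz: "prob (Z -` C Int space M) = measure nm C" if "C : sets borel" for C using eqA[OF sp that] by (simp add: prob_space Int_absorb1)
 show "indep_set (sets G) (sets (vimage_algebra (space M) Z borel))" unfolding indep_sets2_eq
 proof (intro conjI ballI)
  show "sets G <= events" using G by (simp add: subalgebra_def)
  show "sets (vimage_algebra (space M) Z borel) <= events" by (auto simp: sets_vimage_algebra2 intro!: measurable_sets)
  fix a b assume "a : sets G" "b : sets (vimage_algebra (space M) Z borel)"
  thus "prob (a Int b) = prob a * prob b" by (auto simp: sets_vimage_algebra2 eqA pz)
 qed
 have "distr M lborel Z = nm" proof (rule measure_eqI)
  fix C assume "C : sets (distr M lborel Z)"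
  hence C[measurable]: "C : sets borel" by simp
  have "emeasure (distr M lborel Z) C = emeasure M (Z -` C Int space M)" by (simp add: emeasure_distr)
  also have "... = emeasure nm C" by (simp add: emeasure_eq_measure nm.emeasure_eq_measure pz)
  finally show "emeasure (distr M lborel Z) C = emeasure nm C" .
 qed (simp add: nm_def)
 thus "distributed M lborel Z (normal_density 0 (sqrt v))" by (simp add: distributed_def nm_def)
qed

end

section \<open>Brownian filtrations\<close>

lemma space_process_sigma[simp]: "space (psigma M J X) = space M" by (simp add: process_sigma_def space_measure_of_conv)

lemma sets_process_sigma:
 "sets (psigma M J X) = sigma_sets (space M) (UN i:J. {X i -` C Int space M |C. C : sets borel})" unfolding process_sigma_def
 by (subst sets_measure_of) (auto simp: sets_vimage_algebra2)

lemma psigma_meas: "i : J ==> X i : bor (psigma M J X)" by (rule measurableI) (auto simp: sets_process_sigma intro!: sigma_sets.Basic)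

lemma psigma_subset:
 assumes "space G = space M" "!!i. i : J ==> X i : bor G"
 shows "sets (psigma M J X) <= sets G" unfolding sets_process_sigma
proof (subst assms(1)[symmetric], rule sets.sigma_sets_subset, safe)
 fix i and C :: "real set" assume "i : J" "C : sets borel"
 thus "X i -` C Int space M : sets G" using measurable_sets[OF assms(2), of i C] assms(1) by simp
qed

lemma psigma_subalg:
 "(!!i. i : J ==> X i : bor M) ==> subalgebra M (psigma M J X)" using psigma_subset[of M M J X] by (auto simp: subalgebra_def)

definition cylinders :: "'a measure => 'i set => ('i => 'a => real) => 'a set set" where
 "cylinders M J X = {{w : space M. ALL a:I. X a w : C a} |I C. finite I & I <= J & (ALL a. C a : sets borel)}"

lemma Int_stable_cylinders: "Int_stable (cylinders M J X)"
proof (rule Int_stableI)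
 fix A B assume "A : cylinders M J X" "B : cylinders M J X"
 then obtain I C I' C' where A: "A = {w : space M. ALL a:I. X a w : C a}" "finite I" "I <= J" "!!a. C a : sets borel"
  and B: "B = {w : space M. ALL a:I'. X a w : C' a}" "finite I'" "I' <= J" "!!a. C' a : sets borel" unfolding cylinders_def by blast
 let ?C = "%a. (if a : I then C a else UNIV) Int (if a : I' then C' a else UNIV)"
 have "A Int B = {w : space M. ALL a:I Un I'. X a w : ?C a}" unfolding A B by auto
 moreover have "finite (I Un I')" "I Un I' <= J" using A(2,3) B(2,3) by auto
 moreover have "ALL a. ?C a : sets borel" using A(4) B(4) by (intro allI sets.Int) simp_all
 ultimately show "A Int B : cylinders M J X" unfolding cylinders_def mem_Collect_eq by (intro exI[of _ "I Un I'"] exI[of _ ?C] conjI)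
qed

lemma sigma_sets_cylinders: "sigma_sets (space M) (cylinders M J X) = sets (psigma M J X)"
proof (rule antisym)
 show "sigma_sets (space M) (cylinders M J X) <= sets (psigma M J X)"
 proof (subst space_process_sigma[symmetric, of M J X], rule sets.sigma_sets_subset, rule subsetI)
  fix A assume "A : cylinders M J X"
  then obtain I C where A: "A = {w : space M. ALL a:I. X a w : C a}" "finite I" "I <= J" "!!a. C a : sets borel" unfolding cylinders_def by blast
  have "{w : space (psigma M J X). ALL a:I. X a w : C a} : sets (psigma M J X)"
  proof (rule sets.sets_Collect_finite_All[OF _ A(2)])
  fix i assume "i : I"
  hence [measurable]: "X i : bor (psigma M J X)" using A by (intro psigma_meas) auto
  show "{w : space (psigma M J X). X i w : C i} : sets (psigma M J X)" using A(4)[of i] by measurable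
  qed
  thus "A : sets (psigma M J X)" using A by simp
 qed
next
 show "sets (psigma M J X) <= sigma_sets (space M) (cylinders M J X)" unfolding sets_process_sigma
 proof (rule sigma_sets_mono, safe)
  fix i and C :: "real set" assume "i : J" "C : sets borel"
  thus "X i -` C Int space M : sigma_sets (space M) (cylinders M J X)" by (intro sigma_sets.Basic) (auto simp: cylinders_def intro!: exI[of _ "{i}"] exI[of _ "%_. C"])
 qed qed

text \<open>Finite-dimensional cylinders are an intersection-stable generator, so Dynkin's argument
  extends the product rule to the whole process.\<close>

lemma (in prob_space) indep_process_sigmaI:
 assumes G: "subalgebra M G" and X: "!!i. i : J ==> X i : bor M" and ind: "!!D I C. D : sets G ==> finite I ==> I <= J ==> (!!a. C a : sets borel) ==>
  prob (D Int {w : space M. ALL a:I. X a w : C a}) = prob D * prob {w : space M. ALL a:I. X a w : C a}"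
 shows "indep_set (sets G) (sets (psigma M J X))"
proof -
 have "indep_set (sets G) (cylinders M J X)" unfolding indep_sets2_eq proof (intro conjI ballI)
  show "sets G <= events" using G by (simp add: subalgebra_def)
  have "sigma_sets (space M) (cylinders M J X) <= events" unfolding sigma_sets_cylinders by (rule psigma_subset[OF refl X])
  thus "cylinders M J X <= events" by (meson sigma_sets_superset_generator subset_trans)
  fix a b assume "a : sets G" "b : cylinders M J X"
  thus "prob (a Int b) = prob a * prob b" unfolding cylinders_def using ind by blast
 qed
 from indep_set_sigma_sets[OF this _ Int_stable_cylinders]
 have "indep_set (sigma_sets (space M) (sets G)) (sets (psigma M J X))" by (simp add: sigma_sets_cylinders sets.Int_stable)
 moreover have "sigma_sets (space M) (sets G) = sets G" using G sets.sigma_sets_eq[of G] by (simp add: subalgebra_def)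
 ultimately show ?thesis by simp
qed

text \<open>Freezing: given \<open>G\<close> the variable \<open>c\<close> is a constant, and the
  expectation of \<open>iexp (c * D)\<close> is the Gaussian characteristic function at
  \<open>c\<close>.\<close>

lemma (in prob_space) indep_iexp:
 assumes G: "subalgebra M G" and ind: "indep_set (sets G) (sets (vimage_algebra (space M) D borel))" and D: "distributed M lborel D (normal_density 0 sg)" "sg > 0"
  and z: "ze : bor G" "!!w. w : space M ==> cmod (ze w) <= C" and c: "c : bor G"
 shows "(CLINT w|M. ze w * iexp (c w * D w)) = (CLINT w|M. ze w * exp (- ((c w)^2 * sg^2/2)))"
proof -
 have [measurable]: "D : bor M" using distributed_measurable[OF D(1)] by simp
 \<comment> \<open>The bound on \<open>ze\<close> holds only on \<open>space M\<close>; cutting off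
   large values inside \<open>f\<close> makes it bounded everywhere, as
   \<open>indep_integral\<close> requires.\<close>
 define f :: "(complex \<times> real) \<times> real => complex"
  where "f = (%((z,c),d). (if cmod z <= C then z else 0) * iexp (c * d))"
 have fm: "f : bor ((borel \<Otimes>\<^sub>M borel) \<Otimes>\<^sub>M borel)" unfolding f_def split_beta by measurable
 obtain w\<^sub>0 where "w\<^sub>0 : space M" using not_empty by blast
 hence C: "0 <= C" using z(2) norm_ge_zero order_trans by blast
 have "(CLINT w|M. ze w * iexp (c w * D w)) = (CLINT w|M. f ((ze w, c w), D w))" by (intro b_cong) (auto simp: f_def z)
 also have "... = (CLINT w|M. (CLINT d|distr M borel D. f ((ze w, c w), d)))"
 proof (rule indep_integral[OF G ind _ _ fm])
  show "(%w. (ze w, c w)) : measurable G (borel \<Otimes>\<^sub>M borel)" using z c by measurable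
  show "norm (f z) <= C" for z using C by (auto simp: f_def split_beta norm_mult)
 qed measurable
 also have "... = (CLINT w|M. ze w * exp (- ((c w)^2 * sg^2/2)))" proof (rule b_cong[OF refl])
  fix w assume "w : space M"
  hence "(CLINT d|distr M borel D. f ((ze w, c w), d)) = ze w*(CLINT d|distr M borel D. iexp (c w * d))" by (simp add: f_def z)
  also have "(CLINT d|distr M borel D. iexp (c w * d)) = (CLINT x|M. iexp (c w * D x))" by (subst integral_distr) auto
  also have "... = exp (- ((c w)^2 * sg^2/2))" by (rule normal_moments(5)[OF D])
  finally show "(CLINT d|distr M borel D. f ((ze w, c w), d)) = ze w * exp (- ((c w)^2 * sg^2/2))" .
 qed
 finally show ?thesis .
qed

context cps
begin

lemma bm_facts:
 assumes "brownian_motion_wrt M G B"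
 shows "0 <= t ==> subalgebra M (G t)" "0 <= s ==> s <= t ==> sets (G s) <= sets (G t)"
  "0 <= t ==> B t : bor (G t)" "acont M B"
  "AE w in M. B 0 w = 0"
  "0 <= s ==> s < t ==> indep_set (sets (G s)) (sets (vimage_algebra (space M) (%w. B t w - B s w) borel))"
  "0 <= s ==> s < t ==> distributed M lborel (%w. B t w - B s w) (normal_density 0 (sqrt (t - s)))"
  "0 <= s ==> s <= t ==> B s : bor (G t)"
  "0 <= t ==> B t : bor M"
proof -
 show *: "0 <= t ==> subalgebra M (G t)" "0 <= s ==> s <= t ==> sets (G s) <= sets (G t)"
  "0 <= t ==> B t : bor (G t)" "acont M B"
  "AE w in M. B 0 w = 0"
  "0 <= s ==> s < t ==> indep_set (sets (G s)) (sets (vimage_algebra (space M) (%w. B t w - B s w) borel))"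
  "0 <= s ==> s < t ==> distributed M lborel (%w. B t w - B s w) (normal_density 0 (sqrt (t - s)))" for s t
  using assms by (auto simp: brownian_motion_wrt_def is_filtration_def ca_def)
 show "0 <= t ==> B t : bor M" using *(1,3)[of t] meas_subalg by blast
 assume st: "0 <= s" "s <= t"
 have "subalgebra (G t) (G s)" using *(1)[of s] *(1)[of t] *(2)[of s t] st by (auto simp: subalgebra_def)
 thus "B s : bor (G t)" using *(3)[of s] st meas_subalg by blast
qed

section \<open>Independence of future increments from the past\<close>

lemma bm_markov:
 fixes g :: "real => real"
 assumes bm: "brownian_motion_wrt M G B" and sbT: "0 <= s" "s <= b" "b < T"
  and F: "Ph : bor (G b)" "!!w. abs (Ph w) <= 1" and g[measurable]: "g : bor borel" "!!x. abs (g x) <= C"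
 shows "(LINT w|M. Ph w * g (B T w - B s w)) = (LINT w|M. Ph w*(LINT d|distr M borel (%w. B T w - B b w). g ((B b w - B s w) + d)))"
proof -
 have meas: "(%w. B T w - B b w) : bor M" using sbT by (intro borel_measurable_diff bm_facts(9)[OF bm]) auto
 \<comment> \<open>Clamping the weight to [-1,1] does not affect the values of \<open>Ph\<close> and
   makes the test function bounded on the whole product space.\<close>
 define f :: "(real \<times> real) \<times> real => real" where "f = (%((p,y),d). max (-1) (min 1 p) * g (y + d))"
 have cl: "max (-1) (min 1 (Ph w)) = Ph w" for w using F(2)[of w] by auto
 have "(LINT w|M. Ph w * g (B T w - B s w)) = (LINT w|M. f ((Ph w, B b w - B s w), B T w - B b w))" by (simp add: f_def cl)
 also have "... = (LINT w|M. (LINT d|distr M borel (%w. B T w - B b w). f ((Ph w, B b w - B s w), d)))"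
 proof (rule indep_integral[where G="G b" and N="borel \<Otimes>\<^sub>M borel" and C=C])
  show "subalgebra M (G b)" using bm_facts(1)[OF bm] sbT by simp
  show "indep_set (sets (G b)) (sets (vimage_algebra (space M) (%w. B T w - B b w) borel))" using bm_facts(6)[OF bm] sbT by simp
  have "B b : bor (G b)" "B s : bor (G b)" using bm_facts(8)[OF bm] sbT by auto
  thus "(%w. (Ph w, B b w - B s w)) : measurable (G b) (borel \<Otimes>\<^sub>M borel)" using F by measurable
  show "f : bor ((borel \<Otimes>\<^sub>M borel) \<Otimes>\<^sub>M borel)" unfolding f_def split_beta by measurable
  fix z :: "(real \<times> real) \<times> real"
  have "abs (max (-1) (min 1 p) * g y) <= 1 * C" for p y unfolding abs_mult by (intro mult_mono g) auto
  thus "norm (f z) <= C" by (auto simp: f_def split_beta)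
 qed (rule meas)
 also have "... = (LINT w|M. Ph w*(LINT d|distr M borel (%w. B T w - B b w). g ((B b w - B s w) + d)))" by (simp add: f_def cl)
 finally show ?thesis .
qed

text \<open>Induction on the number of times, removing the latest one: integrating out the last
  increment replaces the test function by its average over a Gaussian step, which is again bounded
  and measurable and is attached to the previous time.\<close>

lemma bm_future_indep:
 assumes bm: "brownian_motion_wrt M G B" and s: "0 <= s"
 shows "indep_set (sets (G s)) (sets (psigma M {0..} (%u w. B (s + u) w - B s w)))"
proof (rule indep_process_sigmaI)
 show sG: "subalgebra M (G s)" using bm_facts(1)[OF bm s] .
 have Bm: "B t : bor M" if "0 <= t" for t using bm_facts(9)[OF bm that] .
 show "(%w. B (s + i) w - B s w) : bor M" if "i : {0..}" for i using that s by (intro borel_measurable_diff Bm) auto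
 fix D :: "'a set" and I :: "real set" and C :: "real => real set"
 assume D: "D : sets (G s)" and "finite I" "I <= {0..}" and C[measurable]: "!!a. C a : sets borel"
 have DM[measurable]: "D : sets M" using D sG by (auto simp: subalgebra_def)
 let ?R = "%u w. B (s + u) w - B s w" and ?C = "{w : space M. ALL a:I. B (s + a) w - B s w : C a}"
 define cyl where "cyl I w = (PROD a:I. indicat_real (C a) (?R a w))" for I w
 have Pb: "abs (cyl I w) <= 1" for I w unfolding cyl_def abs_prod by (intro prod_le_1) (auto simp: indicator_def)
 have Pm: "cyl I : bor (G t)" if "I <= {0..}" "!!a. a : I ==> s + a <= t" "s <= t" for I t unfolding cyl_def
 proof (rule borel_measurable_prod)
  fix i assume "i : I"
  hence [measurable]: "B (s+i) : bor (G t)" "B s : bor (G t)" using that s by (auto intro!: bm_facts(8)[OF bm])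
  show "(%w. indicat_real (C i) (?R i w)) : bor (G t)" by measurable
 qed
 have Dm: "D : sets (G t)" if "s <= t" for t using D bm_facts(2)[OF bm s that] by auto
 \<comment> \<open>The statement is strengthened to all bounded \<open>g\<close> and all times
   \<open>T\<close> not before those of the cylinder, because the averaging step changes
   both.\<close>
 have claim: "ALL T>=0. ALL g : bor borel. ALL K. (ALL x. abs (g x) <= K) --> (ALL a:I. a <= T) --> (LINT w|M. indicator D w * cyl I w * g (?R T w)) =
  prob D*(LINT w|M. cyl I w * g (?R T w))" using \<open>finite I\<close> \<open>I <= {0..}\<close>
 proof (induction I rule: finite_linorder_max_induct) case empty
  show ?case proof (intro allI ballI impI)
  fix T K :: real and g :: "real => real" assume T: "0 <= T" and g[measurable]: "g : bor borel" "ALL x. abs (g x) <= K"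
  show "(LINT w|M. indicator D w * cyl {} w * g (?R T w)) =
  prob D*(LINT w|M. cyl {} w * g (?R T w))" proof (cases "T = 0") case False
  let ?c = "LINT d|distr M borel (?R T). g d"
  have c: "(LINT w|M. Ph w * g (?R T w)) = (LINT w|M. Ph w * ?c)" if "Ph : bor (G s)" "!!w. abs (Ph w) <= 1" for Ph
  using bm_markov[OF bm s order_refl _ that g(1), of "s + T" K] False T g(2) by simp
  have "(LINT w|M. indicator D w * g (?R T w)) = (LINT w|M. indicator D w * ?c)" by (rule c) (use D in "auto simp: indicator_def")
  thus ?thesis using c[of "%_. 1"] DM by (simp add: cyl_def prob_space)
  qed (simp add: cyl_def prob_space)
  qed
 next case (insert b I)
  have IJ: "I <= {0..}" "b >= 0" using insert.prems by auto
  have ins: "cyl (insert b I) w = indicator (C b) (?R b w) * cyl I w" for w unfolding cyl_def using insert by (subst prod.insert) auto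
  have base: "(LINT w|M. indicator D w * cyl (insert b I) w * g (?R b w)) =
  prob D*(LINT w|M. cyl (insert b I) w * g (?R b w))" if g[measurable]: "g : bor borel" "ALL x. abs (g x) <= K" for g :: "real => real" and K
  proof -
  have "(LINT w|M. indicator D w * cyl I w*(indicator (C b) (?R b w) * g (?R b w))) =
  prob D*(LINT w|M. cyl I w*(indicator (C b) (?R b w) * g (?R b w)))"
  proof (rule insert.IH[OF IJ(1), rule_format, of b "%x. indicator (C b) x * g x" K])
  have "0 <= K" using g(2)[rule_format, of 0] by (rule order_trans[OF abs_ge_zero])
  thus "abs (indicator (C b) x * g x) <= K" for x using g(2) by (auto simp: indicator_def)
  qed (use IJ insert.hyps(2) in "auto intro: less_imp_le")
  thus ?thesis by (simp add: ins ac_simps)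
  qed
  show ?case proof (intro allI ballI impI)
  fix T K :: real and g :: "real => real" assume T: "0 <= T" and g[measurable]: "g : bor borel" and gb: "ALL x. abs (g x) <= K" and le: "ALL a:insert b I. a <= T"
  show "(LINT w|M. indicator D w * cyl (insert b I) w * g (?R T w)) =
  prob D*(LINT w|M. cyl (insert b I) w * g (?R T w))" proof (cases "T = b") case True
  thus ?thesis using base[OF g gb] by simp
  next case False
  hence bT: "b < T" using le by auto
  let ?nm = "distr M borel (%w. B (s + T) w - B (s + b) w)"
  have "(%w. B (s + T) w - B (s + b) w) : bor M" using IJ T s by (intro borel_measurable_diff Bm) auto
  then interpret nm: prob_space ?nm by (rule prob_space_distr)
  define g' where "g' y = (LINT d|?nm. g (y + d))" for y
  have g'm: "g' : bor borel" unfolding g'_def by measurable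
  have K: "0 <= K" using gb[rule_format, of 0] by (rule order_trans[OF abs_ge_zero])
  have g'b: "ALL x. abs (g' x) <= K" proof
  fix x
  have "abs (g' x) <= (LINT d|?nm. abs (g (x + d)))" unfolding g'_def by (rule integral_abs_bound)
  also have "... <= (LINT d|?nm. K)" by (rule integral_mono) (use gb K in "auto intro!: nm.integrable_const_bound[where B=K]")
  also have "... = K" by (simp add: nm.prob_space del: space_distr)
  finally show "abs (g' x) <= K" .
  qed
  have Pmb: "cyl (insert b I) : bor (G (s + b))" using insert.prems insert.hyps(2) IJ by (intro Pm) (auto intro: less_imp_le)
  have m1: "(LINT w|M. Ph w * g (?R T w)) = (LINT w|M. Ph w * g' (?R b w))"
  if "Ph : bor (G (s + b))" "!!w. abs (Ph w) <= 1" for Ph unfolding g'_def using s IJ bT gb by (intro bm_markov[OF bm _ _ _ that]) auto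
  have "(LINT w|M. (indicator D w * cyl (insert b I) w) * g (?R T w))
  = (LINT w|M. (indicator D w * cyl (insert b I) w) * g' (?R b w))" proof (rule m1)
  show "(%w. indicat_real D w * cyl (insert b I) w) : bor (G (s + b))" by (intro borel_measurable_times borel_measurable_indicator Pmb Dm) (use IJ in simp)
  show "abs (indicat_real D w * cyl (insert b I) w) <= 1" for w using Pb[of "insert b I" w] by (auto simp: indicator_def)
  qed
  also have "... = prob D*(LINT w|M. cyl (insert b I) w * g' (?R b w))" by (rule base[OF g'm g'b])
  also have "(LINT w|M. cyl (insert b I) w * g' (?R b w)) = (LINT w|M. cyl (insert b I) w * g (?R T w))" by (rule m1[symmetric, OF Pmb Pb])
  finally show ?thesis .
  qed qed qed
 define T where "T = Max (insert 0 I)"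
 have T: "0 <= T" "ALL a:I. a <= T" using \<open>finite I\<close> by (auto simp: T_def)
 have ind: "indicat_real ?C w = cyl I w" if "w : space M" for w
  using \<open>finite I\<close> that unfolding cyl_def by (induction I) (auto simp: indicator_def)
 have Cm: "?C : sets M" proof -
  have "sets (psigma M {0..} (%u w. ?R u w)) <= sets M" by (rule psigma_subset) (use s in "auto intro!: borel_measurable_diff Bm")
  moreover have "?C : cylinders M {0..} (%u w. ?R u w)"
  unfolding cylinders_def using \<open>finite I\<close> \<open>I <= {0..}\<close> C by blast
  ultimately show ?thesis using sigma_sets_cylinders by blast
 qed
 have "prob (D Int ?C) = (LINT w|M. indicator D w * cyl I w*1)"
 proof -
  have "prob (D Int ?C) = (LINT w|M. indicator (D Int ?C) w)"
  using Cm DM by simp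
  also have "... = (LINT w|M. indicator D w * cyl I w*1)" by (rule b_cong) (auto simp: indicator_inter_arith ind)
  finally show ?thesis .
 qed
 also have "... = prob D*(LINT w|M. cyl I w*1)" using claim[rule_format, of T "%_. 1" 1] T by simp
 also have "(LINT w|M. cyl I w*1) = (LINT w|M. indicator ?C w)" by (rule b_cong) (auto simp: ind)
 also have "... = prob ?C" using Cm by simp
 finally show "prob (D Int ?C) =
  prob D * prob ?C" .
qed

section \<open>Augmented filtrations\<close>

lemma sets_augmentation:
 assumes sp: "!!t. space (F t) = space M"
 shows "sets (usual_augmentation M F t) = (INT s:{t<..}. sets (sigma (space M) (sets (F s) Un null_sets M)))"
proof -
 let ?I = "INT s:{t<..}. sets (sigma (space M) (sets (F s) Un null_sets M))"
 have pow: "sets (F s) Un null_sets M <= Pow (space M)" for s using sets.space_closed[of "F s"] sets.space_closed[of M] by (auto simp: null_sets_def sp)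
 have I: "?I <= Pow (space M)" proof
  fix x assume "x : ?I"
  hence "x : sets (sigma (space M) (sets (F (t+1)) Un null_sets M))" by (rule INT_D[of x _ "{t<..}"]) simp
  from sets.sets_into_space[OF this] show "x : Pow (space M)" by (simp add: space_measure_of_conv)
 qed
 have "sigma_sets (space M) ?I <= sets (sigma (space M) (sets (F s) Un null_sets M))" if "s > t" for s proof -
  have "sigma_sets (space (sigma (space M) (sets (F s) Un null_sets M))) ?I <= sets (sigma (space M) (sets (F s) Un null_sets M))"
  by (rule sets.sigma_sets_subset) (use that in auto)
  thus ?thesis using pow by (simp add: space_measure_of_conv)
 qed
 hence "sigma_sets (space M) ?I = ?I" by (auto intro: sigma_sets.Basic)
 thus ?thesis unfolding usual_augmentation_def using I by (subst sets_measure_of) auto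
qed

lemma space_augmentation[simp]: "space (usual_augmentation M F t) = space M" by (simp add: usual_augmentation_def space_measure_of_conv)

text \<open>Induction over the generation of the sigma-algebra. It lets probabilities of augmented
  events be computed with events of the raw sigma-algebra.\<close>

lemma null_completion_sets:
 assumes F: "subalgebra M F" and A: "A : sets (sigma (space M) (sets F Un null_sets M))"
 shows "EX A':sets F. AE x in M. x : A \<longleftrightarrow> x : A'"
proof -
 have sF: "space F = space M" "sets F <= sets M" using F by (auto simp: subalgebra_def)
 have pow: "sets F Un null_sets M <= Pow (space M)" using sets.sets_into_space[of _ M] sF by (auto simp: null_sets_def)
 have "A : sigma_sets (space M) (sets F Un null_sets M)" using A pow by simp
 thus ?thesis proof induction case (Basic a)
  show ?case proof (cases "a : sets F") case False
  hence "a : null_sets M" using Basic by auto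
  hence "AE x in M. x ~: a" by (rule AE_not_in)
  thus ?thesis by (intro bexI[of _ "{}"]) auto
  qed auto
 next case Empty show ?case by (intro bexI[of _ "{}"]) auto
 next case (Compl a)
  then obtain A' where "A' : sets F" "AE x in M. x : a \<longleftrightarrow> x : A'" by blast
  thus ?case using sF by (intro bexI[of _ "space M - A'"]) (auto simp flip: sF(1))
 next case (Union a)
  then obtain A' where A': "!!i::nat. A' i : sets F" "!!i. AE x in M. x : a i \<longleftrightarrow> x : A' i" by metis
  hence "AE x in M. ALL i. x : a i \<longleftrightarrow> x : A' i" by (simp add: AE_all_countable)
  hence "AE x in M. x : (UN i. a i) \<longleftrightarrow> x : (UN i. A' i)" by eventually_elim auto
  thus ?case using A' by (intro bexI[of _ "UN i. A' i"]) auto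
 qed qed

lemma space_sigma_join[simp]: "space (sigma_join M G H) = space M" by (simp add: sigma_join_def space_measure_of_conv)

lemma sets_sigma_join_pi:
 assumes G: "subalgebra M G" and H: "subalgebra M H"
 shows "sets (sigma_join M G H) = sigma_sets (space M) {a Int b |a b. a : sets G & b : sets H}" (is "_ = sigma_sets _ ?AB") and "Int_stable {a Int b |a b. a : sets G & b : sets H}"
proof -
 have sp: "space G = space M" "space H = space M" using G H by (auto simp: subalgebra_def)
 have pow: "sets G Un sets H <= Pow (space M)" using sets.sets_into_space[of _ G] sets.sets_into_space[of _ H] sp by auto
 have s: "sets (sigma_join M G H) = sigma_sets (space M) (sets G Un sets H)" unfolding sigma_join_def using pow by simp
 show "sets (sigma_join M G H) = sigma_sets (space M) ?AB"
 proof (rule antisym)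
  show "sets (sigma_join M G H) <= sigma_sets (space M) ?AB" unfolding s
  proof (rule sigma_sets_mono, safe)
  fix x assume x: "x : sets G"
  have "x = x Int space M" using sets.sets_into_space[OF x] sp by auto
  thus "x : sigma_sets (space M) ?AB" using x sets.top[of H] sp(2) by (intro sigma_sets.Basic) (simp, metis)
  next
  fix x assume x: "x : sets H"
  have "x = space M Int x" using sets.sets_into_space[OF x] sp by auto
  thus "x : sigma_sets (space M) ?AB" using x sets.top[of G] sp(1) by (intro sigma_sets.Basic) (simp, metis)
  qed
  have "?AB <= sets (sigma_join M G H)" proof safe
  fix a b assume "a : sets G" "b : sets H"
  hence "a : sets (sigma_join M G H)" "b : sets (sigma_join M G H)" unfolding s by (auto intro: sigma_sets.Basic)
  thus "a Int b : sets (sigma_join M G H)" by (rule sets.Int)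
  qed
  from sets.sigma_sets_subset[OF this]
  show "sigma_sets (space M) ?AB <= sets (sigma_join M G H)" by simp
 qed
 show "Int_stable ?AB" proof (rule Int_stableI, safe)
  fix a b a' b' assume h: "a : sets G" "b : sets H" "a' : sets G" "b' : sets H"
  show "EX a'' b''. (a Int b) Int (a' Int b') = a'' Int b'' & a'' : sets G & b'' : sets H" by (rule exI[of _ "a Int a'"], rule exI[of _ "b Int b'"]) (use h in auto)
 qed qed

lemma join_subalg:
 assumes G: "subalgebra M G" and H: "subalgebra M H"
 shows "subalgebra M (sigma_join M G H)" "sets G <= sets (sigma_join M G H)" "sets H <= sets (sigma_join M G H)"
proof -
 have sp: "space G = space M" "space H = space M" "sets G Un sets H <= sets M" using G H by (auto simp: subalgebra_def)
 have pow: "sets G Un sets H <= Pow (space M)" using sets.sets_into_space[of _ G] sets.sets_into_space[of _ H] sp by auto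
 have s: "sets (sigma_join M G H) = sigma_sets (space M) (sets G Un sets H)" unfolding sigma_join_def using pow by simp
 show "sets G <= sets (sigma_join M G H)" "sets H <= sets (sigma_join M G H)" unfolding s by (auto intro: sigma_sets.Basic)
 show "subalgebra M (sigma_join M G H)" unfolding subalgebra_def s using sets.sigma_sets_subset[OF sp(3)] by simp
qed

end

text \<open>The environment filtrations and the driving filtration are all of the following form.\<close>

locale augmented_bm = cps M for M :: "'a measure" +
 fixes V :: "real => 'a => real" and S :: "'a measure" and G :: "real => 'a measure"
 assumes V: "brownian_motion M V" and S: "subalgebra M S" and ind: "indep_set (sets S) (sets (psigma M {0..} V))"
  and G_def: "G = usual_augmentation M (%t. sigma_join M (natural_filtration M V t) S)"
begin

abbreviation (input) "J t \<equiv> sigma_join M (natural_filtration M V t) S"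

lemma V_measurable: "0 <= t ==> V t : bor M" using bm_facts(9)[OF V[unfolded brownian_motion_def]] .

lemma nat_sub: "subalgebra M (natural_filtration M V t)" unfolding natural_filtration_def by (rule psigma_subalg) (auto intro: V_measurable)

lemma J_sub: "subalgebra M (J t)" by (rule join_subalg(1)[OF nat_sub S])

lemma nat_mono: "s <= t ==> sets (natural_filtration M V s) <= sets (natural_filtration M V t)"
 unfolding natural_filtration_def by (intro psigma_subset psigma_meas) auto

lemma J_mono: "s <= t ==> sets (J s) <= sets (J t)"
proof -
 assume st: "s <= t"
 have "sigma_sets (space M) (sets (natural_filtration M V s) Un sets S) <= sets (J t)" using join_subalg(2,3)[OF nat_sub S, of t] nat_mono[OF st]
  by (subst space_sigma_join[symmetric, of "natural_filtration M V t" S], intro sets.sigma_sets_subset) blast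
 moreover have "sets (natural_filtration M V s) Un sets S <= Pow (space M)"
  using sets.space_closed[of "natural_filtration M V s"] sets.space_closed[of S] nat_sub[of s] S by (auto simp: subalgebra_def)
 ultimately show ?thesis unfolding sigma_join_def by simp
qed

lemma sets_G: "sets (G t) = (INT s:{t<..}. sets (sigma (space M) (sets (J s) Un null_sets M)))" unfolding G_def by (rule sets_augmentation) simp

lemma space_G[simp]: "space (G t) = space M" by (simp add: G_def)

lemma aug_pow: "sets (J s) Un null_sets M <= sets M" using J_sub[of s] by (auto simp: subalgebra_def null_sets_def)

lemma aug_sets: "sets (sigma (space M) (sets (J s) Un null_sets M)) = sigma_sets (space M) (sets (J s) Un null_sets M)"
 using aug_pow[of s] sets.sets_into_space by (subst sets_measure_of) blast+

lemma G_full: "full_alg M (G t)" unfolding full_alg_def subalgebra_def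
proof (intro conjI)
 have "sets (G t) <= sigma_sets (space M) (sets (J (t+1)) Un null_sets M)" unfolding sets_G aug_sets by auto
 also have "... <= sets M" by (rule sets.sigma_sets_subset[OF aug_pow])
 finally show "sets (G t) <= sets M" .
 show "null_sets M <= sets (G t)" unfolding sets_G aug_sets by (auto intro: sigma_sets.Basic)
qed simp

lemma G_mono: "s <= t ==> sets (G s) <= sets (G t)" unfolding sets_G by auto

lemma J_G: "sets (J t) <= sets (G t)" unfolding sets_G aug_sets
proof (intro INT_greatest subsetI)
 fix s x assume "s : {t<..}" "x : sets (J t)"
 hence "x : sets (J s)" using J_mono[of t s] by auto
 thus "x : sigma_sets (space M) (sets (J s) Un null_sets M)" by auto
qed

lemma S_G: "sets S <= sets (G t)" using J_G[of t] join_subalg(3)[OF nat_sub S, of t] by auto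

lemma V_G: "0 <= s ==> s <= t ==> V s : bor (G t)"
proof (rule meas_subalg)
 show "subalgebra (G t) (natural_filtration M V t)" using J_G[of t] join_subalg(2)[OF nat_sub S, of t] by (auto simp: subalgebra_def natural_filtration_def)
qed (auto simp: natural_filtration_def intro: psigma_meas)

text \<open>On an intersection of a past event with an event of \<open>S\<close>, the independence
  of \<open>S\<close> from the whole path peels off the latter; the past of \<open>V\<close> and its
  increment are then split by the Brownian property.\<close>

lemma J_indep:
 assumes "0 <= s" "s < t"
 shows "indep_set (sets (J s)) (sets (vimage_algebra (space M) (%w. V t w - V s w) borel))"
proof -
 let ?D = "%w. V t w - V s w"
 let ?E = "{a Int b |a b. a : sets (natural_filtration M V s) & b : sets S}"
 have [measurable]: "?D : bor M" using assms by (intro borel_measurable_diff V_measurable) auto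
 have Dp: "?D : bor (psigma M {0..} V)" using assms by (intro borel_measurable_diff psigma_meas) auto
 have np: "sets (natural_filtration M V s) <= sets (psigma M {0..} V)"
  unfolding natural_filtration_def by (intro psigma_subset psigma_meas) auto
 have i1: "indep_set (sets (natural_filtration M V s)) (sets (vimage_algebra (space M) ?D borel))" using bm_facts(6)[OF V[unfolded brownian_motion_def] assms] .
 have vM: "sets (vimage_algebra (space M) ?D borel) <= events" by (auto simp: sets_vimage_algebra2 intro!: measurable_sets)
 have vp: "sets (vimage_algebra (space M) ?D borel) <= sets (psigma M {0..} V)" using measurable_sets[OF Dp] by (auto simp: sets_vimage_algebra2)
 have "indep_set ?E (sets (vimage_algebra (space M) ?D borel))" unfolding indep_sets2_eq
 proof (intro conjI ballI vM)
  show "?E <= events" using nat_sub[of s] S by (auto simp: subalgebra_def)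
  fix e c assume "e : ?E" and c: "c : sets (vimage_algebra (space M) ?D borel)"
  then obtain a b where e: "e = a Int b" "a : sets (natural_filtration M V s)" "b : sets S" by auto
  have ac: "a : sets (psigma M {0..} V)" "a Int c : sets (psigma M {0..} V)" using e c np vp by auto
  have "prob (e Int c) = prob (b Int (a Int c))" by (simp add: e ac_simps)
  also have "... = prob b * prob (a Int c)" by (rule indep_setD[OF ind e(3) ac(2)])
  also have "prob (a Int c) = prob a * prob c" by (rule indep_setD[OF i1 e(2) c])
  also have "prob b*(prob a * prob c) = (prob b * prob a) * prob c" by simp
  also have "prob b * prob a = prob (b Int a)" by (rule indep_setD[OF ind e(3) ac(1), symmetric])
  finally show "prob (e Int c) = prob e * prob c" by (simp add: e Int_commute)
 qed
 from indep_set_sigma_sets[OF this sets_sigma_join_pi(2)[OF nat_sub S] sets.Int_stable]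
 have "indep_set (sets (J s)) (sigma_sets (space M) (sets (vimage_algebra (space M) ?D borel)))" by (simp add: sets_sigma_join_pi(1)[OF nat_sub S])
 thus ?thesis using sets.sigma_sets_eq[of "vimage_algebra (space M) ?D borel"] by simp
qed

text \<open>Augmentation looks infinitesimally into the future. An event of \<open>G s\<close>
  belongs, up to null sets, to the raw sigma-algebra at every later time, so the characteristic
  function of the increment is computed from \<open>r n\<close>, and path continuity lets
  \<open>r n\<close> decrease to \<open>s\<close>.\<close>

lemma bm_G: "brownian_motion_wrt M G V"
proof -
 have V': "brownian_motion_wrt M (natural_filtration M V) V" using V by (simp add: brownian_motion_def)
 have main: "(CLINT w|M. indicator A w *\<^sub>R iexp (th*(V t w - V s w))) = prob A *\<^sub>R exp (- (th^2*(t - s)/2))"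
  if st: "0 <= s" "s < t" and A: "A : sets (G s)" for A th s t proof -
  \<comment> \<open>The denominator starts at 2 so that even the first point lies strictly before
    \<open>t\<close>.\<close>
  define r where "r n = s + (t - s)/real (n + 2)" for n
  have r: "s < r n" "r n < t" for n proof -
  have "(t - s)/real (n + 2) < (t - s)/1" by (rule divide_strict_left_mono) (use st in auto)
  thus "r n < t" by (simp add: r_def)
  show "s < r n" using st by (simp add: r_def)
  qed
  have rs: "r ---> s" unfolding r_def by real_asymp
  have AM[measurable]: "A : sets M" using A full_algD(2)[OF G_full] by auto
  have Vm[measurable]: "V t : bor M" "V s : bor M" "V (r n) : bor M" for n using st r[of n] by (auto intro!: V_measurable)
  have eq: "(CLINT w|M. indicator A w *\<^sub>R iexp (th*(V t w - V (r n) w))) = prob A *\<^sub>R exp (- (th^2*(t - r n)/2))" for n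
  proof -
  have "A : sets (sigma (space M) (sets (J (r n)) Un null_sets M))" using A r[of n] unfolding sets_G by auto
  from null_completion_sets[OF J_sub this] obtain A' where A': "A' : sets (J (r n))" "AE x in M. x : A \<longleftrightarrow> x : A'" by auto
  have [measurable]: "A' : sets M" using A' J_sub[of "r n"] by (auto simp: subalgebra_def)
  have pA: "prob A = prob A'" by (rule measure_eq_AE[OF A'(2)]) auto
  have rn: "0 <= r n" "r n < t" using r[of n] st by auto
  have "(CLINT w|M. indicator A w *\<^sub>R iexp (th*(V t w - V (r n) w))) = (CLINT w|M. complex_of_real (indicator A' w) * iexp (th*(V t w - V (r n) w)))"
  by (rule integral_cong_AE) (use A'(2) in "auto simp: scaleR_conv_of_real indicator_def elim!: eventually_mono")
  also have "... = (CLINT w|M. complex_of_real (indicator A' w) * exp (- (th^2*(sqrt (t - r n))^2/2)))"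
  by (rule indep_iexp[OF J_sub J_indep[OF rn] bm_facts(7)[OF V' rn], where C=1]) (use rn A' in "auto simp: indicator_def")
  also have "... = prob A' *\<^sub>R exp (- (th^2*(t - r n)/2))" using rn by (simp add: scaleR_conv_of_real)
  finally show ?thesis using pA by simp
  qed
  have l1: "(%n. CLINT w|M. indicator A w *\<^sub>R iexp (th*(V t w - V (r n) w))) ---> (CLINT w|M. indicator A w *\<^sub>R iexp (th*(V t w - V s w)))"
  proof (rule dom_conv[where w="%_. 1"])
  show "AE w in M. (%n. indicator A w *\<^sub>R iexp (th*(V t w - V (r n) w))) ---> indicator A w *\<^sub>R iexp (th*(V t w - V s w))" using bm_facts(4)[OF V']
  proof eventually_elim case (elim w)
  have "(%n. V (r n) w) ---> V s w" by (rule continuous_on_tendsto_compose[OF elim rs]) (use st less_imp_le[OF order_le_less_trans[OF st(1) r(1)]] in auto)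
  thus ?case by (intro tendsto_intros)
  qed
  qed (auto simp: indicator_def)
  have l2: "(%n. prob A *\<^sub>R exp (- (th^2*(t - r n)/2)) :: complex) ---> prob A *\<^sub>R exp (- (th^2*(t - s)/2))" using rs by (intro tendsto_intros) simp_all
  show ?thesis by (rule LIMSEQ_unique[OF l1[unfolded eq] l2])
 qed
 have sub: "subalgebra M (G t)" for t using full_algD(4)[OF G_full] .
 show ?thesis unfolding brownian_motion_wrt_def is_filtration_def ca_def proof (intro conjI allI impI)
  show "subalgebra M (G t)" for t by (rule sub)
  show "s <= t ==> sets (G s) <= sets (G t)" for s t by (rule G_mono)
  show "0 <= t ==> V t : bor (G t)" for t by (rule V_G) auto
  show "acont M V" using bm_facts(4)[OF V'] .
  show "AE w in M. V 0 w = 0" using bm_facts(5)[OF V'] .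
  fix s t :: real assume st: "0 <= s" "s < t"
  have m: "(%w. V t w - V s w) : bor M" using st by (intro borel_measurable_diff V_measurable) auto
  have v: "t - s > 0" using st by simp
  show "indep_set (sets (G s)) (sets (vimage_algebra (space M) (%w. V t w - V s w) borel))" by (rule char_imp_indep_normal(1)[OF sub m v main[OF st]])
  show "distributed M lborel (%w. V t w - V s w) (normal_density 0 (sqrt (t - s)))" using bm_facts(7)[OF V' st] .
 qed qed

end

section \<open>Pairs of a martingale value and its bracket\<close>

text \<open>The last identity holds for \<open>Y = \<integral> H dB\<close>, \<open>V = \<integral> H\<^sup>2 dt\<close> with bounded \<open>V\<close> and implies the moment
  identities. It passes to almost sure limits with uniformly bounded brackets, so deterministic grids suffice.\<close>

definition good_pair :: "'a measure => ('a => real) => ('a => real) => bool" where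
 "good_pair M Y V = (Y : bor M & V : bor M & (EX C. AE w in M. 0 <= V w & V w <= C) &
  integrable M (%w. Y w^4) & (LINT w|M. Y w) = 0 & (LINT w|M. (Y w)^2) = (LINT w|M. V w) & (LINT w|M. Y w^4) <= 36*(LINT w|M. (V w)^2) &
  (ALL th. (CLINT w|M. iexp (th * Y w) * exp (th^2 * V w/2)) = 1))"

context cps
begin

lemma int_bdd_mult:
 fixes X Z :: "'a => real"
 assumes "integrable M X" "Z : bor M" "AE w in M. abs (Z w) <= K"
 shows "integrable M (%w. Z w * X w)"
proof (rule b_int_bound[of _ "%w. K * X w"])
 show "AE w in M. norm (Z w * X w) <= norm (K * X w)" using assms(3) by eventually_elim (auto simp: abs_mult intro!: mult_right_mono)
qed (use assms in auto)

lemma int_power_le4: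
 fixes Y :: "'a => real"
 assumes [measurable]: "Y : bor M" and i: "integrable M (%w. Y w^4)" and j: "j <= 4"
 shows "integrable M (%w. Y w^j)"
proof (rule b_int_bound[of _ "%w. 1 + Y w^4"])
 have "abs (y^j) <= 1 + y^4" for y :: real proof (cases "abs y <= 1") case True
  hence "abs y^j <= 1" by (simp add: power_le_one)
  thus ?thesis by (simp add: power_abs add_increasing2)
 next case False
  hence "abs y^j <= abs y^4" using j by (intro power_increasing) auto
  thus ?thesis by (simp add: power_abs)
 qed
 thus "AE w in M. norm (Y w^j) <= norm (1 + Y w^4)" by (auto intro: order_trans[OF _ abs_ge_self])
qed (use i in auto)

lemma fatou_L2:
 fixes X :: "nat => 'a => real"
 assumes m[measurable]: "!!n. X n : bor M" "L : bor M" and i: "!!n. integrable M (%w. (X n w)^2)" and b: "!!n. (LINT w|M. (X n w)^2) <= k n" and k: "k ---> K"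
  and ae: "AE w in M. (%n. X n w) ---> L w"
 shows "integrable M (%w. (L w)^2)" "(LINT w|M. (L w)^2) <= K"
proof -
 have K0: "0 <= K" using k order_trans[OF integral_nonneg_AE b] by (intro LIMSEQ_le_const) auto
 have "(\<integral>\<^sup>+w. ennreal ((L w)^2) \<partial>M) = (\<integral>\<^sup>+w. liminf (%n. ennreal ((X n w)^2)) \<partial>M)"
 proof (rule nn_integral_cong_AE)
  show "AE w in M. ennreal ((L w)^2) = liminf (%n. ennreal ((X n w)^2))"
  using ae by eventually_elim (intro lim_imp_Liminf[symmetric] tendsto_ennrealI tendsto_power, auto)
 qed
 also have "... <= liminf (%n. \<integral>\<^sup>+w. ennreal ((X n w)^2) \<partial>M)" by (rule nn_integral_liminf) measurable
 also have "... <= liminf (%n. ennreal (k n))" by (intro Liminf_mono always_eventually allI) (subst nn_integral_eq_integral, use i b in "auto intro!: ennreal_leI")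
 also have "... = ennreal K" by (intro lim_imp_Liminf tendsto_ennrealI k) auto
 finally have nn: "(\<integral>\<^sup>+w. ennreal ((L w)^2) \<partial>M) <= ennreal K" .
 show iL: "integrable M (%w. (L w)^2)" by (rule integrableI_bounded) (use nn in "auto intro: le_less_trans")
 show LK: "(LINT w|M. (L w)^2) <= K" using nn K0 by (subst (asm) nn_integral_eq_integral[OF iL]) auto
qed

text \<open>No integrability of \<open>Y\<close> is known beforehand, so the exponential identity
  cannot simply be differentiated at 0. Bounded difference quotients of cosine and sine with step
  \<open>1/N n\<close> take the place of derivatives: the imaginary part yields the mean, the real
  part the second and fourth moments.\<close>

lemma good_pairI:
 assumes m[measurable]: "Y : bor M" "V : bor M" and V: "AE w in M. 0 <= V w & V w <= C"
  and ch: "!!th. (CLINT w|M. iexp (th * Y w) * exp (th^2 * V w/2)) = 1"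
 shows "good_pair M Y V"
proof -
 obtain w0 where "0 <= V w0 & V w0 <= C" using eventually_happens[OF V] by (auto simp: ae_filter_eq_bot_iff emeasure_space_1)
 hence C0: "0 <= C" by linarith
 define S where "S th w = exp (th^2 * V w/2)" for th w
 have Sm[measurable]: "S th : bor M" for th unfolding S_def by measurable
 have Sb: "AE w in M. 1 <= S th w & S th w <= exp (th^2 * C/2)" for th
  using V by eventually_elim (auto simp: S_def intro!: mult_left_mono)
 have Sn: "AE w in M. abs (S th w) <= exp (th^2 * C/2)" for th using Sb[of th] by eventually_elim auto
 have bi: "integrable M (%w. S th w * g w)" if "g : bor M" "!!w. abs (g w) <= 1" for th and g :: "'a => real"
  by (rule int_bdd_mult[OF integrable_const_bound[of _ 1] _ Sn]) (use that in auto)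
 have Si: "integrable M (S th)" for th using bi[of "%_. 1" th] by simp
 have Rc: "(LINT w|M. S th w * cos (th * Y w)) = 1" and Is: "(LINT w|M. S th w * sin (th * Y w)) = 0" for th
 proof -
  have e: "iexp (th * Y w) * exp (th^2 * V w/2) = Complex (S th w * cos (th * Y w)) (S th w * sin (th * Y w))" for w
  by (simp add: S_def complex_eq_iff Re_exp Im_exp exp_of_real)
  have i: "complex_integrable M (%w. Complex (S th w * cos (th * Y w)) (S th w * sin (th * Y w)))"
  unfolding Complex_eq by (intro b_int_add integrable_mult_right integrable_of_real bi) auto
  show "(LINT w|M. S th w * cos (th * Y w)) = 1" "(LINT w|M. S th w * sin (th * Y w)) = 0"
  using integral_Re[OF i] integral_Im[OF i] ch[of th] unfolding e by simp_all
 qed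
 define N where "N n = real n + 1" for n
 have N: "N n > 0" "N n >= 1" for n by (auto simp: N_def)
 define u where "u n w = (N n)^2*(1 - cos (Y w/N n))" for n w
 \<comment> \<open>Since \<open>S (2 * th) w = (S th w)^4\<close>, this is the rescaled difference
   of the exponential weights at \<open>2/N n\<close> and \<open>1/N n\<close>; its limit has the
   factor 2 - 1/2 = 3/2.\<close>
 define d where "d n w = (N n)^2*((S (1/N n) w)^4 - S (1/N n) w)" for n w
 have um[measurable]: "u n : bor M" "d n : bor M" for n unfolding u_def d_def by measurable
 have ul: "(%n. u n w) ---> (Y w)^2/2" for w unfolding u_def N_def sq_eq[of "Y w"] by real_asymp
 have dl: "(%n. d n w) ---> 3/2 * V w" for w unfolding d_def N_def S_def by real_asymp
 have db: "AE w in M. abs (d n w) <= 2*C*exp (2*C)" for n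
  using V Sb[of "1/N n"] proof eventually_elim case (elim w)
  let ?x = "2*V w/(N n)^2"
  have x: "0 <= ?x" "?x <= 2*C" using elim(1) C0 N[of n] by (auto simp: divide_simps intro: order_trans[OF _ mult_left_mono[of 1]])
  have "(S (1/N n) w)^4 = exp ?x" unfolding S_def exp_of_nat_mult[symmetric] by (simp add: power_divide)
  moreover have "exp ?x - 1 <= ?x * exp ?x" using exp_ge_add_one_self[of "- ?x"] by (simp add: exp_minus field_simps)
  moreover have "S (1/N n) w <= (S (1/N n) w)^4" using elim(2) by (simp add: self_le_power)
  ultimately have "0 <= (S (1/N n) w)^4 - S (1/N n) w" "(S (1/N n) w)^4 - S (1/N n) w <= ?x * exp (2*C)"
  using elim(2) mult_left_mono[OF exp_le_cancel_iff[THEN iffD2, OF x(2)] x(1)] by auto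
  from mult_left_mono[OF this(2), of "(N n)^2"] this(1) have "0 <= d n w" "d n w <= 2 * V w * exp (2*C)" using N[of n] by (auto simp: d_def)
  moreover have "2 * V w * exp (2*C) <= 2*C*exp (2*C)" using elim(1) by simp
  ultimately show ?case by linarith
 qed
 have d2b: "AE w in M. (d n w)^2 <= (2*C*exp (2*C))^2" for n using db[of n] by eventually_elim (metis abs_ge_zero power2_abs power_mono)
 have d2i: "integrable M (%w. (d n w)^2)" for n by (rule integrable_const_bound[where B="(2*C*exp (2*C))^2"]) (use d2b in auto)
 have ub: "abs (u n w) <= (N n)^2*2" for n w proof -
  have "abs (1 - cos (Y w/N n)) <= 2" unfolding abs_le_iff using cos_ge_minus_one[of "Y w/N n"] cos_le_one[of "Y w/N n"] by linarith
  thus ?thesis unfolding u_def abs_mult by (intro mult_mono) auto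
 qed
 have u2i: "integrable M (%w. (u n w)^2)" for n
 proof (rule integrable_const_bound[where B="((N n)^2*2)^2"], rule AE_I2)
  show "norm ((u n w)^2) <= ((N n)^2*2)^2" for w using power_mono[OF ub abs_ge_zero, of n w 2] by (simp only: real_norm_def power2_abs abs_power2)
 qed measurable
 have a4: "4*(s - 1) <= s^4 - 1" if "1 <= s" for s :: real proof -
  have "0 <= (s - 1)^2*(s^2 + s*2 + 3)" using that by simp
  thus ?thesis by (simp add: sq_eq power4_eq_xxxx algebra_simps)
 qed
 have a5: "s - 1 <= s^4 - s" if "1 <= s" for s :: real using a4[OF that] that by argo
 text \<open>Expanding \<open>2 (1 - cos a)\<^sup>2 = 3 - 4 cos a + cos 2a\<close> and comparing with the exponential identity at \<open>\<theta>\<close> and \<open>2\<theta>\<close>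
  bounds \<open>E (1 - cos \<theta>Y)\<^sup>2\<close> by the brackets; the fourth moment follows as \<open>\<theta> \<rightarrow> 0\<close>.\<close>
 have uL: "(LINT w|M. (u n w)^2) <= 4*(LINT w|M. (d n w)^2)" for n proof -
  let ?s = "S (1/N n)" and ?c = "%w. cos (1/N n * Y w)" and ?c2 = "%w. cos (2/N n * Y w)"
  have s4: "S (2/N n) w = (?s w)^4" for w unfolding S_def exp_of_nat_mult[symmetric] by (simp add: power_divide)
  have i: "integrable M (%w. ?s w * ?c w)" "integrable M (%w. S (2/N n) w * ?c2 w)" by (intro bi; simp)+
  have "(LINT w|M. 2*(u n w)^2) <= (LINT w|M. (u n w)^2 + 4*(d n w)^2 + (N n)^4*(3 - 4*(?s w * ?c w) + S (2/N n) w * ?c2 w))"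
  proof (rule integral_mono_AE)
  show "AE w in M. 2*(u n w)^2 <= (u n w)^2 + 4*(d n w)^2 + (N n)^4*(3 - 4*(?s w * ?c w) + S (2/N n) w * ?c2 w)"
  using Sb[of "1/N n"] proof eventually_elim case (elim w)
  define s where "s = ?s w"
  define x where "x = 1 - ?c w"
  have c2: "?c2 w = 2*(1 - x)^2 - 1" using cos_double_cos[of "1/N n * Y w"] by (simp add: x_def)
  have s1: "1 <= s" using elim by (simp add: s_def)
  have x: "0 <= x" by (simp add: x_def)
  have b: "0 <= 2*x^2*(s^4 - 1)" using s1 by simp
  \<comment> \<open>This square absorbs the mixed term of \<open>x\<close> and
    \<open>s^4 - s\<close>; what remains is nonnegative by \<open>a4\<close> and
    \<open>b\<close>.\<close>
  have "0 <= (x - 2*(s^4 - s))^2" by simp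
  hence "2*x^2 <= x^2 + 4*(s^4 - s)^2 + (3 - 4*(s*(1 - x)) + s^4*(2*(1 - x)^2 - 1))"
  using a4[OF s1] b by (simp add: sq_eq algebra_simps)
  hence "(N n)^4*(2*x^2) <= (N n)^4*(x^2 + 4*(s^4 - s)^2 + (3 - 4*(s*(1 - x)) + s^4*(2*(1 - x)^2 - 1)))" by (rule mult_left_mono) simp
  thus ?case unfolding s4 c2 u_def d_def by (simp add: s_def[symmetric] x_def sq_eq power4_eq_xxxx algebra_simps)
  qed
  qed (use u2i d2i i in auto)
  also have "... = (LINT w|M. (u n w)^2) + 4*(LINT w|M. (d n w)^2)"
  using u2i d2i i Rc[of "1/N n"] Rc[of "2/N n"] by (simp add: prob_space)
  finally show ?thesis by simp
 qed
 have dL: "(%n. LINT w|M. (d n w)^2) ---> (LINT w|M. (3/2 * V w)^2)"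
 proof (rule dom_conv[where w="%_. (2*C*exp (2*C))^2"])
  show "AE w in M. (%n. (d n w)^2) ---> (3/2 * V w)^2" by (intro AE_I2 tendsto_power dl)
 qed (use d2b in auto)
 note F = fatou_L2[where X=u and L="%w. (Y w)^2/2", OF _ _ u2i uL tendsto_mult_left[OF dL] AE_I2[OF ul]]
 have q: "((Y w)^2/2)^2 = Y w^4/4" "(3/2 * V w)^2 = 9/4*(V w)^2" for w by (simp_all add: power_divide power_mult_distrib power_mult[symmetric])
 have "integrable M (%w. Y w^4/4)" using F(1) unfolding q by simp
 from integrable_mult_right[OF this, of 4] have i4: "integrable M (%w. Y w^4)" by simp
 \<comment> \<open>Fatou bounds the mean of \<open>Y^4/4\<close> by 4 * 9/4 times the mean of
   \<open>V^2\<close>, which is the factor 36.\<close>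
 have e4: "(LINT w|M. Y w^4) <= 36*(LINT w|M. (V w)^2)" using F(2) unfolding q by simp
 have i: "integrable M (%w. (Y w)^2)" "integrable M Y" using int_power_le4[OF m(1) i4, of 2] int_power_le4[OF m(1) i4, of 1] by auto
 have SC: "AE w in M. abs (S (1/N n) w) <= exp C" for n
  using Sn[of "1/N n"] proof eventually_elim case (elim w)
  have "(1/N n)^2 <= 1^2" using N[of n] by (intro power_mono) auto
  hence "(1/N n)^2 * C <= C" using C0 by (metis mult_right_mono mult_1 one_power2)
  hence "(1/N n)^2 * C/2 <= C" using C0 by linarith
  thus ?case using elim by (meson exp_le_cancel_iff order_trans)
 qed
 have Sl: "(%n. S (1/N n) w) ---> 1" for w unfolding S_def N_def by real_asymp
 have "(%n. LINT w|M. S (1/N n) w*(N n * sin (Y w/N n))) ---> (LINT w|M. 1 * Y w)"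
 proof (rule dom_conv[where w="%w. exp C*abs (Y w)"])
  have "(%n. N n * sin (Y w/N n)) ---> Y w" for w unfolding N_def by real_asymp
  thus "AE w in M. (%n. S (1/N n) w*(N n * sin (Y w/N n))) ---> 1 * Y w" by (intro AE_I2 tendsto_mult Sl)
  have s: "abs (N n * sin (Y w/N n)) <= abs (Y w)" for n w using abs_sin_x_le_abs_x[of "Y w/N n"] N[of n] by (simp add: abs_mult field_simps)
  show "AE w in M. norm (S (1/N n) w*(N n * sin (Y w/N n))) <= exp C*abs (Y w)" for n
  using SC[of n] by eventually_elim (simp only: real_norm_def abs_mult[of "S _ _"], intro mult_mono s, auto)
 qed (use i in auto)
 moreover have "(LINT w|M. S (1/N n) w*(N n * sin (Y w/N n))) = 0" for n using Is[of "1/N n"] by (simp add: mult.left_commute[of _ "N n"])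
 ultimately have e1: "(LINT w|M. Y w) = 0" by (simp add: LIMSEQ_const_iff)
 have "(%n. LINT w|M. S (1/N n) w * u n w) ---> (LINT w|M. 1*((Y w)^2/2))"
 proof (rule dom_conv[where w="%w. exp C*((Y w)^2/2)"])
  show "AE w in M. (%n. S (1/N n) w * u n w) ---> 1*((Y w)^2/2)" by (intro AE_I2 tendsto_mult Sl ul)
  have c: "1 - cos x <= x^2/2" for x :: real
  using cos_double_sin[of "x/2"] power_mono[OF abs_sin_x_le_abs_x[of "x/2"] abs_ge_zero, of 2] by (simp add: power_divide)
  have s: "abs (u n w) <= (Y w)^2/2" for n w
  using mult_left_mono[OF c[of "Y w/N n"], of "(N n)^2"] N[of n] by (simp add: u_def abs_mult power_divide)
  show "AE w in M. norm (S (1/N n) w * u n w) <= exp C*((Y w)^2/2)" for n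
  using SC[of n] by eventually_elim (simp only: real_norm_def abs_mult[of "S _ _"], intro mult_mono s, auto)
 qed (use i in auto)
 moreover have "(LINT w|M. S (1/N n) w * u n w) = (LINT w|M. (N n)^2*(S (1/N n) w - 1))" for n proof -
  have "(LINT w|M. S (1/N n) w * u n w) = (LINT w|M. (N n)^2*(S (1/N n) w - S (1/N n) w * cos (1/N n * Y w)))"
  by (rule b_cong) (auto simp: u_def algebra_simps)
  also have "... = (LINT w|M. (N n)^2*(S (1/N n) w - 1))" using Si[of "1/N n"] bi[of "%w. cos (1/N n * Y w)" "1/N n"] Rc[of "1/N n"] by (simp add: prob_space)
  finally show ?thesis .
 qed
 moreover have "(%n. LINT w|M. (N n)^2*(S (1/N n) w - 1)) ---> (LINT w|M. V w/2)"
 proof (rule dom_conv[where w="%_. 2*C*exp (2*C)"])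
  have "(%n. (N n)^2*(S (1/N n) w - 1)) ---> V w/2" for w unfolding S_def N_def by real_asymp
  thus "AE w in M. (%n. (N n)^2*(S (1/N n) w - 1)) ---> V w/2" by (rule AE_I2)
  show "AE w in M. norm ((N n)^2*(S (1/N n) w - 1)) <= 2*C*exp (2*C)" for n
  using db[of n] Sb[of "1/N n"] proof eventually_elim case (elim w)
  have "S (1/N n) w - 1 <= (S (1/N n) w)^4 - S (1/N n) w" by (rule a5[OF conjunct1[OF elim(2)]])
  hence "abs ((N n)^2*(S (1/N n) w - 1)) <= abs (d n w)" using elim(2) unfolding d_def abs_mult by (intro mult_left_mono) auto
  thus ?case using elim(1) by simp
  qed
 qed auto
 ultimately have "(LINT w|M. (Y w)^2/2) = (LINT w|M. V w/2)" by (auto dest: LIMSEQ_unique)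
 hence e2: "(LINT w|M. (Y w)^2) = (LINT w|M. V w)" by simp
 show ?thesis unfolding good_pair_def using m V i4 e1 e2 e4 ch by blast
qed

text \<open>The integrands have modulus at most \<open>exp (th^2 * C/2)\<close>, so dominated
  convergence carries over the exponential identity; the moment identities of the limit then follow
  from it afresh, without uniform integrability of the fourth powers.\<close>

lemma good_pair_limit:
 assumes gp: "!!n. good_pair M (Y n) (V n)" and m[measurable]: "Y' : bor M" "V' : bor M"
  and Y: "AE w in M. (%n. Y n w) ---> Y' w" and V: "AE w in M. (%n. V n w) ---> V' w" and C: "!!n. AE w in M. V n w <= C"
 shows "good_pair M Y' V'"
proof -
 have ms[measurable]: "Y n : bor M" "V n : bor M" for n using gp by (auto simp: good_pair_def)
 have V0: "AE w in M. 0 <= V n w" for n proof -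
  from gp[of n] obtain c where "AE w in M. 0 <= V n w & V n w <= c" unfolding good_pair_def by blast
  thus ?thesis by eventually_elim simp
 qed
 have Vall: "AE w in M. ALL n. 0 <= V n w & V n w <= C" unfolding AE_all_countable using V0 C by auto
 have V'b: "AE w in M. 0 <= V' w & V' w <= C" using Vall V by eventually_elim (auto intro: LIMSEQ_le_const LIMSEQ_le_const2)
 have ex: "(CLINT w|M. iexp (th * Y' w) * exp (th^2 * V' w/2)) = 1" for th proof -
  have "(%n. CLINT w|M. iexp (th * Y n w) * exp (th^2 * V n w/2)) ---> (CLINT w|M. iexp (th * Y' w) * exp (th^2 * V' w/2))"
  proof (rule dom_conv[where w="%_. exp (th^2 * C/2)"])
  show "AE w in M. (%n. iexp (th * Y n w) * exp (th^2 * V n w/2)) ---> iexp (th * Y' w) * exp (th^2 * V' w/2)" using Y V by eventually_elim (intro tendsto_intros, auto)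
  show "AE w in M. norm (iexp (th * Y n w) * exp (th^2 * V n w/2)) <= exp (th^2 * C/2)" for n
  using C[of n] by eventually_elim (auto simp: norm_mult intro!: mult_left_mono)
  qed auto
  thus ?thesis using gp by (simp add: good_pair_def LIMSEQ_const_iff)
 qed
 show ?thesis by (rule good_pairI[OF m V'b ex])
qed

text \<open>Conditionally on the past each step is Gaussian with variance
  \<open>(c m)^2 * dl\<close>; its characteristic function cancels exactly the factor by which the
  exponential of the bracket grows.\<close>

lemma good_pair_grid:
 assumes bm: "brownian_motion_wrt M G B" and t: "mono t" "0 <= t 0" and c: "!!k. k < n ==> c k : bor (G (t k))"
  and cb: "!!k w. k < n ==> w : space M ==> abs (c k w) <= C"
 shows "good_pair M (%w. SUM k<n. c k w*(B (t (Suc k)) w - B (t k) w)) (%w. SUM k<n. (c k w)^2*(t (Suc k) - t k))"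
proof -
 define Y where "Y n w = (SUM k<n. c k w*(B (t (Suc k)) w - B (t k) w))" for n w
 define V where "V n w = (SUM k<n. (c k w)^2*(t (Suc k) - t k))" for n w
 have tk: "0 <= t k" "t k <= t (Suc k)" for k using t monoD[OF t(1), of 0 k] monoD[OF t(1), of k "Suc k"] by auto
 have step: "Y (Suc m) w = Y m w + c m w*(B (t (Suc m)) w - B (t m) w)" "V (Suc m) w = V m w + (c m w)^2*(t (Suc m) - t m)" for m w by (simp_all add: Y_def V_def)
 have subG: "subalgebra M (G (t k))" for k using bm_facts(1)[OF bm tk(1)] .
 have up: "f : bor (G (t j))" if "f : bor (G (t k))" "k <= j" for f :: "'a => real" and j k using bm_facts(2)[OF bm tk(1) monoD[OF t(1) that(2)]] subG[of j] subG[of k]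
  by (intro meas_subalg[OF _ that(1)]) (auto simp: subalgebra_def)
 have toM: "f : bor M" if "f : bor (G (t k))" for f :: "'a => real" and k by (rule meas_subalg[OF subG that])
 have inv: "Y m : bor (G (t m)) & V m : bor (G (t m)) & (ALL w:space M. 0 <= V m w & V m w <= C^2*(t m - t 0)) & (ALL th. (CLINT w|M. iexp (th * Y m w) * exp (th^2 * V m w/2)) = 1)" if "m <= n" for m using that
 proof (induction m) case 0
  show ?case by (simp add: Y_def V_def prob_space)
 next case (Suc m)
  hence mn: "m < n" by simp
  note IH = Suc.IH[OF less_imp_le[OF mn]]
  show ?case proof (cases "t (Suc m) = t m") case True
  hence "Y (Suc m) = Y m" "V (Suc m) = V m" by (auto simp: step)
  thus ?thesis using IH True by simp
  next case False
  define D where "D w = B (t (Suc m)) w - B (t m) w" for w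
  define dl where "dl = t (Suc m) - t m"
  have d: "dl > 0" using False tk(2)[of m] by (simp add: dl_def)
  have ind: "indep_set (sets (G (t m))) (sets (vimage_algebra (space M) D borel))" using bm_facts(6)[OF bm tk(1)[of m], of "t (Suc m)"] d unfolding D_def dl_def by simp
  have dis: "distributed M lborel D (normal_density 0 (sqrt dl))" using bm_facts(7)[OF bm tk(1)[of m], of "t (Suc m)"] d unfolding D_def dl_def by simp
  have sd: "sqrt dl > 0" using d by simp
  have Dm[measurable]: "D : bor M" using distributed_measurable[OF dis] by simp
  have YG: "Y m : bor (G (t m))" and VG: "V m : bor (G (t m))" using IH by auto
  have cG: "c m : bor (G (t m))" using c[OF mn] .
  note [measurable] = toM[OF YG] toM[OF VG] toM[OF cG]
  have Vb: "0 <= V m w" "V m w <= C^2*(t m - t 0)" if "w : space M" for w using IH that by auto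
  have cmb: "abs (c m w) <= C" if "w : space M" for w using cb[OF mn that] .
  have c2: "(c m w)^2 <= C^2" if "w : space M" for w using cmb[OF that] by (metis abs_ge_zero power2_abs power_mono)
  have YS: "Y (Suc m) w = Y m w + c m w * D w" and VS: "V (Suc m) w = V m w + (c m w)^2 * dl" for w by (simp_all add: step D_def dl_def)
  have VSb: "0 <= V (Suc m) w" "V (Suc m) w <= C^2*(t (Suc m) - t 0)" if "w : space M" for w proof -
  show "0 <= V (Suc m) w" using Vb[OF that] d by (simp add: VS)
  have "V (Suc m) w <= C^2*(t m - t 0) + C^2 * dl" unfolding VS using Vb(2)[OF that] c2[OF that] d by (intro add_mono mult_right_mono) auto
  thus "V (Suc m) w <= C^2*(t (Suc m) - t 0)" by (simp add: dl_def algebra_simps)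
  qed
  \<comment> \<open>The bracket after the step is already known at its beginning, hence it can be
    frozen together with the past.\<close>
  have VSG: "V (Suc m) : bor (G (t m))" unfolding VS using VG cG by measurable
  have VSM[measurable]: "V (Suc m) : bor M" by (rule toM[OF VSG])
  have Dt: "D : bor (G (t (Suc m)))" unfolding D_def using bm_facts(8)[OF bm tk(1)[of m] tk(2)[of m]] bm_facts(3)[OF bm tk(1)[of "Suc m"]] by measurable
  have YSG: "Y (Suc m) : bor (G (t (Suc m)))" unfolding YS using up[OF YG, of "Suc m"] up[OF cG, of "Suc m"] Dt by measurable
  define K where "K = C^2*(t (Suc m) - t 0)"
  have EX: "(CLINT w|M. iexp (th * Y (Suc m) w) * exp (th^2 * V (Suc m) w/2)) = 1" for th proof -
  have "(CLINT w|M. iexp (th * Y (Suc m) w) * exp (th^2 * V (Suc m) w/2)) = (CLINT w|M. (iexp (th * Y m w) * exp (th^2 * V (Suc m) w/2)) * iexp ((th * c m w) * D w))"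
  by (intro b_cong refl) (simp add: YS algebra_simps exp_add)
  also have "... = (CLINT w|M. (iexp (th * Y m w) * exp (th^2 * V (Suc m) w/2)) * exp (- ((th * c m w)^2*(sqrt dl)^2/2)))"
  proof (rule indep_iexp[OF subG ind dis sd])
  show "(%x. iexp (th * Y m x) * exp (th^2 * V (Suc m) x/2)) : bor (G (t m))" using YG VSG by measurable
  show "(%x. th * c m x) : bor (G (t m))" using cG by measurable
  show "cmod (iexp (th * Y m w) * exp (th^2 * V (Suc m) w/2)) <= exp (th^2 * K/2)" if "w : space M" for w
  using VSb(2)[OF that] by (auto simp: norm_mult K_def intro!: mult_left_mono)
  qed
  also have "... = (CLINT w|M. iexp (th * Y m w) * exp (th^2 * V m w/2))" proof (intro b_cong refl)
  fix w
  have e: "exp (th^2 * V (Suc m) w/2) * exp (- ((th * c m w)^2*(sqrt dl)^2/2)) = exp (th^2 * V m w/2)"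
  using d by (simp add: exp_add[symmetric] VS power_mult_distrib field_simps)
  have "(iexp (th * Y m w) * exp (th^2 * V (Suc m) w/2)) * exp (- ((th * c m w)^2*(sqrt dl)^2/2)) =
  iexp (th * Y m w) * complex_of_real (exp (th^2 * V (Suc m) w/2) * exp (- ((th * c m w)^2*(sqrt dl)^2/2)))" by (simp add: mult.assoc)
  thus "(iexp (th * Y m w) * exp (th^2 * V (Suc m) w/2)) * exp (- ((th * c m w)^2*(sqrt dl)^2/2)) =
  iexp (th * Y m w) * exp (th^2 * V m w/2)" unfolding e .
  qed
  also have "... = 1" using IH by blast
  finally show ?thesis .
  qed
  have "V (Suc m) : bor (G (t (Suc m)))" by (rule up[OF VSG]) simp
  with YSG VSb EX show ?thesis by blast
  qed qed
 note I = inv[OF order_refl]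
 have m[measurable]: "Y n : bor M" "V n : bor M" using toM[OF conjunct1[OF I]] toM[OF conjunct1[OF conjunct2[OF I]]] by auto
 have "good_pair M (Y n) (V n)" by (rule good_pairI[OF m, where C="C^2*(t n - t 0)"]) (use I in auto)
 thus ?thesis by (simp add: Y_def[abs_def] V_def[abs_def])
qed

end

section \<open>Time-changed Brownian motion\<close>

text \<open>The rules \<open>F_D\<close> and \<open>F_I\<close> characterise \<open>F t\<close> as
  the sigma-algebra stopped at \<open>tau t\<close> without naming its construction, so that the
  trivial clock \<open>tau t = t\<close> with \<open>F = G\<close> is an instance as well.\<close>

locale time_change = cps M for M :: "'a measure" +
 fixes B :: "real => 'a => real" and G :: "real => 'a measure" and tau :: "real => 'a => real" and F :: "real => 'a measure"
 assumes bm: "brownian_motion_wrt M G B" and Gfull: "0 <= t ==> full_alg M (G t)" and Ffull: "0 <= t ==> full_alg M (F t)"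
  and Fmono: "0 <= s ==> s <= t ==> sets (F s) <= sets (F t)" and F_D: "0 <= t ==> 0 <= u ==> A : sets (F t) ==> {w : A. tau t w <= u} : sets (G u)"
  and F_I: "0 <= t ==> A <= space M ==> (!!u. 0 <= u ==> {w : A. tau t w <= u} : sets (G u)) ==> A : sets (F t)"
  and tau_ae: "AE w in M. cont0 (%t. tau t w) & mono_on {0..} (%t. tau t w) & tau 0 w = 0"
begin

definition X :: "real => 'a => real" where "X t w = B (tau t w) w"
text \<open>The clock has no deterministic bound; holding \<open>B\<close> at its own time
  \<open>K\<close> makes the bracket \<open>AK\<close> bounded, as the exponential identity
  demands.\<close>

definition XK :: "real => real => 'a => real" where "XK K t w = B (min (tau t w) K) w"
definition AK :: "real => real => 'a => real" where "AK K t w = min (tau t w) K"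

lemma Gmono: "0 <= s ==> s <= t ==> sets (G s) <= sets (G t)" using bm_facts(2)[OF bm] .

lemma spaceF: "0 <= t ==> space (F t) = space M" and spaceG: "0 <= t ==> space (G t) = space M" using full_algD(1)[OF Ffull] full_algD(1)[OF Gfull] by auto

lemma F_meas_M: "0 <= t ==> f : bor (F t) ==> f : bor M" for f :: "'a => real" using meas_subalg full_algD(4)[OF Ffull] by blast

lemma F_meas_mono: "0 <= s ==> s <= t ==> f : bor (F s) ==> f : bor (F t)" for f :: "'a => real"
 using Fmono[of s t] spaceF[of s] spaceF[of t] by (intro meas_subalg[of "F t" "F s"]) (auto simp: subalgebra_def)

lemma G_meas_mono: "0 <= s ==> s <= t ==> f : bor (G s) ==> f : bor (G t)" for f :: "'a => real"
 using Gmono[of s t] spaceG[of s] spaceG[of t] by (intro meas_subalg[of "G t" "G s"]) (auto simp: subalgebra_def)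

lemma tau_nonneg: "AE w in M. ALL t>=0. 0 <= tau t w" using tau_ae by eventually_elim (metis atLeast_iff mono_onD order_refl)

lemma stopping: "0 <= t ==> 0 <= u ==> {w : space M. tau t w <= u} : sets (G u)" using F_D[of t u "space M"] spaceF sets.top[of "F t"] by metis

lemma tau_min_meas:
 assumes "0 <= t" "0 <= u"
 shows "(%w. min (tau t w) u) : bor (G u)"
proof (rule borel_measurableI_le)
 fix a
 consider "u <= a" | "0 <= a" "a < u" | "a < 0" by linarith
 thus "{w : space (G u). min (tau t w) u <= a} : sets (G u)" proof cases
  case 1 thus ?thesis by (simp add: min_le_iff_disj)
 next case 2
  hence "{w : space (G u). min (tau t w) u <= a} = {w : space M. tau t w <= a}" using assms by (auto simp: spaceG)
  thus ?thesis using stopping[OF assms(1) 2(1)] Gmono[of a u] 2 by auto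
 next case 3
  have "AE w in M. ~ min (tau t w) u <= a" using tau_nonneg by eventually_elim (use 3 assms in force)
  from full_subset_null[OF Gfull[OF assms(2)] this] show ?thesis using assms by (simp add: spaceG)
 qed qed

lemma F_measurableI:
 fixes f :: "'a => real"
 assumes t: "0 <= t" and f: "!!u. 0 <= u ==> EX g:bor (G u). ALL w:space M. tau t w <= u --> f w = g w"
 shows "f : bor (F t)"
proof (rule measurableI)
 fix A :: "real set" assume A: "A : sets borel"
 show "f -` A Int space (F t) : sets (F t)" proof (rule F_I[OF t])
  show "f -` A Int space (F t) <= space M" using t by (auto simp: spaceF)
  fix u :: real assume u: "0 <= u"
  from f[OF u] obtain g where g: "g : bor (G u)" "!!w. w : space M ==> tau t w <= u ==> f w = g w" by blast
  have "{w : f -` A Int space (F t). tau t w <= u} = (g -` A Int space (G u)) Int {w : space M. tau t w <= u}" using t u g(2) by (auto simp: spaceF spaceG)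
  thus "{w : f -` A Int space (F t). tau t w <= u} : sets (G u)" using measurable_sets[OF g(1) A] stopping[OF t u] by auto
 qed
qed simp

text \<open>On the event that the clock is at most \<open>u\<close>, the value agrees with
  \<open>Z\<close> at the index \<open>min (tau t w) u\<close>, and this is
  \<open>G u\<close>-measurable by composition.\<close>

lemma stop_adapted:
 fixes Z :: "real => 'a => real"
 assumes t: "0 <= t" and Z: "!!s. 0 <= s ==> Z s : bor (G s)" and ae: "acont M Z"
 shows "(%w. Z (tau t w) w) : bor (F t)"
proof (rule F_measurableI[OF t])
 fix u :: real assume u: "0 <= u"
 have "(%w. (%s. Z (min s u)) (min (tau t w) u) w) : bor (G u)"
 proof (rule full_compose[OF Gfull[OF u], where S="{0..}" and Y="%s. Z (min s u)" and Z="%w. min (tau t w) u"])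
  show "Z (min s u) : bor (G u)" if "s : {0..}" for s using that u by (intro G_meas_mono[OF _ _ Z]) auto
  show "acont M (%s w. Z (min s u) w)" using ae by eventually_elim (rule cont_comp2[of "{0..}"], auto intro!: cont_intros simp: u)
  show "AE w in M. min (tau t w) u : {0..}" using tau_nonneg by eventually_elim (use t u in auto)
 qed (use tau_min_meas t u in auto)
 thus "EX g:bor (G u). ALL w:space M. tau t w <= u --> Z (tau t w) w = g w" by (intro bexI) auto
qed

lemma X_adapted: "0 <= t ==> X t : bor (F t)" unfolding X_def[abs_def] by (rule stop_adapted[where Z=B]) (use bm_facts(3,4)[OF bm] in auto)

lemma XK_adapted: "0 <= t ==> 0 <= K ==> XK K t : bor (F t)"
proof -
 assume t: "0 <= t" and K: "0 <= K"
 have "(%w. (%s. B (min s K)) (tau t w) w) : bor (F t)"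
 proof (rule stop_adapted[OF t, where Z="%s. B (min s K)"])
  show "B (min s K) : bor (G s)" if "0 <= s" for s using that K by (intro bm_facts(8)[OF bm]) auto
  show "acont M (%s w. B (min s K) w)" using bm_facts(4)[OF bm] by eventually_elim (rule cont_comp2[of "{0..}"], auto intro!: cont_intros simp: K)
 qed
 thus ?thesis by (simp add: XK_def[abs_def])
qed

lemma tau_adapted: "0 <= t ==> tau t : bor (F t)" using stop_adapted[of t "%s _. s"] by simp

lemma AK_adapted: "0 <= t ==> AK K t : bor (F t)" unfolding AK_def[abs_def] using tau_adapted by measurable

lemma F_cut:
 fixes f :: "'a => real"
 assumes "0 <= t" "0 <= u" "f : bor (F t)"
 shows "(%w. f w * of_bool (tau t w <= u)) : bor (G u)"
proof (rule measurableI)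
 fix A :: "real set" assume A: "A : sets borel"
 let ?E = "{w : f -` A Int space (F t). tau t w <= u}"
 have E: "?E : sets (G u)" by (rule F_D[OF assms(1,2) measurable_sets[OF assms(3) A]])
 have S: "{w : space M. tau t w <= u} : sets (G u)" by (rule stopping[OF assms(1,2)])
 have "(%w. f w * of_bool (tau t w <= u)) -` A Int space (G u) = (if 0 : A then ?E Un (space (G u) - {w : space M. tau t w <= u}) else ?E)"
  using assms by (auto simp: spaceF spaceG of_bool_def split: if_splits)
 thus "(%w. f w * of_bool (tau t w <= u)) -` A Int space (G u) : sets (G u)" using E S by (auto intro: sets.Un sets.Diff)
qed simp

end

definition ebracket :: "'a elementary_data => (real => 'a => real) => real => 'a => real" where
 "ebracket e A t w = (SUM i<steps e. (coef e i w)^2*(inc (%s. A s w) (grid e) i t))"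

lemma telescope_window:
 fixes f :: "nat => real"
 assumes "p <= q"
 shows "(SUM j<N. of_bool (p <= j & j < q)*(f (Suc j) - f j)) = f (min q N) - f (min p N)" using assms by (induction N) (auto simp: min_def le_Suc_eq)

text \<open>At most one of the 0-1 factors is nonzero, so squaring produces no cross terms; this is
  how the bracket of a step process becomes a sum over its steps.\<close>

lemma sum_disjoint_square:
 fixes c x :: "'i => real"
 assumes "finite I" "!!i. i : I ==> x i = 0 \<or> x i = 1" "!!i k. i : I ==> k : I ==> i ~= k ==> x i * x k = 0"
 shows "(SUM i:I. c i * x i)^2 = (SUM i:I. (c i)^2 * x i)"
proof (cases "EX k:I. x k = 1") case True
 then obtain k where k: "k : I" "x k = 1" by blast
 hence z: "x i = 0" if "i : I - {k}" for i using assms(3)[of i k] that by auto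
 have "(SUM i:I. c i * x i) = c k" "(SUM i:I. (c i)^2 * x i) = (c k)^2" using assms(1) k z by (simp_all add: sum.remove[of I k])
 thus ?thesis by simp
next case False
 hence "x i = 0" if "i : I" for i using assms(2) that by blast
 thus ?thesis by simp
qed

lemma ceil_dyadic: "(%m. dy m (nat \<lceil>2^m * x\<rceil>)) ---> x" if "0 <= x" for x :: real
proof (rule tendsto_sandwich[OF _ _ tendsto_const])
 have n: "real (nat \<lceil>2^m * x\<rceil>) = of_int \<lceil>2^m * x\<rceil>" for m using that by (simp add: of_nat_nat)
 show "\<forall>\<^sub>F m in sequentially. x <= dy m (nat \<lceil>2^m * x\<rceil>)" unfolding n by (intro always_eventually allI) (simp add: field_simps)
 show "\<forall>\<^sub>F m in sequentially. dy m (nat \<lceil>2^m * x\<rceil>) <= x + (1/2)^m"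
  unfolding n by (intro always_eventually allI) (simp add: field_simps power_divide, linarith)
 show "(%m. x + (1/2)^m) ---> x" by real_asymp
qed

context time_change
begin

text \<open>In the time of \<open>B\<close> the integrand jumps at the random times
  \<open>sg i\<close>. Rounding them up to dyadic times gives coefficients on a deterministic grid
  that are known when each grid interval begins, and the exponential identity survives the
  refinement of the grid.\<close>

theorem good_pair_elementary:
 assumes e: "epred M F e" and C: "!!i w. i < steps e ==> w : space M ==> abs (coef e i w) <= C" and t: "0 <= t"
 shows "good_pair M (eint e (XK (real K)) t) (ebracket e (AK (real K)) t)"
proof -
 define n where "n = steps e"
 define sg where "sg i w = tau (min (grid e i) t) w" for i w
 have g: "0 <= grid e 0" "!!i. i < n ==> grid e i <= grid e (Suc i)" "!!i. i < n ==> coef e i : bor (F (grid e i))"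
  using e by (auto simp: epred_def n_def)
 have g0: "0 <= grid e i" if "i <= n" for i using that by (induction i) (use g in "auto intro: order_trans")
 have gm: "grid e i <= grid e j" if "i <= j" "j <= n" for i j using that(1,2) by (induction j rule: dec_induct) (use g(2) in "auto intro: order_trans")
 \<comment> \<open>Value of the integrand on the dyadic interval starting at \<open>dy m j\<close>:
   the coefficient whose random window, from \<open>sg i\<close> up to but excluding
   \<open>sg (Suc i)\<close>, contains that point.\<close>
 define a where "a m j w = (SUM i<n. coef e i w * of_bool (sg i w <= dy m j & dy m j < sg (Suc i) w))" for m j :: nat and w
 define T where "T m j = dy m j" for m j :: nat
 have cb: "abs (a m j w) <= real n * C" if "w : space M" for m j w proof -
  have "abs (a m j w) <= (SUM i<n. abs (coef e i w * of_bool (sg i w <= dy m j & dy m j < sg (Suc i) w)))" unfolding a_def by (rule sum_abs)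
  also have "... <= (SUM i<n. C)" proof (rule sum_mono)
  fix i assume "i : {..<n}"
  hence "abs (coef e i w) <= C" using C that by (auto simp: n_def)
  thus "abs (coef e i w * of_bool (sg i w <= dy m j & dy m j < sg (Suc i) w)) <= C" by (auto simp: of_bool_def)
  qed
  finally show ?thesis by simp
 qed
 have am: "a m j : bor (G (T m j))" for m j proof -
  have u: "0 <= T m j" by (simp add: T_def)
  have "(%w. coef e i w * of_bool (sg i w <= T m j & T m j < sg (Suc i) w)) : bor (G (T m j))" if i: "i < n" for i
  proof (cases "grid e i <= t") case True
  have "sg i = tau (grid e i)" using True by (auto simp: sg_def min_def)
  hence m1: "(%w. coef e i w * of_bool (sg i w <= T m j)) : bor (G (T m j))" using F_cut[OF g0 u g(3)[OF i]] i by simp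
  have s: "{w : space M. sg (Suc i) w <= T m j} : sets (G (T m j))" unfolding sg_def using stopping[OF _ u] g0[of "Suc i"] i t by simp
  have "(%w. indicat_real (space (G (T m j)) - {w : space M. sg (Suc i) w <= T m j}) w) : bor (G (T m j))" using s by (intro borel_measurable_indicator sets.Diff) auto
  from borel_measurable_times[OF m1 this] show ?thesis by (rule measurable_cong[THEN iffD1, rotated]) (auto simp: indicator_def spaceG[OF u])
  next case False
  hence "sg i = sg (Suc i)" using g(2)[OF i] by (auto simp: sg_def fun_eq_iff min_def)
  hence "(%w. coef e i w * of_bool (sg i w <= T m j & T m j < sg (Suc i) w)) = (%_. 0)" by auto
  thus ?thesis by simp
  qed
  thus ?thesis unfolding a_def T_def[symmetric] by (intro borel_measurable_sum) auto
 qed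
 \<comment> \<open>The grid ends at time \<open>K\<close>, which produces the stopped processes
   \<open>XK\<close> and \<open>AK\<close> in the limit.\<close>
 define N where "N m = K*2^m" for m :: nat
 define Y' where "Y' m w = (SUM j<N m. a m j w*(B (T m (Suc j)) w - B (T m j) w))" for m w
 define V' where "V' m w = (SUM j<N m. (a m j w)^2*(T m (Suc j) - T m j))" for m w
 have gp: "good_pair M (Y' m) (V' m)" for m unfolding Y'_def[abs_def] V'_def[abs_def]
  by (rule good_pair_grid[OF bm, where C="real n * C"]) (use am cb in "auto simp: T_def mono_def divide_right_mono")
 have dT: "T m (Suc j) - T m j = 1/2^m" for m j by (simp add: T_def diff_divide_distrib[symmetric])
 have Vb: "V' m w <= (real n * C)^2 * real K" if "w : space M" for m w proof -
  have "V' m w <= (SUM j<N m. (real n * C)^2*(1/2^m))" unfolding V'_def dT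
  proof (intro sum_mono mult_right_mono)
  fix j show "(a m j w)^2 <= (real n * C)^2" using cb[OF that, of m j] by (metis abs_ge_zero power2_abs power_mono)
  qed auto
  also have "... = (real n * C)^2 * real K" by (simp add: N_def)
  finally show ?thesis .
 qed
 have path: "AE w in M. (%m. Y' m w) ---> eint e (XK (real K)) t w & (%m. V' m w) ---> ebracket e (AK (real K)) t w" using tau_ae tau_nonneg bm_facts(4)[OF bm]
 proof eventually_elim case (elim w)
  have s0: "0 <= sg i w" if "i <= n" for i using elim(2) g0[OF that] t by (simp add: sg_def)
  have sm: "sg i w <= sg j w" if "i <= j" "j <= n" for i j
  unfolding sg_def using elim(1) gm[OF that] g0 that t by (intro mono_onD[of "{0..}" "%t. tau t w"]) (auto simp: min_def intro: order_trans)
  \<comment> \<open>Index of the first dyadic point that is not before \<open>sg i\<close>; the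
    windows become integer intervals, over which the sums telescope.\<close>
  define p where "p m i = nat \<lceil>2^m * sg i w\<rceil>" for m :: nat and i
  have pm: "p m i <= p m j" if "i <= j" "j <= n" for m i j unfolding p_def using sm[OF that] by (intro nat_mono ceiling_mono mult_left_mono) auto
  have ww: "of_bool (sg i w <= dy m j & dy m j < sg (Suc i) w) = (of_bool (p m i <= j & j < p m (Suc i)) :: real)" if "i < n" for i j m
  proof -
  have "sg i w <= dy m j \<longleftrightarrow> p m i <= j" using s0[of i] that by (simp add: p_def nat_le_iff ceiling_le_iff field_simps)
  moreover have "dy m j < sg (Suc i) w \<longleftrightarrow> j < p m (Suc i)"
  using s0[of "Suc i"] that by (simp add: p_def zless_nat_eq_int_zless less_ceiling_iff field_simps)
  ultimately show ?thesis by simp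
  qed
  have aw: "a m j w = (SUM i<n. coef e i w * of_bool (p m i <= j & j < p m (Suc i)))" for m j unfolding a_def by (rule sum.cong) (auto simp: ww)
  have Y: "Y' m w = (SUM i<n. coef e i w*(inc (%s. B (T m s) w) (p m) i (N m)))" for m proof -
  have "Y' m w = (SUM i<n. coef e i w*(SUM j<N m. of_bool (p m i <= j & j < p m (Suc i))*(B (T m (Suc j)) w - B (T m j) w)))"
  unfolding Y'_def aw sum_distrib_right sum_distrib_left by (subst sum.swap) (simp add: mult.assoc)
  also have "... = (SUM i<n. coef e i w*(inc (%s. B (T m s) w) (p m) i (N m)))"
  by (intro sum.cong refl) (subst telescope_window[where f="%j. B (T m j) w"], auto intro: pm)
  finally show ?thesis .
  qed
  have V: "V' m w = (SUM i<n. (coef e i w)^2*(inc (T m) (p m) i (N m)))" for m proof -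
  have sq: "(a m j w)^2 = (SUM i<n. (coef e i w)^2 * of_bool (p m i <= j & j < p m (Suc i)))" for j unfolding aw
  proof (rule sum_disjoint_square)
  fix i k assume ik: "i : {..<n}" "k : {..<n}" "i ~= k"
  hence "p m (Suc i) <= p m k \<or> p m (Suc k) <= p m i" using pm[of "Suc i" k m] pm[of "Suc k" i m] by (cases "i < k") auto
  thus "of_bool (p m i <= j & j < p m (Suc i)) * of_bool (p m k <= j & j < p m (Suc k)) = (0::real)" by auto
  qed auto
  have "V' m w = (SUM i<n. (coef e i w)^2*(SUM j<N m. of_bool (p m i <= j & j < p m (Suc i))*(T m (Suc j) - T m j)))"
  unfolding V'_def sq sum_distrib_right sum_distrib_left by (subst sum.swap) (simp add: mult.assoc)
  also have "... = (SUM i<n. (coef e i w)^2*(inc (T m) (p m) i (N m)))"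
  by (intro sum.cong refl) (subst telescope_window[where f="%j. T m j"], auto intro: pm)
  finally show ?thesis .
  qed
  have Tlim: "(%m. T m (min (p m i) (N m))) ---> min (sg i w) (real K)" if "i <= n" for i proof -
  have "T m (min (p m i) (N m)) = min (dy m (p m i)) (real K)" for m by (simp add: T_def N_def min_def field_simps)
  (metis of_nat_le_iff of_nat_mult of_nat_numeral of_nat_power)
  thus ?thesis unfolding p_def using ceil_dyadic[OF s0[OF that]] by (auto intro!: tendsto_intros)
  qed
  have Blim: "(%m. B (T m (min (p m i) (N m))) w) ---> B (min (sg i w) (real K)) w" if "i <= n" for i
  by (rule continuous_on_tendsto_compose[OF elim(3) Tlim[OF that]]) (use s0[OF that] in "auto simp: T_def")
  have "(%m. Y' m w) ---> (SUM i<n. coef e i w*(B (min (sg (Suc i) w) (real K)) w - B (min (sg i w) (real K)) w))" unfolding Y by (intro tendsto_intros Blim) auto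
  moreover have "(%m. V' m w) ---> (SUM i<n. (coef e i w)^2*(min (sg (Suc i) w) (real K) - min (sg i w) (real K)))" unfolding V by (intro tendsto_intros Tlim) auto
  ultimately show ?case by (simp add: eint_def ebracket_def XK_def AK_def sg_def n_def)
 qed
 have cM: "coef e i : bor M" if "i < n" for i using F_meas_M[OF g0 g(3)] that by simp
 have gt0: "0 <= min (grid e i) t" if "i <= n" for i using g0[OF that] t by simp
 have XM: "XK (real K) (min (grid e i) t) : bor M" "AK (real K) (min (grid e i) t) : bor M" if "i <= n" for i
  using F_meas_M[OF gt0[OF that] XK_adapted[OF gt0[OF that]], of "real K"] F_meas_M[OF gt0[OF that] AK_adapted[OF gt0[OF that]], of "real K"] by auto
 show ?thesis proof (rule good_pair_limit[OF gp])
  show "eint e (XK (real K)) t : bor M" unfolding eint_def[abs_def] n_def[symmetric]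
  by (intro borel_measurable_sum borel_measurable_times borel_measurable_diff cM XM) auto
  show "ebracket e (AK (real K)) t : bor M" unfolding ebracket_def[abs_def] n_def[symmetric]
  by (intro borel_measurable_sum borel_measurable_times borel_measurable_diff borel_measurable_power cM XM) auto
  show "AE w in M. (%m. Y' m w) ---> eint e (XK (real K)) t w" using path by eventually_elim simp
  show "AE w in M. (%m. V' m w) ---> ebracket e (AK (real K)) t w" using path by eventually_elim simp
  show "AE w in M. V' m w <= (real n * C)^2 * real K" for m using Vb by (intro AE_I2)
 qed qed

end

section \<open>Elementary integrals\<close>

lemma finite_set_grid:
 fixes S :: "real set"
 assumes "finite S" "S ~= {}"
 obtains p :: "nat => real" and N :: nat where "mono p" "p ` {..N} = S" "!!k. p k : S"
proof -
 define L where "L = sorted_list_of_set S"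
 define N where "N = length L - 1"
 define p where "p k = L ! (min k N)" for k
 have L: "sorted L" "set L = S" "L ~= []" using assms by (auto simp: L_def)
 have "mono p" unfolding p_def using L by (intro monoI sorted_nth_mono) (auto simp: N_def min_def length_greater_0_conv[symmetric] simp del: length_greater_0_conv)
 moreover have "p ` {..N} = S" proof -
  have "p ` {..N} = (%k. L ! k) ` {..<length L}"
  using L(3) by (intro image_cong) (auto simp: p_def N_def length_greater_0_conv[symmetric] simp del: length_greater_0_conv)
  thus ?thesis using L(2) by (simp add: set_conv_nth) (auto simp: image_def)
 qed
 moreover have "p k : S" for k using L by (auto simp: p_def N_def min_def intro!: nth_mem[of _ L, unfolded L(2)] simp: length_greater_0_conv[symmetric] simp del: length_greater_0_conv)
 ultimately show ?thesis by (rule that)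
qed

lemma telescope_interval:
 fixes p :: "nat => real" and f :: "real => real"
 assumes p: "mono p" and a: "a : p ` {..N}" and b: "b : p ` {..N}" and ab: "a <= b"
 shows "(SUM k<N. indicator {a<..b} (p (Suc k))*(f (p (Suc k)) - f (p k))) = f b - f a"
proof -
 obtain i j where i: "a = p i" "i <= N" and j: "b = p j" "j <= N" using a b by auto
 define cl where "cl u = max a (min b u)" for u
 have "indicator {a<..b} (p (Suc k))*(f (p (Suc k)) - f (p k)) = f (cl (p (Suc k))) - f (cl (p k))" for k
 proof -
  have m: "p k <= p (Suc k)" using p by (simp add: mono_def)
  have ai: "a <= p k \<or> p (Suc k) <= a" using monoD[OF p, of i k] monoD[OF p, of "Suc k" i] i by (cases "i <= k") auto
  have bi: "b <= p k \<or> p (Suc k) <= b" using monoD[OF p, of j k] monoD[OF p, of "Suc k" j] j by (cases "j <= k") auto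
  consider "p (Suc k) <= a" | "b <= p k" | "a <= p k" "p (Suc k) <= b" using ai bi by auto
  thus ?thesis proof cases case 1
  hence "cl (p (Suc k)) = a" "cl (p k) = a" using m ab by (auto simp: cl_def)
  thus ?thesis using 1 by simp
  next
  case 2 thus ?thesis using m ab by (cases "p (Suc k) = b") (auto simp: cl_def max_def min_def indicator_def)
  next
  case 3 thus ?thesis using m by (cases "p (Suc k) = a") (auto simp: cl_def max_def min_def indicator_def)
  qed qed
 hence "(SUM k<N. indicator {a<..b} (p (Suc k))*(f (p (Suc k)) - f (p k))) = (SUM k<N. f (cl (p (Suc k))) - f (cl (p k)))" by simp
 also have "... = f (cl (p N)) - f (cl (p 0))" by (rule sum_lessThan_telescope[where f="%k. f (cl (p k))"])
 also have "cl (p N) = b" using monoD[OF p j(2)] j ab by (auto simp: cl_def)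
 also have "cl (p 0) = a" using monoD[OF p, of 0 i] i ab by (auto simp: cl_def)
 finally show ?thesis .
qed

definition stepv :: "'a elementary_data => real => 'a => real" where
 "stepv e u w = (SUM i<steps e. coef e i w * indicator {grid e i<..grid e (Suc i)} u)"

lemma eproc_step: "eproc e u w = init e w * indicator {0} u + stepv e u w" by (simp add: elementary_process_def stepv_def)

definition grid_mono :: "'a elementary_data => bool" where
 "grid_mono e = ((ALL i<steps e. grid e i <= grid e (Suc i)))"

lemma grid_monoD: "grid_mono e ==> i <= j ==> j <= steps e ==> grid e i <= grid e j"
proof (induction j) case (Suc j)
 hence "grid e j <= grid e (Suc j)" by (auto simp: grid_mono_def)
 thus ?case using Suc by (cases "i = Suc j") auto
qed auto

lemma epredD:
 assumes "epred M F e"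
 shows "grid_mono e" "i <= steps e ==> 0 <= grid e i" "i < steps e ==> coef e i : bor (F (grid e i))"
  "EX C. ALL i<steps e. ALL w:space M. abs (coef e i w) <= C"
proof -
 show gm: "grid_mono e" using assms by (auto simp: epred_def grid_mono_def)
 show "i <= steps e ==> 0 <= grid e i" using grid_monoD[OF gm, of 0 i] assms by (auto simp: epred_def)
 show "i < steps e ==> coef e i : bor (F (grid e i))" using assms by (auto simp: epred_def)
 have "EX c. ALL w:space M. abs (coef e i w) <= c" if "i < steps e" for i using assms that unfolding epred_def bounded_iff by force
 then obtain c where c: "!!i w. i < steps e ==> w : space M ==> abs (coef e i w) <= c i" by metis
 have "abs (coef e i w) <= (SUM i<steps e. abs (c i))" if "i < steps e" "w : space M" for i w
  using c[OF that] member_le_sum[of i "{..<steps e}" "%i. abs (c i)"] that by auto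
 thus "EX C. ALL i<steps e. ALL w:space M. abs (coef e i w) <= C" by blast
qed

lemma stepv_coef:
 assumes "grid_mono e" "i < steps e" "grid e i < u" "u <= grid e (Suc i)"
 shows "stepv e u w = coef e i w"
proof -
 have "coef e k w * indicator {grid e k<..grid e (Suc k)} u = 0" if "k < steps e" "k ~= i" for k
 proof (cases "k < i") case True
  hence "grid e (Suc k) <= grid e i" using assms by (intro grid_monoD) auto
  thus ?thesis using assms by auto
 next case False
  hence "grid e (Suc i) <= grid e k" using assms that by (intro grid_monoD) auto
  thus ?thesis using assms by auto
 qed
 hence "(SUM k:{..<steps e} - {i}. coef e k w * indicator {grid e k<..grid e (Suc k)} u) = 0" by (intro sum.neutral) simp
 hence "stepv e u w = coef e i w * indicator {grid e i<..grid e (Suc i)} u" unfolding stepv_def using assms(2) by (subst sum.remove[of _ i]) auto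
 thus ?thesis using assms by simp
qed

lemma stepv_sq:
 assumes "grid_mono e"
 shows "(stepv e u w)^2 = (SUM i<steps e. (coef e i w)^2 * indicator {grid e i<..grid e (Suc i)} u)" unfolding stepv_def
proof (rule sum_disjoint_square)
 fix i k assume ik: "i : {..<steps e}" "k : {..<steps e}" "i ~= k"
 have "grid e (Suc i) <= grid e k \<or> grid e (Suc k) <= grid e i" using ik grid_monoD[OF assms, of "Suc i" k] grid_monoD[OF assms, of "Suc k" i] by (cases "i < k") auto
 thus "indicator {grid e i<..grid e (Suc i)} u * indicator {grid e k<..grid e (Suc k)} u = (0::real)" by (auto simp: indicator_def)
qed (auto simp: indicator_def)

text \<open>On each step of a grid refining that of \<open>e\<close> the process is constant, and
  its value is read off at the right endpoint because steps are closed on the right. Elementary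
  processes can thus be compared on a common grid.\<close>

lemma regrid:
 assumes e: "grid_mono e" and p: "mono p" and g: "grid e ` {..steps e} <= p ` {..N}"
 shows "eint e x t w = (SUM k<N. stepv e (p (Suc k)) w*(inc (%s. x s w) p k t))"
  and "ebracket e x t w = (SUM k<N. (stepv e (p (Suc k)) w)^2*(inc (%s. x s w) p k t))"
  and "stepv e u w = (SUM k<N. stepv e (p (Suc k)) w * indicator {p k<..p (Suc k)} u)"
proof -
 have tl: "(SUM k<N. indicator {grid e i<..grid e (Suc i)} (p (Suc k))*(f (p (Suc k)) - f (p k))) = f (grid e (Suc i)) - f (grid e i)"
  if "i < steps e" for i and f :: "real => real" by (rule telescope_interval[OF p]) (use g that e in "auto simp: grid_mono_def")
 have gen: "(SUM k<N. (SUM i<steps e. c i * indicator {grid e i<..grid e (Suc i)} (p (Suc k)))*(f (p (Suc k)) - f (p k)))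
  = (SUM i<steps e. c i*(f (grid e (Suc i)) - f (grid e i)))" for c :: "nat => real" and f :: "real => real"
 proof -
  have "(SUM k<N. (SUM i<steps e. c i * indicator {grid e i<..grid e (Suc i)} (p (Suc k)))*(f (p (Suc k)) - f (p k)))
  = (SUM k<N. SUM i<steps e. c i*(indicator {grid e i<..grid e (Suc i)} (p (Suc k))*(f (p (Suc k)) - f (p k))))" by (simp only: sum_distrib_right mult.assoc)
  also have "... = (SUM i<steps e. SUM k<N. c i*(indicator {grid e i<..grid e (Suc i)} (p (Suc k))*(f (p (Suc k)) - f (p k))))" by (rule sum.swap)
  also have "... = (SUM i<steps e. c i*(f (grid e (Suc i)) - f (grid e i)))" proof (rule sum.cong[OF refl])
  fix i assume "i : {..<steps e}"
  hence i: "i < steps e" by simp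
  show "(SUM k<N. c i*(indicator {grid e i<..grid e (Suc i)} (p (Suc k))*(f (p (Suc k)) - f (p k)))) = c i*(f (grid e (Suc i)) - f (grid e i))"
  unfolding sum_distrib_left[symmetric] tl[OF i] ..
  qed
  finally show ?thesis .
 qed
 show "eint e x t w = (SUM k<N. stepv e (p (Suc k)) w*(inc (%s. x s w) p k t))"
  unfolding stepv_def gen[where f="%u. x (min u t) w"] by (simp add: eint_def)
 show "ebracket e x t w = (SUM k<N. (stepv e (p (Suc k)) w)^2*(inc (%s. x s w) p k t))"
  unfolding stepv_sq[OF e] gen[where f="%u. x (min u t) w"] by (simp add: ebracket_def)
 have i1: "(indicator {p k<..p (Suc k)} u :: real) = of_bool (u <= p (Suc k)) - of_bool (u <= p k)" for k using monoD[OF p, of k "Suc k"] by (auto simp: indicator_def)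
 have i2: "(indicator {grid e i<..grid e (Suc i)} u :: real) = of_bool (u <= grid e (Suc i)) - of_bool (u <= grid e i)" if "i < steps e" for i
  using e that by (auto simp: indicator_def grid_mono_def)
 have "stepv e u w = (SUM i<steps e. coef e i w*(of_bool (u <= grid e (Suc i)) - of_bool (u <= grid e i)))"
  unfolding stepv_def by (intro sum.cong refl) (simp only: i2 lessThan_iff)
 thus "stepv e u w = (SUM k<N. stepv e (p (Suc k)) w * indicator {p k<..p (Suc k)} u)"
  unfolding i1 stepv_def[of e "p (Suc _)"] gen[where f="%v. of_bool (u <= v)"] by simp
qed

lemma continuous_at_left_indicator: "continuous (at_left (s::real)) (indicator {a<..b} :: real => real)"
proof -
 have "\<forall>\<^sub>F u in at_left s. (indicator {a<..b} u :: real) = indicator {a<..b} s" proof -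
  consider "s <= a" | "a < s" "s <= b" | "b < s" "a < s" | "b < s" "s <= a" by linarith
  thus ?thesis proof cases case 2
  have "\<forall>\<^sub>F u in at_left s. a < u" using 2 by (auto simp: eventually_at_left_field)
  moreover have "\<forall>\<^sub>F u in at_left s. u < s" by (auto simp: eventually_at_left_field intro: exI[of _ "s - 1"])
  ultimately show ?thesis by eventually_elim (use 2 in auto)
  next case 3
  have "\<forall>\<^sub>F u in at_left s. b < u" using 3 by (auto simp: eventually_at_left_field)
  thus ?thesis by eventually_elim (use 3 in auto)
  next case 1
  have "\<forall>\<^sub>F u in at_left s. u < s" by (auto simp: eventually_at_left_field intro: exI[of _ "s - 1"])
  thus ?thesis by eventually_elim (use 1 in auto)
  next case 4
  have "\<forall>\<^sub>F u in at_left s. u < s" by (auto simp: eventually_at_left_field intro: exI[of _ "s - 1"])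
  thus ?thesis by eventually_elim (use 4 in auto)
  qed qed
 thus ?thesis unfolding continuous_within by (rule tendsto_eventually)
qed

lemma eproc_left: "0 < s ==> continuous (at_left s) (%s. eproc e s w)"
proof -
 assume s: "0 < s"
 have "\<forall>\<^sub>F u in at_left s. (indicator {0} u :: real) = 0" using s by (auto simp: eventually_at_left_field intro!: exI[of _ 0])
 hence i: "continuous (at_left s) (indicator {0} :: real => real)" unfolding continuous_within using s by (simp add: tendsto_eventually)
 show ?thesis unfolding elementary_process_def by (intro cont_intros continuous_at_left_indicator i)
qed

lemma cont_left: "cont0 f ==> 0 < s ==> continuous (at_left (s::real)) (f :: real => real)" using at_within_interior[of s "{0..}"]
 by (metis atLeast_iff continuous_at_imp_continuous_within continuous_on_eq_continuous_within interior_real_atLeast greaterThan_iff less_imp_le)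

lemma eint_cont:
 assumes "cont0 (%s. x s w)" "!!i. i <= steps e ==> 0 <= grid e i"
 shows "cont0 (%s. eint e x s w)" unfolding eint_def by (intro cont_intros cont_comp2[OF assms(1)]) (use assms(2) in auto)

lemma eint_adapted:
 assumes F: "is_filtration M F" and e: "epred M F e" and x: "!!s. 0 <= s ==> x s : bor (F s)" and s: "0 <= s"
 shows "eint e x s : bor (F s)"
proof -
 note eD = epredD[OF e]
 have mono: "f : bor (F s)" if "f : bor (F r)" "0 <= r" "r <= s" for f :: "'a => real" and r using F that unfolding is_filtration_def
  by (intro meas_subalg[OF _ that(1)]) (auto simp: subalgebra_def)
 have "(%w. coef e i w*(inc (%u. x u w) (grid e) i s)) : bor (F s)" if i: "i < steps e" for i
 proof (cases "grid e i <= s") case True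
  have "0 <= grid e i" "0 <= grid e (Suc i)" using eD(2) i by auto
  thus ?thesis using True s eD(3)[OF i] by (intro borel_measurable_times borel_measurable_diff mono[OF x] mono[OF eD(3)[OF i]]) auto
 next case False
  hence "min (grid e (Suc i)) s = min (grid e i) s" using eD(1) i by (auto simp: grid_mono_def min_def)
  thus ?thesis by simp
 qed
 thus ?thesis unfolding eint_def[abs_def] by (intro borel_measurable_sum) auto
qed

text \<open>The value on the step ending at \<open>p (Suc k)\<close> comes from a coefficient fixed
  at an earlier grid point of \<open>e\<close>; such points are among the \<open>p j\<close>, hence
  not later than \<open>p k\<close>.\<close>

lemma stepv_adapted:
 assumes F: "is_filtration M F" and e: "epred M F e" and p: "mono p" "0 <= p 0" and g: "grid e ` {..steps e} <= p ` {..N}"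
 shows "stepv e (p (Suc k)) : bor (F (p k))" unfolding stepv_def[abs_def]
proof (rule borel_measurable_sum)
 fix i assume i: "i : {..<steps e}"
 note eD = epredD[OF e]
 have pk: "0 <= p k" using p monoD[OF p(1), of 0 k] by simp
 show "(%w. coef e i w * indicator {grid e i<..grid e (Suc i)} (p (Suc k))) : bor (F (p k))"
 proof (cases "grid e i < p (Suc k)") case True
  have "grid e i : p ` {..N}" using g i by (auto simp: image_subset_iff)
  then obtain j where j: "grid e i = p j" by blast
  hence "j <= k" using True monoD[OF p(1), of "Suc k" j] by (auto simp: not_le[symmetric] Suc_le_eq)
  hence "grid e i <= p k" using j monoD[OF p(1)] by simp
  hence "coef e i : bor (F (p k))" using F eD(2)[of i] i pk unfolding is_filtration_def by (intro meas_subalg[OF _ eD(3)[of i]]) (auto simp: subalgebra_def)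
  thus ?thesis by measurable
 qed (simp add: indicator_def)
qed

lemma stepv_bound:
 assumes "grid_mono e" "!!i. i < steps e ==> abs (coef e i w) <= C" "0 <= C"
 shows "abs (stepv e u w) <= C"
proof (cases "EX i<steps e. grid e i < u & u <= grid e (Suc i)") case True
 thus ?thesis using stepv_coef[OF assms(1)] assms(2) by auto
next case False
 hence "stepv e u w = 0" unfolding stepv_def by (intro sum.neutral) (auto simp: indicator_def)
 thus ?thesis using assms by simp
qed

lemma elementary_diff:
 assumes F: "is_filtration M F" and e: "epred M F e" and f: "epred M F f"
 obtains d :: "'a elementary_data" where "epred M F d"
  "!!u w. eproc d u w = eproc e u w - eproc f u w"
  "!!x t w. eint d x t w = eint e x t w - eint f x t w"
proof -
 note eD = epredD[OF e] and fD = epredD[OF f]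
 define S where "S = grid e ` {..steps e} Un grid f ` {..steps f}"
 have "finite S" "S ~= {}" by (auto simp: S_def)
 then obtain p :: "nat => real" and N :: nat where p: "mono p" "p ` {..N} = S" "!!k. p k : S" using finite_set_grid by metis
 have p0: "0 <= p k" for k using p(3)[of k] eD(2) fD(2) by (auto simp: S_def)
 have ge: "grid e ` {..steps e} <= p ` {..N}" and gf: "grid f ` {..steps f} <= p ` {..N}" using p(2) by (auto simp: S_def)
 let ?v = "%k w. stepv e (p (Suc k)) w - stepv f (p (Suc k)) w"
 define d where "d = Elementary (%w. init e w - init f w) N p ?v"
 have d[simp]: "steps d = N" "grid d = p" "coef d = ?v" "init d = (%w. init e w - init f w)"
  by (simp_all add: d_def)
 show ?thesis proof (rule that)
  obtain Ce Cf where C: "!!i w. i < steps e ==> w : space M ==> abs (coef e i w) <= Ce" "!!i w. i < steps f ==> w : space M ==> abs (coef f i w) <= Cf"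
  using eD(4) fD(4) by blast
  have "bounded ((?v k) ` space M)" for k unfolding bounded_iff
  proof (intro exI ballI)
  fix y assume "y : (?v k) ` space M"
  then obtain w where ww: "w : space M" "y = ?v k w" by auto
  have "abs (stepv e (p (Suc k)) w) <= abs Ce" "abs (stepv f (p (Suc k)) w) <= abs Cf"
  using C ww by (auto intro!: stepv_bound eD fD intro: order_trans[OF _ abs_ge_self])
  thus "norm y <= abs Ce + abs Cf" unfolding ww by simp
  qed
  moreover have "bounded ((%w. init e w - init f w) ` space M)" using e f unfolding epred_def by (intro bounded_minus_comp) auto
  moreover have "stepv e (p (Suc k)) : bor (F (p k))" for k by (rule stepv_adapted[OF F e p(1) p0 ge])
  moreover have "stepv f (p (Suc k)) : bor (F (p k))" for k by (rule stepv_adapted[OF F f p(1) p0 gf])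
  moreover have "init e : bor (F 0)" "init f : bor (F 0)" using e f by (auto simp: epred_def)
  moreover have "p k <= p (Suc k)" for k using p(1) by (simp add: mono_def)
  ultimately show "epred M F d" unfolding epred_def d using p0 by (intro conjI allI impI borel_measurable_diff) simp_all
  have dv: "stepv d u w = stepv e u w - stepv f u w" for u w unfolding regrid(3)[OF eD(1) p(1) ge, of u w] regrid(3)[OF fD(1) p(1) gf, of u w]
  by (simp add: stepv_def[of d] left_diff_distrib sum_subtractf)
  thus "eproc d u w = eproc e u w - eproc f u w" for u w by (simp add: eproc_step algebra_simps)
  show "eint d x t w = eint e x t w - eint f x t w" for x t w unfolding regrid(1)[OF eD(1) p(1) ge] regrid(1)[OF fD(1) p(1) gf]
  by (simp add: eint_def left_diff_distrib sum_subtractf)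
 qed qed

context time_change
begin

lemma filt: "is_filtration M F" unfolding is_filtration_def using full_algD(4)[OF Ffull] Fmono by blast

lemma AK_ae: "AE w in M. ALL s t. 0 <= s --> s <= t --> AK K s w <= AK K t w" using tau_ae
proof eventually_elim case (elim w)
 hence "tau s w <= tau t w" if "0 <= s" "s <= t" for s t using that by (auto simp: mono_on_def)
 thus ?case unfolding AK_def by (intro allI impI min.mono order_refl)
qed

lemma AK_bounds: "0 <= K ==> AE w in M. ALL s>=0. 0 <= AK K s w & AK K s w <= K" using tau_nonneg by eventually_elim (auto simp: AK_def)

lemma XK_continuous:
 assumes K: "0 <= K"
 shows "acont M (XK K)" using bm_facts(4)[OF bm] tau_ae tau_nonneg
proof eventually_elim case (elim w)
 have c: "cont0 (%s. min (tau s w) K)" by (intro continuous_on_min continuous_on_const conjunct1[OF elim(2)])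
 show ?case unfolding XK_def proof (rule cont_comp2[OF elim(1) c])
  show "(%s. min (tau s w) K) ` {0..} <= {0..}" using elim(3) K by (simp add: image_subset_iff)
 qed qed

lemma X_continuous: "acont M X" using bm_facts(4)[OF bm] tau_ae tau_nonneg
proof eventually_elim case (elim w)
 show ?case unfolding X_def proof (rule cont_comp2[OF elim(1) conjunct1[OF elim(2)]])
  show "(%s. tau s w) ` {0..} <= {0..}" using elim(3) by (simp add: image_subset_iff)
 qed qed

section \<open>Maximal inequalities and the integrator property\<close>

lemma bracket_nonneg:
 assumes e: "epred M F e" and mono: "ALL s t. 0 <= s --> s <= t --> A s w <= A t w" and t: "0 <= t"
 shows "0 <= ebracket e A t w" unfolding ebracket_def
proof (intro sum_nonneg mult_nonneg_nonneg)
 fix i assume "i : {..<steps e}"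
 hence "0 <= grid e i" "grid e i <= grid e (Suc i)" using epredD[OF e] by (auto simp: grid_mono_def)
 hence "A (min (grid e i) t) w <= A (min (grid e (Suc i)) t) w" using mono t by (auto simp: min_def)
 thus "0 <= inc (%s. A s w) (grid e) i t" by simp
qed auto

text \<open>Doob's inequality without a stopping theorem: switching the integrand off after the
  first exceedance gives another elementary process, whose integral at \<open>t\<close> is
  \<open>Y\<close> at that moment and whose bracket is not larger. Chebyshev with the second and the
  fourth moment yields the two bounds.\<close>

lemma maximal_finite:
 fixes K :: nat
 assumes e: "epred M F e" and C: "!!i w. i < steps e ==> w : space M ==> abs (coef e i w) <= C"
  and C0: "0 <= C" and t: "0 <= t" and Q: "finite Q" "Q <= {0..t}" and eps: "0 < eps"
 defines "Y \<equiv> eint e (XK (real K))" and "V \<equiv> ebracket e (AK (real K)) t"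
 shows "prob {w : space M. EX s:Q. abs (Y s w) > eps} <= (LINT w|M. V w)/eps^2" and "prob {w : space M. EX s:Q. abs (Y s w) > eps} <= 36*(LINT w|M. (V w)^2)/eps^4"
proof -
 note eD = epredD[OF e]
 \<comment> \<open>Besides the jump times the grid contains \<open>Q\<close>, so an exceedance at a
   point of \<open>Q\<close> is an exceedance at a grid point.\<close>
 define S where "S = Q Un grid e ` {..steps e} Un {0, t}"
 have "finite S" "S ~= {}" using Q by (auto simp: S_def)
 then obtain p :: "nat => real" and N :: nat where p: "mono p" "p ` {..N} = S" "!!k. p k : S" using finite_set_grid by metis
 have p0: "0 <= p k" for k using p(3)[of k] eD(2) Q t by (auto simp: S_def)
 have ge: "grid e ` {..steps e} <= p ` {..N}" using p(2) by (auto simp: S_def)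
 have pm: "p i <= p j" if "i <= j" for i j using monoD[OF p(1) that] .
 \<comment> \<open>No exceedance among the grid points up to index \<open>k\<close>; this is decided
   at time \<open>p k\<close>, so multiplying by it keeps the coefficient predictable.\<close>
 define ok where "ok k w = (ALL j:{..k}. p j <= t --> abs (Y (p j) w) <= eps)" for k w
 define c where "c k w = stepv e (p (Suc k)) w * of_bool (ok k w)" for k w
 define e' where "e' = Elementary (%_. 0) N p c"
 have [simp]: "steps e' = N" "grid e' = p" "coef e' = c" "init e' = (%_. 0)" by (simp_all add: e'_def)
 have cC: "abs (c k w) <= C" if "w : space M" for k w using stepv_bound[OF eD(1) C C0] that C0 by (auto simp: c_def of_bool_def)
 have Yad: "Y s : bor (F s)" if "0 <= s" for s unfolding Y_def by (rule eint_adapted[OF filt e XK_adapted that]) auto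
 have cm: "c k : bor (F (p k))" for k proof -
  have "{w : space (F (p k)). ok k w} : sets (F (p k))" unfolding ok_def
  proof (rule sets.sets_Collect_finite_All)
  fix j assume j: "j : {..k}"
  have [measurable]: "Y (p j) : bor (F (p k))" by (rule F_meas_mono[OF p0 pm Yad[OF p0]]) (use j in auto)
  show "{w : space (F (p k)). p j <= t --> abs (Y (p j) w) <= eps} : sets (F (p k))" by measurable
  qed auto
  hence "Measurable.pred (F (p k)) (ok k)" by (simp add: pred_def)
  moreover have "stepv e (p (Suc k)) : bor (F (p k))" by (rule stepv_adapted[OF filt e p(1) p0 ge])
  ultimately show ?thesis unfolding c_def[abs_def] by measurable
 qed
 have e': "epred M F e'" unfolding epred_def proof (intro conjI allI impI)
  show "bounded (coef e' i ` space M)" for i unfolding bounded_iff using cC by (intro exI[of _ C]) auto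
  show "bounded (init e' ` space M)" unfolding bounded_iff by (intro exI[of _ 0]) auto
 qed (use p0 pm cm in auto)
 define Y' where "Y' = eint e' (XK (real K)) t"
 define V' where "V' = ebracket e' (AK (real K)) t"
 have gp': "good_pair M Y' V'" unfolding Y'_def V'_def by (rule good_pair_elementary[OF e' _ t, where C=C]) (use cC in auto)
 have gp: "good_pair M (Y t) V" unfolding Y_def V_def by (rule good_pair_elementary[OF e _ t, where C=C]) (use C in auto)
 have VV: "AE w in M. 0 <= V' w & V' w <= V w" using AK_ae[of "real K"] proof eventually_elim case (elim w)
  have "V' w = (SUM k<N. (c k w)^2*(inc (%s. AK (real K) s w) p k t))" by (simp add: V'_def ebracket_def)
  also have "... <= (SUM k<N. (stepv e (p (Suc k)) w)^2*(inc (%s. AK (real K) s w) p k t))"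
  proof (intro sum_mono mult_right_mono)
  fix k
  show "(c k w)^2 <= (stepv e (p (Suc k)) w)^2" by (auto simp: c_def of_bool_def)
  show "0 <= inc (%s. AK (real K) s w) p k t"
  using elim[rule_format, of "min (p k) t" "min (p (Suc k)) t"] p0[of k] pm[of k "Suc k"] t by (simp add: min_def)
  qed
  also have "... = V w" unfolding V_def regrid(2)[OF eD(1) p(1) ge] ..
  finally show ?case using bracket_nonneg[OF e' _ t, of "AK (real K)" w] elim by (simp add: V'_def)
 qed
 have key: "abs (Y' w) > eps" if ex: "EX s:Q. abs (Y s w) > eps" for w proof -
  from ex obtain s where s: "s : Q" "abs (Y s w) > eps" by blast
  hence "s : p ` {..N}" using p(2) by (auto simp: S_def)
  then obtain j0 where j0: "s = p j0" "j0 <= N" by auto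
  define j where "j = (LEAST j. p j <= t & abs (Y (p j) w) > eps)"
  have ex0: "p j0 <= t & abs (Y (p j0) w) > eps" using s j0 Q by auto
  have j: "p j <= t" "abs (Y (p j) w) > eps" using LeastI[of "%j. p j <= t & abs (Y (p j) w) > eps", OF ex0] by (auto simp: j_def)
  have okj: "ok k w \<longleftrightarrow> k < j" for k proof
  assume ok: "ok k w"
  show "k < j" proof (rule ccontr)
  assume "~ k < j"
  hence "abs (Y (p j) w) <= eps" using ok j(1) by (simp add: ok_def)
  thus False using j(2) by simp
  qed
  next
  assume "k < j"
  hence "~ (p i <= t & abs (Y (p i) w) > eps)" if "i <= k" for i using not_less_Least[of i "%j. p j <= t & abs (Y (p j) w) > eps"] that by (simp add: j_def)
  thus "ok k w" unfolding ok_def by (auto simp: not_less)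
  qed
  have "Y' w = (SUM k<N. c k w*(inc (%s. XK (real K) s w) p k t))" by (simp add: Y'_def eint_def)
  also have "... = (SUM k<N. stepv e (p (Suc k)) w*(inc (%s. XK (real K) s w) p k (p j)))"
  proof (rule sum.cong[OF refl])
  fix k
  show "c k w*(inc (%s. XK (real K) s w) p k t) =
  stepv e (p (Suc k)) w*(inc (%s. XK (real K) s w) p k (p j))" proof (cases "k < j") case True
  hence "p (Suc k) <= p j" "p k <= p j" using pm by auto
  thus ?thesis using True okj[of k] j(1) by (simp add: c_def min_absorb1)
  next case False
  hence "p j <= p (Suc k)" "p j <= p k" using pm by auto
  thus ?thesis using False okj[of k] by (simp add: c_def min_absorb2)
  qed qed
  also have "... = Y (p j) w" unfolding Y_def regrid(1)[OF eD(1) p(1) ge] ..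
  finally show ?thesis using j by simp
 qed
 have mY'[measurable]: "Y' : bor M" and i4: "integrable M (%w. Y' w^4)" using gp' by (auto simp: good_pair_def)
 have mV: "V : bor M" "V' : bor M" using gp gp' by (auto simp: good_pair_def)
 obtain b where b: "AE w in M. 0 <= V w & V w <= b" using gp unfolding good_pair_def by blast
 have iV: "integrable M V" "integrable M V'" "integrable M (%w. (V w)^2)" "integrable M (%w. (V' w)^2)"
 proof -
  show "integrable M V" by (rule integrable_const_bound[OF _ mV(1), where B=b]) (use b in "eventually_elim, auto")
  show "integrable M V'" by (rule integrable_const_bound[OF _ mV(2), where B=b]) (use b VV in "eventually_elim, auto")
  have "AE w in M. norm ((V w)^2) <= b^2" using b by eventually_elim (auto intro!: power_mono)
  thus "integrable M (%w. (V w)^2)" by (rule integrable_const_bound) (use mV in auto)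
  have "AE w in M. norm ((V' w)^2) <= b^2" using b VV by eventually_elim (auto intro!: power_mono)
  thus "integrable M (%w. (V' w)^2)" by (rule integrable_const_bound) (use mV in auto)
 qed
 have sub: "prob {w : space M. EX s:Q. abs (Y s w) > eps} <= prob {w : space M. abs (Y' w) > eps}" by (intro finite_measure_mono) (use key in auto)
 have i2: "integrable M (%w. (Y' w)^2)" by (rule int_power_le4[OF mY' i4]) simp
 have "prob {w : space M. abs (Y' w) > eps} <= prob {w : space M. eps^2 <= (Y' w)^2}"
 proof (intro finite_measure_mono subsetI)
  fix w assume "w : {w : space M. abs (Y' w) > eps}"
  thus "w : {w : space M. eps^2 <= (Y' w)^2}" using power_mono[of eps "abs (Y' w)" 2] eps by auto
 qed measurable
 also have "... <= (LINT w|M. (Y' w)^2)/eps^2" by (rule integral_Markov_inequality_measure[OF i2, where A="space M"]) (use eps in simp_all)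
 also have "... = (LINT w|M. V' w)/eps^2" using gp' by (simp add: good_pair_def)
 also have "... <= (LINT w|M. V w)/eps^2" by (intro divide_right_mono integral_mono_AE iV) (use VV in "eventually_elim, auto")+
 finally show "prob {w : space M. EX s:Q. abs (Y s w) > eps} <= (LINT w|M. V w)/eps^2" using sub by linarith
 have "prob {w : space M. abs (Y' w) > eps} <= prob {w : space M. eps^4 <= Y' w^4}"
 proof (intro finite_measure_mono subsetI)
  fix w assume "w : {w : space M. abs (Y' w) > eps}"
  thus "w : {w : space M. eps^4 <= Y' w^4}" using power_mono[of eps "abs (Y' w)" 4] eps by (auto simp: power_even_abs)
 qed measurable
 also have "... <= (LINT w|M. Y' w^4)/eps^4" by (rule integral_Markov_inequality_measure[OF i4, where A="space M"]) (use eps in simp_all)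
 also have "... <= 36*(LINT w|M. (V' w)^2)/eps^4" using gp' by (intro divide_right_mono) (auto simp: good_pair_def)
 also have "... <= 36*(LINT w|M. (V w)^2)/eps^4" by (intro divide_right_mono mult_left_mono integral_mono_AE iV) (use VV in "eventually_elim, auto intro: power_mono")+
 finally show "prob {w : space M. EX s:Q. abs (Y s w) > eps} <= 36*(LINT w|M. (V w)^2)/eps^4" using sub by linarith
qed

lemma prob_exists_le:
 fixes Y :: "real => 'a => real"
 assumes m: "!!s. 0 <= s ==> Y s : bor M" and ae: "acont M Y" and t: "0 <= t"
  and le: "!!Q. finite Q ==> Q <= {0..t} ==> prob {w : space M. EX s:Q. abs (Y s w) > eps} <= b"
 shows "prob (exc M t eps Y) <= b"
proof -
 let ?Q = "insert 0 \<rat> Int {0..t}"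
 have cnt: "countable ?Q" "?Q ~= {}" using countable_rat t by auto
 define q where "q = from_nat_into ?Q"
 have q: "range q = ?Q" unfolding q_def by (rule range_from_nat_into[OF cnt(2,1)])
 have qt: "q n : {0..t}" for n using q by auto
 define A where "A n = {w : space M. EX s:q ` {..n}. abs (Y s w) > eps}" for n
 have Am: "A n : sets M" for n unfolding A_def proof (rule sets.sets_Collect_finite_Ex)
  fix s assume "s : q ` {..n}"
  hence [measurable]: "Y s : bor M" using qt by (auto intro!: m)
  show "{w : space M. abs (Y s w) > eps} : sets M" by measurable
 qed auto
 have "(%n. prob (A n)) ---> prob (UN n. A n)" by (rule finite_Lim_measure_incseq) (use Am in "auto simp: incseq_def A_def")
 moreover have "prob (A n) <= b" for n unfolding A_def by (rule le) (use qt in auto)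
 ultimately have "prob (UN n. A n) <= b" by (intro LIMSEQ_le_const2) auto
 moreover have "prob (exc M t eps Y) = prob (UN n. A n)" proof (rule measure_eq_AE)
  show "exc M t eps Y : sets M" by (rule exists_measurable[OF m]) (use ae in "auto elim!: eventually_mono intro: cont_left")
  show "(UN n. A n) : sets M" using Am by auto
  show "AE w in M. w : exc M t eps Y \<longleftrightarrow> w : (UN n. A n)" using ae AE_space
  proof eventually_elim case (elim w)
  have "(EX s:{0..t}. abs (Y s w) > eps) \<longleftrightarrow> (EX s:range q. abs (Y s w) > eps)"
  unfolding q by (rule exists_rational_iff) (rule cont_left[OF elim(1)])
  thus ?case using elim(2) by (auto simp: A_def)
  qed qed
 ultimately show ?thesis by simp
qed

lemma maximal:
 fixes K :: nat
 assumes e: "epred M F e" and C: "!!i w. i < steps e ==> w : space M ==> abs (coef e i w) <= C" and C0: "0 <= C" and t: "0 <= t" and eps: "0 < eps"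
 defines "Y \<equiv> eint e (XK (real K))" and "V \<equiv> ebracket e (AK (real K)) t"
 shows "prob (exc M t eps Y) <= (LINT w|M. V w)/eps^2" and "prob (exc M t eps Y) <= 36*(LINT w|M. (V w)^2)/eps^4"
proof -
 have m: "Y s : bor M" if "0 <= s" for s unfolding Y_def by (rule F_meas_M[OF that eint_adapted[OF filt e XK_adapted that]]) auto
 have ae: "acont M Y" using XK_continuous[of "real K"] unfolding Y_def
  by (auto elim!: eventually_mono intro: eint_cont epredD(2)[OF e])
 show "prob (exc M t eps Y) <= (LINT w|M. V w)/eps^2" by (rule prob_exists_le[OF m ae t]) (auto simp: Y_def V_def intro!: maximal_finite(1)[OF e C C0 t _ _ eps])
 show "prob (exc M t eps Y) <= 36*(LINT w|M. (V w)^2)/eps^4" by (rule prob_exists_le[OF m ae t]) (auto simp: Y_def V_def intro!: maximal_finite(2)[OF e C C0 t _ _ eps])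
qed

lemma clock_tail: "0 <= t ==> 0 < dl ==> EX K::nat. prob {w : space M. tau t w > real K} < dl"
proof -
 assume t: "0 <= t" and d: "0 < dl"
 have [measurable]: "tau t : bor M" by (rule F_meas_M[OF t tau_adapted[OF t]])
 have "(%n. prob {w : space M. tau t w > real n}) ---> 0" proof (rule meas_to_0)
  show "subseq_ae M (%s w. EV n. w ~: {w : space M. tau t w > real (s n)})"
  proof (rule subseq_ae_AE, intro AE_I2 allI impI)
  fix w and s :: "nat => nat" assume s: "strict_mono s"
  have "EV n. tau t w <= real n" by (meson eventually_at_top_linorder of_nat_le_iff order_trans real_arch_simple)
  from eventually_subseq[OF s this]
  show "EV n. w ~: {w : space M. tau t w > real (s n)}" by eventually_elim auto
  qed
 qed measurable
 hence "EV n. prob {w : space M. tau t w > real n} < dl" using d by (rule order_tendstoD)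
 thus ?thesis by (auto simp: ev_seq)
qed

lemma bracket_bound:
 assumes e: "epred M F e" and C: "!!i. i < steps e ==> abs (coef e i w) <= C"
  and mono: "ALL s t. 0 <= s --> s <= t --> A s w <= A t w" and b: "ALL s>=0. 0 <= A s w & A s w <= K" and t: "0 <= t"
 shows "ebracket e A t w <= C^2 * K"
proof -
 note eD = epredD[OF e]
 have "ebracket e A t w <= (SUM i<steps e. C^2*(inc (%s. A s w) (grid e) i t))" unfolding ebracket_def
 proof (intro sum_mono mult_right_mono)
  fix i assume i: "i : {..<steps e}"
  thus "(coef e i w)^2 <= C^2" using C by (metis abs_ge_zero lessThan_iff power2_abs power_mono)
  have "0 <= grid e i" "grid e i <= grid e (Suc i)" using eD i by (auto simp: grid_mono_def)
  thus "0 <= inc (%s. A s w) (grid e) i t" using mono t by (auto simp: min_def)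
 qed
 also have "... = C^2*(A (min (grid e (steps e)) t) w - A (min (grid e 0) t) w)"
  by (simp add: sum_distrib_left[symmetric] sum_lessThan_telescope[where f="%i. A (min (grid e i) t) w"])
 also have "... <= C^2 * K" proof (rule mult_left_mono)
  have "A (min (grid e (steps e)) t) w <= K" "0 <= A (min (grid e 0) t) w" using b t eD(2)[of "steps e"] eD(2)[of 0] by auto
  thus "A (min (grid e (steps e)) t) w - A (min (grid e 0) t) w <= K" by simp
 qed simp
 finally show ?thesis .
qed

text \<open>Three bad events of probability at most \<open>dl/3\<close> each: the integrand exceeds
  \<open>et\<close>, the clock exceeds \<open>K\<close>, or the clipped and stopped integral exceeds
  \<open>eps\<close>. Off the first two the clipped integral is the original one.\<close>

theorem good_integrator:
 assumes t: "0 <= t" and eps: "0 < eps" and dl: "0 < dl"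
 shows "EX et>0. ALL e. epred M F e -->
  prob (exc M t et (%s w. eproc e s w)) < et -->
  prob (exc M t eps (%s w. eint e X s w)) <= dl"
proof -
 have "0 < dl/3" using dl by simp
 from clock_tail[OF t this] obtain K :: nat where K: "prob {w : space M. tau t w > real K} < dl/3" by auto
 \<comment> \<open>The second entry is chosen so that \<open>et^2 * K/eps^2\<close>, the Chebyshev
   bound for the clipped integral, is at most \<open>dl/3\<close>.\<close>
 define et where "et = min (dl/3) (eps * sqrt (dl/(3*(real K + 1))))"
 have et0: "et > 0" using dl eps by (simp add: et_def add_nonneg_pos)
 have "et^2 <= (eps * sqrt (dl/(3*(real K + 1))))^2" using et0 by (intro power_mono) (auto simp: et_def)
 also have "... = eps^2*(dl/(3*(real K + 1)))" using dl by (simp add: power_mult_distrib)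
 finally have "et^2*(real K + 1) <= eps^2*(dl/3)" by (simp add: field_simps)
 hence "et^2 * real K <= eps^2*(dl/3)" using mult_left_mono[of "real K" "real K + 1" "et^2"] by simp
 hence etK: "et^2 * real K/eps^2 <= dl/3" using eps by (simp add: field_simps)
 show ?thesis proof (intro exI[of _ et] conjI allI impI)
  show "et > 0" by fact
  fix e assume e: "epred M F e" and small: "prob (exc M t et (%s w. eproc e s w)) < et"
  note eD = epredD[OF e]
  \<comment> \<open>Large coefficients are dropped, which is decided at the start of their step; off
    the first event every coefficient active before \<open>t\<close> is small and survives.\<close>
  define c where "c i w = coef e i w * of_bool (abs (coef e i w) <= et)" for i w
  define e' where "e' = Elementary (%_. 0) (steps e) (grid e) c"
  have [simp]: "steps e' = steps e" "grid e' = grid e" "coef e' = c" "init e' = (%_. 0)" by (simp_all add: e'_def)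
  have cb: "abs (c i w) <= et" for i w using et0 by (auto simp: c_def of_bool_def)
  have e': "epred M F e'" unfolding epred_def proof (intro conjI allI impI)
  show "bounded (init e' ` space M)" unfolding bounded_iff by (intro exI[of _ 0]) auto
  show "bounded (coef e' i ` space M)" for i unfolding bounded_iff using cb by (intro exI[of _ et]) auto
  fix i assume i: "i < steps e'"
  have [measurable]: "coef e i : bor (F (grid e i))" using eD(3) i by simp
  have "c i : bor (F (grid e i))" unfolding c_def[abs_def] by measurable
  thus "coef e' i : bor (F (grid e' i))" by simp
  qed (use eD in "auto simp: grid_mono_def")
  let ?E1 = "exc M t et (%s w. eproc e s w)"
  let ?E2 = "{w : space M. tau t w > real K}"
  let ?E3 = "exc M t eps (%s w. eint e' (XK (real K)) s w)"
  let ?V = "ebracket e' (AK (real K)) t"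
  have gp: "good_pair M (eint e' (XK (real K)) t) ?V" by (rule good_pair_elementary[OF e' _ t, where C=et]) (use cb in auto)
  have Vb: "AE w in M. 0 <= ?V w & ?V w <= et^2 * real K" using AK_ae[of "real K"] AK_bounds[of "real K", simplified]
  proof eventually_elim case (elim w)
  thus ?case using bracket_nonneg[OF e' _ t, of "AK (real K)" w] bracket_bound[OF e' _ _ _ t, of w et "AK (real K)" "real K"] cb by auto
  qed
  have mV: "?V : bor M" using gp by (simp add: good_pair_def)
  have "integrable M ?V" by (rule integrable_const_bound[OF _ mV, where B="et^2 * real K"]) (use Vb in "eventually_elim, auto")
  hence "(LINT w|M. ?V w) <= (LINT w|M. et^2 * real K)" by (intro integral_mono_AE) (use Vb in auto)
  hence "(LINT w|M. ?V w) <= et^2 * real K" by (simp add: prob_space)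
  hence "(LINT w|M. ?V w)/eps^2 <= et^2 * real K/eps^2" by (intro divide_right_mono) auto
  moreover have "prob ?E3 <= (LINT w|M. ?V w)/eps^2" by (rule maximal(1)[OF e' _ less_imp_le[OF et0] t eps, of K]) (use cb in auto)
  ultimately have p3: "prob ?E3 <= dl/3" using etK by linarith
  have [measurable]: "tau t : bor M" by (rule F_meas_M[OF t tau_adapted[OF t]])
  have E1: "?E1 : sets M" proof (rule exists_measurable)
  show "eproc e s : bor M" for s proof -
  have c: "coef e i : bor M" if "i < steps e" for i using F_meas_M[OF eD(2) eD(3)] that by auto
  have "init e : bor (F 0)" using e by (simp add: epred_def)
  hence "init e : bor M" by (rule F_meas_M[OF order_refl])
  thus ?thesis unfolding elementary_process_def[abs_def] by (intro borel_measurable_add borel_measurable_times borel_measurable_sum c) auto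
  qed
  qed (auto intro: eproc_left)
  have E2: "?E2 : sets M" by measurable
  have E3: "?E3 : sets M" proof (rule exists_measurable)
  show "eint e' (XK (real K)) s : bor M" if "0 <= s" for s by (rule F_meas_M[OF that eint_adapted[OF filt e' XK_adapted that]]) auto
  show "AE w in M. ALL s>0. continuous (at_left s) (%s. eint e' (XK (real K)) s w)" using XK_continuous[of "real K", simplified]
  proof eventually_elim case (elim w)
  have "cont0 (%s. eint e' (XK (real K)) s w)" by (rule eint_cont[where x="XK (real K)", OF elim epredD(2)[OF e']])
  thus ?case by (auto intro: cont_left)
  qed qed
  have "prob (exc M t eps (%s w. eint e X s w)) <= prob ((?E1 Un ?E2) Un ?E3)"
  proof (rule finite_measure_mono_AE)
  show "AE w in M. w : exc M t eps (%s w. eint e X s w) --> w : (?E1 Un ?E2) Un ?E3" using tau_ae AE_space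
  proof eventually_elim case (elim w)
  show ?case proof (rule impI, rule ccontr)
  assume "w : exc M t eps (%s w. eint e X s w)"
  then obtain s where s: "0 <= s" "s <= t" "abs (eint e X s w) > eps" by auto
  assume "w ~: (?E1 Un ?E2) Un ?E3"
  hence n: "!!s. 0 <= s ==> s <= t ==> abs (eproc e s w) <= et" "tau t w <= real K"
  "!!s. 0 <= s ==> s <= t ==> abs (eint e' (XK (real K)) s w) <= eps" using elim(2) by (auto simp: not_less)
  have XX: "X u w = XK (real K) u w" if "0 <= u" "u <= t" for u proof -
  have "tau u w <= tau t w" using elim(1) that t by (auto simp: mono_on_def)
  thus ?thesis using n(2) by (simp add: X_def XK_def)
  qed
  have "eint e X s w = eint e' (XK (real K)) s w" unfolding eint_def
  proof (rule sum.cong, simp)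
  fix i assume "i : {..<steps e'}"
  hence i: "i < steps e" by simp
  have g: "0 <= grid e i" "0 <= grid e (Suc i)" "grid e i <= grid e (Suc i)" using eD(1) eD(2)[of i] eD(2)[of "Suc i"] i by (auto simp: grid_mono_def)
  show "coef e i w*(inc (%u. X u w) (grid e) i s) =
  coef e' i w*(inc (%u. XK (real K) u w) (grid e') i s)" proof (cases "grid e i < min (grid e (Suc i)) s")
  case True
  define u where "u = min (grid e (Suc i)) s"
  have u: "grid e i < u" "u <= grid e (Suc i)" "0 <= u" "u <= t" "u ~= 0" using True g s by (auto simp: u_def)
  have "eproc e u w = coef e i w" using stepv_coef[OF eD(1) i u(1,2)] u(5) by (simp add: eproc_step)
  hence "abs (coef e i w) <= et" using n(1)[OF u(3,4)] by simp
  hence "coef e' i w = coef e i w" by (simp add: c_def)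
  moreover have "X (min (grid e (Suc i)) s) w = XK (real K) (min (grid e (Suc i)) s) w"
  "X (min (grid e i) s) w = XK (real K) (min (grid e i) s) w" using g s by (auto intro!: XX)
  ultimately show ?thesis by simp
  next case False
  hence "min (grid e (Suc i)) s = min (grid e i) s" using g by (auto simp: min_def)
  thus ?thesis by simp
  qed qed
  thus False using s n(3)[OF s(1,2)] by simp
  qed qed
  show "(?E1 Un ?E2) Un ?E3 : sets M" by (intro sets.Un E1 E2 E3)
  qed
  also have "... <= (prob ?E1 + prob ?E2) + prob ?E3" using measure_Un_le[OF sets.Un[OF E1 E2] E3] measure_Un_le[OF E1 E2] by linarith
  also have "... <= dl" using small K p3 by (auto simp: et_def)
  finally show "prob (exc M t eps (%s w. eint e X s w)) <= dl" .
 qed qed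

end

section \<open>Existence and stability of stochastic integrals\<close>

definition trunc :: "real => real => real" where "trunc R x = max (- R) (min R x)"

lemma trunc_bound: "0 <= R ==> abs (trunc R x) <= R" and trunc_id: "abs x <= R ==> trunc R x = x" by (auto simp: trunc_def)

lemma trunc_measurable[measurable]: "trunc R : bor borel" unfolding trunc_def by measurable

lemma trunc_continuous: "continuous_on S f ==> continuous_on S (%x. trunc R (f x))" unfolding trunc_def by (intro cont_intros)

text \<open>Left-endpoint sampling with mesh \<open>2^-n\<close> up to time \<open>n\<close>; the
  values are cut at \<open>n\<close> because elementary coefficients must be bounded.\<close>

definition dyel :: "nat => (real => 'a => real) => 'a elementary_data" where
 "dyel n H = Elementary (%w. trunc n (H 0 w)) (n*2^n) (%i. dy n i) (%i w. trunc n (H (dy n i) w))"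

lemma dyel_simps[simp]:
 "init (dyel n H) = (%w. trunc n (H 0 w))" "steps (dyel n H) = n*2^n"
 "grid (dyel n H) = (%i. dy n i)" "coef (dyel n H) = (%i w. trunc n (H (dy n i) w))" by (simp_all add: dyel_def)

lemma dyadic_predictable:
 assumes "!!t. 0 <= t ==> H t : bor (F t)"
 shows "epred M F (dyel n H)" unfolding epred_def
proof (intro conjI allI impI)
 have [measurable]: "H 0 : bor (F 0)" using assms by simp
 show "init (dyel n H) : bor (F 0)" by simp
 fix i
 have [measurable]: "H (dy n i) : bor (F (dy n i))" using assms by simp
 show "coef (dyel n H) i : bor (F (grid (dyel n H) i))" by simp
qed (auto simp: bounded_iff trunc_bound divide_right_mono intro!: exI[of _ "real n"])

lemma dyadic_process_value:
 assumes "0 < u" "u <= real n"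
 obtains v where "0 <= v" "v <= u" "u - v <= 1/2^n" "eproc (dyel n H) u w = trunc n (H v w)"
proof -
 define i where "i = nat \<lceil>2^n * u\<rceil> - 1"
 have c: "0 < \<lceil>2^n * u\<rceil>" using assms by simp
 have "1 <= nat \<lceil>2^n * u\<rceil>" using c by linarith
 hence ri: "real i = of_int \<lceil>2^n * u\<rceil> - 1" using c by (simp add: i_def of_nat_diff del: of_nat_nat One_nat_def)
 have b: "real i < 2^n * u" "2^n * u <= real i + 1" unfolding ri by linarith+
 have "2^n * u <= real (n*2^n)" using assms by (simp add: mult.commute)
 hence iN: "i < n*2^n" using b(1) by (metis of_nat_less_iff less_le_trans)
 have g: "grid_mono (dyel n H)" by (simp add: grid_mono_def divide_right_mono)
 have "stepv (dyel n H) u w = coef (dyel n H) i w" by (rule stepv_coef[OF g]) (use b iN in "auto simp: field_simps")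
 hence "eproc (dyel n H) u w = trunc n (H (dy n i) w)" using assms by (simp add: eproc_step)
 moreover have "u <= (real i + 1)/2^n" using b(2) by (simp add: pos_le_divide_eq mult.commute)
 hence "u - dy n i <= 1/2^n" by (simp add: add_divide_distrib)
 moreover have "dy n i <= u" using b(1) by (simp add: pos_divide_le_eq mult.commute)
 ultimately show ?thesis by (intro that[of "dy n i"]) auto
qed

text \<open>The sampled function may vary with the index: uniform convergence of
  \<open>H (s n)\<close> is combined with uniform continuity of the limit, and the truncation is
  eventually inactive since the limit is bounded on compacts.\<close>

lemma dyadic_path:
 assumes s: "strict_mono (s :: nat => nat)" and u: "upath (%n u. H (s n) u w) h" and h: "cont0 h"
 shows "upath (%n u. eproc (dyel (s n) (H (s n))) u w) h" unfolding upath_def uniform_limit_iff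
proof (intro allI impI)
 fix t e :: real assume t: "0 <= t" and e: "0 < e"
 have ht: "continuous_on {0..t} h" by (rule cont_subset[OF h]) auto
 hence "uniformly_continuous_on {0..t} h" by (rule compact_uniformly_continuous) simp
 then obtain d where d: "d > 0" "!!x y. x : {0..t} ==> y : {0..t} ==> dist x y < d ==> dist (h x) (h y) < e/2"
  unfolding uniformly_continuous_on_def using e by (metis half_gt_zero)
 have "bounded (h ` {0..t})" by (intro compact_imp_bounded compact_image ht) simp
 then obtain R where "ALL y:h ` {0..t}. norm y <= R" unfolding bounded_iff by blast
 hence R: "abs (h x) <= R" if "x : {0..t}" for x using that by simp
 have u': "EV n. ALL x:{0..t}. dist (H (s n) x w) (h x) < c" if "c > 0" for c using u t that unfolding upath_def uniform_limit_iff by blast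
 have "EV n. ALL x:{0..t}. dist (H (s n) x w) (h x) < min 1 (e/2)" by (rule u') (use e in simp)
 moreover have "EV n. t <= real (s n)" by (rule eventually_subseq[OF s]) real_asymp
 moreover have "EV n. R + 1 <= real (s n)" by (rule eventually_subseq[OF s]) real_asymp
 moreover have "EV n. 1/2^s n < d" proof (rule eventually_subseq[OF s])
  have "(%n. 1/2^n :: real) ---> 0" by real_asymp
  thus "EV n. 1/2^n < d" using d(1) by (rule order_tendstoD)
 qed
 ultimately show "EV n. ALL x:{0..t}. dist (eproc (dyel (s n) (H (s n))) x w) (h x) < e" proof eventually_elim
  case (elim n)
  have cl: "trunc (s n) (H (s n) v w) = H (s n) v w" if "v : {0..t}" for v proof (rule trunc_id)
  have "dist (H (s n) v w) (h v) < 1" using elim(1) that by auto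
  thus "abs (H (s n) v w) <= real (s n)" using R[OF that] elim(3) by (auto simp: dist_real_def)
  qed
  show ?case proof
  fix x assume x: "x : {0..t}"
  show "dist (eproc (dyel (s n) (H (s n))) x w) (h x) < e" proof (cases "x = 0") case True
  have "stepv (dyel (s n) (H (s n))) 0 w = 0" unfolding stepv_def by (intro sum.neutral) (auto simp: indicator_def divide_less_0_iff)
  moreover have "dist (H (s n) 0 w) (h 0) < min 1 (e/2)" using elim(1) t by simp
  ultimately show ?thesis using True t cl[of 0] e by (simp add: eproc_step)
  next case False
  hence "0 < x" "x <= real (s n)" using x elim(2) by auto
  from dyadic_process_value[OF this, of "H (s n)" w] obtain v where
  v: "0 <= v" "v <= x" "x - v <= 1/2^s n" "eproc (dyel (s n) (H (s n))) x w = trunc (s n) (H (s n) v w)" by blast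
  have vt: "v : {0..t}" using v x by auto
  have "dist (H (s n) v w) (h v) < e/2" using elim(1) vt by auto
  moreover have "dist (h v) (h x) < e/2" using v x vt elim(4) by (intro d) (auto simp: dist_real_def)
  ultimately show ?thesis using dist_triangle_half_l[of "H (s n) v w" "h v" e "h x"] v(4) cl[OF vt] by (metis dist_commute dist_triangle_half_r)
  qed qed qed qed

lemma fast_uniform_Cauchy:
 fixes y :: "nat => real => real"
 assumes "\<forall>\<^sub>F k in sequentially. ALL u:{0..real k}. abs (y (Suc k) u - y k u) <= (1/2)^k"
 shows "upath y (%u. lim (%k. y k u))" unfolding upath_def
proof (intro allI impI)
 fix t :: real assume t: "0 <= t"
 have "uniformly_Cauchy_on {0..t} y" proof (rule uniformly_Cauchy_onI')
  fix e :: real assume e: "e > 0"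
  have "\<forall>\<^sub>F k in sequentially. t <= real k" by real_asymp
  moreover have "\<forall>\<^sub>F k in sequentially. 2*(1/2::real)^k < e" proof -
  have "(%k. 2*(1/2::real)^k) ---> 0" by real_asymp
  thus ?thesis using e by (rule order_tendstoD)
  qed
  ultimately have "\<forall>\<^sub>F k in sequentially. t <= real k & 2*(1/2::real)^k < e & (ALL u:{0..real k}. abs (y (Suc k) u - y k u) <= (1/2)^k)"
  using assms by eventually_elim auto
  then obtain N where N: "!!k. k >= N ==> t <= real k & 2*(1/2::real)^k < e & (ALL u:{0..real k}. abs (y (Suc k) u - y k u) <= (1/2)^k)"
  unfolding ev_seq by blast
  have tel: "abs (y n u - y m u) <= 2*(1/2)^m - 2*(1/2)^n" if "N <= m" "m <= n" "u : {0..t}" for m n u using that(2)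
  proof (induction n rule: dec_induct) case (step n)
  have "abs (y (Suc n) u - y n u) <= (1/2)^n" using N[of n] step that by auto
  thus ?case using step by simp
  qed simp
  show "EX Ma. ALL x:{0..t}. ALL m>=Ma. ALL n>m. dist (y m x) (y n x) < e" proof (intro exI ballI allI impI)
  fix x m n assume h: "x : {0..t}" "N <= m" "m < n"
  have "abs (y n x - y m x) <= 2*(1/2)^m - 2*(1/2)^n" using h by (intro tel) auto
  also have "... < e" using N[OF h(2)] zero_less_power[of "1/2::real" n] by linarith
  finally show "dist (y m x) (y n x) < e" by (simp add: dist_real_def abs_minus_commute)
  qed qed
 thus "uniform_limit {0..t} y (%u. lim (%k. y k u)) sequentially" by (simp add: Cauchy_uniformly_convergent uniformly_convergent_uniform_limit_iff[symmetric])
qed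

context cps
begin

lemma filt_meas:
 assumes "is_filtration M F" "0 <= t" "(f :: 'a => real) : bor (F t)"
 shows "f : bor M" using assms meas_subalg unfolding is_filtration_def by blast

lemma eproc_meas:
 assumes F: "is_filtration M F" and e: "epred M F e"
 shows "eproc e s : bor M"
proof -
 note eD = epredD[OF e]
 have c: "coef e i : bor M" if "i < steps e" for i by (rule filt_meas[OF F eD(2) eD(3)[OF that]]) (use that in simp)
 have "init e : bor (F 0)" using e by (simp add: epred_def)
 hence i: "init e : bor M" by (rule filt_meas[OF F order_refl])
 show ?thesis unfolding elementary_process_def[abs_def] by (intro borel_measurable_add borel_measurable_times borel_measurable_sum c i) auto
qed

lemma exc_eproc_meas:
 assumes F: "is_filtration M F" and e: "epred M F e" and H: "cadapt M F H"
 shows "exc M t eps (%s w. eproc e s w - H s w) : sets M"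
proof (rule exists_measurable)
 show "(%w. eproc e s w - H s w) : bor M" if "0 <= s" for s using H that filt_meas[OF F that, of "H s"] eproc_meas[OF F e, of s]
  by (auto simp: ca_def)
 have "acont M H" using H by (simp add: ca_def)
 thus "AE w in M. ALL s>0. continuous (at_left s) (%s. eproc e s w - H s w)"
  by eventually_elim (intro allI impI continuous_diff eproc_left cont_left)
qed

lemma exc_cont_meas:
 assumes F: "is_filtration M F" and H: "cadapt M F H" and I: "cadapt M F I"
 shows "exc M t eps (%s w. H s w - I s w) : sets M"
proof (rule exists_measurable)
 show "(%w. H s w - I s w) : bor M" if "0 <= s" for s using H I that filt_meas[OF F that, of "H s"] filt_meas[OF F that, of "I s"]
  by (auto simp: ca_def)
 have "acont M H" "acont M I" using H I by (auto simp: ca_def)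
 thus "AE w in M. ALL s>0. continuous (at_left s) (%s. H s w - I s w)" by eventually_elim (intro allI impI continuous_diff cont_left)
qed

lemma eint_ca:
 assumes F: "is_filtration M F" and e: "epred M F e" and X: "cadapt M F X"
 shows "cadapt M F (eint e X)" unfolding ca_def
proof (intro conjI allI impI)
 show "eint e X t : bor (F t)" if "0 <= t" for t by (rule eint_adapted[OF F e _ that]) (use X in "simp add: ca_def")
 have "acont M X" using X by (simp add: ca_def)
 thus "acont M (%t w. eint e X t w)" proof eventually_elim case (elim w)
  show ?case by (rule eint_cont[where x=X, OF elim epredD(2)[OF e]])
 qed qed

lemma ca_zero: "is_filtration M F ==> cadapt M F (%_ _. 0)" by (simp add: ca_def)

lemma dyadic_uconv:
 assumes H: "!!n t. 0 <= t ==> Hn n t : bor (F t)" and u: "uconv M Hn H" and h: "cadapt M F H"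
 shows "uconv M (%n. eproc (dyel n (Hn n))) H"
proof (rule subseq_ae_mono[OF u])
 have "acont M H" using h by (simp add: ca_def)
 thus "AE w in M. ALL s. strict_mono s --> upath (%n u. Hn (s n) u w) (%u. H u w) -->
  upath (%n u. eproc (dyel (s n) (Hn (s n))) u w) (%u. H u w)" proof eventually_elim case (elim w)
  show ?case by (intro allI impI dyadic_path[where H=Hn, OF _ _ elim])
 qed qed

lemma uconv_refl: "uconv M (%_. H) H" by (rule subseq_ae_AE) (auto simp: upath_def uniform_limit_const)

lemma SI_uconv:
 assumes SI: "SI M F X H I" and e: "!!n. epred M F (e n)" and u: "uconv M (%n. eproc (e n)) H"
 shows "uconv M (%n. eint (e n) X) I"
proof -
 have F: "is_filtration M F" and ca: "cadapt M F X" "cadapt M F H" "cadapt M F I" using SI by (auto simp: SI_def)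
 have "ucp_converges M (%n. eproc (e n)) H" by (rule uconv_imp_ucp[OF exc_eproc_meas[OF F e ca(2)] u])
 hence "ucp_converges M (%n. eint (e n) X) I" using SI e unfolding SI_def by blast
 thus ?thesis by (rule ucp_imp_uconv[OF exc_cont_meas[OF F eint_ca[OF F e ca(1)] ca(3)]])
qed

lemma SI_dyadic:
 assumes SI: "SI M F X H I" and H: "!!n t. 0 <= t ==> Hn n t : bor (F t)" and u: "uconv M Hn H"
 shows "uconv M (%n. eint (dyel n (Hn n)) X) I" by (rule SI_uconv[OF SI dyadic_predictable[OF H] dyadic_uconv[OF H u]])
  (use SI in "auto simp: SI_def")

lemma uconv_unique:
 assumes "uconv M Y Z" "uconv M Y Z'"
 shows "AE w in M. ALL t>=0. Z t w = Z' t w"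
proof -
 have "subseq_ae M (%s w. upath (%n u. Y (s n) u w) (%u. Z u w) & upath (%n u. Y (s n) u w) (%u. Z' u w))"
  by (rule subseq_ae_conj[OF assms]) (rule upath_subseq[where f="%n u. Y n u _"])
 then obtain q where "AE w in M. upath (%n u. Y ((id o q) n) u w) (%u. Z u w) & upath (%n u. Y ((id o q) n) u w) (%u. Z' u w)"
  unfolding subseq_ae_def using strict_mono_id by blast
 thus ?thesis by eventually_elim (auto intro: upath_unique)
qed

lemma SI_unique:
 assumes "SI M F X H I" "SI M F X H I'"
 shows "AE w in M. ALL t>=0. I t w = I' t w"
proof -
 have H: "0 <= t ==> H t : bor (F t)" for t using assms by (auto simp: SI_def ca_def)
 show ?thesis by (rule uconv_unique[OF SI_dyadic[OF assms(1) H uconv_refl] SI_dyadic[OF assms(2) H uconv_refl]])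
qed

lemma half_borel_cantelli:
 assumes "!!n. A n : sets M" "!!n::nat. prob (A n) <= (1/2)^n"
 shows "AE w in M. EV n. w : space M - A n"
proof (rule borel_cantelli_AE1)
 show "summable (%n. prob (A n))" by (rule summable_comparison_test[of _ "%k. (1/2)^k"]) (use assms in "auto intro!: exI[of _ 0]")
qed (use assms in "auto simp: emeasure_eq_measure")

lemma fast_uconv_path:
 fixes y :: "nat => real => real"
 assumes "EV n. ALL u:{0..real n}. abs (y n u) <= (1/2)^n"
 shows "upath y (%_. 0)" unfolding upath_def uniform_limit_iff
proof (intro allI impI)
 fix t e :: real assume te: "0 <= t" "0 < e"
 have "EV n. t <= real n" by real_asymp
 moreover have "EV n. (1/2::real)^n < e" by (rule order_tendstoD[OF LIMSEQ_realpow_zero]) (use te in auto)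
 ultimately show "EV n. ALL x:{0..t}. dist (y n x) 0 < e" using assms by eventually_elim (force simp: dist_real_def)
qed

text \<open>The definition of the integral tests only elementary processes, so each
  \<open>Hn n\<close> is replaced by a dyadic one: up to time \<open>n\<close> the process and its
  integral are within \<open>2^-n\<close> of \<open>Hn n\<close> and \<open>In n\<close>, off events
  of probability at most \<open>2^-n\<close>. This diagonal sequence approximates \<open>H\<close>,
  hence its integrals tend to \<open>I\<close>.\<close>

theorem SI_stable:
 assumes SI: "SI M F X H I" and SIn: "!!n. SI M F X (Hn n) (In n)" and u: "uconv M Hn H"
 shows "uconv M In I"
proof -
 have F: "is_filtration M F" and ca: "cadapt M F X" "cadapt M F H" "cadapt M F I"
  "!!n. cadapt M F (Hn n)" "!!n. cadapt M F (In n)" using SI SIn by (auto simp: SI_def)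
 have Hm: "0 <= t ==> Hn n t : bor (F t)" for n t using ca(4) by (auto simp: ca_def)
 have dp: "epred M F (dyel m (Hn n))" for m n by (rule dyadic_predictable[OF Hm])
 define A1 where "A1 n m = exc M (real n) ((1/2)^n) (%s w. eproc (dyel m (Hn n)) s w - Hn n s w)" for n m
 define A2 where "A2 n m = exc M (real n) ((1/2)^n) (%s w. eint (dyel m (Hn n)) X s w - In n s w)" for n m
 have s1: "A1 n m : sets M" for n m unfolding A1_def by (rule exc_eproc_meas[OF F dp ca(4)])
 have s2: "A2 n m : sets M" for n m unfolding A2_def by (rule exc_cont_meas[OF F eint_ca[OF F dp ca(1)] ca(5)])
 have "EX m. prob (A1 n m) <= (1/2)^n & prob (A2 n m) <= (1/2)^n" for n proof -
  have "ucp_converges M (%m. eproc (dyel m (Hn n))) (Hn n)"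
  by (rule uconv_imp_ucp[OF exc_eproc_meas[OF F dp ca(4)] dyadic_uconv[OF Hm uconv_refl ca(4)]])
  hence "(%m. prob (A1 n m)) ---> 0" unfolding ucp_converges_def A1_def by simp
  hence "\<forall>\<^sub>F m in sequentially. prob (A1 n m) < (1/2)^n" by (rule order_tendstoD) simp
  moreover have "ucp_converges M (%m. eint (dyel m (Hn n)) X) (In n)"
  by (rule uconv_imp_ucp[OF exc_cont_meas[OF F eint_ca[OF F dp ca(1)] ca(5)]
  SI_dyadic[OF SIn Hm uconv_refl]])
  hence "(%m. prob (A2 n m)) ---> 0" unfolding ucp_converges_def A2_def by simp
  hence "\<forall>\<^sub>F m in sequentially. prob (A2 n m) < (1/2)^n" by (rule order_tendstoD) simp
  ultimately have "\<forall>\<^sub>F m in sequentially. prob (A1 n m) <= (1/2)^n & prob (A2 n m) <= (1/2)^n" by eventually_elim (simp add: less_imp_le)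
  from eventually_happens'[OF sequentially_bot this] show ?thesis .
 qed
 then obtain m where m: "!!n. prob (A1 n (m n)) <= (1/2)^n" "!!n. prob (A2 n (m n)) <= (1/2)^n" by metis
 define e where "e n = dyel (m n) (Hn n)" for n
 have A1n: "abs (eproc (e n) u w - Hn n u w) <= (1/2)^n" if "w : space M - A1 n (m n)" "u : {0..real n}" for n u w
  using that unfolding A1_def e_def by (simp add: not_less)
 have A2n: "abs (eint (e n) X u w - In n u w) <= (1/2)^n" if "w : space M - A2 n (m n)" "u : {0..real n}" for n u w
  using that unfolding A2_def e_def by (simp add: not_less)
 have d1: "AE w in M. upath (%n s. eproc (e n) s w - Hn n s w) (%_. 0)" using half_borel_cantelli[OF s1 m(1)]
  by eventually_elim (rule fast_uconv_path, erule eventually_mono, intro ballI A1n)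
 have d2: "AE w in M. upath (%n s. eint (e n) X s w - In n s w) (%_. 0)" using half_borel_cantelli[OF s2 m(2)]
  by eventually_elim (rule fast_uconv_path, erule eventually_mono, intro ballI A2n)
 have "uconv M (%n. eproc (e n)) H" proof (rule subseq_ae_mono[OF u])
  show "AE w in M. ALL s. strict_mono s --> upath (%n u. Hn (s n) u w) (%u. H u w) -->
  upath (%n u. eproc (e (s n)) u w) (%u. H u w)" using d1 proof (eventually_elim, intro allI impI)
  fix w s assume d: "upath (%n s. eproc (e n) s w - Hn n s w) (%_. 0)" and s: "strict_mono s" and h: "upath (%n u. Hn (s n) u w) (%u. H u w)"
  have "upath (%n u. eproc (e (s n)) u w - Hn (s n) u w) (%_. 0)" using upath_subseq[OF s, of "%n s. eproc (e n) s w - Hn n s w" id "%_. 0"] d by simp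
  from upath_add[OF this h] show "upath (%n u. eproc (e (s n)) u w) (%u. H u w)" by simp
  qed qed
 hence "uconv M (%n. eint (e n) X) I" by (rule SI_uconv[OF SI, rotated]) (simp add: e_def dp)
 thus ?thesis proof (rule subseq_ae_mono)
  show "AE w in M. ALL s. strict_mono s --> upath (%n u. eint (e (s n)) X u w) (%u. I u w) -->
  upath (%n u. In (s n) u w) (%u. I u w)" using d2 proof (eventually_elim, intro allI impI)
  fix w s assume d: "upath (%n s. eint (e n) X s w - In n s w) (%_. 0)" and s: "strict_mono s" and h: "upath (%n u. eint (e (s n)) X u w) (%u. I u w)"
  have "upath (%n u. eint (e (s n)) X u w - In (s n) u w) (%_. 0)" using upath_subseq[OF s, of "%n s. eint (e n) X s w - In n s w" id "%_. 0"] d by simp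
  from upath_diff[OF h this] show "upath (%n u. In (s n) u w) (%u. I u w)" by simp
  qed qed qed

end

context time_change
begin

lemma X_ca: "cadapt M F X" unfolding ca_def using X_adapted X_continuous by blast

lemma elementary_null_uconv:
 assumes e: "!!n. epred M F (e n)" and u: "uconv M (%n. eproc (e n)) (%_ _. 0)"
 shows "uconv M (%n. eint (e n) X) (%_ _. 0)"
proof (rule ucp_imp_uconv)
 show "exc M t eps (%s w. eint (e n) X s w - 0) : sets M" for n t eps
  by (rule exc_cont_meas[OF filt eint_ca[OF filt e X_ca] ca_zero[OF filt]])
 have ucp: "ucp_converges M (%n. eproc (e n)) (%_ _. 0)" by (rule uconv_imp_ucp[OF exc_eproc_meas[OF filt e ca_zero[OF filt]] u])
 show "ucp_converges M (%n. eint (e n) X) (%_ _. 0)" unfolding ucp_converges_def proof (intro allI impI)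
  fix t eps :: real assume t: "0 <= t" and ep: "0 < eps"
  show "(%n. prob (exc M t eps (%s w. eint (e n) X s w - 0))) ---> 0" proof (rule LIMSEQ_I)
  fix r :: real assume r: "0 < r"
  have r2: "0 < r/2" using r by simp
  from good_integrator[OF t ep r2] obtain et where et: "et > 0" and gi: "!!e. epred M F e ==>
  prob (exc M t et (%s w. eproc e s w)) < et ==>
  prob (exc M t eps (%s w. eint e X s w)) <= r/2" by blast
  have "(%n. prob (exc M t et (%s w. eproc (e n) s w - 0))) ---> 0" using ucp t et unfolding ucp_converges_def by blast
  hence "EV n. prob (exc M t et (%s w. eproc (e n) s w - 0)) < et" using et by (rule order_tendstoD)
  then obtain N where N: "!!n. n >= N ==> prob (exc M t et (%s w. eproc (e n) s w)) < et" by (auto simp: ev_seq)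
  show "EX no. ALL n>=no. norm (prob (exc M t eps (%s w. eint (e n) X s w - 0)) - 0) < r"
  proof (intro exI allI impI)
  fix n assume "n >= N"
  from gi[OF e N[OF this]] show "norm (prob (exc M t eps (%s w. eint (e n) X s w - 0)) - 0) < r" using r by simp
  qed qed qed qed

text \<open>Integrals of dyadic approximations are Cauchy in ucp by the integrator bound applied to
  their differences, and the limit is taken along a fast subsequence. Any other approximating
  sequence differs from this one by elementary processes tending to 0, whose integrals vanish in the
  limit.\<close>

theorem SI_exists:
 assumes H: "cadapt M F H"
 shows "EX I. SI M F X H I"
proof -
 have Hm: "0 <= t ==> H t : bor (F t)" for t using H by (auto simp: ca_def)
 define e where "e n = dyel n H" for n
 have ep: "epred M F (e n)" for n unfolding e_def by (rule dyadic_predictable[OF Hm])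
 have eu: "uconv M (%n. eproc (e n)) H" unfolding e_def by (rule dyadic_uconv[OF Hm uconv_refl H])
 have eucp: "ucp_converges M (%n. eproc (e n)) H" by (rule uconv_imp_ucp[OF exc_eproc_meas[OF filt ep H] eu])
 define Y where "Y n = eint (e n) X" for n
 have Yca: "cadapt M F (Y n)" for n unfolding Y_def by (rule eint_ca[OF filt ep X_ca])
 define A where "A k n m = exc M (real k) ((1/2)^k) (%s w. Y n s w - Y m s w)" for k n m
 have As: "A k n m : sets M" for k n m unfolding A_def by (rule exc_cont_meas[OF filt Yca Yca])
 have "EX N. ALL n>=N. ALL m>=n. prob (A k m n) <= (1/2)^k" for k proof -
  have "0 <= real k" "0 < (1/2::real)^k" "0 < (1/2::real)^k" by auto
  from good_integrator[OF this] obtain et where et: "et > 0" and gi: "!!e. epred M F e ==>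
  prob (exc M (real k) et (%s w. eproc e s w)) < et ==>
  prob (exc M (real k) ((1/2)^k) (%s w. eint e X s w)) <= (1/2)^k" by blast
  define D where "D n = exc M (real k) (et/2) (%s w. eproc (e n) s w - H s w)" for n
  have Ds: "D n : sets M" for n unfolding D_def by (rule exc_eproc_meas[OF filt ep H])
  have "(%n. prob (D n)) ---> 0" using eucp[unfolded ucp_converges_def, rule_format, of "real k" "et/2"] et by (simp add: D_def)
  hence "EV n. prob (D n) < et/2" by (rule order_tendstoD) (use et in simp)
  then obtain N where N: "!!n. n >= N ==> prob (D n) < et/2" by (auto simp: ev_seq)
  have "prob (A k m n) <= (1/2)^k" if "n >= N" "m >= n" for n m proof -
  obtain d where d: "epred M F d"
  "!!u w. eproc d u w = eproc (e m) u w - eproc (e n) u w"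
  "!!x t w. eint d x t w = eint (e m) x t w - eint (e n) x t w" using elementary_diff[OF filt ep ep] by metis
  have "prob (exc M (real k) et (%s w. eproc d s w)) <= prob (D m Un D n)"
  proof (intro finite_measure_mono subsetI)
  fix w assume "w : exc M (real k) et (%s w. eproc d s w)"
  then obtain s where s: "w : space M" "s : {0..real k}" "abs (eproc (e m) s w - eproc (e n) s w) > et" by (auto simp: d(2))
  hence "abs (eproc (e m) s w - H s w) > et/2 \<or> abs (eproc (e n) s w - H s w) > et/2" by linarith
  thus "w : D m Un D n" using s(1,2) unfolding D_def by blast
  qed (use Ds in auto)
  also have "... <= prob (D m) + prob (D n)" by (rule measure_Un_le[OF Ds Ds])
  also have "... < et" using N[of m] N[of n] that by simp
  finally show ?thesis using gi[OF d(1)] by (simp add: A_def Y_def d(3))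
  qed
  thus ?thesis by blast
 qed
 from fast_subseq[where P="%k n. ALL m>=n. prob (A k m n) <= (1/2)^k", OF this]
 obtain r where r: "strict_mono r" "!!k m. m >= r k ==> prob (A k m (r k)) <= (1/2)^k" by blast
 \<comment> \<open>\<open>lim\<close> is arbitrary off the almost sure event of convergence;
   measurability of \<open>I t\<close> rests on the null sets contained in
   \<open>F t\<close>.\<close>
 define I where "I u w = lim (%k. Y (r k) u w)" for u w
 have "prob (A k (r (Suc k)) (r k)) <= (1/2)^k" for k using r(1) by (intro r(2)) (auto simp: strict_mono_less_eq)
 note bc = half_borel_cantelli[OF As this]
 have An: "abs (Y (r (Suc k)) u w - Y (r k) u w) <= (1/2)^k" if "w : space M - A k (r (Suc k)) (r k)" "u : {0..real k}" for k u w
  using that unfolding A_def by (simp add: not_less)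
 from bc have path: "AE w in M. upath (%k u. Y (r k) u w) (%u. I u w)"
  unfolding I_def by eventually_elim (rule fast_uniform_Cauchy, erule eventually_mono, intro ballI An)
 have Ica: "cadapt M F I" unfolding ca_def proof (intro conjI allI impI)
  fix t :: real assume t: "0 <= t"
  show "I t : bor (F t)" proof (rule full_limit[OF Ffull[OF t]])
  show "Y (r n) t : bor (F t)" for n using Yca t by (simp add: ca_def)
  show "AE w in M. (%n. Y (r n) t w) ---> I t w" using path by eventually_elim (erule upathD[OF _ t])
  qed
 next
  have "AE w in M. ALL n. cont0 (%t. Y n t w)" using Yca by (simp add: AE_all_countable ca_def)
  thus "acont M I" using path by eventually_elim (erule upath_cont, blast)
 qed
 have "SI M F X H I" unfolding SI_def
 proof (intro conjI filt X_ca H Ica exI[of _ e] allI impI ep eucp)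
  fix f assume f: "ALL n. epred M F (f n)" and fu: "ucp_converges M (%n. eproc (f n)) H"
  have fu': "uconv M (%n. eproc (f n)) H" by (rule ucp_imp_uconv[OF exc_eproc_meas[OF filt _ H] fu]) (use f in blast)
  have "ALL n. EX d. epred M F d & (ALL u w. eproc d u w = eproc (f n) u w - eproc (e (r n)) u w) &
  (ALL x t w. eint d x t w = eint (f n) x t w - eint (e (r n)) x t w)" using elementary_diff[OF filt _ ep] f by metis
  then obtain d where d: "!!n. epred M F (d n)"
  "!!n u w. eproc (d n) u w = eproc (f n) u w - eproc (e (r n)) u w"
  "!!n x t w. eint (d n) x t w = eint (f n) x t w - eint (e (r n)) x t w" by metis
  have eur: "AE w in M. ALL s. strict_mono s --> upath (%n u. eproc (e (r (s n))) u w) (%u. H u w)" proof -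
  have "acont M H" using H by (simp add: ca_def)
  thus ?thesis proof (eventually_elim, intro allI impI)
  fix w and s :: "nat => nat" assume h: "cont0 (%t. H t w)" and s: "strict_mono s"
  show "upath (%n u. eproc (e (r (s n))) u w) (%u. H u w)" unfolding e_def by (rule dyadic_path[where s="%n. r (s n)" and H="%_. H", OF _ _ h])
  (use strict_mono_o[OF r(1) s] in "auto simp: o_def upath_def uniform_limit_const")
  qed qed
  have "uconv M (%n. eproc (d n)) (%_ _. 0)" proof (rule subseq_ae_mono[OF fu'])
  show "AE w in M. ALL s. strict_mono s --> upath (%n u. eproc (f (s n)) u w) (%u. H u w) -->
  upath (%n u. eproc (d (s n)) u w) (%u. 0)" using eur proof (eventually_elim, intro allI impI)
  fix w and s :: "nat => nat" assume "ALL s. strict_mono s --> upath (%n u. eproc (e (r (s n))) u w) (%u. H u w)"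
  and s: "strict_mono s" and p: "upath (%n u. eproc (f (s n)) u w) (%u. H u w)"
  hence "upath (%n u. eproc (e (r (s n))) u w) (%u. H u w)" by blast
  from upath_diff[OF p this] show "upath (%n u. eproc (d (s n)) u w) (%u. 0)" by (simp add: d(2))
  qed qed
  from elementary_null_uconv[OF d(1) this]
  have "uconv M (%n. eint (f n) X) I" proof (rule subseq_ae_mono)
  show "AE w in M. ALL s. strict_mono s --> upath (%n u. eint (d (s n)) X u w) (%u. 0) -->
  upath (%n u. eint (f (s n)) X u w) (%u. I u w)" using path proof (eventually_elim, intro allI impI)
  fix w and s :: "nat => nat" assume p: "upath (%k u. Y (r k) u w) (%u. I u w)" and s: "strict_mono s" and q: "upath (%n u. eint (d (s n)) X u w) (%u. 0)"
  have "upath (%n u. Y (r (s n)) u w) (%u. I u w)" using upath_subseq[OF s, of "%k u. Y (r k) u w" id] p by simp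
  from upath_add[OF q this] show "upath (%n u. eint (f (s n)) X u w) (%u. I u w)" by (simp add: d(3) Y_def)
  qed qed
  thus "ucp_converges M (%n. eint (f n) X) I"
  by (rule uconv_imp_ucp[OF exc_cont_meas[OF filt eint_ca[OF filt _ X_ca] Ica], rotated]) (use f in blast)
 qed
 thus ?thesis by blast
qed

end

section \<open>Quadratic variation and the Ito formula\<close>

lemma dyadic_mesh:
 fixes x :: "real => real"
 assumes x: "cont0 x" and t: "0 <= t" and e: "0 < e"
 shows "EV n. ALL i. abs (inc x (dy n) i t) < e"
proof -
 have "continuous_on {0..t} x" by (rule cont_subset[OF x]) auto
 hence "uniformly_continuous_on {0..t} x" by (rule compact_uniformly_continuous) simp
 then obtain d where d: "d > 0" "!!u v. u : {0..t} ==> v : {0..t} ==> dist u v < d ==> dist (x u) (x v) < e" unfolding uniformly_continuous_on_def using e by metis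
 have "(%n. 1/2^n :: real) ---> 0" by real_asymp
 hence "EV n. 1/2^n < d" using d(1) by (rule order_tendstoD)
 thus ?thesis proof eventually_elim case (elim n)
  show ?case proof
  fix i
  have "dy n (Suc i) - dy n i = 1/2^n" by (simp add: diff_divide_distrib[symmetric])
  moreover have "0 <= dy n i" "0 <= dy n (Suc i)" by auto
  ultimately have "dist (min (dy n (Suc i)) t) (min (dy n i) t) < d"
  using elim d(1) divide_right_mono[of "real i" "real (Suc i)" "2^n"] by (auto simp: dist_real_def min_def)
  thus "abs (inc x (dy n) i t) < e" using d(2)[of "min (dy n (Suc i)) t" "min (dy n i) t"] t by (simp add: dist_real_def)
  qed qed qed

lemma dyadic_telescope:
 fixes f :: "real => real"
 assumes "t <= real n" "0 <= t"
 shows "(SUM i<n*2^n. inc f (dy n) i t) = f t - f 0"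
proof -
 have "(SUM i<n*2^n. inc f (dy n) i t) = f (min (dy n (n*2^n)) t) - f (min (real 0/2^n) t)"
  by (rule sum_lessThan_telescope[where f="%i. f (min (dy n i) t)"])
 thus ?thesis using assms by (simp add: min_def)
qed

lemma sum_integrals:
 fixes k :: "real => real"
 assumes "!!i. b i <= b (Suc i)" "continuous_on {b 0..b M} k"
 shows "(SUM i<M. integral {b i..b (Suc i)} k) = integral {b 0..b M} k" using assms(2)
proof (induction M) case (Suc M)
 have m: "b 0 <= b M" "b M <= b (Suc M)" using lift_Suc_mono_le[of b 0 M] assms(1) by auto
 have "k integrable_on {b 0..b (Suc M)}" by (rule int_cont[OF Suc.prems])
 moreover have "continuous_on {b 0..b M} k" by (rule cont_subset[OF Suc.prems]) (use m in auto)
 ultimately show ?case using Suc.IH Henstock_Kurzweil_Integration.integral_combine[OF m, of k] by simp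
qed simp

text \<open>A Riemann-Stieltjes sum for the increasing \<open>a\<close>; writing the limiting
  integrand as \<open>k (a s)\<close> turns the Stieltjes integral into an ordinary integral of
  \<open>k\<close> over the range of \<open>a\<close>, whatever the smoothness of
  \<open>a\<close>.\<close>

lemma dyadic_riemann:
 fixes a k h :: "real => real" and hn :: "nat => real => real"
 assumes a: "cont0 a" "mono_on {0..} a" "a 0 = 0" and k: "cont0 k" and N: "strict_mono N" and u: "upath hn (%s. k (a s))" and t: "0 <= t"
 shows "(%n. SUM i<N n*2^N n. hn n (dy (N n) i)*(inc a (dy (N n)) i t))
  ---> integral {0..a t} k"
proof (rule LIMSEQ_I)
 fix r :: real assume r: "0 < r"
 have am: "a u <= a v" if "0 <= u" "u <= v" for u v using a(2) that by (auto simp: mono_on_def)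
 have at: "0 <= a t" using am[of 0 t] t a(3) by simp
 \<comment> \<open>The error on each step is at most \<open>2 * e\<close> per unit of
   \<open>a\<close>: one \<open>e\<close> for the approximation \<open>hn\<close>, one for the
   oscillation of \<open>k\<close>.\<close>
 define e where "e = r/(2*(a t + 1))"
 have e: "0 < e" using r at by (simp add: e_def)
 have ea: "2 * e * a t < r" proof -
  have "2 * e * a t < 2 * e*(a t + 1)" using e by simp
  also have "... = r" using at by (simp add: e_def field_simps)
  finally show ?thesis .
 qed
 have kt: "continuous_on {0..a t} k" by (rule cont_subset[OF k]) auto
 hence "uniformly_continuous_on {0..a t} k" by (rule compact_uniformly_continuous) simp
 then obtain d where d: "d > 0" "!!u v. u : {0..a t} ==> v : {0..a t} ==> dist u v < d ==> dist (k u) (k v) < e" unfolding uniformly_continuous_on_def using e by metis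
 have "EV n. ALL i. abs (inc a (dy (N n)) i t) < d" by (rule eventually_subseq[OF N dyadic_mesh[OF a(1) t d(1)]])
 moreover have "EV n. t <= real (N n)" by (rule eventually_subseq[OF N]) real_asymp
 moreover have "EV n. ALL x:{0..t}. dist (hn n x) (k (a x)) < e" using u t e unfolding upath_def uniform_limit_iff by blast
 ultimately have "EV n. norm ((SUM i<N n*2^N n. hn n (dy (N n) i)*(inc a (dy (N n)) i t)) - integral {0..a t} k) < r"
 proof eventually_elim case (elim n)
  define m where "m i = min (dy (N n) i) t" for i
  define M where "M = N n*2^N n"
  have m0: "m 0 = 0" using t by (simp add: m_def)
  have mM: "m M = t" using elim(2) by (simp add: m_def M_def)
  have mm: "0 <= m i" "m i <= m (Suc i)" "m i <= t" for i using t by (auto simp: m_def divide_right_mono min.coboundedI1 intro: min.mono)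
  have b: "a (m i) <= a (m (Suc i))" for i using am mm by auto
  have "integral {0..a t} k = (SUM i<M. integral {a (m i)..a (m (Suc i))} k)" by (subst sum_integrals[where b="%i. a (m i)"]) (use b kt in "auto simp: m0 mM a(3)")
  hence "(SUM i<M. hn n (dy (N n) i)*(a (m (Suc i)) - a (m i))) - integral {0..a t} k =
  (SUM i<M. hn n (dy (N n) i)*(a (m (Suc i)) - a (m i)) - integral {a (m i)..a (m (Suc i))} k)" by (simp add: sum_subtractf)
  also have "norm ... <= (SUM i<M. 2 * e*(a (m (Suc i)) - a (m i)))" proof (rule sum_norm_le)
  fix i assume "i : {..<M}"
  show "norm (hn n (dy (N n) i)*(a (m (Suc i)) - a (m i)) - integral {a (m i)..a (m (Suc i))} k) <= 2 * e*(a (m (Suc i)) - a (m i))"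
  proof (cases "dy (N n) i < t") case False
  hence "m i = t" "m (Suc i) = t" using divide_right_mono[of "real i" "real (Suc i)" "2^N n"] by (auto simp: m_def)
  thus ?thesis by simp
  next case True
  hence mi: "m i = dy (N n) i" by (simp add: m_def)
  let ?c = "hn n (dy (N n) i)"
  have sub: "{a (m i)..a (m (Suc i))} <= {0..a t}" using am[OF _ mm(1)[of i]] am[OF mm(1) mm(3), of "Suc i"] a(3) by auto
  have ci: "continuous_on {a (m i)..a (m (Suc i))} k" by (rule cont_subset[OF kt sub])
  have i1: "integral {a (m i)..a (m (Suc i))} (%v. ?c - k v) = ?c*(a (m (Suc i)) - a (m i)) - integral {a (m i)..a (m (Suc i))} k"
  using b by (subst Henstock_Kurzweil_Integration.integral_diff) (auto intro: int_cont ci)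
  have i2: "norm (integral {a (m i)..a (m (Suc i))} (%v. ?c - k v)) <= 2 * e*(a (m (Suc i)) - a (m i))"
  proof (rule integral_bound[OF b])
  show "continuous_on {a (m i)..a (m (Suc i))} (%v. ?c - k v)" by (intro cont_intros ci)
  show "norm (?c - k v) <= 2 * e" if v: "v : {a (m i)..a (m (Suc i))}" for v proof -
  have "dist (k (a (m i))) (k v) < e" proof (rule d(2))
  show "a (m i) : {0..a t}" "v : {0..a t}" using sub b v by auto
  show "dist (a (m i)) v < d" using elim(1)[rule_format, of i] v by (auto simp: dist_real_def m_def)
  qed
  moreover have "dist ?c (k (a (m i))) < e" using elim(3) True mi by auto
  ultimately show "norm (?c - k v) <= 2 * e" by (simp add: dist_real_def)
  qed qed
  show ?thesis using i2 unfolding i1 .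
  qed qed
  also have "... = 2 * e*(a t - a 0)" by (simp add: sum_distrib_left[symmetric] sum_lessThan_telescope[where f="%i. a (m i)"] m0 mM)
  also have "... < r" using ea a(3) by simp
  finally show ?case by (simp add: M_def m_def)
 qed
 thus "EX no. ALL n>=no. norm ((SUM i<N n*2^N n. hn n (dy (N n) i)*(inc a (dy (N n)) i t)) - integral {0..a t} k) < r"
  by (simp add: ev_seq)
qed

lemma taylor2:
 fixes g g1 g2 :: "real => real"
 assumes "!!z. (g hasD g1 z) (at z)" "!!z. (g1 hasD g2 z) (at z)" and ww: "!!z. min x y <= z ==> z <= max x y ==> abs (g2 z - g2 x) <= ww"
 shows "abs (g y - g x - g1 x*(y - x) - 1/2 * g2 x*(y - x)^2) <= 1/2*ww*(y - x)^2"
proof (cases "x = y") case False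
 define df where "df m = (if m = 0 then g else if m = Suc 0 then g1 else g2)" for m :: nat
 have "EX z. (if y < x then y < z & z < x else x < z & z < y) &
  g y = (SUM m<2. df m x/fact m*(y - x)^m) + df 2 z/fact 2*(y - x)^2"
 proof (rule Taylor[where a="min x y" and b="max x y"])
  show "ALL m t. m < 2 & min x y <= t & t <= max x y --> (df m hasD df (Suc m) t) (at t)" using assms(1,2) by (auto simp: df_def less_2_cases_iff)
 qed (use False in "auto simp: df_def")
 then obtain z where z': "if y < x then y < z & z < x else x < z & z < y"
  "g y = (SUM m<2. df m x/fact m*(y - x)^m) + df 2 z/fact 2*(y - x)^2" by blast
 have z: "min x y <= z" "z <= max x y" using z'(1) by (auto split: if_splits)
 have z3: "g y = g x + g1 x*(y - x) + g2 z/2*(y - x)^2" using z'(2) by (simp add: df_def numeral_2_eq_2)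
 have "g y - g x - g1 x*(y - x) - 1/2 * g2 x*(y - x)^2 = 1/2*(g2 z - g2 x)*(y - x)^2" unfolding z3 by (simp add: algebra_simps)
 hence "abs (g y - g x - g1 x*(y - x) - 1/2 * g2 x*(y - x)^2) = abs (1/2*(g2 z - g2 x)*(y - x)^2)" by (rule arg_cong)
 also have "... = 1/2*abs (g2 z - g2 x)*(y - x)^2" by (simp add: abs_mult)
 also have "... <= 1/2*ww*(y - x)^2" using ww[OF z] by (intro mult_right_mono) auto
 finally show ?thesis .
qed simp

lemma upath_mult:
 assumes u: "upath y z" and z: "cont0 z" and f: "cont0 f"
 shows "upath (%n u. y n u * f u) (%u. z u * f u)" unfolding upath_def
proof (intro allI impI)
 fix t :: real assume t: "0 <= t"
 have bd: "bounded (h ` {0..t})" if "cont0 h" for h :: "real => real" by (intro compact_imp_bounded compact_image cont_subset[OF that]) auto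
 show "uniform_limit {0..t} (%n u. y n u * f u) (%u. z u * f u) sequentially"
  using u t unfolding upath_def by (intro uniform_lim_mult uniform_limit_const bd z f) auto
qed

lemma uconv_path_cong:
 assumes "upath y z" "!!s. 0 <= s ==> z s = z' s"
 shows "upath y z'" unfolding upath_def uniform_limit_iff
proof (intro allI impI)
 fix t e :: real assume "0 <= t" "0 < e"
 hence "EV n. ALL x:{0..t}. dist (y n x) (z x) < e" using assms(1) unfolding upath_def uniform_limit_iff by blast
 thus "EV n. ALL x:{0..t}. dist (y n x) (z' x) < e" by eventually_elim (use assms(2) in auto)
qed

lemma uconv_path_bounded:
 assumes u: "upath y z" and z: "cont0 z" and t: "0 <= t"
 obtains R where "0 <= R" "EV n. ALL u:{0..t}. abs (y n u) <= R"
proof -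
 have "bounded (z ` {0..t})" by (intro compact_imp_bounded compact_image cont_subset[OF z]) auto
 then obtain R where "ALL v:z ` {0..t}. norm v <= R" unfolding bounded_iff by blast
 hence R: "abs (z u) <= R" if "u : {0..t}" for u using that by simp
 have "EV n. ALL u:{0..t}. dist (y n u) (z u) < 1" proof -
  have "uniform_limit {0..t} y z sequentially" using u t unfolding upath_def by simp
  from uniform_limitD[OF this zero_less_one] show ?thesis .
 qed
 hence "EV n. ALL u:{0..t}. abs (y n u) <= R + 1" proof eventually_elim case (elim n)
  show ?case proof
  fix u assume u: "u : {0..t}"
  hence "dist (y n u) (z u) < 1" using elim by blast
  thus "abs (y n u) <= R + 1" using R[OF u] by (simp add: dist_real_def)
  qed qed
 moreover have "abs (z 0) <= R" by (rule R) (use t in simp)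
 hence "0 <= R + 1" by linarith
 ultimately show ?thesis by (rule that[rotated])
qed

text \<open>Taylor to second order splits the weighted increments into the first-order sum
  (\<open>A1\<close>), the defect of squared increments from clock increments (\<open>A2\<close>), a
  Riemann sum in the clock, and a remainder. \<open>A3\<close> bounds the sum of squares that
  controls the remainder.\<close>

lemma ito_path:
 fixes x a ph k g g1 g2 :: "real => real" and phn :: "nat => real => real" and N :: "nat => nat" and t :: real
 defines "p \<equiv> %n i. dy (N n) i"
 defines "dx \<equiv> %n i. inc x (p n) i t"
 defines "da \<equiv> %n i. inc a (p n) i t"
 assumes x: "cont0 x" and a: "cont0 a" "mono_on {0..} a" "a 0 = 0" and ph: "cont0 ph" and N: "strict_mono N" and u: "upath phn ph" and t: "0 <= t"
  and g: "!!z. (g hasD g1 z) (at z)" "!!z. (g1 hasD g2 z) (at z)" "continuous_on UNIV g2"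
  and k: "cont0 k" "!!s. 0 <= s ==> ph s * g2 (x s) = k (a s)" and A1: "(%n. SUM i<N n*2^N n. trunc (N n) (phn n (p n i) * g1 (x (p n i))) * dx n i) ---> J"
  and A2: "(%n. SUM i<N n*2^N n. trunc (N n) (phn n (p n i) * g2 (x (p n i)))*((dx n i)^2 - da n i)) ---> 0"
  and A3: "(%n. SUM i<N n*2^N n. trunc (N n) 1*((dx n i)^2 - da n i)) ---> 0"
 shows "(%n. SUM i<N n*2^N n. phn n (p n i)*(inc (%s. g (x s)) (p n) i t)) ---> J + 1/2 * integral {0..a t} k"
proof -
 have am: "a u <= a v" if "0 <= u" "u <= v" for u v using a(2) that by (auto simp: mono_on_def)
 have at: "0 <= a t" using am[of 0 t] t a(3) by simp
 have p0: "0 <= p n i" "p n i <= p n (Suc i)" for n i by (auto simp: p_def divide_right_mono)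
 have out: "dx n i = 0 & da n i = 0 & min (p n (Suc i)) t = min (p n i) t" if "~ p n i < t" for n i proof -
  have "min (p n (Suc i)) t = t" "min (p n i) t = t" using that p0(2)[of n i] by auto
  thus ?thesis by (simp add: dx_def da_def)
 qed
 have g1c: "continuous_on UNIV g1" using g(2) by (meson DERIV_isCont isCont_cont)
 have g2x: "cont0 (%s. g2 (x s))" by (rule cont_comp2[OF g(3) x]) auto
 have g1x: "cont0 (%s. g1 (x s))" by (rule cont_comp2[OF g1c x]) auto
 have U1: "upath (%n s. phn n s * g1 (x s)) (%s. ph s * g1 (x s))" by (rule upath_mult[OF u ph g1x])
 have U2: "upath (%n s. phn n s * g2 (x s)) (%s. ph s * g2 (x s))" by (rule upath_mult[OF u ph g2x])
 obtain R0 where R0: "0 <= R0" "EV n. ALL u:{0..t}. abs (phn n u) <= R0" by (rule uconv_path_bounded[OF u ph t])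
 obtain R1 where R1: "0 <= R1" "EV n. ALL u:{0..t}. abs (phn n u * g1 (x u)) <= R1" by (rule uconv_path_bounded[OF U1 _ t]) (intro cont_intros ph g1x)
 obtain R2 where R2: "0 <= R2" "EV n. ALL u:{0..t}. abs (phn n u * g2 (x u)) <= R2" by (rule uconv_path_bounded[OF U2 _ t]) (intro cont_intros ph g2x)
 define S3 where "S3 n = (SUM i<N n*2^N n. (phn n (p n i) * g2 (x (p n i))) * da n i)" for n
 have S3: "S3 ---> integral {0..a t} k" proof -
  have "upath (%n s. phn n s * g2 (x s)) (%s. k (a s))" by (rule uconv_path_cong[OF U2]) (rule k(2))
  from dyadic_riemann[OF a k(1) N this t] show ?thesis by (simp add: S3_def[abs_def] p_def da_def)
 qed
 \<comment> \<open>The Taylor remainder is at most half the oscillation of \<open>g2\<close> over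
   the step times the squared increment.\<close>
 define rh where "rh n i = inc (%s. g (x s)) (p n) i t - g1 (x (min (p n i) t)) * dx n i - 1/2 * g2 (x (min (p n i) t))*(dx n i)^2" for n i
 define S4 where "S4 n = (SUM i<N n*2^N n. phn n (p n i)*rh n i)" for n
 have big: "EV n. c <= real (N n)" for c :: real by (rule eventually_subseq[OF N]) real_asymp
 have S4: "S4 ---> 0" proof (rule LIMSEQ_I)
  fix r :: real assume r: "0 < r"
  define C where "C = R0*(a t + 1)"
  have C: "0 <= C" using R0(1) at by (simp add: C_def)
  define ww where "ww = r/(C + 1)"
  have ww: "0 < ww" using r C by (simp add: ww_def)
  have wr: "1/2*ww * C < r" proof -
  have "1/2*ww * C <= ww * C" using ww C by simp
  also have "... < ww*(C + 1)" using ww by simp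
  also have "... = r" using C by (simp add: ww_def)
  finally show ?thesis .
  qed
  have "bounded (x ` {0..t})" by (intro compact_imp_bounded compact_image cont_subset[OF x]) auto
  then obtain b where "ALL v:x ` {0..t}. norm v <= b" unfolding bounded_iff by blast
  hence b: "abs (x s) <= b" if "s : {0..t}" for s using that by simp
  have "uniformly_continuous_on {-b..b} g2" by (intro compact_uniformly_continuous cont_subset[OF g(3)]) auto
  then obtain d where d: "d > 0" "!!u v. u : {-b..b} ==> v : {-b..b} ==> dist u v < d ==> dist (g2 u) (g2 v) < ww" unfolding uniformly_continuous_on_def using ww by metis
  have mesh: "EV n. ALL i. abs (dx n i) < d" using eventually_subseq[OF N dyadic_mesh[OF x t d(1)]] by (simp add: dx_def p_def)
  have A3': "EV n. (SUM i<N n*2^N n. trunc (N n) 1*((dx n i)^2 - da n i)) < 1" using A3 by (rule order_tendstoD) simp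
  have "EV n. norm (S4 n - 0) < r" using mesh A3' big[of 1] big[of t] R0(2) proof eventually_elim
  case (elim n)
  have rh: "abs (rh n i) <= 1/2*ww*(dx n i)^2" for i unfolding rh_def dx_def
  proof (rule taylor2[OF g(1,2)])
  fix z let ?u = "x (min (p n i) t)" and ?v = "x (min (p n (Suc i)) t)"
  assume z: "min ?u ?v <= z" "z <= max ?u ?v"
  have uv: "abs ?u <= b" "abs ?v <= b" using p0 t by (auto intro!: b)
  have "dist z ?u < d" using z elim(1)[rule_format, of i] by (auto simp: dist_real_def dx_def min_def max_def abs_if split: if_splits)
  moreover have "z : {-b..b}" "?u : {-b..b}" using z uv by (auto simp: min_def max_def abs_le_iff split: if_splits)
  ultimately have "dist (g2 z) (g2 ?u) < ww" by (intro d(2))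
  thus "abs (g2 z - g2 ?u) <= ww" by (simp add: dist_real_def)
  qed
  have "(SUM i<N n*2^N n. (dx n i)^2) = (SUM i<N n*2^N n. trunc (N n) 1*((dx n i)^2 - da n i)) + (SUM i<N n*2^N n. da n i)"
  using elim(3) by (simp add: trunc_id sum_subtractf)
  also have "(SUM i<N n*2^N n. da n i) = a t" unfolding da_def p_def using dyadic_telescope[OF elim(4) t, of a] a(3) by simp
  finally have sq: "(SUM i<N n*2^N n. (dx n i)^2) <= a t + 1" using elim(2) by simp
  have "abs (S4 n) <= (SUM i<N n*2^N n. abs (phn n (p n i)*rh n i))" unfolding S4_def by (rule sum_abs)
  also have "... <= (SUM i<N n*2^N n. R0*(1/2*ww*(dx n i)^2))" proof (rule sum_mono)
  fix i
  show "abs (phn n (p n i)*rh n i) <= R0*(1/2*ww*(dx n i)^2)" proof (cases "p n i < t") case True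
  hence "abs (phn n (p n i)) <= R0" using elim(5) p0 by auto
  thus ?thesis unfolding abs_mult using rh[of i] R0 by (intro mult_mono) auto
  next case False
  hence "rh n i = 0" using out[OF False] by (simp add: rh_def)
  thus ?thesis using R0 ww by simp
  qed qed
  also have "... = R0*(1/2*ww)*(SUM i<N n*2^N n. (dx n i)^2)" by (simp add: sum_distrib_left mult.assoc)
  also have "... <= R0*(1/2*ww)*(a t + 1)" using sq R0 ww by (intro mult_left_mono) auto
  also have "... = 1/2*ww * C" by (simp add: C_def)
  finally show ?case using wr by simp
  qed
  thus "EX no. ALL n>=no. norm (S4 n - 0) < r" by (simp add: ev_seq)
 qed
 let ?S1 = "%n. SUM i<N n*2^N n. trunc (N n) (phn n (p n i) * g1 (x (p n i))) * dx n i"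
 let ?S2 = "%n. SUM i<N n*2^N n. trunc (N n) (phn n (p n i) * g2 (x (p n i)))*((dx n i)^2 - da n i)"
 have "(%n. ?S1 n + 1/2 * ?S2 n + 1/2 * S3 n + S4 n) ---> J + 1/2*0 + 1/2 * integral {0..a t} k + 0" by (intro tendsto_intros A1 A2 S3 S4)
 \<comment> \<open>The truncations in the hypotheses disappear here: the sampled integrands are
   bounded on \<open>[0,t]\<close> uniformly for large \<open>n\<close>, and \<open>N n\<close>
   tends to infinity.\<close>
 moreover have "EV n. ?S1 n + 1/2 * ?S2 n + 1/2 * S3 n + S4 n = (SUM i<N n*2^N n. phn n (p n i)*(inc (%s. g (x s)) (p n) i t))"
  using R1(2) R2(2) big[of R1] big[of R2] proof eventually_elim case (elim n)
  have "trunc (N n) (phn n (p n i) * g1 (x (p n i))) * dx n i + 1/2*(trunc (N n) (phn n (p n i) * g2 (x (p n i)))*((dx n i)^2 - da n i))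
  + 1/2*((phn n (p n i) * g2 (x (p n i))) * da n i) + phn n (p n i)*rh n i
  = phn n (p n i)*(inc (%s. g (x s)) (p n) i t)" for i proof (cases "p n i < t") case True
  hence pi: "p n i : {0..t}" "min (p n i) t = p n i" using p0 by auto
  have "trunc (N n) (phn n (p n i) * g1 (x (p n i))) = phn n (p n i) * g1 (x (p n i))"
  "trunc (N n) (phn n (p n i) * g2 (x (p n i))) = phn n (p n i) * g2 (x (p n i))" using elim pi(1) by (auto intro!: trunc_id intro: order_trans)
  thus ?thesis unfolding rh_def pi(2) by (simp add: algebra_simps)
  next case False
  thus ?thesis using out[OF False] by (simp add: rh_def)
  qed
  hence "(SUM i<N n*2^N n. trunc (N n) (phn n (p n i) * g1 (x (p n i))) * dx n i + 1/2*(trunc (N n) (phn n (p n i) * g2 (x (p n i)))*((dx n i)^2 - da n i))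
  + 1/2*((phn n (p n i) * g2 (x (p n i))) * da n i) + phn n (p n i)*rh n i)
  = (SUM i<N n*2^N n. phn n (p n i)*(inc (%s. g (x s)) (p n) i t))" by (intro sum.cong refl)
  thus ?case by (simp only: sum.distrib sum_distrib_left[symmetric] S3_def S4_def)
 qed
 ultimately show ?thesis by (auto dest: Lim_transform_eventually)
qed

section \<open>Compensated squares of increments\<close>

context time_change
begin

context
 fixes K :: nat and s u :: real
 assumes su: "0 <= s" "s <= u"
begin

lemma single_step:
 assumes c: "c : bor (F s)" and C: "!!w. w : space M ==> abs (c w) <= C"
 shows "good_pair M (%w. c w*(XK K u w - XK K s w)) (%w. (c w)^2*(AK K u w - AK K s w))"
proof -
 define e where "e = Elementary (%_. 0) 1 (%i. if i = 0 then s else u) (%_. c)"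
 have [simp]: "init e = (%_. 0)" "steps e = 1" "grid e = (%i. if i = 0 then s else u)" "coef e = (%_. c)" by (simp_all add: e_def)
 have b: "bounded (c ` space M)" unfolding bounded_iff using C by (intro exI[of _ C]) auto
 have "bounded ((%_. 0::real) ` space M)" unfolding bounded_iff by (intro exI[of _ 0]) auto
 hence e: "epred M F e" unfolding epred_def using su c b by auto
 have "good_pair M (eint e (XK (real K)) u) (ebracket e (AK (real K)) u)" by (rule good_pair_elementary[OF e, where C=C]) (use C su in auto)
 moreover have "eint e (XK (real K)) u = (%w. c w*(XK K u w - XK K s w))" using su by (auto simp: eint_def min_def)
 moreover have "ebracket e (AK (real K)) u = (%w. (c w)^2*(AK K u w - AK K s w))" using su by (auto simp: ebracket_def min_def)
 ultimately show ?thesis by simp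
qed

text \<open>Squared increment minus its compensator; summed over a grid it measures the distance of
  the quadratic variation from the clock.\<close>

definition qvZ :: "'a => real" where "qvZ w = (XK K u w - XK K s w)^2 - (AK K u w - AK K s w)"

lemma step_measurable:
 "XK K u : bor M" "XK K s : bor M" "AK K u : bor M" "AK K s : bor M"
proof -
 have "0 <= u" using su by simp
 thus "XK K u : bor M" "XK K s : bor M" "AK K u : bor M" "AK K s : bor M"
  using F_meas_M[OF _ XK_adapted, of u K] F_meas_M[OF _ XK_adapted, of s K] F_meas_M[OF _ AK_adapted, of u K] F_meas_M[OF _ AK_adapted, of s K] su by auto
qed

lemma dA_bounds: "AE w in M. 0 <= AK K u w - AK K s w & AK K u w - AK K s w <= real K" using AK_ae[of "real K"] AK_bounds[of "real K", simplified]
proof eventually_elim case (elim w)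
 have "AK K s w <= AK K u w" "0 <= AK K s w" "AK K u w <= K" using elim su by auto
 thus ?case by simp
qed

text \<open>From \<open>(x^2 - a)^2 <= 2 * x^4 + 2 * a^2\<close> and the fourth moment bound with
  constant 36 one gets 74 = 2 * 36 + 2.\<close>

lemma qvZ_facts:
 shows "qvZ : bor M" "integrable M (%w. (qvZ w)^2)" "integrable M qvZ"
  "integrable M (%w. (AK K u w - AK K s w)^2)"
  "(LINT w|M. (qvZ w)^2) <= 74*(LINT w|M. (AK K u w - AK K s w)^2)"
proof -
 note [measurable] = step_measurable
 define x where "x w = XK K u w - XK K s w" for w
 define a where "a w = AK K u w - AK K s w" for w
 have [measurable]: "x : bor M" "a : bor M" unfolding x_def[abs_def] a_def[abs_def] by measurable
 have gp: "good_pair M x a" using single_step[of "%_. 1" 1] by (simp add: x_def[abs_def] a_def[abs_def])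
 hence x4: "integrable M (%w. x w^4)" "(LINT w|M. x w^4) <= 36*(LINT w|M. (a w)^2)" by (auto simp: good_pair_def)
 have "AE w in M. norm ((a w)^2) <= (real K)^2" using dA_bounds by eventually_elim (auto simp: a_def intro!: power_mono)
 hence a2: "integrable M (%w. (a w)^2)" by (rule integrable_const_bound) measurable
 have q: "qvZ = (%w. (x w)^2 - a w)" by (auto simp: qvZ_def x_def a_def)
 show qm[measurable]: "qvZ : bor M" unfolding q by measurable
 have le: "(qvZ w)^2 <= 2 * x w^4 + 2*(a w)^2" for w proof -
  have "0 <= ((x w)^2 + a w)^2" by simp
  thus ?thesis unfolding q by (simp add: sq_eq power4_eq_xxxx algebra_simps)
 qed
 have ib: "integrable M (%w. 2 * x w^4 + 2*(a w)^2)" using x4 a2 by auto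
 show i2: "integrable M (%w. (qvZ w)^2)" by (rule b_int_bound[OF ib]) (use le in "auto intro!: AE_I2 intro: order_trans[OF _ abs_ge_self]")
 show "integrable M qvZ" by (rule square_integrable_imp_integrable[OF qm i2])
 show "integrable M (%w. (AK K u w - AK K s w)^2)" using a2 by (simp add: a_def)
 have "(LINT w|M. (qvZ w)^2) <= (LINT w|M. 2 * x w^4 + 2*(a w)^2)" by (rule integral_mono[OF i2 ib le])
 also have "... = 2*(LINT w|M. x w^4) + 2*(LINT w|M. (a w)^2)" using x4 a2 by simp
 also have "... <= 74*(LINT w|M. (a w)^2)" using x4(2) by simp
 finally show "(LINT w|M. (qvZ w)^2) <= 74*(LINT w|M. (AK K u w - AK K s w)^2)" by (simp add: a_def)
qed

text \<open>With the square root of the weight as integrand, the second moment identity of a good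
  pair is exactly the weighted centering.\<close>

lemma qvZ_centered_nonneg:
 assumes ww: "ww : bor (F s)" and C: "!!w. 0 <= ww w & ww w <= C"
 shows "(LINT w|M. ww w * qvZ w) = 0"
proof -
 have [measurable]: "ww : bor M" by (rule F_meas_M[OF su(1) ww])
 note [measurable] = step_measurable
 have "(%w. sqrt (ww w)) : bor (F s)" using ww by measurable
 hence gp: "good_pair M (%w. sqrt (ww w)*(XK K u w - XK K s w)) (%w. (sqrt (ww w))^2*(AK K u w - AK K s w))" by (rule single_step[where C="sqrt C"]) (use C in auto)
 have sw: "(sqrt (ww w))^2 = ww w" for w using C by simp
 have eq: "(LINT w|M. ww w*(XK K u w - XK K s w)^2) = (LINT w|M. ww w*(AK K u w - AK K s w))" using gp by (simp add: good_pair_def power_mult_distrib sw)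
 have "AE w in M. norm (AK K u w - AK K s w) <= K" using dA_bounds by eventually_elim auto
 hence ia: "integrable M (%w. AK K u w - AK K s w)" by (rule integrable_const_bound) measurable
 have wb: "AE w in M. abs (ww w) <= C" using C by (intro AE_I2) auto
 have iz: "integrable M (%w. ww w * qvZ w)" by (rule int_bdd_mult[OF qvZ_facts(3) _ wb]) measurable
 have iwa: "integrable M (%w. ww w*(AK K u w - AK K s w))" by (rule int_bdd_mult[OF ia _ wb]) measurable
 have "(LINT w|M. ww w*(XK K u w - XK K s w)^2) = (LINT w|M. ww w * qvZ w + ww w*(AK K u w - AK K s w))" by (intro b_cong) (auto simp: qvZ_def algebra_simps)
 also have "... = (LINT w|M. ww w * qvZ w) + (LINT w|M. ww w*(AK K u w - AK K s w))" by (rule b_add[OF iz iwa])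
 finally show ?thesis using eq by simp
qed

lemma qvZ_centered:
 assumes ww: "ww : bor (F s)" and i2: "integrable M (%w. (ww w)^2)"
 shows "integrable M (%w. ww w * qvZ w)" "(LINT w|M. ww w * qvZ w) = 0"
proof -
 have wm[measurable]: "ww : bor M" by (rule F_meas_M[OF su(1) ww])
 note [measurable] = qvZ_facts(1)
 have le: "abs (v * z) <= v^2 + z^2" for v z :: real proof -
  have "0 <= (abs v - abs z)^2" by simp
  hence "2*abs (v * z) <= v^2 + z^2" by (simp add: power2_diff abs_mult)
  thus ?thesis using abs_ge_zero[of "v * z"] by linarith
 qed
 have ib: "integrable M (%w. (ww w)^2 + (qvZ w)^2)" using i2 qvZ_facts(2) by auto
 show iwz: "integrable M (%w. ww w * qvZ w)" by (rule b_int_bound[OF ib]) (use le in auto)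
 define w' where "w' n w = trunc (real n) (ww w)" for n w
 have w'm: "w' n : bor (F s)" for n unfolding w'_def[abs_def] using ww by measurable
 have z: "(LINT w|M. w' n w * qvZ w) = 0" for n proof -
  have b: "abs (w' n w) <= real n" for w unfolding w'_def by (rule trunc_bound) simp
  have p: "(%w. max 0 (w' n w)) : bor (F s)" "(%w. max 0 (- w' n w)) : bor (F s)" using w'm[of n] by measurable
  have bb: "0 <= max 0 (w' n w) & max 0 (w' n w) <= real n" "0 <= max 0 (- w' n w) & max 0 (- w' n w) <= real n" for w using b[of w] by auto
  have i: "integrable M (%w. max 0 (w' n w) * qvZ w)" "integrable M (%w. max 0 (- w' n w) * qvZ w)"
  using bb by (auto intro!: int_bdd_mult[OF qvZ_facts(3), where K="real n"] F_meas_M[OF su(1)] p)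
  have "(LINT w|M. w' n w * qvZ w) = (LINT w|M. max 0 (w' n w) * qvZ w - max 0 (- w' n w) * qvZ w)" by (intro b_cong refl) (auto simp: max_def)
  also have "... = 0" unfolding b_diff[OF i] qvZ_centered_nonneg[OF p(1) bb(1)] qvZ_centered_nonneg[OF p(2) bb(2)] by simp
  finally show ?thesis .
 qed
 have [measurable]: "w' n : bor M" for n by (rule F_meas_M[OF su(1) w'm])
 have "(%n. LINT w|M. w' n w * qvZ w) ---> (LINT w|M. ww w * qvZ w)"
 proof (rule dom_conv[OF _ _ ib])
  show "AE w in M. (%n. w' n w * qvZ w) ---> ww w * qvZ w" proof (rule AE_I2)
  fix w
  have "EV n. abs (ww w) <= real n" by real_asymp
  hence "EV n. w' n w = ww w" by eventually_elim (simp add: w'_def trunc_id)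
  hence "(%n. w' n w) ---> ww w" by (rule tendsto_eventually)
  thus "(%n. w' n w * qvZ w) ---> ww w * qvZ w" by (intro tendsto_intros)
  qed
  fix n
  have "abs (w' n w) <= abs (ww w)" for w by (auto simp: w'_def trunc_def)
  hence "abs (w' n w * qvZ w) <= abs (ww w * qvZ w)" for w unfolding abs_mult by (intro mult_right_mono) auto
  thus "AE w in M. norm (w' n w * qvZ w) <= (ww w)^2 + (qvZ w)^2" using le by (intro AE_I2) (auto intro: order_trans)
 qed measurable
 thus "(LINT w|M. ww w * qvZ w) = 0" unfolding z using LIMSEQ_const_iff by metis
qed

end
end

lemma dyadic_step:
 fixes t :: real and n i :: nat
 assumes "0 <= t"
 shows "0 <= min (dy n i) t" "min (dy n i) t <= min (dy n (Suc i)) t" "min (dy n i) t <= t"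
 using assms divide_right_mono[of "real i" "real (Suc i)" "2^n"] by auto

context time_change
begin

text \<open>Martingale differences are orthogonal: the mixed term vanishes because
  \<open>z * S N\<close> is known before the step. That product is square integrable but unbounded
  in general, which is why \<open>qvZ_centered\<close> covers such weights.\<close>

lemma qv_sum_L2:
 fixes K n :: nat and t :: real
 defines "m \<equiv> %i. min (dy n i) t"
 assumes t: "0 <= t" and ze: "!!i. ze i : bor (F (dy n i))" and R: "!!i w. abs (ze i w) <= R"
 shows "integrable M (%w. (SUM i<N. ze i w * qvZ K (m i) (m (Suc i)) w)^2)" and "(LINT w|M. (SUM i<N. ze i w * qvZ K (m i) (m (Suc i)) w)^2)
  <= 74 * R^2*(SUM i<N. LINT w|M. (AK K (m (Suc i)) w - AK K (m i) w)^2)"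
proof -
 define S where "S N w = (SUM i<N. ze i w * qvZ K (m i) (m (Suc i)) w)" for N w
 have m0: "0 <= m i" "m i <= m (Suc i)" for i using dyadic_step[OF t] by (simp_all only: m_def)
 have "S N : bor (F (m N)) & integrable M (%w. (S N w)^2) & (LINT w|M. (S N w)^2) <= 74 * R^2*(SUM i<N. LINT w|M. (AK K (m (Suc i)) w - AK K (m i) w)^2)"
 proof (induction N) case (Suc N)
  \<comment> \<open>A weight sampled after \<open>t\<close> is not known to be measurable at
    \<open>m N = t\<close>; the increment there is degenerate and contributes 0, so the weight may
    be replaced by 0.\<close>
  define z where "z = (if real N/2^n <= t then ze N else (%_. 0))"
  let ?Z = "qvZ K (m N) (m (Suc N))"
  note Zf = qvZ_facts[OF m0(1) m0(2), of K N]
  have zb: "abs (z w) <= R" for w using R[of N w] order_trans[OF abs_ge_zero R] by (auto simp: z_def)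
  have zm: "z : bor (F (m N))" using ze[of N] by (auto simp: z_def m_def min_def)
  have SN: "S (Suc N) w = S N w + z w * ?Z w" for w proof (cases "real N/2^n <= t") case False
  hence "m N = t" "m (Suc N) = t" using divide_right_mono[of "real N" "real (Suc N)" "2^n"] by (auto simp: m_def)
  thus ?thesis by (simp add: S_def qvZ_def[OF t order_refl])
  qed (simp add: S_def z_def)
  have S2: "integrable M (%w. (S N w)^2)" using Suc by blast
  have SMm: "S N : bor (F (m N))" using Suc by blast
  have zM[measurable]: "z : bor M" by (rule F_meas_M[OF m0(1) zm])
  have SM[measurable]: "S N : bor M" by (rule F_meas_M[OF m0(1) SMm])
  have wm: "(%w. z w * S N w) : bor (F (m N))" using zm SMm by measurable
  have z2b: "(z w)^2 <= R^2" for w using zb[of w] by (metis abs_ge_zero power2_abs power_mono)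
  have wi: "integrable M (%w. (z w * S N w)^2)" unfolding power_mult_distrib by (rule int_bdd_mult[OF S2, where K="R^2"]) (use z2b in auto)
  note wZ = qvZ_centered[OF m0(1) m0(2) wm wi]
  have zZi: "integrable M (%w. (z w)^2*(?Z w)^2)" by (rule int_bdd_mult[OF Zf(2), where K="R^2"]) (use z2b in auto)
  have sq: "(S (Suc N) w)^2 = (S N w)^2 + 2*(z w * S N w * ?Z w) + (z w)^2*(?Z w)^2" for w unfolding SN by (simp add: sq_eq algebra_simps)
  have i2: "integrable M (%w. (S N w)^2 + 2*(z w * S N w * ?Z w))" using S2 wZ(1) by auto
  have iS: "integrable M (%w. (S (Suc N) w)^2)" unfolding sq by (intro b_int_add i2 zZi)
  have "(LINT w|M. (S (Suc N) w)^2) = (LINT w|M. (S N w)^2) + 2*(LINT w|M. z w * S N w * ?Z w) + (LINT w|M. (z w)^2*(?Z w)^2)"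
  unfolding sq b_add[OF i2 zZi] using S2 wZ(1) by simp
  also have "... = (LINT w|M. (S N w)^2) + (LINT w|M. (z w)^2*(?Z w)^2)" using wZ(2) by simp
  also have "(LINT w|M. (z w)^2*(?Z w)^2) <= (LINT w|M. R^2*(?Z w)^2)" by (rule integral_mono[OF zZi]) (use Zf(2) z2b in "auto intro: mult_right_mono")
  also have "... = R^2*(LINT w|M. (?Z w)^2)" by simp
  also have "... <= R^2*(74*(LINT w|M. (AK K (m (Suc N)) w - AK K (m N) w)^2))" by (intro mult_left_mono Zf(5)) simp
  finally have "(LINT w|M. (S (Suc N) w)^2) <= 74 * R^2*(SUM i<Suc N. LINT w|M. (AK K (m (Suc i)) w - AK K (m i) w)^2)" using Suc by (simp add: algebra_simps)
  moreover have "S (Suc N) : bor (F (m (Suc N)))" proof -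
  have a: "XK K (m (Suc N)) : bor (F (m (Suc N)))" "AK K (m (Suc N)) : bor (F (m (Suc N)))" using m0 by (auto intro: XK_adapted AK_adapted)
  have b: "XK K (m N) : bor (F (m (Suc N)))" "AK K (m N) : bor (F (m (Suc N)))"
  by (rule F_meas_mono[OF m0(1) m0(2)], rule XK_adapted[OF m0(1)] AK_adapted[OF m0(1)], (rule of_nat_0_le_iff)?)+
  have c: "z : bor (F (m (Suc N)))" "S N : bor (F (m (Suc N)))" by (rule F_meas_mono[OF m0(1) m0(2)], rule zm SMm)+
  show ?thesis unfolding SN[abs_def] qvZ_def[OF m0(1) m0(2)] using a b c by measurable
  qed
  ultimately show ?case using iS by blast
 qed (simp add: S_def)
 thus "integrable M (%w. (SUM i<N. ze i w * qvZ K (m i) (m (Suc i)) w)^2)"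
  "(LINT w|M. (SUM i<N. ze i w * qvZ K (m i) (m (Suc i)) w)^2)
  <= 74 * R^2*(SUM i<N. LINT w|M. (AK K (m (Suc i)) w - AK K (m i) w)^2)" by (simp_all add: S_def)
qed

lemma AK_continuous: "0 <= K ==> acont M (AK K)" using tau_ae unfolding AK_def by (auto elim!: eventually_mono intro: continuous_on_min)

text \<open>The sum of squared clock increments is at most the largest increment times the total
  clock, which \<open>K\<close> bounds; it tends to 0 along paths and is dominated by
  \<open>K^2\<close>.\<close>

lemma bracket_squares:
 fixes K :: nat
 assumes t: "0 <= t"
 shows "(%n. SUM i<n*2^n. LINT w|M. (inc (%s. AK K s w) (dy n) i t)^2) ---> 0"
proof -
 define d where "d n i w = inc (%s. AK K s w) (dy n) i t" for n i w
 have mm: "0 <= min (dy n i) t" "min (dy n i) t <= min (dy n (Suc i)) t" for n i by (rule dyadic_step[OF t])+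
 have ii: "integrable M (%w. (d n i w)^2)" for n i unfolding d_def by (rule qvZ_facts(4)[OF mm])
 have dm[measurable]: "d n i : bor M" for n i unfolding d_def using step_measurable(3,4)[OF mm, of K i n] by measurable
 have props: "AE w in M. cont0 (%s. AK K s w) & (ALL n i. 0 <= d n i w) & 0 <= AK K 0 w & AK K t w <= real K"
  using AK_continuous[of "real K", simplified] AK_ae[of "real K"] AK_bounds[of "real K", simplified]
 proof eventually_elim case (elim w)
  thus ?case using mm t by (auto simp: d_def)
 qed
 have "(%n. LINT w|M. (SUM i<n*2^n. (d n i w)^2)) ---> (LINT w|M. 0)"
 proof (rule dom_conv[where w="%_. (real K)^2"])
  show "AE w in M. (%n. SUM i<n*2^n. (d n i w)^2) ---> 0" using props proof eventually_elim case P: (elim w)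
  show ?case proof (rule LIMSEQ_I)
  fix r :: real assume r: "0 < r"
  define e where "e = r/(real K + 1)"
  have e: "0 < e" using r by (simp add: e_def add_nonneg_pos)
  have "e*(real K + 1) = r" by (simp add: e_def)
  hence eK: "e * real K < r" using e by (simp add: distrib_left)
  have "EV n. ALL i. abs (d n i w) < e" unfolding d_def by (rule dyadic_mesh[OF conjunct1[OF P] t e])
  moreover have "EV n. t <= real n" by real_asymp
  ultimately have "EV n. norm ((SUM i<n*2^n. (d n i w)^2) - 0) < r" proof eventually_elim case (elim n)
  have "(SUM i<n*2^n. (d n i w)^2) <= (SUM i<n*2^n. e * d n i w)" proof (rule sum_mono)
  fix i
  have "d n i w * d n i w <= e * d n i w" using elim(1)[rule_format, of i] P by (intro mult_right_mono) auto
  thus "(d n i w)^2 <= e * d n i w" by (simp add: sq_eq)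
  qed
  also have "... = e*(AK K t w - AK K 0 w)" unfolding sum_distrib_left[symmetric] d_def using dyadic_telescope[OF elim(2) t, of "%s. AK K s w"] by simp
  also have "... <= e * real K" using P e by (intro mult_left_mono) auto
  finally show ?case using eK by (simp add: sum_nonneg)
  qed
  thus "EX no. ALL n>=no. norm ((SUM i<n*2^n. (d n i w)^2) - 0) < r" by (simp add: ev_seq)
  qed qed
  show "AE w in M. norm (SUM i<n*2^n. (d n i w)^2) <= (real K)^2" for n using props proof eventually_elim
  case P: (elim w)
  define f where "f i = AK K (min (dy n i) t) w" for i
  have tel: "(SUM i<n*2^n. d n i w) = f (n*2^n) - f 0" unfolding d_def f_def[symmetric] by (rule sum_lessThan_telescope)
  have fi: "0 <= f 0" "f (n*2^n) <= real K" using P t dyadic_step(3)[OF t, of "n*2^n" n] by (auto simp: f_def AK_def)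
  have "(SUM i<n*2^n. (d n i w)^2) <= (SUM i<n*2^n. real K * d n i w)" proof (rule sum_mono)
  fix i assume i: "i : {..<n*2^n}"
  have "d n i w <= (SUM i<n*2^n. d n i w)" using P i by (intro member_le_sum) auto
  hence "d n i w <= real K" unfolding tel using fi by linarith
  hence "d n i w * d n i w <= real K * d n i w" using P by (intro mult_right_mono) auto
  thus "(d n i w)^2 <= real K * d n i w" by (simp add: sq_eq)
  qed
  also have "... = real K*(f (n*2^n) - f 0)" unfolding sum_distrib_left[symmetric] tel ..
  also have "... <= real K * real K" using fi by (intro mult_left_mono) auto
  finally show ?case by (simp add: sum_nonneg sq_eq)
  qed
 qed auto
 thus ?thesis using ii by (simp add: d_def)
qed

lemma paths_tight:
 assumes ph: "cadapt M F ph" and t: "0 <= t" and dl: "0 < dl"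
 shows "EX R::nat. prob (exc M t (real R) ph) < dl"
proof -
 have m: "exc M t r ph : sets M" for r using exc_cont_meas[OF filt ph ca_zero[OF filt], of t r] by simp
 have "(%n. prob (exc M t (real n) ph)) ---> 0" proof (rule meas_to_0[OF m])
  have "acont M ph" using ph by (simp add: ca_def)
  thus "subseq_ae M (%s w. EV n. w ~: {w : space M. EX u:{0..t}. abs (ph u w) > real (s n)})"
  proof (rule subseq_ae_AE[OF AE_mp[OF _ AE_I2]], intro allI impI)
  fix w and s :: "nat => nat" assume c: "cont0 (%s. ph s w)" and s: "strict_mono s"
  have "bounded ((%u. ph u w) ` {0..t})" by (intro compact_imp_bounded compact_image cont_subset[OF c]) auto
  then obtain b where b: "ALL v:(%u. ph u w) ` {0..t}. norm v <= b" unfolding bounded_iff by blast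
  have "EV n. b <= real (s n)" by (rule eventually_subseq[OF s]) real_asymp
  thus "EV n. w ~: {w : space M. EX u:{0..t}. abs (ph u w) > real (s n)}" by eventually_elim (use b in force)
  qed qed
 hence "EV n. prob (exc M t (real n) ph) < dl" using dl by (rule order_tendstoD)
 thus ?thesis by (auto simp: ev_seq)
qed

text \<open>Localisation: off three events of small probability the clock is below \<open>K\<close>
  and the sampled weights below \<open>R + 1\<close>, and the sum equals the one estimated in mean
  square.\<close>

theorem quadratic_variation:
 assumes H: "!!n t. 0 <= t ==> Hn n t : bor (F t)" and ph: "cadapt M F ph" and u: "uconv M Hn ph" and t: "0 <= t"
 shows "pconv M (%n w. SUM i<n*2^n. trunc n (Hn n (dy n i) w) *
  ((inc (%s. X s w) (dy n) i t)^2 - (inc (%s. tau s w) (dy n) i t))) (%_. 0)" (is "pconv M ?Q _")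
proof (rule measure_imp_pconv0)
 have mm: "0 <= min (dy n i) t" "min (dy n i) t <= min (dy n (Suc i)) t" "min (dy n i) t <= t" for n i by (rule dyadic_step[OF t])+
 have Hm: "Hn n (dy n i) : bor M" for n i by (rule F_meas_M[OF _ H]) auto
 have Xm: "X (min (dy n i) t) : bor M" "tau (min (dy n i) t) : bor M" for n i
  using F_meas_M[OF mm(1) X_adapted[OF mm(1)]] F_meas_M[OF mm(1) tau_adapted[OF mm(1)]] by auto
 show Qm: "?Q n : bor M" for n by (intro borel_measurable_sum borel_measurable_times borel_measurable_diff borel_measurable_power Xm
  measurable_compose[OF Hm trunc_measurable])
 fix eps :: real assume eps: "0 < eps"
 let ?P = "%n. prob {w : space M. abs (?Q n w) > eps}"
 show "?P ---> 0" proof (rule LIMSEQ_I)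
  fix dl :: real assume dl: "0 < dl"
  hence d4: "0 < dl/4" by simp
  obtain K :: nat where K: "prob {w : space M. tau t w > real K} < dl/4" using clock_tail[OF t d4] by blast
  obtain R :: nat where R: "prob (exc M t (real R) ph) < dl/4" using paths_tight[OF ph t d4] by blast
  define e where "e n = dyel n (Hn n)" for n
  have ep: "epred M F (e n)" for n unfolding e_def by (rule dyadic_predictable[OF H])
  have eD: "grid_mono (e n)" for n by (rule epredD(1)[OF ep])
  have "ucp_converges M (%n. eproc (e n)) ph" by (rule uconv_imp_ucp[OF exc_eproc_meas[OF filt ep ph]]) (use dyadic_uconv[OF H u ph] in "simp add: e_def")
  hence "(%n. prob (exc M t 1 (%s w. eproc (e n) s w - ph s w))) ---> 0" unfolding ucp_converges_def using t by simp
  hence ev1: "EV n. prob (exc M t 1 (%s w. eproc (e n) s w - ph s w)) < dl/4" using d4 by (rule order_tendstoD)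
  \<comment> \<open>Off the bad events the elementary process built from \<open>Hn\<close> is within
    1 of \<open>ph\<close>, and \<open>ph\<close> is at most \<open>R\<close>, hence the level
    \<open>R + 1\<close>.\<close>
  define z where "z n i w = trunc (real R + 1) (trunc n (Hn n (dy n i) w))" for n i w
  have zb: "abs (z n i w) <= real R + 1" for n i w unfolding z_def by (rule trunc_bound) simp
  have zm: "z n i : bor (F (dy n i))" for n i proof -
  have [measurable]: "Hn n (dy n i) : bor (F (dy n i))" by (rule H) simp
  show ?thesis unfolding z_def[abs_def] by measurable
  qed
  define Q where "Q n w = (SUM i<n*2^n. z n i w * qvZ K (min (dy n i) t) (min (dy n (Suc i)) t) w)" for n w
  have Q2: "integrable M (%w. (Q n w)^2)" for n unfolding Q_def by (rule qv_sum_L2(1)[OF t zm zb])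
  have Qmeas[measurable]: "Q n : bor M" for n unfolding Q_def[abs_def] by (intro borel_measurable_sum borel_measurable_times F_meas_M[OF _ zm] qvZ_facts(1) mm) auto
  have "(%n. 74*(real R + 1)^2*(SUM i<n*2^n. LINT w|M. (inc (%s. AK K s w) (dy n) i t)^2)) ---> 74*(real R + 1)^2*0"
  by (intro tendsto_mult_left bracket_squares[OF t])
  hence "(%n. 74*(real R + 1)^2*(SUM i<n*2^n. LINT w|M. (inc (%s. AK K s w) (dy n) i t)^2)) ---> 0" by (simp only: mult_zero_right)
  moreover have "0 < eps^2*(dl/4)" using eps dl by simp
  ultimately have ev2: "EV n. 74*(real R + 1)^2*(SUM i<n*2^n. LINT w|M. (inc (%s. AK K s w) (dy n) i t)^2) < eps^2*(dl/4)"
  by (rule order_tendstoD)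
  have "EV n. norm (?P n - 0) < dl" using ev1 ev2 proof eventually_elim case (elim n)
  let ?E1 = "{w : space M. tau t w > real K}"
  let ?E2 = "exc M t (real R) ph"
  let ?E3 = "exc M t 1 (%s w. eproc (e n) s w - ph s w)"
  let ?E4 = "{w : space M. abs (Q n w) > eps}"
  have [measurable]: "tau t : bor M" by (rule F_meas_M[OF t tau_adapted[OF t]])
  have E1: "?E1 : sets M" by measurable
  have E2: "?E2 : sets M" using exc_cont_meas[OF filt ph ca_zero[OF filt], of t "real R"] by simp
  have E3: "?E3 : sets M" by (rule exc_eproc_meas[OF filt ep ph])
  have E4: "?E4 : sets M" by measurable
  have "?P n <= prob (((?E1 Un ?E2) Un ?E3) Un ?E4)" proof (rule finite_measure_mono_AE)
  show "AE w in M. w : {w : space M. abs (?Q n w) > eps} --> w : ((?E1 Un ?E2) Un ?E3) Un ?E4" using tau_ae AE_space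
  proof eventually_elim case (elim w)
  show ?case proof (rule impI, rule ccontr)
  assume a: "w : {w : space M. abs (?Q n w) > eps}" "w ~: ((?E1 Un ?E2) Un ?E3) Un ?E4"
  have sp: "w : space M" by (rule elim(2))
  have n: "tau t w <= real K" "abs (Q n w) <= eps" using a(2) sp by simp_all
  have e: "w ~: ?E2" "w ~: ?E3" using a(2) by (simp_all only: Un_iff de_Morgan_disj simp_thms)
  have n2: "abs (ph s w) <= real R" "abs (eproc (e n) s w - ph s w) <= 1" if "0 <= s" "s <= t" for s
  proof (rule_tac [!] ccontr)
  have s: "s : {0..t}" using that by simp
  show False if "~ abs (ph s w) <= real R" by (rule notE[OF e(1)]) (rule CollectI, rule conjI[OF sp], rule bexI[OF _ s], use that in simp)
  show False if "~ abs (eproc (e n) s w - ph s w) <= 1" by (rule notE[OF e(2)]) (rule CollectI, rule conjI[OF sp], rule bexI[OF _ s], use that in simp)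
  qed
  have XX: "X v w = XK (real K) v w" "tau v w = AK (real K) v w" if "0 <= v" "v <= t" for v proof -
  have "tau v w <= tau t w" using elim(1) that t by (auto simp: mono_on_def)
  thus "X v w = XK (real K) v w" "tau v w = AK (real K) v w" using n(1) by (simp_all add: X_def XK_def AK_def)
  qed
  have "?Q n w = Q n w" unfolding Q_def proof (rule sum.cong[OF refl])
  fix i assume i: "i : {..<n*2^n}"
  define v ww where "v = min (dy n i) t" and "ww = min (dy n (Suc i)) t"
  have vw: "0 <= v" "v <= ww" "ww <= t" using mm by (auto simp: v_def ww_def)
  have "trunc n (Hn n (dy n i) w)*((X ww w - X v w)^2 - (tau ww w - tau v w)) = z n i w * qvZ K v ww w"
  proof (cases "dy n i < t") case False
  hence "v = t" "ww = t" using divide_right_mono[of "real i" "real (Suc i)" "2^n"] by (auto simp: v_def ww_def)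
  thus ?thesis by (simp add: qvZ_def[OF t order_refl])
  next case True
  hence lt: "dy n i < ww" by (simp add: ww_def divide_strict_right_mono)
  have "stepv (e n) ww w = coef (e n) i w" by (rule stepv_coef[OF eD]) (use i lt in "auto simp: e_def ww_def")
  moreover have "ww ~= 0" using lt by (metis divide_nonneg_pos linorder_not_less of_nat_0_le_iff zero_less_numeral zero_less_power)
  ultimately have "eproc (e n) ww w = trunc n (Hn n (dy n i) w)" by (simp add: eproc_step e_def)
  hence "abs (trunc n (Hn n (dy n i) w)) <= real R + 1" using n2[of ww] vw by simp
  hence "z n i w = trunc n (Hn n (dy n i) w)" unfolding z_def by (rule trunc_id)
  thus ?thesis using XX[of v] XX[of ww] vw by (simp add: qvZ_def[OF vw(1,2)])
  qed
  thus "trunc n (Hn n (dy n i) w)*((inc (%s. X s w) (dy n) i t)^2 - (inc (%s. tau s w) (dy n) i t)) =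
  z n i w * qvZ K (min (dy n i) t) (min (dy n (Suc i)) t) w" by (simp only: v_def ww_def)
  qed
  thus False using a(1) n(2) by simp
  qed qed
  qed (intro sets.Un E1 E2 E3 E4)
  also have "... <= prob ?E1 + prob ?E2 + prob ?E3 + prob ?E4"
  using measure_Un_le[OF sets.Un[OF sets.Un[OF E1 E2] E3] E4] measure_Un_le[OF sets.Un[OF E1 E2] E3] measure_Un_le[OF E1 E2] by linarith
  also have "prob ?E4 < dl/4" proof -
  have "prob ?E4 <= prob {w : space M. eps^2 <= (Q n w)^2}" proof (intro finite_measure_mono subsetI)
  fix w assume "w : ?E4"
  thus "w : {w : space M. eps^2 <= (Q n w)^2}" using power_mono[of eps "abs (Q n w)" 2] eps by auto
  qed measurable
  also have "... <= (LINT w|M. (Q n w)^2)/eps^2" by (rule integral_Markov_inequality_measure[OF Q2, where A="space M"]) (use eps in simp_all)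
  also have "... < eps^2*(dl/4)/eps^2" unfolding Q_def by (rule divide_strict_right_mono[OF le_less_trans[OF qv_sum_L2(2)[OF t zm zb] elim(2)]]) (use eps in simp)
  also have "... = dl/4" using eps by simp
  finally show ?thesis .
  qed
  finally have "?P n < dl" using K R elim(1) by simp
  thus ?case by simp
  qed
  thus "EX no. ALL n>=no. norm (?P n - 0) < dl" by (simp add: ev_seq)
 qed qed

text \<open>The weights let the formula serve two purposes: with weight 1 it telescopes to the usual
  Ito formula, and with approximate local times as weights it is used in the space variable. The
  function may depend on \<omega> as long as its derivatives along the path are adapted.\<close>

theorem weighted_ito:
 fixes g g1 g2 :: "'a => real => real"
 assumes phn: "!!n t. 0 <= t ==> phn n t : bor (F t)" and ph: "cadapt M F ph" and u: "uconv M phn ph" and t: "0 <= t"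
  and g: "AE w in M. (ALL z. (g w hasD g1 w z) (at z)) & (ALL z. (g1 w hasD g2 w z) (at z)) & continuous_on UNIV (g2 w)"
  and g1m: "!!t. 0 <= t ==> (%w. g1 w (X t w)) : bor (F t)" and g2m: "!!t. 0 <= t ==> (%w. g2 w (X t w)) : bor (F t)"
  and SI: "SI M F X (%t w. ph t w * g1 w (X t w)) I" and k: "AE w in M. cont0 (k w) & (ALL s>=0. ph s w * g2 w (X s w) = k w (tau s w))"
 shows "pconv M (%n w. SUM i<n*2^n. phn n (dy n i) w *
  (inc (%s. g w (X s w)) (dy n) i t)) (%w. I t w + 1/2 * integral {0..tau t w} (k w))"
proof -
 have phc: "acont M ph" using ph by (simp add: ca_def)
 have g1c: "AE w in M. cont0 (%s. g1 w (X s w)) & cont0 (%s. g2 w (X s w))" using g X_continuous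
 proof eventually_elim case (elim w)
  have "continuous_on UNIV (g1 w)" using elim(1) by (meson DERIV_isCont isCont_cont)
  thus ?case using elim cont_comp2[of UNIV _ "{0..}" "%s. X s w"] by auto
 qed
 have prod: "uconv M (%n s w. phn n s w * f w (X s w)) (%s w. ph s w * f w (X s w))" if "acont M (%s w. f w (X s w))" for f :: "'a => real => real"
 proof (rule subseq_ae_mono[OF u])
  show "AE w in M. ALL s. strict_mono s --> upath (%n u. phn (s n) u w) (%u. ph u w) -->
  upath (%n u. phn (s n) u w * f w (X u w)) (%u. ph u w * f w (X u w))" using that phc by eventually_elim (intro allI impI upath_mult)
 qed
 have m1: "(%w. phn n s w * g1 w (X s w)) : bor (F s)" "(%w. phn n s w * g2 w (X s w)) : bor (F s)" if "0 <= s" for n s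
  using phn g1m g2m that by (auto intro: borel_measurable_times)
 have u1: "uconv M (%n s w. phn n s w * g1 w (X s w)) (%s w. ph s w * g1 w (X s w))" by (rule prod) (use g1c in "auto elim: eventually_mono")
 have u2: "uconv M (%n s w. phn n s w * g2 w (X s w)) (%s w. ph s w * g2 w (X s w))" by (rule prod) (use g1c in "auto elim: eventually_mono")
 have h2: "cadapt M F (%s w. ph s w * g2 w (X s w))" unfolding ca_def proof (intro conjI allI impI)
  show "(%w. ph s w * g2 w (X s w)) : bor (F s)" if "0 <= s" for s using ph g2m that by (auto intro: borel_measurable_times simp: ca_def)
  show "acont M (%s w. ph s w * g2 w (X s w))" using g1c phc by eventually_elim (auto intro: continuous_on_mult)
 qed
 have c1: "cadapt M F (%_ _. 1)" by (simp add: ca_def)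
 define E where "E = (%n. eint (dyel n (%s w. phn n s w * g1 w (X s w))) X t)"
 define Q where "Q h n w = (SUM i<n*2^n. trunc n (h n (dy n i) w) *
  ((inc (%s. X s w) (dy n) i t)^2 - (inc (%s. tau s w) (dy n) i t)))"
  for h :: "nat => real => 'a => real" and n w
 define h2 where "h2 n s w = phn n s w * g2 w (X s w)" for n s w
 \<comment> \<open>The constant weight supplies the bound on the sum of squared increments that
   \<open>ito_path\<close> asks for.\<close>
 define h3 where "h3 = (%(n::nat) (s::real) (w::'a). 1::real)"
 define D where "D n w = (SUM i<n*2^n. phn n (dy n i) w * (inc (%s. g w (X s w)) (dy n) i t))" for n w
 have a1: "pconv M E (I t)" unfolding E_def by (rule uconv_pconv[OF SI_dyadic[OF SI m1(1) u1] t])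
 have a2: "pconv M (Q h2) (%_. 0)" unfolding Q_def[abs_def] h2_def by (rule quadratic_variation[OF m1(2) h2 u2 t])
 have a3: "pconv M (Q h3) (%_. 0)" unfolding Q_def[abs_def] h3_def by (rule quadratic_variation[OF _ c1 uconv_refl t]) auto
 have "pconv M D (%w. I t w + 1/2 * integral {0..tau t w} (k w))"
 proof (rule subseq_ae_mono[OF subseq_ae_conj[OF a1 subseq_ae_conj[OF a2 subseq_ae_conj[OF a3 u]]]])
  fix s w and q :: "nat => nat" assume q: "strict_mono q"
  show "(%n. E (s n) w) ---> I t w ==> (%n. E ((s o q) n) w) ---> I t w" by (rule tendsto_subseq[OF q, where f="%n. E n w"])
  show "(%n. Q h2 (s n) w) ---> 0 ==> (%n. Q h2 ((s o q) n) w) ---> 0" by (rule tendsto_subseq[OF q, where f="%n. Q h2 n w"])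
  show "(%n. Q h3 (s n) w) ---> 0 ==> (%n. Q h3 ((s o q) n) w) ---> 0" by (rule tendsto_subseq[OF q, where f="%n. Q h3 n w"])
 next
  show "AE w in M. ALL s. strict_mono s --> (%n. E (s n) w) ---> I t w & (%n. Q h2 (s n) w) ---> 0 & (%n. Q h3 (s n) w) ---> 0 &
  upath (%n u. phn (s n) u w) (%u. ph u w) --> (%n. D (s n) w) ---> I t w + 1/2 * integral {0..tau t w} (k w)" using g k X_continuous tau_ae phc
  proof eventually_elim case (elim w)
  show ?case proof (intro allI impI, elim conjE)
  fix s :: "nat => nat"
  assume s: "strict_mono s" and l: "(%n. E (s n) w) ---> I t w" "(%n. Q h2 (s n) w) ---> 0" "(%n. Q h3 (s n) w) ---> 0"
  "upath (%n u. phn (s n) u w) (%u. ph u w)"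
  have c: "cont0 (%t. tau t w)" "mono_on {0..} (%t. tau t w)" "tau 0 w = 0" using elim(4) by auto
  show "(%n. D (s n) w) ---> I t w + 1/2 * integral {0..tau t w} (k w)" unfolding D_def
  proof (rule ito_path[where x="%s. X s w" and a="%s. tau s w" and ph="%s. ph s w" and phn="%n v. phn (s n) v w" and N=s and g="g w"
  and ?g1.0="g1 w" and ?g2.0="g2 w" and k="k w", OF elim(3) c elim(5) s l(4) t])
  show "(g w hasD g1 w z) (at z)" "(g1 w hasD g2 w z) (at z)" for z using elim(1) by auto
  show "continuous_on UNIV (g2 w)" using elim(1) by blast
  show "cont0 (k w)" using elim(2) by blast
  show "ph s w * g2 w (X s w) = k w (tau s w)" if "0 <= s" for s using elim(2) that by blast
  qed (use l(1,2,3) in "simp_all only: E_def Q_def h2_def h3_def eint_def dyel_def elementary_data.sel")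
  qed qed qed
 thus ?thesis by (simp only: D_def[abs_def])
qed

section \<open>Brackets and maximal bound for general integrals\<close>

lemma dyadic_cutoff:
 fixes K :: nat and N :: "nat => nat"
 assumes a: "cont0 (%t. tau t w)" "mono_on {0..} (%t. tau t w)" and cut: "!!s. 0 <= s ==> s <= t ==> H s w ~= 0 ==> tau s w <= real K"
  and N: "strict_mono N" and t: "0 <= t"
 shows "EV n. ALL s:{0..t}.
  eint (dyel (N n) H) X s w = eint (dyel (N n) H) (XK (real (Suc K))) s w &
  ebracket (dyel (N n) H) tau s w = ebracket (dyel (N n) H) (AK (real (Suc K))) s w"
 using eventually_subseq[OF N dyadic_mesh[OF a(1) t zero_less_one]]
proof eventually_elim case (elim n)
 show ?case proof
  fix s assume s: "s : {0..t}"
  hence s0: "0 <= s" "s <= t" by auto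
  let ?p = "%i. dy (N n) i"
  have *: "trunc (N n) (H (?p i) w) = 0 \<or> (min (?p (Suc i)) s = s & min (?p i) s = s) \<or>
  (tau (min (?p (Suc i)) s) w <= real (Suc K) & tau (min (?p i) s) w <= real (Suc K))" for i proof -
  consider "H (?p i) w = 0" | "s <= ?p i" | "H (?p i) w ~= 0" "?p i < s" by linarith
  thus ?thesis proof cases case 1 thus ?thesis by (simp add: trunc_id)
  next case 2 thus ?thesis using dyadic_step(2)[OF s0(1), of i "N n"] by simp
  next case 3
  \<comment> \<open>The integrand is nonzero at the left endpoint, where the clock is at most
    \<open>K\<close>; within one mesh step the clock grows by less than 1, so stopping at
    \<open>Suc K\<close> leaves the increment unchanged.\<close>
  have le: "tau (?p i) w <= real K" by (rule cut) (use 3 s0 in auto)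
  have m1: "tau (min (?p (Suc i)) s) w <= tau (min (?p (Suc i)) t) w" by (rule mono_onD[OF a(2)]) (use s0 in auto)
  have m2: "min (?p i) t = ?p i" "min (?p i) s = ?p i" using 3 s0 by auto
  have "abs (tau (min (?p (Suc i)) t) w - tau (?p i) w) < 1" using elim[rule_format, of i] unfolding m2 .
  hence "tau (min (?p (Suc i)) s) w <= real (Suc K)" using le m1 by (simp del: of_nat_Suc add: of_nat_Suc[of K])
  thus ?thesis using le unfolding m2 by simp
  qed qed
  show "eint (dyel (N n) H) X s w = eint (dyel (N n) H) (XK (real (Suc K))) s w &
  ebracket (dyel (N n) H) tau s w = ebracket (dyel (N n) H) (AK (real (Suc K))) s w"
  unfolding eint_def ebracket_def dyel_simps proof (intro conjI sum.cong refl)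
  fix i
  show "trunc (N n) (H (?p i) w)*(inc (%u. X u w) ?p i s) =
  trunc (N n) (H (?p i) w)*(inc (%u. XK (real (Suc K)) u w) ?p i s)" using *[of i] by (auto simp: X_def XK_def min_absorb1)
  show "(trunc (N n) (H (?p i) w))^2*(inc (%u. tau u w) ?p i s) =
  (trunc (N n) (H (?p i) w))^2*(inc (%u. AK (real (Suc K)) u w) ?p i s)" using *[of i] by (auto simp: AK_def min_absorb1)
  qed qed qed

text \<open>Moving the grid points up to \<open>max (grid e i) r\<close> and multiplying the
  coefficients by the indicator of \<open>D\<close> gives an elementary process again, whose
  integral is the increment after \<open>r\<close> restricted to \<open>D\<close>. Conditional
  statements are thus obtained from unconditional ones.\<close>

lemma good_pair_restrict:
 assumes e: "epred M F e" and C: "!!i w. i < steps e ==> w : space M ==> abs (coef e i w) <= C" and rt: "0 <= r" "r <= t" and D: "D : sets (F r)"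
 shows "good_pair M (%w. indicator D w*(eint e (XK (real K)) t w - eint e (XK (real K)) r w))
  (%w. indicator D w*(ebracket e (AK (real K)) t w - ebracket e (AK (real K)) r w))"
proof -
 define f where "f = Elementary (%_. 0) (steps e) (%i. max (grid e i) r) (%i w. indicator D w * coef e i w)"
 have sel[simp]: "init f = (%_. 0)" "steps f = steps e" "grid f = (%i. max (grid e i) r)" "coef f = (%i w. indicator D w * coef e i w)" by (simp_all add: f_def)
 have fb: "abs (coef f i w) <= C" if "i < steps f" "w : space M" for i w using C[of i w] that order_trans[OF abs_ge_zero C[of i w]] by (simp add: indicator_def)
 have "epred M F f" unfolding epred_def proof (intro conjI allI impI)
  fix i assume i: "i < steps f"
  hence i': "i < steps e" by simp
  show "grid f i <= grid f (Suc i)" using e i' by (auto simp: epred_def intro: max.mono)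
  have g0: "0 <= grid e i" by (rule epredD(2)[OF e]) (use i' in simp)
  have "coef e i : bor (F (grid e i))" by (rule epredD(3)[OF e i'])
  hence [measurable]: "coef e i : bor (F (max (grid e i) r))" by (rule F_meas_mono[rotated 2]) (use g0 in auto)
  have [measurable]: "D : sets (F (max (grid e i) r))" using Fmono[OF rt(1), of "max (grid e i) r"] D by auto
  show "coef f i : bor (F (grid f i))" by simp
  show "bounded (coef f i ` space M)" unfolding bounded_iff using fb[OF i] by auto
 qed (use rt in "auto simp: bounded_iff")
 from good_pair_elementary[OF this fb, of t K]
 have gp: "good_pair M (eint f (XK (real K)) t) (ebracket f (AK (real K)) t)" using rt by simp
 have ext: "y (min (max a r) t) = y (min a t) - y (min a r) + y r" for a and y :: "real => real"
 proof (cases "a <= r") case True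
  hence "min (max a r) t = r" "min a t = a" "min a r = a" using rt by auto
  thus ?thesis by simp
 next case False
  hence "min (max a r) t = min a t" "min a r = r" using rt by auto
  thus ?thesis by simp
 qed
 have "eint f (XK (real K)) t = (%w. indicator D w*(eint e (XK (real K)) t w - eint e (XK (real K)) r w))"
  unfolding eint_def sel ext[of "%s. XK (real K) s _"] by (auto simp: fun_eq_iff sum_subtractf[symmetric] sum_distrib_left algebra_simps intro!: sum.cong)
 moreover have "ebracket f (AK (real K)) t = (%w. indicator D w*(ebracket e (AK (real K)) t w - ebracket e (AK (real K)) r w))"
  unfolding ebracket_def sel ext[of "%s. AK (real K) s _"]
  by (auto simp: fun_eq_iff sum_subtractf[symmetric] sum_distrib_left power_mult_distrib algebra_simps indicator_def intro!: sum.cong)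
 ultimately show ?thesis using gp by simp
qed

context
 fixes H I :: "real => 'a => real" and K :: nat and C T :: real and k :: "'a => real => real"
 assumes SI: "SI M F X H I" and C: "!!s w. abs (H s w) <= C" and cut: "AE w in M. ALL s:{0..T}. H s w ~= 0 --> tau s w <= real K"
  and k: "AE w in M. cont0 (k w) & (ALL s>=0. (H s w)^2 = k w (tau s w))"
begin

text \<open>The integrand vanishes once the clock has passed \<open>K\<close>, so on each path the
  integrals stopped at \<open>Suc K\<close> eventually equal the unstopped ones. Their brackets are
  Riemann sums in the clock, whose limit \<open>k\<close> expresses in the time of
  \<open>B\<close>.\<close>

lemma integral_approximants:
 obtains q :: "nat => nat" where "strict_mono q"
  "!!t. 0 <= t ==> t <= T ==> AE w in M. uniform_limit {0..t} (%n u. eint (dyel (q n) H) (XK (real (Suc K))) u w) (%u. I u w) sequentially"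
  "!!t. 0 <= t ==> t <= T ==> AE w in M. (%n. ebracket (dyel (q n) H) (AK (real (Suc K))) t w) ---> integral {0..tau t w} (k w)"
proof -
 have Hm: "H t : bor (F t)" if "0 <= t" for t using SI that by (simp add: SI_def ca_def)
 have "uconv M (%n. eint (dyel n H) X) I" by (rule SI_dyadic[OF SI Hm uconv_refl])
 then obtain q where q: "strict_mono q" "AE w in M. upath (%n u. eint (dyel (q n) H) X u w) (%u. I u w)"
  unfolding subseq_ae_def using strict_mono_id by (force simp: id_def comp_def)
 have 1: "AE w in M. uniform_limit {0..t} (%n u. eint (dyel (q n) H) (XK (real (Suc K))) u w) (%u. I u w) sequentially" if t: "0 <= t" "t <= T" for t
  using q(2) cut tau_ae proof eventually_elim case (elim w)
  have "EV n. ALL s:{0..t}. eint (dyel (q n) H) X s w = eint (dyel (q n) H) (XK (real (Suc K))) s w"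
  by (rule eventually_mono[OF dyadic_cutoff[where w=w and H=H and K=K, OF _ _ _ q(1) t(1)]]) (use elim t in force)+
  moreover have "uniform_limit {0..t} (%n u. eint (dyel (q n) H) X u w) (%u. I u w) sequentially" using elim(1) t unfolding upath_def by blast
  ultimately show ?case by (subst (asm) uniform_limit_cong) (auto elim: eventually_mono)
 qed
 have 2: "AE w in M. (%n. ebracket (dyel (q n) H) (AK (real (Suc K))) t w) ---> integral {0..tau t w} (k w)" if t: "0 <= t" "t <= T" for t
  using cut tau_ae k proof eventually_elim case (elim w)
  have a: "cont0 (%t. tau t w)" "mono_on {0..} (%t. tau t w)" "tau 0 w = 0" using elim(2) by auto
  have ev1: "EV n. ALL s:{0..t}. ebracket (dyel (q n) H) tau s w = ebracket (dyel (q n) H) (AK (real (Suc K))) s w"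
  by (rule eventually_mono[OF dyadic_cutoff[where w=w and H=H and K=K, OF a(1,2) _ q(1) t(1)]]) (use elim(1) t in force)+
  have ev2: "EV n. C <= real (q n)" by (rule eventually_subseq[OF q(1)]) real_asymp
  have "(%n. SUM i<q n*2^q n. (H (dy (q n) i) w)^2*(inc (%s. tau s w) (dy (q n)) i t)) ---> integral {0..tau t w} (k w)"
  proof (rule dyadic_riemann[where hn="%_ s. (H s w)^2" and a="%s. tau s w", OF a _ q(1) _ t(1)])
  show "cont0 (k w)" using elim(3) by blast
  show "upath (%_ s. (H s w)^2) (%s. k w (tau s w))"
  by (rule uconv_path_cong[where z="%s. (H s w)^2"]) (use elim(3) in "auto simp: upath_def uniform_limit_iff")
  qed
  thus ?case proof (rule Lim_transform_eventually)
  show "EV n. (SUM i<q n*2^q n. (H (dy (q n) i) w)^2*(inc (%s. tau s w) (dy (q n)) i t))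
  = ebracket (dyel (q n) H) (AK (real (Suc K))) t w" using ev1 ev2 proof eventually_elim case (elim n)
  have "trunc (real (q n)) (H s w) = H s w" for s by (rule trunc_id) (use elim(2) C[of s w] in linarith)
  hence "(SUM i<q n*2^q n. (H (dy (q n) i) w)^2*(inc (%s. tau s w) (dy (q n)) i t))
  = ebracket (dyel (q n) H) tau t w" by (simp add: ebracket_def)
  thus ?case using elim(1) t by simp
  qed qed qed
 show ?thesis by (rule that[OF q(1) 1 2])
qed

lemma approx_facts:
 assumes t: "0 <= t"
 shows "epred M F (dyel n H)" "abs (coef (dyel n H) i w) <= C"
  "AE w in M. ebracket (dyel n H) (AK (real (Suc K))) t w <= C^2 * real (Suc K)"
  "AE w in M. 0 <= ebracket (dyel n H) (AK (real (Suc K))) t w"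
proof -
 show e: "epred M F (dyel n H)" by (rule dyadic_predictable) (use SI in "simp add: SI_def ca_def")
 show c: "abs (coef (dyel n H) i w) <= C" for i w using C[of "dy n i" w] by (auto simp: trunc_def)
 show "AE w in M. ebracket (dyel n H) (AK (real (Suc K))) t w <= C^2 * real (Suc K)"
  using AK_ae[of "real (Suc K)"] AK_bounds[OF of_nat_0_le_iff[of "Suc K"]] by eventually_elim (rule bracket_bound[OF e c _ _ t])
 show "AE w in M. 0 <= ebracket (dyel n H) (AK (real (Suc K))) t w"
  using AK_ae[of "real (Suc K)"] by eventually_elim (rule bracket_nonneg[OF e _ t])
qed

lemma good_pair_integral:
 assumes rt: "0 <= r" "r <= t" "t <= T" and D: "D : sets (F r)"
 shows "good_pair M (%w. indicator D w*(I t w - I r w)) (%w. indicator D w*(integral {0..tau t w} (k w) - integral {0..tau r w} (k w)))"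
proof -
 have t: "0 <= t" "r <= T" using rt by simp_all
 obtain q where q: "strict_mono q"
  and br: "!!t. 0 <= t ==> t <= T ==> AE w in M. uniform_limit {0..t} (%n u. eint (dyel (q n) H) (XK (real (Suc K))) u w) (%u. I u w) sequentially"
  "!!t. 0 <= t ==> t <= T ==> AE w in M. (%n. ebracket (dyel (q n) H) (AK (real (Suc K))) t w) ---> integral {0..tau t w} (k w)"
  by (rule integral_approximants) blast
 define Y where "Y n u = eint (dyel (q n) H) (XK (real (Suc K))) u" for n u
 define V where "V n u = ebracket (dyel (q n) H) (AK (real (Suc K))) u" for n u
 note Y = br(1)[folded Y_def, OF t(1) rt(3)] and V = br(2)[folded V_def]
 have gp: "good_pair M (%w. indicator D w*(Y n t w - Y n r w)) (%w. indicator D w*(V n t w - V n r w))" for n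
  unfolding Y_def V_def by (rule good_pair_restrict[OF approx_facts(1)[OF t(1)] approx_facts(2)[OF t(1)] rt(1,2) D])
 have Yl: "AE w in M. (%n. indicator D w*(Y n t w - Y n r w)) ---> indicator D w*(I t w - I r w)"
  using Y by eventually_elim (intro tendsto_mult_left tendsto_diff, (erule tendsto_uniform_limitI, use t rt in simp)+)
 have Vl: "AE w in M. (%n. indicator D w*(V n t w - V n r w)) ---> indicator D w*(integral {0..tau t w} (k w) - integral {0..tau r w} (k w))"
  using V[OF t(1) rt(3)] V[OF rt(1) t(2)] by eventually_elim (intro tendsto_intros; assumption)
 show ?thesis proof (rule good_pair_limit[OF gp _ _ Yl Vl])
  show "(%w. indicator D w*(I t w - I r w)) : bor M" by (rule full_limit[OF full_self _ Yl]) (use gp in "simp add: good_pair_def")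
  show "(%w. indicator D w*(integral {0..tau t w} (k w) - integral {0..tau r w} (k w))) : bor M"
  by (rule full_limit[OF full_self _ Vl]) (use gp in "simp add: good_pair_def")
  show "AE w in M. indicator D w*(V n t w - V n r w) <= C^2 * real (Suc K)" for n
  using approx_facts(3)[OF t(1), of "q n"] approx_facts(4)[OF rt(1), of "q n"] approx_facts(4)[OF t(1), of "q n"]
  unfolding V_def[symmetric] by eventually_elim (auto simp: indicator_def)
 qed qed

text \<open>The approximants obey the fourth moment bound at level \<open>eps/2\<close>, and 36 *
  2^4 = 576; their distance to \<open>I\<close> exceeds \<open>eps/2\<close> with vanishing
  probability.\<close>

lemma maximal_integral:
 assumes t: "0 <= t" and tT: "t <= T" and eps: "0 < eps"
 shows "prob (exc M t eps I) <= 576*(LINT w|M. (integral {0..tau t w} (k w))^2)/eps^4"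
proof -
 obtain q where q: "strict_mono q"
  and br: "!!t. 0 <= t ==> t <= T ==> AE w in M. uniform_limit {0..t} (%n u. eint (dyel (q n) H) (XK (real (Suc K))) u w) (%u. I u w) sequentially"
  "!!t. 0 <= t ==> t <= T ==> AE w in M. (%n. ebracket (dyel (q n) H) (AK (real (Suc K))) t w) ---> integral {0..tau t w} (k w)"
  by (rule integral_approximants) blast
 define Y where "Y n u = eint (dyel (q n) H) (XK (real (Suc K))) u" for n u
 define V where "V n = ebracket (dyel (q n) H) (AK (real (Suc K))) t" for n
 note Y = br(1)[folded Y_def, OF t tT] and V = br(2)[OF t tT, folded V_def]
 note e = approx_facts(1)[OF t]
 have C0: "0 <= C" using C[of 0 undefined] by linarith
 have XKca: "cadapt M F (XK (real (Suc K)))" unfolding ca_def by (intro conjI allI impI XK_adapted XK_continuous of_nat_0_le_iff)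
 have Ica: "cadapt M F I" using SI by (simp add: SI_def)
 have Yca: "cadapt M F (Y n)" for n unfolding Y_def[abs_def] by (rule eint_ca[OF filt e XKca])
 have Vm: "V n : bor M" for n using good_pair_elementary[OF e approx_facts(2)[OF t] t, of "q n" "Suc K"] by (simp add: V_def good_pair_def)
 have Vl: "(%n. LINT w|M. (V n w)^2) ---> (LINT w|M. (integral {0..tau t w} (k w))^2)"
 proof (rule dom_conv[where w="%_. (C^2 * real (Suc K))^2"])
  show "(%w. (integral {0..tau t w} (k w))^2) : bor M" by (intro borel_measurable_power full_limit[OF full_self Vm V])
  show "AE w in M. (%n. (V n w)^2) ---> (integral {0..tau t w} (k w))^2" using V by eventually_elim (rule tendsto_power)
  show "AE w in M. norm ((V n w)^2) <= (C^2 * real (Suc K))^2" for n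
  using approx_facts(3,4)[OF t, of "q n"] unfolding V_def[symmetric] by eventually_elim (simp add: power_mono)
 qed (use Vm in auto)
 let ?A = "exc M t eps I"
 let ?E = "%n. exc M t (eps/2) (%s w. Y n s w - I s w)"
 let ?F = "%n. exc M t (eps/2) (%s w. Y n s w)"
 have Em: "?E n : sets M" for n by (rule exc_cont_meas[OF filt Yca Ica])
 have Fm: "?F n : sets M" for n using exc_cont_meas[OF filt Yca ca_zero[OF filt], where t=t and eps="eps/2"] unfolding diff_zero .
 have E0: "(%n. prob (?E n)) ---> 0" proof (rule meas_to_0[OF Em subseq_ae_AE])
  show "AE w in M. ALL s. strict_mono s --> (EV n. w ~: {w : space M. EX u:{0..t}. eps/2 < abs (Y (s n) u w - I u w)})" using Y
  proof eventually_elim case (elim w)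
  have "EV n. ALL u:{0..t}. dist (Y n u w) (I u w) < eps/2" by (rule uniform_limitD[OF elim]) (use eps in simp)
  hence ev: "EV n. w ~: ?E n" by eventually_elim (force simp: dist_real_def)
  show ?case by (intro allI impI) (rule eventually_subseq[OF _ ev])
  qed qed
 have le: "prob ?A <= prob (?E n) + 36*(LINT w|M. (V n w)^2)/(eps/2)^4" for n proof -
  have "?A <= ?E n Un ?F n" proof
  fix w assume "w : ?A"
  then obtain s where s: "w : space M" "s : {0..t}" "abs (I s w) > eps" by blast
  hence "abs (Y n s w - I s w) > eps/2 \<or> abs (Y n s w) > eps/2" by linarith
  thus "w : ?E n Un ?F n" using s by blast
  qed
  hence "prob ?A <= prob (?E n Un ?F n)" by (rule finite_measure_mono) (intro sets.Un Em Fm)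
  also have "... <= prob (?E n) + prob (?F n)" by (rule measure_Un_le[OF Em Fm])
  also have "prob (?F n) <= 36*(LINT w|M. (V n w)^2)/(eps/2)^4" unfolding Y_def V_def by (rule maximal(2)[OF e approx_facts(2)[OF t] C0 t]) (use eps in simp)
  finally show ?thesis by simp
 qed
 have "(%n. prob (?E n) + 36*(LINT w|M. (V n w)^2)/(eps/2)^4) ---> 0 + 36*(LINT w|M. (integral {0..tau t w} (k w))^2)/(eps/2)^4"
  using eps by (intro tendsto_intros E0 Vl) simp
 hence "prob ?A <= 0 + 36*(LINT w|M. (integral {0..tau t w} (k w))^2)/(eps/2)^4" by (rule LIMSEQ_le_const) (use le in blast)
 thus ?thesis by (simp add: power_divide field_simps)
qed

end

end

section \<open>Local time: pathwise construction\<close>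

definition hat :: "real => real" where "hat y = max 0 (1 - abs y)"

lemma hat_props: "0 <= hat y" "hat y <= 1" "1 <= abs y ==> hat y = 0" "hat (- y) = hat y" and hat_refine: "hat y = 1/2 * hat (2*y - 1) + hat (2*y) + 1/2 * hat (2*y + 1)"
 and hat_continuous[continuous_intros]: "continuous_on S f ==> continuous_on S (%x. hat (f x))" unfolding hat_def by (auto simp: max_def abs_if)[5] (intro continuous_intros)

lemma hat_interpolation:
 fixes v :: "int => real" and y :: real
 assumes "finite K" "\<lfloor>y\<rfloor> : K" "\<lfloor>y\<rfloor> + 1 : K"
 shows "(SUM k:K. v k * hat (y - k)) = (1 - frac y) * v \<lfloor>y\<rfloor> + frac y * v (\<lfloor>y\<rfloor> + 1)"
proof -
 have f: "0 <= frac y" "frac y < 1" "y = \<lfloor>y\<rfloor> + frac y" using frac_lt_1[of y] by (auto simp: frac_def)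
 have "(SUM k:K. v k * hat (y - k)) = (SUM k:{\<lfloor>y\<rfloor>, \<lfloor>y\<rfloor>+1}. v k * hat (y - k))"
 proof (rule sum.mono_neutral_right[OF assms(1)])
  show "ALL k:K - {\<lfloor>y\<rfloor>, \<lfloor>y\<rfloor>+1}. v k * hat (y - k) = 0" proof
  fix k assume "k : K - {\<lfloor>y\<rfloor>, \<lfloor>y\<rfloor>+1}"
  hence "k <= \<lfloor>y\<rfloor> - 1 \<or> \<lfloor>y\<rfloor> + 2 <= k" by auto
  hence "1 <= abs (y - k)" using f by linarith
  thus "v k * hat (y - k) = 0" by (simp add: hat_props)
  qed
 qed (use assms in auto)
 also have "... = (1 - frac y) * v \<lfloor>y\<rfloor> + frac y * v (\<lfloor>y\<rfloor> + 1)" using f by (simp add: hat_def frac_def algebra_simps)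
 finally show ?thesis .
qed

lemma convex_near:
 fixes x y z :: real
 assumes "abs (x - z) <= d" "abs (y - z) <= d" "0 <= th" "th <= 1"
 shows "abs ((1 - th) * x + th * y - z) <= d"
proof -
 have "(1 - th) * x + th * y - z = (1 - th)*(x - z) + th*(y - z)" by (simp add: algebra_simps)
 also have "abs (...) <= (1 - th)*abs (x - z) + th*abs (y - z)" using assms abs_triangle_ineq[of "(1 - th)*(x - z)" "th*(y - z)"] by (simp add: abs_mult)
 also have "... <= (1 - th) * d + th * d" using assms by (intro add_mono mult_left_mono) auto
 finally show ?thesis by (simp add: algebra_simps)
qed

text \<open>Occupation up to \<open>t\<close> weighted by a tent of mass 1 and radius
  \<open>2^-n\<close> around \<open>k/2^n\<close>: an approximate local time at that point.\<close>

definition cell :: "(real => real) => nat => real => int => real" where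
 "cell b n t k = integral {0..t} (%s. 2^n * hat (2^n * b s - k))"

context
 fixes b :: "real => real"
 assumes b: "cont0 b"
begin

lemma cell_continuous: "continuous_on {0..t} (%s. 2^n * hat (2^n * b s - k))" by (intro continuous_intros cont_subset[OF b]) auto

text \<open>Integrated two-scale equation of the tent; the normalisation by \<open>2^n\<close> turns
  its coefficients into averaging weights.\<close>

lemma cell_refine: "cell b n t k = 1/4 * cell b (Suc n) t (2*k-1) + 1/2 * cell b (Suc n) t (2*k) + 1/4 * cell b (Suc n) t (2*k+1)"
proof -
 let ?f = "%j::int. %s. 2^Suc n * hat (2^Suc n * b s - j)"
 have i: "?f j integrable_on {0..t}" for j by (rule int_cont[OF cell_continuous])
 have "2^n * hat (2^n * b s - k) = 1/4 * ?f (2*k-1) s + 1/2 * ?f (2*k) s + 1/4 * ?f (2*k+1) s" for s by (subst hat_refine) (simp add: algebra_simps)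
 hence "cell b n t k = integral {0..t} (%s. 1/4 * ?f (2*k-1) s + 1/2 * ?f (2*k) s + 1/4 * ?f (2*k+1) s)" by (simp only: cell_def)
 also have "... = 1/4 * integral {0..t} (?f (2*k-1)) + 1/2 * integral {0..t} (?f (2*k)) + 1/4 * integral {0..t} (?f (2*k+1))"
  by (simp only: Henstock_Kurzweil_Integration.integral_add integrable_add integrable_on_mult_right i Henstock_Kurzweil_Integration.integral_mult_right)
 finally show ?thesis by (simp only: cell_def)
qed

lemma cell_continuous_time: "continuous_on {0..T} (%t. cell b n t k)"
 unfolding cell_def by (rule indefinite_integral_continuous_1[OF int_cont[OF cell_continuous]])

definition adens :: "nat => real => real => real" where
 "adens n t a = (SUM k:{- int (n*2^n)..int (n*2^n)}. cell b n t k * hat (2^n * a - k))"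

lemma adens_interp:
 assumes "abs a + 1 <= real n"
 defines "j \<equiv> \<lfloor>2^n * a\<rfloor>"
 shows "adens n t a = (1 - frac (2^n * a)) * cell b n t j + frac (2^n * a) * cell b n t (j + 1)" and "abs (real_of_int j) + 1 <= real (n*2^n)"
proof -
 define y where "y = 2^n * a"
 have 1: "abs y + 2^n <= real (n*2^n)" using mult_right_mono[OF assms(1), of "2^n"] by (simp add: y_def abs_mult algebra_simps)
 have "n ~= 0" using assms(1) by (cases n) auto
 hence "(2::real)^1 <= 2^n" by (intro power_increasing) auto
 hence 2: "2 <= (2::real)^n" by simp
 have "real_of_int j <= y" "y < real_of_int j + 1" unfolding j_def y_def by linarith+
 thus j: "abs (real_of_int j) + 1 <= real (n*2^n)" using 1 2 by linarith
 hence j': "- int (n*2^n) <= j" "j + 1 <= int (n*2^n)" by linarith+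
 show "adens n t a = (1 - frac (2^n * a)) * cell b n t j + frac (2^n * a) * cell b n t (j + 1)" unfolding adens_def j_def
  by (rule hat_interpolation[where v="cell b n t"]) (use j' in "auto simp: j_def")
qed

text \<open>Both interpolations are compared with the fine cell value at \<open>2 * j\<close>: the
  fine one is within \<open>2 * d\<close>, the coarse one, whose cells average fine neighbours up to
  three steps away, within \<open>3 * d\<close>.\<close>

lemma adens_step:
 assumes a: "abs a + 2 <= real n" and osc: "!!k. abs (real_of_int k) <= real (Suc n*2^Suc n) ==> abs (cell b (Suc n) t (k+1) - cell b (Suc n) t k) <= d"
 shows "abs (adens (Suc n) t a - adens n t a) <= 5 * d"
proof -
 define j where "j = \<lfloor>2^n * a\<rfloor>"
 define m where "m = cell b (Suc n) t"
 have l1: "adens n t a = (1 - frac (2^n * a)) * cell b n t j + frac (2^n * a) * cell b n t (j + 1)" and jb: "abs (real_of_int j) + 1 <= real (n*2^n)"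
  using adens_interp(1)[of a n t] adens_interp(2)[of a n] a by (auto simp: j_def)
 have l2: "adens (Suc n) t a = (1 - frac (2^Suc n * a)) * m \<lfloor>2^Suc n * a\<rfloor> + frac (2^Suc n * a) * m (\<lfloor>2^Suc n * a\<rfloor> + 1)"
  using adens_interp(1)[of a "Suc n" t] a by (simp add: m_def)
 have jj: "\<lfloor>2^Suc n * a\<rfloor> = 2 * j \<or> \<lfloor>2^Suc n * a\<rfloor> = 2 * j + 1" proof -
  have "real_of_int j <= 2^n * a" "2^n * a < real_of_int j + 1" unfolding j_def by linarith+
  hence "real_of_int (2 * j) <= 2^Suc n * a" "2^Suc n * a < real_of_int (2 * j + 2)" by auto
  thus ?thesis by linarith
 qed
 have st: "abs (m (i+1) - m i) <= d" if "2 * j - 1 <= i" "i <= 2 * j + 2" for i proof -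
  have "abs i <= 2*abs j + 2" using that by linarith
  hence "abs (real_of_int i) <= 2*abs (real_of_int j) + 2" by linarith
  also have "... <= 2 * real (n*2^n)" using jb by simp
  also have "... <= real (Suc n*2^Suc n)" by (simp add: algebra_simps)
  finally show ?thesis unfolding m_def by (rule osc)
 qed
 have st': "abs (m (2*j) - m (2*j-1)) <= d" "abs (m (2*j+1) - m (2*j)) <= d" "abs (m (2*j+2) - m (2*j+1)) <= d" "abs (m (2*j+3) - m (2*j+2)) <= d"
  using st[of "2*j-1"] st[of "2*j"] st[of "2*j+1"] st[of "2*j+2"] by (simp_all add: algebra_simps)
 have c1: "abs (cell b n t j - m (2*j)) <= 3 * d" unfolding cell_refine[of n t j] m_def[symmetric] using st' by (auto simp: field_simps abs_le_iff)
 have c2: "abs (cell b n t (j+1) - m (2*j)) <= 3 * d" proof -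
  have "2*(j + 1) - 1 = 2*j+1" "2*(j + 1) = 2*j+2" "2*(j + 1) + 1 = 2*j+3" by auto
  thus ?thesis unfolding cell_refine[of n t "j+1"] m_def[symmetric] using st' by (auto simp: field_simps abs_le_iff)
 qed
 have "abs (m \<lfloor>2^Suc n * a\<rfloor> - m (2*j)) <= 2 * d" "abs (m (\<lfloor>2^Suc n * a\<rfloor> + 1) - m (2*j)) <= 2 * d"
  using jj st' by (auto simp: abs_le_iff add.assoc)
 hence "abs (adens (Suc n) t a - m (2*j)) <= 2 * d" unfolding l2 by (rule convex_near) (auto simp: frac_lt_1 less_imp_le)
 moreover have "abs (adens n t a - m (2*j)) <= 3 * d" unfolding l1 by (rule convex_near[OF c1 c2]) (auto simp: frac_lt_1 less_imp_le)
 ultimately show ?thesis by linarith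
qed

lemma adens_cont:
 fixes S :: "real set"
 shows "continuous_on (S \<times> UNIV) (%(t, a::real). adens n (max t 0) a)"
proof -
 have c: "continuous_on UNIV (%t. cell b n (max t 0) k)" for k proof -
  have "cont0 (%t. cell b n t k)" unfolding continuous_on_eq_continuous_within proof
  fix t :: real assume "t : {0..}"
  hence "continuous (at t within {0..t+1}) (%t. cell b n t k)" using cell_continuous_time[of "t+1" n k] by (auto simp: continuous_on_eq_continuous_within)
  thus "continuous (at t within {0..}) (%t. cell b n t k)" by (subst at_within_nhd[where S="{..<t+1}" and U="{0..t+1}"]) auto
  qed
  thus ?thesis by (rule cont_comp2) (auto intro: continuous_intros)
 qed
 have "continuous_on (S \<times> (UNIV :: real set)) (%x. SUM k:{- int (n*2^n)..int (n*2^n)}. cell b n (max (fst x) 0) k * hat (2^n * snd x - k))"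
  by (intro continuous_intros cont_comp2[OF c]) auto
 thus ?thesis by (simp add: adens_def case_prod_unfold)
qed

lemma adens_outside:
 assumes "!!s. 0 <= s ==> s <= t ==> abs (b s) + 2 <= abs a"
 shows "adens n t a = 0" unfolding adens_def
proof (rule sum.neutral, rule ballI)
 fix k :: int
 show "cell b n t k * hat (2^n * a - k) = 0" proof (cases "1 <= abs (2^n * a - k)") case False
  have "2^n * hat (2^n * b s - k) = 0" if s: "s : {0..t}" for s proof -
  have "2^n*(abs a - abs (b s)) >= 2^n*2" using assms[of s] s by (intro mult_left_mono) auto
  hence "abs (2^n * a) - abs (2^n * b s) >= 2^n*2" by (simp add: abs_mult algebra_simps)
  moreover have "(1::real) <= 2^n" by simp
  ultimately have "1 <= abs (2^n * b s - k)" using False by linarith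
  thus ?thesis by (simp add: hat_props)
  qed
  hence "cell b n t k = integral {0..t} (%_. 0)" unfolding cell_def by (intro integral_cong) auto
  thus ?thesis by simp
 qed (simp add: hat_props)
qed

text \<open>The geometric oscillation bound makes the interpolations converge locally uniformly in
  time and space. The occupation identity follows since a dyadic Riemann sum of \<open>f\<close>
  against the interpolation is exactly the time integral of the interpolated \<open>f\<close> along
  the path.\<close>

theorem occupation_density_exists:
 fixes rh :: real
 assumes rh: "0 <= rh" "rh < 1"
  and osc: "EV n. ALL t:{0..real n}. ALL k. abs (real_of_int k) <= real (n*2^n) --> abs (cell b n t (k+1) - cell b n t k) <= rh^n"
 shows "EX l. continuous_occupation_density b l"
proof -
 define A where "A = (%n x. adens n (max (fst x) 0) (snd x))"
 define L where "L x = lim (%n. A n x)" for x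
 define box where "box m = {- real m..real m} \<times> {- real m..real m}" for m
 have ul: "uniform_limit (box m) A L sequentially" for m proof -
  have ev: "EV n. ALL x:box m. norm (A (Suc n) x - A n x) <= 5*rh^Suc n" using sequentially_offset[OF osc, of 1] eventually_ge_at_top[of "m+2"]
  proof eventually_elim case (elim n)
  show ?case proof
  fix x assume "x : box m"
  hence x: "abs (fst x) <= m" "abs (snd x) <= m" by (auto simp: box_def)
  have n: "abs (snd x) + 2 <= real n" "max (fst x) 0 : {0..real (n+1)}" using x elim(2) by auto
  show "norm (A (Suc n) x - A n x) <= 5*rh^Suc n" unfolding A_def real_norm_def using elim(1) n(2) by (intro adens_step[OF n(1)]) auto
  qed qed
  have "summable (%n. 5*rh^Suc n)" using rh by (intro summable_mult summable_ignore_initial_segment[of _ 1, simplified] summable_geometric) auto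
  from Weierstrass_m_test_ev[OF ev this]
  have "uniform_limit (box m) (%n x. A n x - A 0 x) (%x. \<Sum>i. A (Suc i) x - A i x) sequentially" by (simp only: sum_lessThan_telescope[where f="%i. A i _"])
  from uniform_limit_add[OF this uniform_limit_const[of "A 0"]]
  have u: "uniform_limit (box m) A (%x. (\<Sum>i. A (Suc i) x - A i x) + A 0 x) sequentially" by simp
  have "L x = (\<Sum>i. A (Suc i) x - A i x) + A 0 x" if "x : box m" for x unfolding L_def by (rule limI) (rule tendsto_uniform_limitI[OF u that])
  thus ?thesis using u by (subst uniform_limit_cong'[where g=A and i="%x. (\<Sum>i. A (Suc i) x - A i x) + A 0 x"]) auto
 qed
 have Lb: "continuous_on (box m) L" for m proof (rule uniform_limit_theorem[OF _ ul])
  show "EV n. continuous_on (box m) (A n)" using cont_subset[OF adens_cont[of UNIV], of "box m"] by (simp add: A_def case_prod_unfold)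
 qed simp
 have Lc: "continuous_on UNIV L" proof (rule isCont_cont, rule ballI)
  fix x :: "real \<times> real"
  obtain m :: nat where m: "abs (fst x) + abs (snd x) < m" using reals_Archimedean2 by blast
  hence "x : interior (box m)" by (cases x) (auto simp: box_def interior_Times)
  thus "isCont L x" by (rule continuous_on_interior[OF Lb])
 qed
 have Lpt: "(%n. adens n t a) ---> L (t, a)" if "0 <= t" for t a proof -
  obtain m :: nat where "abs t + abs a < m" using reals_Archimedean2 by blast
  hence "(t, a) : box m" by (auto simp: box_def)
  from tendsto_uniform_limitI[OF ul this] show ?thesis using that by (simp add: A_def max_absorb1)
 qed
 have "continuous_occupation_density b (%t a. L (t, a))" unfolding continuous_occupation_density_def
 proof (intro conjI allI impI)
  show "continuous_on ({0..} \<times> UNIV) (%(t, x). L (t, x))" using cont_subset[OF Lc] by (simp add: case_prod_eta)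
  fix t :: real and f :: "real => real"
  assume t: "0 <= t" and f: "continuous_on UNIV f"
  have bt: "continuous_on {0..t} b" by (rule cont_subset[OF b]) auto
  have "bounded (b ` {0..t})" by (intro compact_imp_bounded compact_image bt) auto
  then obtain R where R: "ALL v:b ` {0..t}. norm v <= R" unfolding bounded_iff by blast
  obtain m :: nat where m: "max R 0 + 2 < real m" using reals_Archimedean2 by blast
  have bm: "abs (b s) + 2 <= real m" if "0 <= s" "s <= t" for s using R that m by force
  define g where "g a = f a * L (t, a)" for a
  have Lt: "continuous_on UNIV (%a. L (t, a))" by (rule cont_comp2[OF Lc]) (auto intro!: continuous_intros)
  have gc: "continuous_on UNIV g" unfolding g_def by (intro continuous_intros f Lt)
  have out: "L (t, a) = 0" if "real m <= abs a" for a proof -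
  have "adens n t a = 0" for n by (rule adens_outside) (use bm that in force)
  thus ?thesis using LIMSEQ_unique[OF Lpt[OF t, of a]] by simp
  qed
  have rhs: "(LINT x|lborel. g x) = integral {0..2 * real m} (%u. g (u - real m))" proof -
  have "(LINT x|lborel. g x) = (LINT x:{- real m..real m}|lborel. g x)" unfolding set_lebesgue_integral_def
  proof (rule b_cong[OF refl])
  fix x show "g x = indicator {- real m..real m} x *\<^sub>R g x" using out[of x] by (cases "real m <= abs x") (auto simp: g_def indicator_def)
  qed
  also have "... = integral {- real m..real m} g"
  by (rule set_borel_integral_eq_integral(2)[OF borel_integrable_atLeastAtMost']) (rule cont_subset[OF gc], simp)
  also have "... = integral {0..2 * real m} (g o (%u. u + - real m))" using integral_shift[of 0 "- real m" "2 * real m" g] cont_subset[OF gc] by simp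
  finally show ?thesis by (simp add: comp_def)
  qed
  have lhs: "(LBINT s=0..ereal t. f (b s)) = integral {0..t} (%s. f (b s))" using interval_integral_eq_integral[OF t, of "%s. f (b s)"]
  by (simp add: zero_ereal_def borel_integrable_atLeastAtMost' cont_comp2[OF f bt])
  \<comment> \<open>Riemann sum of \<open>f\<close> times the approximate density over
    \<open>[-m,m]\<close>, shifted to start at 0 so that the dyadic grid of the half-line
    applies.\<close>
  define P where "P n = (SUM i<n*2^n. (adens n t (dy n i - real m) * f (dy n i - real m))*(inc (%s. s) (dy n) i (2 * real m)))" for n
  have P1: "P ---> integral {0..2 * real m} (%u. g (u - real m))" unfolding P_def
  proof (rule dyadic_riemann[where a="%u. u" and N="%n. n" and hn="%n u. adens n t (u - real m) * f (u - real m)"])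
  show "upath (%n u. adens n t (u - real m) * f (u - real m)) (%s. g (s - real m))"
  proof (rule uconv_path_cong[OF upath_mult])
  show "upath (%n u. adens n t (u - real m)) (%u. L (t, u - real m))" unfolding upath_def
  proof (intro allI impI)
  fix T :: real
  obtain M :: nat where M: "abs t + abs T + m < real M" using reals_Archimedean2 by blast
  have "uniform_limit {0..T} (%n u. A n (t, u - real m)) (%u. L (t, u - real m)) sequentially"
  by (rule uniform_limit_compose'[OF ul[of M]]) (use M in "auto simp: box_def")
  thus "uniform_limit {0..T} (%n u. adens n t (u - real m)) (%u. L (t, u - real m)) sequentially" using t by (simp add: A_def max_absorb1)
  qed
  qed (auto simp: g_def intro!: continuous_intros cont_comp2[OF f] cont_comp2[OF Lt])
  qed (auto simp: strict_mono_def mono_on_def intro!: continuous_intros cont_comp2[OF gc])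
  have "P ---> integral {0..t} (%s. f (b s))" proof (rule LIMSEQ_I)
  fix r :: real assume r: "0 < r"
  define e where "e = r/(t + 1)"
  have e: "0 < e" using r t by (simp add: e_def)
  have et: "e * t < r" proof -
  have "e * t < e*(t + 1)" using e by simp
  thus ?thesis using t by (simp add: e_def)
  qed
  have "uniformly_continuous_on {- real m..real m} f" by (intro compact_uniformly_continuous cont_subset[OF f]) auto
  then obtain d where d: "d > 0" "!!u v. u : {- real m..real m} ==> v : {- real m..real m} ==> dist u v < d ==> dist (f u) (f v) < e"
  unfolding uniformly_continuous_on_def using e by metis
  have "(%n. 1/2^n :: real) ---> 0" by real_asymp
  hence "EV n. 1/2^n < d" using d(1) by (rule order_tendstoD)
  hence "EV n. norm (P n - integral {0..t} (%s. f (b s))) < r" using eventually_ge_at_top[of "2 * m + 1"]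
  proof eventually_elim case (elim n)
  define K where "K = {- int (m*2^n)..<int (m*2^n)}"
  have "P n = (SUM i<2 * m*2^n. (adens n t (dy n i - real m) * f (dy n i - real m))*(inc (%s. s) (dy n) i (2 * real m)))"
  unfolding P_def proof (rule sum.mono_neutral_right)
  show "{..<2 * m*2^n} <= {..<n*2^n}" using elim(2) by (intro lessThan_subset_iff[THEN iffD2] mult_right_mono) auto
  show "ALL i:{..<n*2^n} - {..<2 * m*2^n}. adens n t (dy n i - real m) * f (dy n i - real m)*(inc (%s. s) (dy n) i (2 * real m)) = 0"
  proof
  fix i assume "i : {..<n*2^n} - {..<2 * m*2^n}"
  hence "real (2 * m*2^n) <= real i" by (intro of_nat_mono) auto
  hence "2 * real m <= dy n i" by (simp add: field_simps)
  thus "adens n t (dy n i - real m) * f (dy n i - real m)*(inc (%s. s) (dy n) i (2 * real m)) = 0"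
  using dyadic_step(2)[of "2 * real m" i n] by simp
  qed
  qed simp
  also have "... = (SUM i<2 * m*2^n. cell b n t (int i - int (m*2^n)) * f (real_of_int (int i - int (m*2^n))/2^n)/2^n)"
  proof (rule sum.cong[OF refl])
  fix i assume "i : {..<2 * m*2^n}"
  hence "real (Suc i) <= real (2 * m*2^n)" by (intro of_nat_mono) auto
  hence le: "dy n (Suc i) <= 2 * real m" by (simp add: field_simps)
  hence le': "dy n i <= 2 * real m" using divide_right_mono[of "real i" "real (Suc i)" "2^n"] by simp
  have eq: "dy n i - real m = real_of_int (int i - int (m*2^n))/2^n" by (simp add: field_simps)
  have "0 <= dy n i" by simp
  moreover have "real (2 * m + 1) <= real n" using elim(2) by (intro of_nat_mono)
  ultimately have "abs (dy n i - real m) + 1 <= real n" using le' unfolding of_nat_add of_nat_mult by linarith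
  from adens_interp(1)[OF this, of t]
  have "adens n t (dy n i - real m) = cell b n t (int i - int (m*2^n))" unfolding eq nonzero_mult_div_cancel_left[OF power_not_zero[OF zero_neq_numeral[symmetric]]] times_divide_eq_right frac_of_int floor_of_int by simp
  thus "adens n t (dy n i - real m) * f (dy n i - real m)*(inc (%s. s) (dy n) i (2 * real m)) =
  cell b n t (int i - int (m*2^n)) * f (real_of_int (int i - int (m*2^n))/2^n)/2^n"
  using le le' unfolding eq by (simp add: min_absorb1 diff_divide_distrib[symmetric])
  qed
  also have "... = (SUM k:K. cell b n t k * f (k/2^n)/2^n)" proof -
  define M where "M = m*2^n"
  have M2: "2 * m*2^n = 2 * M" by (simp add: M_def)
  show ?thesis unfolding K_def M2 M_def[symmetric] by (intro sum.reindex_bij_witness[where i="%k. nat (k + int M)" and j="%i. int i - int M"]) auto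
  qed
  also have "... = integral {0..t} (%s. SUM k:K. f (k/2^n) * hat (2^n * b s - k))" proof -
  have "cell b n t k * f (k/2^n)/2^n = integral {0..t} (%s. f (k/2^n) * hat (2^n * b s - k))" for k :: int by (simp add: cell_def)
  thus ?thesis by (simp add: Henstock_Kurzweil_Integration.integral_sum K_def int_cont continuous_intros bt)
  qed
  finally have Pn: "P n - integral {0..t} (%s. f (b s)) = integral {0..t} (%s. (SUM k:K. f (k/2^n) * hat (2^n * b s - k)) - f (b s))"
  by (subst Henstock_Kurzweil_Integration.integral_diff) (auto intro!: int_cont continuous_intros bt cont_comp2[OF f bt])
  have "norm (P n - integral {0..t} (%s. f (b s))) <= e*(t - 0)" unfolding Pn
  proof (rule integral_bound[OF t])
  show "continuous_on {0..t} (%s. (SUM k:K. f (k/2^n) * hat (2^n * b s - k)) - f (b s))" by (intro continuous_intros bt cont_comp2[OF f bt]) auto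
  fix s assume s: "s : {0..t}"
  define j where "j = \<lfloor>2^n * b s\<rfloor>"
  have j: "real_of_int j <= 2^n * b s" "2^n * b s < real_of_int j + 1" unfolding j_def by linarith+
  have jb: "real_of_int j/2^n <= b s" "b s <= real_of_int (j + 1)/2^n" "real_of_int (j + 1)/2^n - real_of_int j/2^n = 1/2^n" using j by (auto simp: field_simps)
  have h1: "1/2^n <= (1::real)" by simp
  have bs: "abs (b s) + 2 <= real m" using bm s by simp
  have jm: "real_of_int j/2^n : {- real m..real m}" "real_of_int (j + 1)/2^n : {- real m..real m}" "b s : {- real m..real m}"
  using jb h1 bs unfolding atLeastAtMost_iff by linarith+
  have "- real m + 1 <= real_of_int j/2^n" "real_of_int (j + 1)/2^n < real m" using jb h1 bs by linarith+
  hence "2^n <= real_of_int j + real m*2^n" "real_of_int (j + 1) < real m*2^n" by (auto simp: field_simps)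
  moreover have "0 < (2::real)^n" by simp
  ultimately have "- (real m*2^n) <= real_of_int j" "real_of_int (j + 1) < real m*2^n" by linarith+
  hence "real_of_int (- int (m*2^n)) <= real_of_int j" "real_of_int (j + 1) < real_of_int (int (m*2^n))" by auto
  hence K: "j : K" "j + 1 : K" unfolding K_def of_int_le_iff of_int_less_iff by auto
  have "(SUM k:K. f (k/2^n) * hat (2^n * b s - k)) = (1 - frac (2^n * b s)) * f (j/2^n) + frac (2^n * b s) * f ((j + 1)/2^n)"
  using hat_interpolation[where v="%k. f (k/2^n)" and y="2^n * b s" and K=K] K by (simp add: j_def K_def)
  moreover have "abs (f (j/2^n) - f (b s)) <= e" "abs (f ((j + 1)/2^n) - f (b s)) <= e"
  using d(2)[OF jm(1,3)] d(2)[OF jm(2,3)] jb elim(1) by (auto simp: dist_real_def)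
  ultimately show "norm ((SUM k:K. f (k/2^n) * hat (2^n * b s - k)) - f (b s)) <= e" by (simp add: convex_near frac_lt_1 less_imp_le)
  qed
  thus ?case using et by simp
  qed
  thus "EX no. ALL n>=no. norm (P n - integral {0..t} (%s. f (b s))) < r" by (simp add: ev_seq)
  qed
  from LIMSEQ_unique[OF this P1] show "(LBINT s=0..ereal t. f (b s)) = (LINT x|lborel. f x * L (t, x))" using lhs rhs by (simp add: g_def)
 qed
 thus ?thesis by blast
qed

end

section \<open>Local time of Brownian motion\<close>

lemma DERIV_pos_power:
 fixes x :: real
 assumes "0 < p"
 shows "((%x. (max 0 x)^Suc p) hasD real (Suc p)*(max 0 x)^p) (at x)"
proof -
 consider "x < 0" | "x = 0" | "0 < x" by linarith
 thus ?thesis proof cases case 1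
  have "((%_. 0) hasD 0) (at x)" by simp
  hence "((%x. (max 0 x)^Suc p) hasD 0) (at x)" by (rule has_field_derivative_transform_within_open[where S="{..<0}"]) (use 1 in auto)
  moreover have "max 0 x = 0" using 1 by simp
  ultimately show ?thesis using assms by (simp only: power_0_left) simp
 next case 2
  show ?thesis unfolding CARAT_DERIV proof (intro exI[of _ "%z. (max 0 z)^p"] conjI allI)
  show "isCont (%z. (max 0 z)^p) x" by (intro continuous_intros)
  qed (use 2 assms in "auto simp: max_def")
 next case 3
  have "((%x. x^Suc p) hasD real (Suc p) * x^p) (at x)" using DERIV_pow[of "Suc p" x] by simp
  hence "((%x. (max 0 x)^Suc p) hasD real (Suc p) * x^p) (at x)" by (rule has_field_derivative_transform_within_open[where S="{0<..}"]) (use 3 in auto)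
  thus ?thesis using 3 by simp
 qed qed

text \<open>\<open>hat\<close> is the second difference of the positive part, so its first and
  second primitives are second differences of higher powers of the positive part.\<close>

definition hat1 :: "real => real" where
 "hat1 y = ((max 0 (y + 1))^2 - 2*(max 0 y)^2 + (max 0 (y - 1))^2)/2"

definition hat2 :: "real => real" where
 "hat2 y = ((max 0 (y + 1))^3 - 2*(max 0 y)^3 + (max 0 (y - 1))^3)/6"

lemma hat1_derivative: "(hat1 hasD hat y) (at y)" and hat2_derivative: "(hat2 hasD hat1 y) (at y)"
proof -
 have d: "((%y. (max 0 (y + c))^Suc p) hasD real (Suc p)*(max 0 (y + c))^p) (at y)" if "0 < p" for c y :: real and p
 proof -
  have "((%y. y + c) hasD 1) (at y)" by (auto intro!: derivative_eq_intros)
  from DERIV_chain2[OF DERIV_pos_power[OF that] this] show ?thesis by simp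
 qed
 let ?D = "%p. real (Suc p)*(max 0 (y + 1))^p - 2*(real (Suc p)*(max 0 (y + 0))^p) + real (Suc p)*(max 0 (y + - 1))^p"
 have "((%y. ((max 0 (y + 1))^Suc 1 - 2*(max 0 (y + 0))^Suc 1 + (max 0 (y + - 1))^Suc 1)/2) hasD
  (?D 1)/2) (at y)"
  by (intro DERIV_cdivide DERIV_add DERIV_diff DERIV_cmult d) simp_all
 moreover have "(?D 1)/2 = hat y" by (auto simp: hat_def max_def)
 ultimately show "(hat1 hasD hat y) (at y)" by (simp add: hat1_def[abs_def] sq_eq)
 have "((%y. ((max 0 (y + 1))^Suc 2 - 2*(max 0 (y + 0))^Suc 2 + (max 0 (y + - 1))^Suc 2)/6) hasD
  (?D 2)/6) (at y)"
  by (intro DERIV_cdivide DERIV_add DERIV_diff DERIV_cmult d) simp_all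
 moreover have "(?D 2)/6 = hat1 y" by (simp add: hat1_def)
 ultimately show "(hat2 hasD hat1 y) (at y)" by (simp add: hat2_def[abs_def] sq_eq power3_eq_cube mult.assoc)
qed

lemma hat1_props: "y <= -1 ==> hat1 y = 0" "1 <= y ==> hat1 y = 1" "0 <= hat1 y" "hat1 y <= 1"
proof -
 show 0: "hat1 y = 0" if "y <= -1" for y using that by (simp add: hat1_def max_def)
 show 1: "hat1 y = 1" if "1 <= y" for y using that by (simp add: hat1_def max_def sq_eq algebra_simps)
 have mono: "hat1 x <= hat1 y" if "x <= y" for x y by (rule DERIV_nonneg_imp_nondecreasing[OF that]) (use hat1_derivative hat_props(1) in blast)
 show "0 <= hat1 y" using mono[of "min y (-1)" y] 0[of "min y (-1)"] by simp
 show "hat1 y <= 1" using mono[of y "max y 1"] 1[of "max y 1"] by simp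
qed

lemma hat2_step: "abs (hat2 (y - 1) - hat2 y) <= 1"
proof -
 obtain z where "hat2 y - hat2 (y - 1) = (y - (y - 1)) * hat1 z" using MVT2[of "y - 1" y hat2 hat1] hat2_derivative by auto
 thus ?thesis using hat1_props(3,4)[of z] by simp
qed

lemma cont_halfline:
 assumes "!!T::real. continuous_on {0..T} h"
 shows "cont0 h" unfolding continuous_on_eq_continuous_within
proof
 fix t :: real assume "t : {0..}"
 hence "continuous (at t within {0..t+1}) h" using assms[of "t+1"] by (auto simp: continuous_on_eq_continuous_within)
 thus "continuous (at t within {0..}) h" by (subst at_within_nhd[where S="{..<t+1}" and U="{0..t+1}"]) auto
qed

lemma AE_continuous_eq:
 fixes f g :: "real => 'a => real"
 assumes eq: "!!t. 0 <= t ==> AE w in M. f t w = g t w" and c: "acont M f" "acont M g"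
 shows "AE w in M. ALL t>=0. f t w = g t w"
proof -
 have "AE w in M. ALL m j. f (dy m j) w = g (dy m j) w" unfolding AE_all_countable by (intro allI eq) simp
 thus ?thesis using c proof eventually_elim case (elim w)
  show ?case proof (intro allI impI)
  fix t :: real assume t: "0 <= t"
  have d: "0 <= dy m j" for m j by simp
  have lim: "(%m. h (dy m (nat \<lceil>2^m * t\<rceil>))) ---> h t" if "cont0 h" for h :: "real => real"
  by (rule continuous_on_tendsto_compose[OF that ceil_dyadic[OF t]]) (simp_all only: atLeast_iff t d eventually_True)
  show "f t w = g t w" using LIMSEQ_unique[OF lim[OF elim(2)]] lim[OF elim(3)] elim(1) by simp
  qed qed qed

lemma antiderivative:
 fixes f :: "real => real"
 assumes "continuous_on UNIV f"
 obtains F where "!!x. (F hasD f x) (at x)"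
proof -
 have "EX F. ALL x::real. - \<infinity> < ereal x --> ereal x < \<infinity> --> (F has_vector_derivative f x) (at x)"
  by (rule einterval_antiderivative) (use assms in "auto simp: continuous_on_eq_continuous_at")
 thus ?thesis using that by (auto simp: has_real_derivative_iff_has_vector_derivative)
qed

lemma antiderivative_bound:
 fixes f :: "real => real"
 assumes F: "!!x. (F hasD f x) (at x)" and c: "!!x. abs (f x) <= c" and out: "!!x. x < p \<or> q < x ==> f x = 0" and pq: "p <= q"
 shows "abs (F x - F p) <= c*(q - p)"
proof -
 have c0: "0 <= c*(q - p)" using order_trans[OF abs_ge_zero c[of 0]] pq by simp
 have mvt: "EX z. u < z & z < v & F v - F u = (v - u) * f z" if "u < v" for u v using MVT2[OF that, of F f] F by blast
 have mid: "abs (F x - F p) <= c*(q - p)" if x: "p < x" "x <= q" for x proof -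
  obtain z where z: "F x - F p = (x - p) * f z" using mvt[OF x(1)] by blast
  have "abs ((x - p) * f z) <= (q - p) * c" unfolding abs_mult by (intro mult_mono) (use x c pq in auto)
  thus ?thesis unfolding z by (simp add: mult.commute)
 qed
 consider "x < p" | "x = p" | "p < x" "x <= q" | "q < x" by linarith
 thus ?thesis proof cases case 1
  obtain z where "z < p" "F p - F x = (p - x) * f z" using mvt[OF 1] by blast
  thus ?thesis using out[of z] c0 by simp
 next case 2 thus ?thesis using c0 by simp
 next case 3 thus ?thesis by (rule mid)
 next case 4
  obtain z where "q < z" "F x - F q = (x - q) * f z" using mvt[OF 4] by blast
  hence "F x = F q" using out[of z] by simp
  thus ?thesis using mid[of q] c0 pq by (cases "p = q") auto
 qed qed

lemma (in cps) full_integral: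
 fixes Y :: "real => 'a => real"
 assumes A: "full_alg M A" and Y: "!!s. 0 <= s ==> s <= t ==> Y s : bor A" and c: "acont M Y" and t: "0 <= t"
 shows "(%w. integral {0..t} (%s. Y s w)) : bor A"
proof (rule full_limit[OF A])
 \<comment> \<open>Evaluation points are capped at \<open>t\<close>, up to which \<open>Y\<close> is
   known to be measurable for \<open>A\<close>.\<close>
 let ?S = "%n w. SUM i<n*2^n. Y (min (dy n i) t) w*(inc (%s. s) (dy n) i t)"
 show "?S n : bor A" for n by (intro borel_measurable_sum borel_measurable_times borel_measurable_const Y) (use t in auto)
 show "AE w in M. (%n. ?S n w) ---> integral {0..t} (%s. Y s w)" using c proof eventually_elim case (elim w)
  have "cont0 (%s. Y (min s t) w)" by (rule cont_comp2[OF elim]) (use t in "auto intro: continuous_intros")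
  hence "(%n. ?S n w) ---> integral {0..t} (%s. Y (min s t) w)"
  using dyadic_riemann[where a="%s. s" and N="%n. n" and hn="%_ s. Y (min s t) w" and k="%s. Y (min s t) w" and t=t] t
  by (auto simp: mono_on_def strict_mono_def upath_def uniform_limit_iff)
  moreover have "integral {0..t} (%s. Y (min s t) w) = integral {0..t} (%s. Y s w)" by (intro integral_cong) auto
  ultimately show ?case by simp
 qed qed

text \<open>With weight 1 the increments of \<open>g\<close> telescope, and continuity in time
  upgrades the identity at fixed times to all times at once.\<close>

lemma (in time_change) ito_random:
 fixes g g1 g2 :: "'a => real => real"
 assumes g: "AE w in M. (ALL z. (g w hasD g1 w z) (at z)) & (ALL z. (g1 w hasD g2 w z) (at z)) & continuous_on UNIV (g2 w)"
  and g1m: "!!t. 0 <= t ==> (%w. g1 w (X t w)) : bor (F t)" and g2m: "!!t. 0 <= t ==> (%w. g2 w (X t w)) : bor (F t)"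
  and SI: "SI M F X (%t w. g1 w (X t w)) I" and k: "AE w in M. cont0 (k w) & (ALL s>=0. g2 w (X s w) = k w (tau s w))"
 shows "AE w in M. ALL t>=0. g w (X t w) - g w (X 0 w) = I t w + 1/2 * integral {0..tau t w} (k w)"
proof (rule AE_continuous_eq)
 fix t :: real assume t: "0 <= t"
 let ?S = "%n w. SUM i<n*2^n. 1*(inc (%s. g w (X s w)) (dy n) i t)"
 have "pconv M ?S (%w. I t w + 1/2 * integral {0..tau t w} (k w))" by (rule weighted_ito[where phn="%_ _ _. 1" and ph="%_ _. 1" and g=g and ?g1.0=g1 and ?g2.0=g2])
  (use g g1m g2m SI k t in "simp_all add: ca_def uconv_refl")
 moreover have "pconv M ?S (%w. g w (X t w) - g w (X 0 w))"
 proof (rule subseq_ae_AE[OF AE_I2], intro allI impI)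
  fix w and s :: "nat => nat" assume s: "strict_mono s"
  have "EV n. t <= real (s n)" by (rule eventually_subseq[OF s]) real_asymp
  hence "EV n. ?S (s n) w = g w (X t w) - g w (X 0 w)" unfolding mult_1 by eventually_elim (rule dyadic_telescope[OF _ t, where f="%s. g w (X s w)"])
  thus "(%n. ?S (s n) w) ---> g w (X t w) - g w (X 0 w)" by (rule tendsto_eventually)
 qed
 ultimately show "AE w in M. g w (X t w) - g w (X 0 w) = I t w + 1/2 * integral {0..tau t w} (k w)" by (rule pconv_unique[rotated])
next
 show "acont M (%t w. g w (X t w) - g w (X 0 w))" using g X_continuous proof eventually_elim
  case (elim w)
  have "continuous_on UNIV (g w)" using elim(1) by (meson DERIV_isCont isCont_cont)
  thus ?case by (intro continuous_intros cont_comp2[OF _ elim(2)]) auto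
 qed
 have "acont M I" using SI by (simp add: SI_def ca_def)
 thus "acont M (%t w. I t w + 1/2 * integral {0..tau t w} (k w))" using k tau_ae tau_nonneg
 proof eventually_elim case (elim w)
  have "cont0 (%u. integral {0..u} (k w))" proof (rule cont_halfline)
  fix T
  have "continuous_on {0..T} (k w)" by (rule cont_subset[of "{0..}"]) (use elim(2) in auto)
  thus "continuous_on {0..T} (%u. integral {0..u} (k w))" by (intro indefinite_integral_continuous_1 int_cont)
  qed
  hence "cont0 (%t. integral {0..tau t w} (k w))" by (rule cont_comp2) (use elim(3,4) in auto)
  thus ?case by (intro continuous_intros elim(1))
 qed qed

section \<open>Brownian motion with the trivial clock\<close>

locale full_bm = cps M for M :: "'a measure" +
 fixes B :: "real => 'a => real" and G :: "real => 'a measure"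
 assumes bmG: "brownian_motion_wrt M G B" and fullG: "!!t. 0 <= t ==> full_alg M (G t)"

sublocale full_bm \<subseteq> time_change M B G "%t _. t" G
proof
 show "{w : A. t <= u} : sets (G u)" if "0 <= t" "0 <= u" "A : sets (G t)" for t u A proof (cases "t <= u")
  case True thus ?thesis using bm_facts(2)[OF bmG that(1) True] that(3) by auto
 qed simp
 show "A : sets (G t)" if "0 <= t" "A <= space M" "!!u. 0 <= u ==> {w : A. t <= u} : sets (G u)" for t A using that(3)[OF that(1)] by simp
qed (use bmG fullG bm_facts(2)[OF bmG] in "auto intro: continuous_intros simp: mono_on_def")

context full_bm
begin

lemma X_eq: "X = B" by (simp add: X_def fun_eq_iff)

lemma ito:
 fixes g g1 g2 :: "real => real"
 assumes g: "!!z. (g hasD g1 z) (at z)" "!!z. (g1 hasD g2 z) (at z)" "continuous_on UNIV g2"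
 obtains I where "SI M G B (%t w. g1 (B t w)) I"
  "AE w in M. ALL t>=0. g (B t w) - g (B 0 w) = I t w + 1/2 * integral {0..t} (%s. g2 (B s w))"
proof -
 have c: "continuous_on UNIV g1" using g by (meson DERIV_isCont isCont_cont)
 have [measurable]: "g1 : bor borel" "g2 : bor borel" using c g(3) by (auto intro: borel_measurable_continuous_onI)
 have Bc: "acont M B" using bm_facts(4)[OF bmG] .
 have Bm: "(%w. g1 (B t w)) : bor (G t)" "(%w. g2 (B t w)) : bor (G t)" if "0 <= t" for t using bm_facts(3)[OF bmG that] by measurable
 have "cadapt M G (%t w. g1 (B t w))" unfolding ca_def proof (intro conjI allI impI Bm)
  show "acont M (%t w. g1 (B t w))" using Bc by eventually_elim (rule cont_comp2[OF c], auto)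
 qed
 then obtain I where I: "SI M G B (%t w. g1 (B t w)) I" using SI_exists unfolding X_eq by blast
 have "AE w in M. ALL t>=0. g (X t w) - g (X 0 w) = I t w + 1/2 * integral {0..t} (%s. g2 (B s w))"
 proof (rule ito_random[where g="%_. g" and ?g1.0="%_. g1" and ?g2.0="%_. g2"])
  show "AE w in M. cont0 (%s. g2 (B s w)) & (ALL s>=0. g2 (X s w) = g2 (B s w))" using Bc by eventually_elim (auto simp: X_eq intro: cont_comp2[OF g(3)])
 qed (use g I Bm in "auto simp: X_eq")
 thus ?thesis unfolding X_eq by (rule that[OF I])
qed

lemma B_continuous: "acont M B" and B_meas: "0 <= t ==> B t : bor (G t)" using bm_facts(3,4)[OF bmG] by auto

lemma integral_meas:
 fixes f :: "real => real"
 assumes f: "continuous_on UNIV f" and t: "0 <= t"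
 shows "(%w. integral {0..t} (%s. f (B s w))) : bor (G t)"
proof (rule full_integral[OF fullG[OF t] _ _ t])
 have [measurable]: "f : bor borel" by (rule borel_measurable_continuous_onI[OF f])
 show "(%w. f (B s w)) : bor (G t)" if "0 <= s" "s <= t" for s using G_meas_mono[OF that B_meas[OF that(1)]] by measurable
 show "acont M (%s w. f (B s w))" using B_continuous by eventually_elim (rule cont_comp2[OF f], auto)
qed

context
 fixes f :: "real => real" and C T :: real and I :: "real => 'a => real"
 assumes f: "continuous_on UNIV f" "!!x. abs (f x) <= C" and T: "0 <= T" and SI: "SI M G B (%t w. f (B t w)) I"
begin

lemma function_integrand:
 "AE w in M. ALL s:{0..T}. f (B s w) ~= 0 --> s <= real (nat \<lceil>T\<rceil>)"
 "AE w in M. cont0 (%s. (f (B s w))^2) & (ALL s>=0. (f (B s w))^2 = (f (B s w))^2)"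
 using B_continuous by (auto elim!: eventually_mono intro!: continuous_intros cont_comp2[OF f(1)]) linarith

lemma SI': "SI M G X (%t w. f (B t w)) I" unfolding X_eq by (rule SI)

lemma function_integral_L2:
 "integrable M (%w. (I T w - I 0 w)^2)" "(LINT w|M. (I T w - I 0 w)^2) <= C^2 * T"
proof -
 have "good_pair M (%w. indicator (space M) w*(I T w - I 0 w)) (%w. indicator (space M) w*(integral {0..T} (%s. (f (B s w))^2) - integral {0..0} (%s. (f (B s w))^2)))"
  by (rule good_pair_integral[where H="%t w. f (B t w)", OF SI' f(2) function_integrand]) (use T sets.top[of "G 0"] in "auto simp: spaceG")
 hence gp: "integrable M (%w. (indicator (space M) w*(I T w - I 0 w))^4)" "(%w. indicator (space M) w*(I T w - I 0 w)) : bor M"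
  "(LINT w|M. (indicator (space M) w*(I T w - I 0 w))^2) = (LINT w|M. indicator (space M) w * integral {0..T} (%s. (f (B s w))^2))" by (auto simp: good_pair_def)
 have ind: "(LINT w|M. g (indicator (space M) w * h w)) = (LINT w|M. g (h w))" "integrable M (%w. g (indicator (space M) w * h w)) = integrable M (%w. g (h w))"
  for g h :: "_ => real" by (auto intro!: b_cong Bochner_Integration.integrable_cong)
 show "integrable M (%w. (I T w - I 0 w)^2)" using int_power_le4[OF gp(2,1), of 2] unfolding ind(2)[of "%x. x^2"] by simp
 have le: "AE w in M. integral {0..T} (%s. (f (B s w))^2) <= C^2 * T" using B_continuous proof eventually_elim
  case (elim w)
  have "norm (integral {0..T} (%s. (f (B s w))^2)) <= C^2*(T - 0)" proof (rule integral_bound[OF T])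
  show "continuous_on {0..T} (%s. (f (B s w))^2)" by (intro continuous_intros cont_comp2[OF f(1)] cont_subset[OF elim]) auto
  qed (use f(2) in "simp add: abs_le_square_iff[symmetric] order_trans[OF _ abs_ge_self]")
  thus ?case by simp
 qed
 have "(LINT w|M. (I T w - I 0 w)^2) = (LINT w|M. integral {0..T} (%s. (f (B s w))^2))" using gp(3) unfolding ind(1)[of "%x. x^2"] ind(1)[of "%x. x"] .
 also have "... <= (LINT w|M. C^2 * T)" proof (cases "integrable M (%w. integral {0..T} (%s. (f (B s w))^2))")
  case True thus ?thesis by (rule integral_mono_AE[OF _ _ le]) simp
 qed (use T in "simp add: not_integrable_integral_eq")
 finally show "(LINT w|M. (I T w - I 0 w)^2) <= C^2 * T" by (simp add: prob_space)
qed

lemma function_integral_maximal: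
 "0 < eps ==> prob (exc M T eps I) <= 576*(LINT w|M. (integral {0..T} (%s. (f (B s w))^2))^2)/eps^4"
 by (rule maximal_integral[where H="%t w. f (B t w)", OF SI' f(2) function_integrand]) (use T in auto)

end

lemma B_increment_L2:
 assumes T: "0 <= T"
 shows "integrable M (%w. (B T w - B 0 w)^2)" "(LINT w|M. (B T w - B 0 w)^2) <= T"
proof -
 have "integrable M (%w. (B T w - B 0 w)^2) & (LINT w|M. (B T w - B 0 w)^2) <= T" proof (cases "T = 0") case False
  hence "0 < T" using T by simp
  hence D: "distributed M lborel (%w. B T w - B 0 w) (normal_density 0 (sqrt T))" using bm_facts(7)[OF bmG, of 0 T] by simp
  show ?thesis using normal_moments(1)[OF D, of 2] normal_moments(3)[OF D] \<open>0 < T\<close> by simp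
 qed simp
 thus "integrable M (%w. (B T w - B 0 w)^2)" "(LINT w|M. (B T w - B 0 w)^2) <= T" by auto
qed

text \<open>Ito's formula for a function with second derivative \<open>2 * f\<close> expresses the
  occupation through an increment of that function and a stochastic integral. Both are controlled by
  the first derivative, at most \<open>2*(q - p)\<close>, which gives 2 * 4 + 2 * 4 = 16.\<close>

lemma occupation_L2:
 fixes f :: "real => real"
 assumes f: "continuous_on UNIV f" "!!x. 0 <= f x" "!!x. f x <= 1" "!!x. x < p \<or> q < x ==> f x = 0" and pq: "p <= q" and T: "0 <= T"
 shows "integrable M (%w. (integral {0..T} (%s. f (B s w)))^2)" "(LINT w|M. (integral {0..T} (%s. f (B s w)))^2) <= 16*(q - p)^2 * T"
proof -
 have "continuous_on UNIV (%x. 2 * f x)" by (intro continuous_intros f)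
 then obtain g0 where g0: "!!x. (g0 hasD 2 * f x) (at x)" by (rule antiderivative) blast
 define g1 where "g1 x = g0 x - g0 p" for x
 have g1: "(g1 hasD 2 * f x) (at x)" for x unfolding g1_def[abs_def] using DERIV_diff[OF g0 DERIV_const] by simp
 have b: "abs (g1 x) <= 2*(q - p)" for x unfolding g1_def by (rule antiderivative_bound[OF g0 _ _ pq]) (use f in auto)
 have g1c: "continuous_on UNIV g1" using g1 by (meson DERIV_isCont isCont_cont)
 obtain g where g: "!!x. (g hasD g1 x) (at x)" by (rule antiderivative[OF g1c]) blast
 have gl: "abs (g x - g y) <= 2*(q - p)*abs (x - y)" for x y proof -
  have "norm (g x - g y) <= 2*(q - p) * norm (x - y)" by (rule field_differentiable_bound[of UNIV g g1]) (use g b in "auto intro: has_field_derivative_at_within")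
  thus ?thesis by simp
 qed
 obtain I where I: "SI M G B (%t w. g1 (B t w)) I"
  "AE w in M. ALL t>=0. g (B t w) - g (B 0 w) = I t w + 1/2 * integral {0..t} (%s. 2 * f (B s w))" by (rule ito[OF g g1]) (auto intro!: continuous_intros f)
 note L = function_integral_L2[OF g1c b T I(1)] and BL = B_increment_L2[OF T]
 let ?J = "%w. integral {0..T} (%s. f (B s w))" and ?c = "2*(q - p)"
 let ?D = "%w. 2*(?c^2*(B T w - B 0 w)^2) + 2*(I T w - I 0 w)^2"
 have [measurable]: "?J : bor M" by (rule F_meas_M[OF T integral_meas[OF f(1) T]])
 have le: "AE w in M. (?J w)^2 <= ?D w" using I(2) proof eventually_elim case (elim w)
  have J: "?J w = (g (B T w) - g (B 0 w)) - (I T w - I 0 w)" using elim[rule_format, of T] elim[rule_format, of 0] T by simp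
  have "(g (B T w) - g (B 0 w))^2 <= (?c*abs (B T w - B 0 w))^2" using gl[of "B T w" "B 0 w"] by (simp add: abs_le_square_iff[symmetric] order_trans[OF _ abs_ge_self])
  hence 1: "(g (B T w) - g (B 0 w))^2 <= ?c^2*(B T w - B 0 w)^2" by (simp add: power_mult_distrib)
  have "(x - y)^2 <= 2 * x^2 + 2 * y^2" for x y :: real using zero_le_power2[of "x + y"] by (simp add: sq_eq algebra_simps)
  from this[of "g (B T w) - g (B 0 w)" "I T w - I 0 w"] show ?case unfolding J using 1 by linarith
 qed
 have Di: "integrable M ?D" using BL(1) L(1) by auto
 show Ji: "integrable M (%w. (?J w)^2)" by (rule b_int_bound[OF Di]) (use le in "auto elim!: eventually_mono")
 have "(LINT w|M. (?J w)^2) <= (LINT w|M. ?D w)" by (rule integral_mono_AE[OF Ji Di le])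
 also have "... = 2*(?c^2*(LINT w|M. (B T w - B 0 w)^2)) + 2*(LINT w|M. (I T w - I 0 w)^2)" using BL(1) L(1) by simp
 also have "... <= 2*(?c^2 * T) + 2*(?c^2 * T)" by (intro add_mono mult_left_mono BL(2) L(2)) auto
 also have "... = 16*(q - p)^2 * T" by (simp add: sq_eq algebra_simps)
 finally show "(LINT w|M. (?J w)^2) <= 16*(q - p)^2 * T" .
qed

text \<open>Ito's formula writes the difference of neighbouring cells as a term of order
  \<open>2^-n\<close> minus a stochastic integral whose integrand lives on a space interval of
  length \<open>3/2^n\<close>. The squared bracket is of order \<open>4^-n\<close> in mean, so the
  fourth moment bound can compete with the number of cells, of order \<open>n * 2^n\<close>.\<close>

lemma cell_oscillation:
 fixes k :: int and n :: nat
 assumes T: "0 <= T" and eps: "8/2^n <= eps"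
 obtains A where "A : sets M" "prob A <= 21233664 * T/4^n/eps^4"
  "AE w in M. w ~: A --> (ALL t:{0..T}. abs (cell (%s. B s w) n t (k+1) - cell (%s. B s w) n t k) <= eps)"
proof -
 \<comment> \<open>Second primitive of the difference of the two tents, doubled to absorb the factor
   1/2 in Ito's formula.\<close>
 define g where "g x = 2/2^n*(hat2 (2^n * x - k - 1) - hat2 (2^n * x - k))" for x :: real
 define g1 where "g1 x = 2*(hat1 (2^n * x - k - 1) - hat1 (2^n * x - k))" for x :: real
 define g2 where "g2 x = 2*(2^n*(hat (2^n * x - k - 1) - hat (2^n * x - k)))" for x :: real
 have lin: "((%x. 2^n * x - c) hasD 2^n) (at x)" for c x :: real by (auto intro!: derivative_eq_intros)
 have g: "(g hasD g1 x) (at x)" for x unfolding g_def[abs_def] diff_diff_eq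
  by (rule DERIV_cong[OF DERIV_cmult[OF DERIV_diff[OF DERIV_chain2[OF hat2_derivative lin] DERIV_chain2[OF hat2_derivative lin]]]]) (simp add: g1_def algebra_simps)
 have g1: "(g1 hasD g2 x) (at x)" for x unfolding g1_def[abs_def] diff_diff_eq
  by (rule DERIV_cong[OF DERIV_cmult[OF DERIV_diff[OF DERIV_chain2[OF hat1_derivative lin] DERIV_chain2[OF hat1_derivative lin]]]]) (simp add: g2_def algebra_simps)
 have g2c: "continuous_on UNIV g2" unfolding g2_def by (intro continuous_intros)
 have g1c: "continuous_on UNIV g1" using g1 by (meson DERIV_isCont isCont_cont)
 have g1b: "abs (g1 x) <= 2" for x using hat1_props(3,4)[of "2^n * x - k - 1"] hat1_props(3,4)[of "2^n * x - k"] by (auto simp: g1_def abs_le_iff)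
 have gb: "abs (g x) <= 2/2^n" for x using hat2_step[of "2^n * x - k"] by (simp add: g_def abs_mult divide_right_mono)
 have e0: "0 < eps" by (rule less_le_trans[OF _ eps]) simp
 obtain I where I: "SI M G B (%t w. g1 (B t w)) I"
  "AE w in M. ALL t>=0. g (B t w) - g (B 0 w) = I t w + 1/2 * integral {0..t} (%s. g2 (B s w))" by (rule ito[OF g g1 g2c])
 define p q where "p = (real_of_int k - 1)/2^n" and "q = (real_of_int k + 2)/2^n"
 have qp: "q - p = 3/2^n" by (simp add: p_def q_def diff_divide_distrib[symmetric])
 define h where "h x = (g1 x)^2/4" for x
 have "(g1 x)^2 <= 2^2" for x using g1b[of x] by (simp only: abs_le_square_iff[symmetric])
 hence h1: "h x <= 1" for x by (simp add: h_def)
 have h0: "h x = 0" if "x < p \<or> q < x" for x proof -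
  have "2^n * x - k <= -1 \<or> 2 <= 2^n * x - k" using that by (auto simp: p_def q_def field_simps)
  thus ?thesis by (auto simp: h_def g1_def hat1_props)
 qed
 note O = occupation_L2[of h p q T, OF _ _ h1 h0 _ T, unfolded qp]
 have O2: "(LINT w|M. (integral {0..T} (%s. h (B s w)))^2) <= 16*(3/2^n)^2 * T" by (rule O(2)) (auto simp: h_def p_def q_def divide_right_mono intro!: continuous_intros g1c)
 have "(LINT w|M. (integral {0..T} (%s. (g1 (B s w))^2))^2) = 16*(LINT w|M. (integral {0..T} (%s. h (B s w)))^2)" by (simp add: h_def power_divide)
 also have "... <= 16*(16*(3/2^n)^2 * T)" by (rule mult_left_mono[OF O2]) simp
 also have "... = 2304 * T/4^n" by (simp add: sq_eq power_mult_distrib[symmetric])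
 finally have V: "(LINT w|M. (integral {0..T} (%s. (g1 (B s w))^2))^2) <= 2304 * T/4^n" .
 show ?thesis proof (rule that)
  let ?A = "exc M T (eps/2) I"
  have "cadapt M G I" using I(1) by (simp add: SI_def)
  from exc_cont_meas[OF filt this ca_zero[OF filt], where t=T and eps="eps/2"]
  show "?A : sets M" unfolding diff_zero .
  have "prob ?A <= 576*(LINT w|M. (integral {0..T} (%s. (g1 (B s w))^2))^2)/(eps/2)^4" by (rule function_integral_maximal[OF g1c g1b T I(1)]) (use e0 in simp)
  also have "... <= 576*(2304 * T/4^n)/(eps/2)^4" by (intro divide_right_mono mult_left_mono V) auto
  \<comment> \<open>The constant is 576 * 2304 * 2^4, where 2304 = 16 * 16 * 9 came from the
    occupation bound for length \<open>3/2^n\<close>.\<close>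
  also have "... = 21233664 * T/4^n/eps^4" by (simp add: power_divide)
  finally show "prob ?A <= 21233664 * T/4^n/eps^4" .
  show "AE w in M. w ~: ?A --> (ALL t:{0..T}. abs (cell (%s. B s w) n t (k+1) - cell (%s. B s w) n t k) <= eps)" using I(2) B_continuous AE_space
  proof (eventually_elim, intro impI ballI)
  fix w t assume a: "ALL t>=0. g (B t w) - g (B 0 w) = I t w + 1/2 * integral {0..t} (%s. g2 (B s w))" "cont0 (%t. B t w)"
  "w : space M" "w ~: ?A" "t : {0..T}"
  have "cell (%s. B s w) n t (k+1) - cell (%s. B s w) n t k = integral {0..t} (%s. 1/2 * g2 (B s w))" unfolding cell_def
  by (subst Henstock_Kurzweil_Integration.integral_diff[symmetric])
  (rule int_cont[OF cell_continuous[OF a(2)]], rule int_cont[OF cell_continuous[OF a(2)]],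
  auto intro!: integral_cong simp: g2_def algebra_simps)
  also have "... = g (B t w) - g (B 0 w) - I t w" using a(1)[rule_format, of t] a(5) by simp
  finally have e: "cell (%s. B s w) n t (k+1) - cell (%s. B s w) n t k = g (B t w) - g (B 0 w) - I t w" .
  have "abs (I t w) <= eps/2" using a(3,4,5) by force
  thus "abs (cell (%s. B s w) n t (k+1) - cell (%s. B s w) n t k) <= eps" unfolding e using gb[of "B t w"] gb[of "B 0 w"] eps by linarith
  qed qed qed

theorem local_time_density: "AE w in M. continuous_occupation_density (%s. B s w) (local_time_of B w)"
proof -
 \<comment> \<open>A ratio below 1 whose fourth power exceeds 1/2, so that \<open>n * 2^n\<close>
   cells times \<open>n/4^n/(rh^n)^4\<close> is summable; it then also dominates
   \<open>8/2^n\<close> eventually.\<close>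
 define rh :: real where "rh = 9/10"
 let ?K = "%n. {- int (n*2^n)..int (n*2^n)}"
 let ?P = "%n k w. ALL t:{0..real n}. abs (cell (%s. B s w) n t (k+1) - cell (%s. B s w) n t k) <= rh^n"
 have "EV n. 8 <= (9/5::real)^n" by real_asymp
 hence "EV n. 8/2^n <= rh^n" by eventually_elim (simp add: rh_def pos_divide_le_eq power_mult_distrib[symmetric])
 then obtain n0 where n0: "!!n. n0 <= n ==> 8/2^n <= rh^n" unfolding ev_seq by blast
 have "EX A. ALL n k. A n k : sets M & (n0 <= n --> prob (A n k) <= 21233664 * real n/4^n/(rh^n)^4 & (AE w in M. w ~: A n k --> ?P n k w))"
 proof (intro choice allI)
  fix n k
  show "EX A. A : sets M & (n0 <= n --> prob A <= 21233664 * real n/4^n/(rh^n)^4 & (AE w in M. w ~: A --> ?P n k w))"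
  proof (cases "n0 <= n") case True
  show ?thesis by (rule cell_oscillation[OF of_nat_0_le_iff[of n] n0[OF True], of k]) blast
  qed auto
 qed
 then obtain A where A: "!!n k. A n k : sets M" "!!n k. n0 <= n ==> prob (A n k) <= 21233664 * real n/4^n/(rh^n)^4"
  "!!n k. n0 <= n ==> AE w in M. w ~: A n k --> ?P n k w" by blast
 define E where "E n = (UN k:?K n. A n k)" for n
 have Em: "E n : sets M" for n unfolding E_def using A(1) by auto
 have "AE w in M. EV n. w : space M - E n" proof (rule borel_cantelli_AE1)
  show "summable (%n. prob (E n))" proof (rule summable_comparison_test_ev)
  \<comment> \<open>The decay rate is 5000/6561; weakening it to 4/5 leaves the factor 6561/6250
    above 1, which swallows the polynomial.\<close>
  have "EV n. (2 * real n + 1)*(21233664 * real n) <= (6561/6250)^n" by real_asymp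
  hence "EV n. (2*(real n*2^n) + 1)*(21233664 * real n/4^n/(rh^n)^4) <= (4/5)^n" proof eventually_elim
  case (elim n)
  have r4: "(rh^n)^4 = (6561/10000)^n" by (simp add: rh_def power_mult[symmetric] mult.commute[of n] power_mult power_divide)
  have "(2*(real n*2^n) + 1)*(21233664 * real n/4^n/(rh^n)^4) <= ((2 * real n + 1)*2^n)*(21233664 * real n/4^n/(rh^n)^4)"
  by (intro mult_right_mono) (simp_all add: algebra_simps rh_def)
  also have "... = ((2 * real n + 1)*(21233664 * real n))*(2^n/4^n/(6561/10000)^n)" by (simp add: r4)
  also have "... <= (6561/6250)^n*(2^n/4^n/(6561/10000)^n)" by (intro mult_right_mono elim) simp
  also have "... = (4/5)^n" by (simp add: power_divide[symmetric] power_mult_distrib[symmetric])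
  finally show ?case .
  qed
  thus "EV n. norm (prob (E n)) <= (4/5)^n" using eventually_ge_at_top[of n0] proof eventually_elim
  case (elim n)
  have "prob (E n) <= (SUM k:?K n. prob (A n k))" unfolding E_def by (rule measure_UNION_le) (use A(1) in auto)
  also have "... <= (SUM k:?K n. 21233664 * real n/4^n/(rh^n)^4)" by (rule sum_mono) (rule A(2)[OF elim(2)])
  also have "... = (2*(real n*2^n) + 1)*(21233664 * real n/4^n/(rh^n)^4)" by (simp add: nat_add_distrib nat_mult_distrib)
  finally show ?case using elim(1) by simp
  qed
  qed (simp add: summable_geometric)
 qed (use Em in "auto simp: emeasure_eq_measure")
 moreover have "AE w in M. ALL n k. n0 <= n --> w ~: A n k --> ?P n k w" unfolding AE_all_countable using A(3) by (intro allI) (rule AE_impI, blast)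
 ultimately show ?thesis using B_continuous proof eventually_elim case (elim w)
  have "EX l. continuous_occupation_density (%s. B s w) l"
  proof (rule occupation_density_exists[OF elim(3), where rh=rh])
  show "EV n. ALL t:{0..real n}. ALL k. abs (real_of_int k) <= real (n*2^n) --> abs (cell (%s. B s w) n t (k+1) - cell (%s. B s w) n t k) <= rh^n"
  using elim(1) eventually_ge_at_top[of n0] proof (eventually_elim, intro ballI allI impI)
  fix n t k assume n: "w : space M - E n" "n0 <= n" and t: "t : {0..real n}" and k: "abs (real_of_int k) <= real (n*2^n)"
  have "k : ?K n" using k unfolding atLeastAtMost_iff by linarith
  hence "w ~: A n k" using n(1) by (auto simp: E_def)
  thus "abs (cell (%s. B s w) n t (k+1) - cell (%s. B s w) n t k) <= rh^n" using elim(2) n(2) t by blast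
  qed
  qed (simp_all add: rh_def)
  thus ?case unfolding local_time_def by (rule someI_ex)
 qed qed

end

section \<open>Recurrence of Brownian motion\<close>

text \<open>Infinite occupation time near the origin, with a tent in place of an interval to keep
  the integrands continuous. The width is left free so that the property survives bounded shifts of
  the path.\<close>

definition recurrent :: "(real => real) => bool" where
 "recurrent b = ((EX K::nat. ALL N::nat. EX T::nat. real N <= integral {0..real T} (%s. hat (b s/real (Suc K)))))"

text \<open>A tent at least twice as wide as the old one plus the shift is at least 1/2 wherever the
  old tent is nonzero, and a delay in time costs a bounded amount of occupation.\<close>

lemma recurrent_shift:
 fixes b :: "real => real"
 assumes b: "cont0 b" and c: "cont0 c" and n: "0 <= (n::real)" "0 <= n'" and bc: "!!s. 0 <= s ==> abs (c (n' + s) - b (n + s)) <= d" and r: "recurrent b"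
 shows "recurrent c"
proof -
 obtain K where K: "!!N. EX T::nat. real N <= integral {0..real T} (%s. hat (b s/real (Suc K)))" using r by (auto simp: recurrent_def)
 have d0: "0 <= d" using order_trans[OF abs_ge_zero bc[of 0]] by simp
 define K' where "K' = nat \<lceil>2*(real (Suc K) + d)\<rceil>"
 have K': "2*(real (Suc K) + d) <= real (Suc K')" using d0 unfolding K'_def by linarith
 have comp: "hat (x/real (Suc K)) <= 2 * hat (y/real (Suc K'))" if "abs (y - x) <= d" for x y
 proof (cases "abs x < real (Suc K)") case True
  hence "abs y*2 <= real (Suc K')" using that K' by argo
  hence "abs y/real (Suc K') <= 1/2" by (simp add: divide_le_eq del: of_nat_Suc)
  hence "1/2 <= hat (y/real (Suc K'))" by (simp add: hat_def abs_divide)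
  thus ?thesis using hat_props(2)[of "x/real (Suc K)"] by simp
 next case False
  hence "1 <= abs (x/real (Suc K))" by (simp add: abs_divide le_divide_eq del: of_nat_Suc)
  thus ?thesis using hat_props(1) by (simp add: hat_props(3))
 qed
 have cont: "continuous_on {u..v} (%s. hat (f s/real (Suc k)))" if "cont0 f" "0 <= u" for f :: "real => real" and u v k
  by (intro continuous_intros cont_subset[OF that(1)]) (use that(2) in "auto intro: order_trans")
 note int = int_cont[OF cont]
 show ?thesis unfolding recurrent_def proof (rule exI[of _ K'], rule allI)
  fix N :: nat
  obtain T :: nat where T: "real (2 * N + nat \<lceil>n\<rceil>) <= integral {0..real T} (%s. hat (b s/real (Suc K)))" using K by blast
  let ?fb = "%s. hat (b s/real (Suc K))" and ?fc = "%s. hat (c s/real (Suc K'))"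
  have T1: "n <= real T + n" "0 <= real T + n" using n by auto
  have "integral {0..real T} ?fb <= integral {0..real T + n} ?fb"
  by (rule integral_subset_le[OF _ int[OF b order_refl] int[OF b order_refl]]) (use n hat_props(1) in auto)
  also have "... = integral {0..n} ?fb + integral {n..real T + n} ?fb"
  by (rule Henstock_Kurzweil_Integration.integral_combine[OF n(1) T1(1), symmetric]) (rule int[OF b order_refl])
  also have "integral {0..n} ?fb <= real (nat \<lceil>n\<rceil>)" proof -
  have "norm (integral {0..n} ?fb) <= 1*(n - 0)" by (rule integral_bound[OF n(1) cont[OF b order_refl]]) (use hat_props(1,2) in auto)
  thus ?thesis by simp linarith
  qed
  also have "integral {n..real T + n} ?fb = integral {0..real T} (%s. ?fb (s + n))" using integral_shift[of 0 n "real T" ?fb] cont[OF b n(1)] by (simp add: comp_def)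
  also have "... <= integral {0..real T} (%s. 2 * ?fc (s + n'))" proof (rule integral_le)
  show "(%s. ?fb (s + n)) integrable_on {0..real T}" "(%s. 2 * ?fc (s + n')) integrable_on {0..real T}"
  by (intro int_cont continuous_intros cont_comp2[OF b] cont_comp2[OF c], use n in auto)+
  show "?fb (s + n) <= 2 * ?fc (s + n')" if "s : {0..real T}" for s using comp[OF bc[of s]] that by (simp add: add.commute)
  qed
  also have "... = 2 * integral {n'..real T + n'} ?fc" using integral_shift[of 0 n' "real T" ?fc] cont[OF c n(2)] by (simp add: comp_def)
  also have "integral {n'..real T + n'} ?fc <= integral {0..real (T + nat \<lceil>n'\<rceil>)} ?fc"
  proof (rule integral_subset_le[OF _ int[OF c n(2)] int[OF c order_refl]])
  have "real T + n' <= real (T + nat \<lceil>n'\<rceil>)" by (simp add: of_nat_ceiling)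
  thus "{n'..real T + n'} <= {0..real (T + nat \<lceil>n'\<rceil>)}" using n(2) by auto
  qed (use hat_props(1) in auto)
  finally have "real N <= integral {0..real (T + nat \<lceil>n'\<rceil>)} ?fc" using T by simp
  thus "EX T::nat. real N <= integral {0..real T} ?fc" by blast
 qed qed

text \<open>Riemann sums make the event measurable for the sigma-algebra of the process itself, without completion.\<close>

definition rec_event :: "'a measure => (real => 'a => real) => 'a set" where
 "rec_event M Y = {w : space M. EX K::nat. ALL N::nat. EX T::nat. real N <=
  lim (%n. SUM i<n*2^n. hat (Y (dy n i) w/real (Suc K))*(inc (%s. s) (dy n) i T))}"

lemma rec_event_sets: "rec_event M Y : sets (psigma M {0..} Y)"
proof -
 let ?G = "psigma M {0..} Y"
 have sp: "space ?G = space M" by (rule space_process_sigma)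
 have [measurable]: "hat : bor borel" by (rule borel_measurable_continuous_onI) (intro continuous_intros)
 have [measurable]: "Y (dy n i) : bor ?G" for i n :: nat by (rule psigma_meas) simp
 have [measurable]: "(%w. lim (%n. SUM i<n*2^n. hat (Y (dy n i) w/real (Suc K))*(inc (%s. s) (dy n) i T))) : bor ?G" for K T :: nat
  by (intro borel_measurable_lim_metric) measurable
 have "rec_event M Y = {w : space ?G. EX K::nat. ALL N::nat. EX T::nat. real N <=
  lim (%n. SUM i<n*2^n. hat (Y (dy n i) w/real (Suc K))*(inc (%s. s) (dy n) i T))}" by (simp only: rec_event_def sp)
 also have "... : sets ?G" by measurable
 finally show ?thesis .
qed

lemma rec_event_iff:
 assumes "w : space M" and c: "cont0 (%s. Y s w)"
 shows "w : rec_event M Y \<longleftrightarrow> recurrent (%s. Y s w)"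
proof -
 have "lim (%n. SUM i<n*2^n. hat (Y (dy n i) w/real (Suc K))*(inc (%s. s) (dy n) i T))
  = integral {0..real T} (%s. hat (Y s w/real (Suc K)))" for K T :: nat proof (rule limI)
  have "cont0 (%s. hat (Y s w/real (Suc K)))" by (intro continuous_intros c) auto
  thus "(%n. SUM i<n*2^n. hat (Y (dy n i) w/real (Suc K))*(inc (%s. s) (dy n) i T)) ---> integral {0..real T} (%s. hat (Y s w/real (Suc K)))"
  by (intro dyadic_riemann[where a="%s. s" and N="%n. n" and hn="%_ s. hat (Y s w/real (Suc K))"])
  (auto simp: mono_on_def strict_mono_def upath_def uniform_limit_iff)
 qed
 thus ?thesis using assms(1) by (simp only: rec_event_def recurrent_def mem_Collect_eq) simp
qed

context prob_space
begin

text \<open>Integrate the bound of \<open>A\<close> by \<open>a/2 + A^2/(2 * l)\<close>, plus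
  \<open>l/2\<close> on the event; \<open>l = 2 * S/a\<close> makes the quadratic term contribute at
  most \<open>a/4\<close>.\<close>

lemma paley_zygmund:
 fixes A :: "'a => real"
 assumes [measurable]: "A : bor M" and i2: "integrable M (%w. (A w)^2)" and S: "(LINT w|M. (A w)^2) <= S" and a: "0 < a" "a <= (LINT w|M. A w)" and S0: "0 < S"
 shows "a^2/(4 * S) <= prob {w : space M. a/2 <= A w}"
proof -
 let ?E = "{w : space M. a/2 <= A w}" and ?P = "prob {w : space M. a/2 <= A w}"
 define l where "l = 2 * S/a"
 have l: "0 < l" using S0 a by (simp add: l_def)
 have i1: "integrable M A" using square_integrable_imp_integrable[OF _ i2] by simp
 have pt: "A w <= a/2 + (1/(2 * l)*(A w)^2 + l/2 * indicator ?E w)" if "w : space M" for w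
 proof (cases "a/2 <= A w") case True
  have "0 <= (A w - l)^2/(2 * l)" using l by simp
  also have "... = 1/(2 * l)*(A w)^2 + l/2 - A w" using l by (simp add: sq_eq field_simps)
  finally show ?thesis using True that a by simp
 next case False
  have "0 <= 1/(2 * l)*(A w)^2" using l by simp
  thus ?thesis using False by simp
 qed
 have "a <= (LINT w|M. A w)" by (rule a)
 also have "... <= (LINT w|M. a/2 + (1/(2 * l)*(A w)^2 + l/2 * indicator ?E w))"
 proof (rule integral_mono[OF i1 _ pt])
  show "integrable M (%w. a/2 + (1/(2 * l)*(A w)^2 + l/2 * indicator ?E w))"
  by (intro b_int_add integrable_mult_right i2 integrable_const integrable_real_indicator) (simp_all add: emeasure_eq_measure)
 qed
 also have "... = a/2 + (1/(2 * l)*(LINT w|M. (A w)^2) + l/2 * ?P)" proof -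
  have "integrable M (%w. 1/(2 * l)*(A w)^2)" "integrable M (%w. l/2 * indicator ?E w :: real)"
  by (intro integrable_mult_right i2 integrable_real_indicator; simp add: emeasure_eq_measure)+
  thus ?thesis by (subst b_add, simp, simp, subst b_add, simp, simp) (simp add: prob_space)
 qed
 also have "... <= a/2 + (1/(2 * l) * S + l/2 * ?P)" using S l by (intro add_mono mult_left_mono) auto
 also have "1/(2 * l) * S = a/4" using a S0 by (simp add: l_def)
 finally have "a <= a/2 + (a/4 + l/2 * ?P)" .
 hence "a/4 <= l/2 * ?P" by argo
 moreover have "l/2 = S/a" by (simp add: l_def)
 ultimately have "a/4 <= S/a * ?P" by metis
 hence "a/(4 * S)*(a/4) <= a/(4 * S)*(S/a * ?P)" by (rule mult_left_mono) (use a S0 in simp)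
 thus ?thesis using a S0 by (simp add: sq_eq)
qed

end

text \<open>\<open>hat2\<close> is a smooth majorant of the positive part: it is 0 far to the left,
  the identity far to the right, and its slope lies between 0 and 1.\<close>

lemma hat2_ge: "max 0 x <= hat2 x" and hat2_0: "hat2 0 = 1/6"
proof -
 show "hat2 0 = 1/6" by (simp add: hat2_def)
 have "hat2 (min x (-1)) <= hat2 x" by (rule DERIV_nonneg_imp_nondecreasing[where f=hat2]) (use hat2_derivative hat1_props(3) in "auto intro!: exI")
 moreover have "hat2 (min x (-1)) = 0" by (simp add: hat2_def)
 moreover have "hat2 (max x 1) - max x 1 <= hat2 x - x"
 proof (rule DERIV_nonpos_imp_nonincreasing[where f="%x. hat2 x - x"])
  fix z show "EX y. ((%x. hat2 x - x) hasD y) (at z) & y <= 0"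
  by (intro exI[of _ "hat1 z - 1"] conjI DERIV_diff hat2_derivative DERIV_ident) (use hat1_props(4)[of z] in simp)
 qed simp
 moreover have "hat2 (max x 1) = max x 1" proof -
  have "hat2 y = y" if "1 <= y" for y using that by (simp add: hat2_def power3_eq_cube algebra_simps)
  thus ?thesis by simp
 qed
 ultimately show "max 0 x <= hat2 x" by simp
qed

context full_bm
begin

text \<open>A smoothed Tanaka formula: the mean occupation is the mean of
  \<open>2 * hat2 (B T)\<close> minus 1/3, hence at least the mean of \<open>abs (B T)\<close> minus
  1/3. The latter mean is bounded below through the second and fourth Gaussian moments.\<close>

lemma occupation_expectation:
 assumes T: "100 <= T"
 shows "sqrt T/6 <= (LINT w|M. integral {0..T} (%s. hat (B s w)))"
proof -
 have T0: "0 <= T" "0 < T" using T by auto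
 define Z where "Z w = B T w - B 0 w" for w
 have "distributed M lborel Z (normal_density 0 (sqrt T))" unfolding Z_def using bm_facts(7)[OF bmG, of 0 T] T0 by simp
 note N = normal_moments[OF this real_sqrt_gt_zero[OF T0(2)]]
 have i4: "integrable M (%w. Z w^4)" and i2: "integrable M (%w. (Z w)^2)" and i1: "integrable M Z" using N(1)[of 4] N(1)[of 2] N(1)[of 1] by auto
 have "(sqrt T)^4 = ((sqrt T)^2)^2" by (simp only: power_mult[symmetric]) simp
 hence m: "(LINT w|M. Z w) = 0" "(LINT w|M. (Z w)^2) = T" "(LINT w|M. Z w^4) = 3 * T^2" using N(2,3,4) T0 by auto
 \<comment> \<open>This choice makes the fourth moment term \<open>3 * T^2/a^2\<close> equal to
   \<open>T/2\<close>, half of the second moment.\<close>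
 define a where "a = sqrt (6 * T)"
 have a: "0 < a" "a^2 = 6 * T" using T0 by (auto simp: a_def)
 have pt: "(Z w)^2 <= a*abs (Z w) + Z w^4/a^2" for w proof (cases "abs (Z w) <= a") case True
  hence "abs (Z w)*abs (Z w) <= a*abs (Z w)" by (intro mult_right_mono) auto
  hence "(Z w)^2 <= a*abs (Z w)" by (simp add: sq_eq)
  thus ?thesis by (rule add_increasing2[rotated]) simp
 next case False
  hence "a^2 <= (Z w)^2" using a(1) power_mono[of a "abs (Z w)" 2] by simp
  hence "a^2*(Z w)^2 <= (Z w)^2*(Z w)^2" by (rule mult_right_mono) simp
  hence "(Z w)^2 <= Z w^4/a^2" using a(1) by (simp add: field_simps sq_eq power4_eq_xxxx)
  thus ?thesis using a(1) by (simp add: add_increasing)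
 qed
 have "T <= (LINT w|M. a*abs (Z w) + Z w^4/a^2)" unfolding m(2)[symmetric] by (rule integral_mono[OF i2 _ pt]) (use i1 i4 in auto)
 also have "... = a*(LINT w|M. abs (Z w)) + 3 * T^2/a^2" using i1 i4 m(3) by simp
 also have "3 * T^2/a^2 = T/2" unfolding a(2) using T0 by (simp add: sq_eq)
 finally have "T/2 <= a*(LINT w|M. abs (Z w))" by simp
 also have "a = sqrt 6 * sqrt T" by (simp add: a_def real_sqrt_mult)
 finally have "sqrt T * sqrt T <= (2 * sqrt 6*(LINT w|M. abs (Z w))) * sqrt T" using T0 by (simp add: algebra_simps)
 hence "sqrt T <= 2 * sqrt 6*(LINT w|M. abs (Z w))" using T0 by (simp only: mult_le_cancel_right_pos real_sqrt_gt_zero)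
 also have "... <= 5*(LINT w|M. abs (Z w))" proof (rule mult_right_mono)
  have "sqrt 6 <= sqrt ((5/2)^2)" by (simp only: real_sqrt_le_iff) (simp add: sq_eq)
  thus "2 * sqrt 6 <= 5" by simp
 qed simp
 finally have EZ: "sqrt T/5 <= (LINT w|M. abs (Z w))" by simp
 obtain I where I: "SI M G B (%t w. hat1 (B t w)) I"
  "AE w in M. ALL t>=0. hat2 (B t w) - hat2 (B 0 w) = I t w + 1/2 * integral {0..t} (%s. hat (B s w))"
  by (rule ito[OF hat2_derivative hat1_derivative]) (auto intro!: continuous_intros)
 have h1c: "continuous_on UNIV hat1" using hat1_derivative by (meson DERIV_isCont isCont_cont)
 have h1b: "abs (hat1 x) <= 1" for x using hat1_props(3,4)[of x] by simp
 note L = function_integral_L2[OF h1c h1b T0(1) I(1)]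
 have "good_pair M (%w. indicator (space M) w*(I T w - I 0 w)) (%w. indicator (space M) w*(integral {0..T} (%s. (hat1 (B s w))^2) - integral {0..0} (%s. (hat1 (B s w))^2)))"
  by (rule good_pair_integral[where H="%t w. hat1 (B t w)", OF SI'[OF h1c h1b T0(1) I(1)] h1b function_integrand[OF h1c h1b T0(1) I(1)]])
  (use T0 sets.top[of "G 0"] in "auto simp: spaceG")
 hence "(LINT w|M. indicator (space M) w*(I T w - I 0 w)) = 0" by (simp add: good_pair_def)
 moreover have "(LINT w|M. indicator (space M) w*(I T w - I 0 w)) = (LINT w|M. I T w - I 0 w)" by (rule b_cong) auto
 ultimately have EI: "(LINT w|M. I T w - I 0 w) = 0" by simp
 have Ica: "cadapt M G I" using I(1) by (simp add: SI_def)
 have "I t : bor M" if "0 <= t" for t by (rule F_meas_M[OF that]) (use Ica that in "simp add: ca_def")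
 hence Ii: "integrable M (%w. I T w - I 0 w)" using square_integrable_imp_integrable[OF _ L(1)] T0 by simp
 let ?J = "%w. integral {0..T} (%s. hat (B s w))"
 have hc: "continuous_on UNIV hat" by (intro continuous_intros)
 have O: "integrable M (%w. (?J w)^2)" by (rule occupation_L2[of hat "-1" 1, OF hc _ _ _ _ T0(1)]) (auto simp: hat_props)
 have "?J : bor M" by (rule F_meas_M[OF T0(1) integral_meas[OF hc T0(1)]])
 hence Ji: "integrable M ?J" by (rule square_integrable_imp_integrable[OF _ O])
 have low: "AE w in M. Z w + abs (Z w) - 1/3 - 2*(I T w - I 0 w) <= ?J w" using I(2) bm_facts(5)[OF bmG]
 proof eventually_elim case (elim w)
  have "hat2 (Z w) - 1/6 = I T w - I 0 w + 1/2 * ?J w" using elim(1)[rule_format, of T] elim(1)[rule_format, of 0] T0 by (simp add: Z_def elim(2) hat2_0)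
  moreover have "Z w + abs (Z w) <= 2 * hat2 (Z w)" using hat2_ge[of "Z w"] by (simp add: max_def split: if_splits)
  ultimately show ?case by argo
 qed
 have "(LINT w|M. abs (Z w)) - 1/3 = (LINT w|M. Z w + abs (Z w) - 1/3 - 2*(I T w - I 0 w))" proof -
  have "(LINT w|M. Z w + abs (Z w) - 1/3 - 2*(I T w - I 0 w)) = (LINT w|M. Z w + abs (Z w) - 1/3) - 2*(LINT w|M. I T w - I 0 w)"
  unfolding integral_mult_right_zero[symmetric] by (rule b_diff) (intro b_int_diff b_int_add integrable_const integrable_abs integrable_mult_right i1 Ii)+
  thus ?thesis using i1 by (simp add: m(1) EI prob_space)
 qed
 also have "... <= (LINT w|M. ?J w)" by (rule integral_mono_AE[OF _ Ji low]) (intro b_int_diff b_int_add integrable_const integrable_abs integrable_mult_right i1 Ii)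
 finally have "sqrt T/5 - 1/3 <= (LINT w|M. ?J w)" using EZ by simp
 \<comment> \<open>\<open>sqrt T/5 - 1/3\<close> is at least \<open>sqrt T/6\<close> exactly when
   \<open>sqrt T\<close> is at least 10.\<close>
 moreover have "10 <= sqrt T" using real_le_rsqrt[of 10 T] T by simp
 ultimately show ?thesis by linarith
qed

text \<open>Squared mean and second moment of the occupation are of the same order in
  \<open>T\<close>, so Paley-Zygmund bounds the probability of a large occupation from below
  uniformly, by \<open>(T/36)/(4 * 64 * T) = 1/9216\<close>. The bound survives the decreasing limit
  over \<open>N\<close>.\<close>

lemma recurrence_positive: "1/9216 <= prob (rec_event M B)"
proof -
 define A where "A N = {w : space M. EX T::nat. real N <= integral {0..real T} (%s. hat (B s w))}" for N :: nat
 have hc: "continuous_on UNIV hat" by (intro continuous_intros)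
 have Jm[measurable]: "(%w. integral {0..T} (%s. hat (B s w))) : bor M" if "0 <= T" for T by (rule F_meas_M[OF that integral_meas[OF hc that]])
 have Am: "A N : sets M" for N unfolding A_def by measurable
 have lb: "1/9216 <= prob (A N)" for N proof -
  \<comment> \<open>\<open>sqrt T/12\<close> has to reach \<open>N\<close> and \<open>T\<close> has
    to reach 100; the square makes the root an integer.\<close>
  define T where "T = (12 * N + 10)^2"
  have T: "100 <= real T" "0 <= real T" proof -
  have "(10::real)^2 <= (real (12 * N + 10))^2" by (rule power_mono) auto
  thus "100 <= real T" by (simp add: T_def)
  qed simp
  have s: "sqrt (real T) = real (12 * N + 10)" by (simp add: T_def)
  let ?J = "%w. integral {0..real T} (%s. hat (B s w))"
  have O: "integrable M (%w. (?J w)^2)" "(LINT w|M. (?J w)^2) <= 16*(1 - -1)^2 * real T" by (rule occupation_L2[of hat "-1" 1 "real T", OF hc]; auto simp: hat_props)+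
  have "(sqrt (real T)/6)^2/(4*(16*(1 - -1)^2 * real T)) <= prob {w : space M. (sqrt (real T)/6)/2 <= ?J w}"
  by (rule paley_zygmund[OF Jm O _ occupation_expectation[OF T(1)]]) (use T in auto)
  moreover have "(sqrt (real T)/6)^2/(4*(16*(1 - -1)^2 * real T)) = 1/9216" using T by (simp add: power_divide real_sqrt_pow2)
  moreover have "prob {w : space M. (sqrt (real T)/6)/2 <= ?J w} <= prob (A N)"
  proof (rule finite_measure_mono[OF subsetI Am])
  fix w assume ww: "w : {w : space M. (sqrt (real T)/6)/2 <= ?J w}"
  hence "real N <= ?J w" unfolding s by simp
  thus "w : A N" using ww unfolding A_def by blast
  qed
  ultimately show ?thesis by linarith
 qed
 have "decseq A" unfolding decseq_def proof (intro allI impI subsetI)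
  fix m n w assume mn: "m <= n" and "w : A n"
  then obtain T :: nat where T: "w : space M" "real n <= integral {0..real T} (%s. hat (B s w))" unfolding A_def by blast
  hence "real m <= integral {0..real T} (%s. hat (B s w))" using mn by linarith
  thus "w : A m" unfolding A_def using T(1) by blast
 qed
 hence "(%N. prob (A N)) ---> prob (INT N. A N)" by (intro finite_Lim_measure_decseq) (use Am in auto)
 hence "1/9216 <= prob (INT N. A N)" by (rule LIMSEQ_le_const) (use lb in blast)
 also have "... <= prob (rec_event M B)" proof (rule finite_measure_mono_AE)
  show "AE w in M. w : (INT N. A N) --> w : rec_event M B" using B_continuous AE_space proof eventually_elim
  case (elim w)
  show ?case unfolding rec_event_iff[where Y=B, OF elim(2,1)] recurrent_def by (intro impI exI[of _ 0]) (auto simp: A_def)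
  qed
  have "subalgebra M (psigma M {0..} B)" by (rule psigma_subalg) (use bm_facts(9)[OF bmG] in simp)
  thus "rec_event M B : sets M" using rec_event_sets[of M B] by (auto simp: subalgebra_def)
 qed
 finally show ?thesis .
qed

text \<open>A zero-one law: up to null sets the event does not change when the path is restarted at
  any time \<open>n\<close>, so it is independent of every \<open>G n\<close>. These generate the
  path, hence the event is independent of itself, and it has positive probability.\<close>

theorem recurrence: "AE w in M. recurrent (%s. B s w)"
proof -
 let ?E = "rec_event M B"
 have sB: "subalgebra M (psigma M {0..} B)" by (rule psigma_subalg) (use bm_facts(9)[OF bmG] in simp)
 have Em: "?E : sets M" using rec_event_sets[of M B] sB by (auto simp: subalgebra_def)
 have ind: "prob (D Int ?E) = prob D * prob ?E" if D: "D : sets (G (real n))" for D n proof -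
  define Y where "Y u w = B (real n + u) w - B (real n) w" for u w
  have sY: "subalgebra M (psigma M {0..} Y)" by (rule psigma_subalg) (use bm_facts(9)[OF bmG] in "auto simp: Y_def[abs_def]")
  have EY: "rec_event M Y : sets M" using rec_event_sets[of M Y] sY by (auto simp: subalgebra_def)
  have Dm: "D : sets M" using D full_algD(4)[OF fullG[of "real n"]] by (auto simp: subalgebra_def)
  have eq: "AE w in M. w : ?E \<longleftrightarrow> w : rec_event M Y" using B_continuous AE_space
  proof eventually_elim case (elim w)
  have Yc: "cont0 (%s. Y s w)" unfolding Y_def by (intro continuous_intros cont_comp2[OF elim(1)]) auto
  have "recurrent (%s. B s w) \<longleftrightarrow> recurrent (%s. Y s w)"
  using recurrent_shift[OF elim(1) Yc, of "real n" 0 "abs (B (real n) w)"] recurrent_shift[OF Yc elim(1), of 0 "real n" "abs (B (real n) w)"] by (auto simp: Y_def)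
  thus ?case using rec_event_iff[where Y=B, OF elim(2,1)] rec_event_iff[where Y=Y, OF elim(2) Yc] by simp
  qed
  have "indep_set (sets (G (real n))) (sets (psigma M {0..} Y))" unfolding Y_def[abs_def] by (rule bm_future_indep[OF bmG]) simp
  hence "prob (D Int rec_event M Y) = prob D * prob (rec_event M Y)" by (rule indep_setD) (rule D, rule rec_event_sets)
  moreover have "prob (D Int rec_event M Y) = prob (D Int ?E)" by (rule finite_measure_eq_AE) (use eq Dm Em EY in auto)
  moreover have "prob (rec_event M Y) = prob ?E" by (rule finite_measure_eq_AE) (use eq Em EY in auto)
  ultimately show ?thesis by simp
 qed
 let ?P = "UN n. sets (G (real n))"
 have "indep_set ?P {?E}" proof (rule indep_setI)
  show "?P <= events" proof (rule UN_least)
  fix n show "sets (G (real n)) <= events" using full_algD(4)[OF fullG[of "real n"]] by (simp add: subalgebra_def)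
  qed
 qed (use ind Em in auto)
 moreover have "Int_stable ?P" proof (rule Int_stableI, safe)
  fix a b :: "'a set" and m n :: nat assume "a : sets (G (real m))" "b : sets (G (real n))"
  hence "a : sets (G (real (max m n)))" "b : sets (G (real (max m n)))" using Gmono[of "real m" "real (max m n)"] Gmono[of "real n" "real (max m n)"] by auto
  thus "a Int b : ?P" by blast
 qed
 ultimately have i: "indep_set (sigma_sets (space M) ?P) (sigma_sets (space M) {?E})" by (rule indep_set_sigma_sets) (simp add: Int_stable_def)
 have sub: "?P <= Pow (space M)" proof (rule UN_least)
  fix n show "sets (G (real n)) <= Pow (space M)" using sets.space_closed[of "G (real n)"] by (simp add: spaceG)
 qed
 have "sets (psigma M {0..} B) <= sets (sigma (space M) ?P)" proof (rule psigma_subset)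
  fix t :: real assume t: "t : {0..}"
  let ?n = "nat \<lceil>t\<rceil>"
  have "B t : bor (G (real ?n))" by (rule bm_facts(8)[OF bmG]) (use t in auto)
  moreover have "subalgebra (sigma (space M) ?P) (G (real ?n))" unfolding subalgebra_def spaceG[OF of_nat_0_le_iff] space_measure_of[OF sub] sets_measure_of[OF sub]
  by (intro conjI refl subsetI sigma_sets.Basic UN_I[of ?n]) simp_all
  ultimately show "B t : bor (sigma (space M) ?P)" by (rule meas_subalg[rotated])
 qed (use sub in simp)
 hence "?E : sigma_sets (space M) ?P" using rec_event_sets[of M B] sets_measure_of[OF sub] by auto
 from indep_setD[OF i this sigma_sets.Basic[of ?E]] have "prob ?E = prob ?E * prob ?E" by simp
 hence "prob ?E = 1" using recurrence_positive by auto
 hence "AE w in M. w : ?E" by (rule prob_eq_1[OF Em, THEN iffD1])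
 thus ?thesis using B_continuous AE_space by eventually_elim (simp add: rec_event_iff)
qed

end

section \<open>Scale function and clock\<close>

text \<open>A positive continuous function is bounded below on the compact support of the tent.
  Applied to \<open>exp\<close> this gives the range of the scale function, applied to the square of
  \<open>h\<close> the range of the clock.\<close>

lemma recurrent_unbounded:
 fixes b ph :: "real => real"
 assumes r: "recurrent b" and b: "cont0 b" and p: "continuous_on UNIV ph" "!!x. 0 < ph x"
 shows "EX T>=0. c <= integral {0..T} (%s. ph (b s))"
proof -
 obtain K where K: "!!N. EX T::nat. real N <= integral {0..real T} (%s. hat (b s/real (Suc K)))" using r by (auto simp: recurrent_def)
 have "continuous_on {- real (Suc K)..real (Suc K)} ph" by (rule cont_subset[OF p(1)]) simp
 moreover have "{- real (Suc K)..real (Suc K)} ~= {}" by simp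
 ultimately obtain z where z: "!!x. x : {- real (Suc K)..real (Suc K)} ==> ph z <= ph x" using continuous_attains_inf[OF compact_Icc] by metis
 have le: "ph z * hat (x/real (Suc K)) <= ph x" for x proof (cases "abs x <= real (Suc K)") case True
  hence "ph z <= ph x" by (intro z) (auto simp: abs_le_iff)
  moreover have "ph z * hat (x/real (Suc K)) <= ph z*1" by (intro mult_left_mono hat_props) (use p(2)[of z] in simp)
  ultimately show ?thesis by simp
 next case False
  hence "1 <= abs (x/real (Suc K))" by (simp add: abs_divide le_divide_eq del: of_nat_Suc)
  thus ?thesis using p(2)[of x] by (simp add: hat_props(3))
 qed
 obtain T :: nat where T: "real (nat \<lceil>c/ph z\<rceil>) <= integral {0..real T} (%s. hat (b s/real (Suc K)))" using K by blast
 have b': "continuous_on {0..real T} b" by (rule cont_subset[OF b]) auto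
 have "c/ph z <= integral {0..real T} (%s. hat (b s/real (Suc K)))" using T by linarith
 hence "c <= ph z * integral {0..real T} (%s. hat (b s/real (Suc K)))" using p(2)[of z] by (simp add: pos_divide_le_eq mult.commute)
 also have "... = integral {0..real T} (%s. ph z * hat (b s/real (Suc K)))" by simp
 also have "... <= integral {0..real T} (%s. ph (b s))"
  by (rule integral_le) (use le in "auto intro!: int_cont continuous_intros b' cont_comp2[OF p(1) b'] simp del: of_nat_Suc")
 finally show ?thesis by (intro exI[of _ "real T"]) simp
qed

lemma LBINT_integral:
 fixes f :: "real => real"
 assumes "continuous_on {0..t} f" "0 <= t"
 shows "(LBINT s=0..ereal t. f s) = integral {0..t} f"
 using interval_integral_eq_integral[OF assms(2) borel_integrable_atLeastAtMost'[OF assms(1)]] by (simp add: zero_ereal_def)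

lemma integral_deriv:
 fixes f :: "real => real"
 assumes f: "cont0 f" and t: "0 < t"
 shows "((%t. integral {0..t} f) hasD f t) (at t)"
proof -
 have "continuous_on {0..t+1} f" by (rule cont_subset[OF f]) auto
 hence "((%t. integral {0..t} f) hasD f t) (at t within {0..t+1})" by (rule integral_has_real_derivative) (use t in auto)
 thus ?thesis using at_within_interior[of t "{0..t+1}"] t by simp
qed

text \<open>Recurrence of both halves of the environment makes the integral of \<open>exp\<close> of
  it diverge on either side, so that the scale function is onto.\<close>

locale environment =
 fixes ww :: "real => real"
 assumes wc: "continuous_on UNIV ww" and rec_pos: "recurrent ww" and rec_neg: "recurrent (%x. ww (- x))"
begin

abbreviation "S \<equiv> scale ww"

lemma exp_w: "continuous_on A (%x. exp (ww x))" by (intro continuous_intros cont_subset[OF wc]) auto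

lemma scale_deriv: "(S hasD exp (ww x)) (at x)"
proof -
 define R where "R = abs x + 1"
 have "((%u. LBINT y=0..u. exp (ww y)) has_vector_derivative exp (ww x)) (at x within {-R..R})"
  unfolding zero_ereal_def by (rule interval_integral_FTC2) (auto simp: R_def exp_w)
 hence "(S has_vector_derivative exp (ww x)) (at x within {-R..R})" by (simp only: scale_def[abs_def])
 moreover have "x : interior {-R..R}" unfolding interior_atLeastAtMost_real by (auto simp: R_def)
 ultimately show ?thesis unfolding has_real_derivative_iff_has_vector_derivative using at_within_interior[of x "{-R..R}"] by simp
qed

lemma scale_0: "S 0 = 0" by (simp add: scale_def zero_ereal_def)

lemma scale_pos: "0 <= x ==> S x = integral {0..x} (%z. exp (ww z))" unfolding scale_def by (rule LBINT_integral[OF exp_w])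

lemma scale_neg: "0 <= x ==> S (- x) = - integral {0..x} (%z. exp (ww (- z)))"
proof -
 assume x: "0 <= x"
 have "S (- x) = (LBINT z=ereal 0..ereal (- x). exp (ww z))" by (simp add: scale_def zero_ereal_def)
 also have "... = - (LBINT z=ereal (- x)..ereal 0. exp (ww z))" by (rule interval_integral_endpoints_reverse)
 also have "(LBINT z=ereal (- x)..ereal 0. exp (ww z)) = (LBINT z=ereal 0..ereal x. exp (ww (- z)))"
  using interval_integral_reflect[of "ereal (- x)" "ereal 0" "%z. exp (ww z)"] by simp
 also have "... = integral {0..x} (%z. exp (ww (- z)))"
  using LBINT_integral[of x "%z. exp (ww (- z))"] x by (simp add: zero_ereal_def continuous_on_exp cont_comp2[OF wc] continuous_intros)
 finally show ?thesis .
qed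

lemma scale_strict: "x < y ==> S x < S y" by (rule DERIV_pos_imp_increasing) (use scale_deriv in "auto intro!: exI")

lemma scale_less_iff: "S x < S y \<longleftrightarrow> x < y" using scale_strict by (metis linorder_neq_iff order_less_asym)

lemma scale_cont: "continuous_on A S" using scale_deriv by (meson DERIV_isCont isCont_cont)

lemma scale_bij: "bij S"
proof (rule bijI)
 show "inj S" using scale_strict by (metis injI linorder_neq_iff order_less_irrefl)
 have "EX x. S x = y" for y proof -
  obtain T where T: "0 <= T" "abs y <= S T" using recurrent_unbounded[OF rec_pos cont_subset[OF wc], of exp "abs y"] by (auto simp: scale_pos continuous_on_exp)
  have "cont0 (%x. ww (- x))" by (rule cont_comp2[OF wc]) (auto intro: continuous_intros)
  then obtain T' where T': "0 <= T'" "S (- T') <= - abs y" using recurrent_unbounded[OF rec_neg, of exp "abs y"] by (auto simp: scale_neg continuous_on_exp)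
  have "EX x>=- T'. x <= T & S x = y" by (rule IVT') (use T T' scale_cont in auto)
  thus ?thesis by blast
 qed
 thus "surj S" unfolding surj_def by metis
qed

lemma scale_inv[simp]: "S (inv S y) = y" "inv S (S x) = x" using scale_bij by (simp_all add: bij_is_inj bij_is_surj surj_f_inv_f)

lemma inv_less_iff: "inv S x < inv S y \<longleftrightarrow> x < y" using scale_less_iff[of "inv S x" "inv S y"] by simp

lemma inv_cont: "continuous_on UNIV (inv S)"
proof (rule isCont_cont, rule ballI)
 fix y
 have "isCont (inv S) (S (inv S y))" by (rule isCont_inverse_function[where d=1]) (use scale_cont[of UNIV] in "auto simp: continuous_on_eq_continuous_at")
 thus "isCont (inv S) y" by simp
qed

lemma inv_deriv: "(inv S hasD exp (- ww (inv S y))) (at y)"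
proof -
 have "(inv S hasD inverse (exp (ww (inv S y)))) (at y)" by (rule DERIV_inverse_function[where a="y - 1" and b="y + 1" and f=S])
  (use scale_deriv inv_cont in "auto simp: continuous_on_eq_continuous_at")
 thus ?thesis by (simp add: exp_minus)
qed

lemma inv_0: "inv S 0 = 0" using scale_inv(2)[of 0] by (simp add: scale_0)

text \<open>Derivative of the inverse scale function; its square along the path is the rate at which
  the clock runs.\<close>

definition h :: "real => real" where "h y = exp (- ww (inv S y))"

lemma h_cont: "continuous_on UNIV h" and h_pos: "0 < h y" unfolding h_def by (auto intro!: continuous_intros cont_comp2[OF wc inv_cont])

end

locale env_path = environment ww for ww + fixes b :: "real => real"
 assumes bc: "cont0 b" and b_rec: "recurrent b"
begin

abbreviation "T \<equiv> clock ww b"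
abbreviation "sg \<equiv> clock_inv ww b"

lemma rate_cont: "cont0 (%s. (h (b s))^2)" by (intro continuous_intros cont_comp2[OF h_cont bc]) auto

lemma clock_integral: "0 <= t ==> T t = integral {0..t} (%s. (h (b s))^2)"
proof -
 assume t: "0 <= t"
 have e: "exp (- 2*ww (inv S (b s))) = (h (b s))^2" for s unfolding h_def by (simp add: sq_eq exp_add[symmetric])
 show ?thesis unfolding clock_def e by (rule LBINT_integral[OF cont_subset[OF rate_cont] t]) auto
qed

lemma clock_0: "T 0 = 0" by (simp add: clock_integral)

lemma clock_cont: "cont0 T"
proof (rule cont_halfline)
 fix u :: real
 have "continuous_on {0..u} (%t. integral {0..t} (%s. (h (b s))^2))"
  by (intro indefinite_integral_continuous_1 int_cont cont_subset[OF rate_cont]) auto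
 thus "continuous_on {0..u} T" by (rule continuous_on_eq) (simp add: clock_integral)
qed

lemma clock_strict: "0 <= s ==> s < t ==> T s < T t"
proof -
 assume st: "0 <= s" "s < t"
 have "EX l z. s < z & z < t & (T hasD l) (at z) & T t - T s = (t - s) * l" proof (rule MVT[OF st(2)])
  show "continuous_on {s..t} T" by (rule cont_subset[OF clock_cont]) (use st in auto)
  show "T differentiable (at x)" if x: "s < x" "x < t" for x proof -
  have "((%t. integral {0..t} (%s. (h (b s))^2)) hasD (h (b x))^2) (at x)" by (rule integral_deriv[OF rate_cont]) (use x st in simp)
  hence "(T hasD (h (b x))^2) (at x)" by (rule has_field_derivative_transform_within_open[where S="{0<..}"]) (use x st in "auto simp: clock_integral")
  thus ?thesis by (auto simp: real_differentiable_def)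
  qed qed
 then obtain l z where z: "s < z" "(T hasD l) (at z)" "T t - T s = (t - s) * l" by blast
 have "((%t. integral {0..t} (%s. (h (b s))^2)) hasD (h (b z))^2) (at z)" by (rule integral_deriv[OF rate_cont]) (use z st in simp)
 hence "(T hasD (h (b z))^2) (at z)" by (rule has_field_derivative_transform_within_open[where S="{0<..}"]) (use z st in "auto simp: clock_integral")
 hence "l = (h (b z))^2" using z(2) DERIV_unique by blast
 moreover have "0 < (t - s)*(h (b z))^2" by (rule mult_pos_pos) (use st h_pos[of "b z"] in auto)
 ultimately show ?thesis using z(3) by simp
qed

lemma clock_bij: "bij_betw T {0..} {0..}"
proof (rule bij_betw_imageI)
 show "inj_on T {0..}" using clock_strict by (metis inj_onI atLeast_iff linorder_neq_iff order_less_irrefl)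
 show "T ` {0..} = {0..}" proof (intro equalityI subsetI)
  fix y assume "y : T ` {0..}"
  thus "y : {0..}" using clock_strict[of 0] clock_0 by (force simp: le_less)
 next
  fix y :: real assume y: "y : {0..}"
  obtain u where u: "0 <= u" "y <= T u"
  using recurrent_unbounded[OF b_rec bc, of "%x. (h x)^2" y] h_pos by (auto simp: clock_integral h_cont continuous_on_power less_imp_neq[symmetric])
  have "EX x>=0. x <= u & T x = y" by (rule IVT') (use u y clock_0 cont_subset[OF clock_cont] in auto)
  thus "y : T ` {0..}" by auto
 qed qed

lemma clock_inv: "0 <= t ==> 0 <= sg t" "0 <= t ==> T (sg t) = t" "0 <= u ==> sg (T u) = u" "0 <= u ==> 0 <= T u"
proof -
 have i: "T ` {0..} = {0..}" "inj_on T {0..}" using clock_bij by (auto simp: bij_betw_def)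
 show "0 <= t ==> 0 <= sg t" using inv_into_into[of t T "{0..}"] i by (simp add: clock_inv_def)
 show "0 <= t ==> T (sg t) = t" using f_inv_into_f[of t T "{0..}"] i by (simp add: clock_inv_def)
 show "0 <= u ==> sg (T u) = u" using inv_into_f_f[OF i(2), of u] by (simp add: clock_inv_def)
 show "0 <= u ==> 0 <= T u" using i(1) by auto
qed

lemma clock_inv_le_iff: "0 <= t ==> 0 <= u ==> sg t <= u \<longleftrightarrow> t <= T u"
 using clock_strict[of "sg t" u] clock_strict[of u "sg t"] clock_inv[of t] by (metis le_less linorder_not_less order_less_imp_le)

lemma clock_inv_0: "sg 0 = 0" using clock_inv(3)[of 0] by (simp add: clock_0)

lemma clock_inv_mono: "mono_on {0..} sg"
proof (rule mono_onI)
 fix s t :: real assume "s : {0..}" "t : {0..}" "s <= t"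
 thus "sg s <= sg t" using clock_inv_le_iff[of s "sg t"] clock_inv[of t] by simp
qed

lemma clock_inv_cont: "cont0 sg"
proof (rule cont_halfline)
 fix t :: real
 have "continuous_on (T ` {0..sg t}) sg" by (rule continuous_on_inv) (auto intro: cont_subset[OF clock_cont] simp: clock_inv)
 moreover have "{0..t} <= T ` {0..sg t}" proof
  fix s assume s: "s : {0..t}"
  hence "sg s : {0..sg t}" using clock_inv(1)[of s] mono_onD[OF clock_inv_mono, of s t] by auto
  moreover have "s = T (sg s)" using clock_inv(2)[of s] s by simp
  ultimately show "s : T ` {0..sg t}" by blast
 qed
 ultimately show "continuous_on {0..t} sg" by (rule cont_subset)
qed

end

section \<open>The Brownian environment and the time-changed filtration\<close>

locale brox = cps M for M :: "'a measure" +
 fixes W B :: "real => 'a => real"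
 assumes W: "two_sided_brownian_motion M W" and B: "brownian_motion M B" and BW: "independent_processes M {0..} B UNIV W"
begin

abbreviation "G \<equiv> driving_filtration M W B"
abbreviation "tau \<equiv> clock_inv_of W B"
abbreviation "FF \<equiv> time_changed_filtration M W B"

lemma W_bm: "brownian_motion M W" "brownian_motion M (%x. W (- x))" using W by (auto simp: two_sided_brownian_motion_def)

lemma W_M: "W x : bor M"
proof (cases "0 <= x") case True
 thus ?thesis using bm_facts(9)[OF W_bm(1)[unfolded brownian_motion_def]] by simp
next case False
 thus ?thesis using bm_facts(9)[OF W_bm(2)[unfolded brownian_motion_def], of "- x"] by simp
qed

lemma B_M: "0 <= t ==> B t : bor M" using bm_facts(9)[OF B[unfolded brownian_motion_def]] by simp

lemma sub_W: "subalgebra M (psigma M UNIV W)" and sub_B: "subalgebra M (psigma M {0..} B)" by (auto intro!: psigma_subalg W_M B_M)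

lemma indep_WB: "indep_set (sets (psigma M UNIV W)) (sets (psigma M {0..} B))" using BW unfolding independent_processes_def
 by (intro indep_setI) (use sub_W sub_B in "auto simp: subalgebra_def Int_commute dest: indep_setD")

lemma augmented: "augmented_bm M B (psigma M UNIV W) G" by unfold_locales (use B sub_W indep_WB in "auto simp: driving_filtration_def")

text \<open>The roles are exchanged: a half of the environment is now the Brownian motion, in space,
  and the whole of \<open>B\<close> is the independent information known from the start.\<close>

lemma augmented_env:
 assumes V: "brownian_motion M V" and s: "sets (psigma M {0..} V) <= sets (psigma M UNIV W)"
 shows "augmented_bm M V (psigma M {0..} B) (environment_filtration M V B)"
proof (unfold_locales)
 show "indep_set (sets (psigma M {0..} B)) (sets (psigma M {0..} V))" using BW s sub_B sub_W unfolding independent_processes_def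
  by (intro indep_setI) (auto simp: subalgebra_def dest!: subsetD intro!: indep_setD)
qed (use V sub_B in "auto simp: environment_filtration_def")

lemma env_sub: "sets (psigma M {0..} W) <= sets (psigma M UNIV W)"
 "sets (psigma M {0..} (%x. W (- x))) <= sets (psigma M UNIV W)"
 by (rule psigma_subset; simp add: psigma_meas psigma_meas[of "- _" UNIV W M])+

lemmas augmented_envs = augmented_env[OF W_bm(1) env_sub(1)] augmented_env[OF W_bm(2) env_sub(2)]

end

lemma augmented_bm_full: "augmented_bm M V S G ==> full_bm M V G"
 by (auto simp: full_bm_def full_bm_axioms_def augmented_bm_def intro: augmented_bm.bm_G augmented_bm.G_full)

sublocale brox \<subseteq> dr: full_bm M B G by (rule augmented_bm_full[OF augmented])
sublocale brox \<subseteq> ep: full_bm M W "environment_filtration M W B" by (rule augmented_bm_full[OF augmented_envs(1)])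
sublocale brox \<subseteq> em: full_bm M "%x. W (- x)" "environment_filtration M (%x. W (- x)) B" by (rule augmented_bm_full[OF augmented_envs(2)])

context brox
begin

lemma W_cont: "AE w in M. continuous_on UNIV (%x. W x w)" using ep.B_continuous em.B_continuous
proof eventually_elim case (elim w)
 have "continuous_on {..0} (%x. W (- (- x)) w)" by (rule cont_comp2[OF elim(2)]) (auto intro: continuous_intros)
 hence "continuous_on ({0..} Un {..0}) (%x. W x w)" by (intro continuous_on_closed_Un elim(1)) auto
 moreover have "{0..} Un {..0::real} = UNIV" by auto
 ultimately show ?case by simp
qed

text \<open>All pathwise requirements are gathered in one almost sure event, on which the
  deterministic locale \<open>env_path\<close> can be interpreted.\<close>

lemma good_path: "AE w in M. env_path (%x. W x w) (%s. B s w) & B 0 w = 0 & W 0 w = 0 &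
  continuous_occupation_density (%s. B s w) (local_time_of B w)"
 using W_cont ep.recurrence em.recurrence dr.recurrence dr.B_continuous bm_facts(5)[OF dr.bmG] bm_facts(5)[OF ep.bmG] dr.local_time_density
 by eventually_elim (auto simp: env_path_def env_path_axioms_def environment_def)

text \<open>Only the environment on \<open>[0,x]\<close> enters; this sharper form is what
  adaptedness to the environment filtration needs.\<close>

lemma scale_meas_pos:
 assumes A: "full_alg M A" and x: "0 <= x" and WA: "!!z. 0 <= z ==> z <= x ==> W z : bor A"
 shows "(%w. scale_of W w x) : bor A"
proof (rule full_meas_AE[OF A])
 show "(%w. integral {0..x} (%z. exp (W z w))) : bor A" proof (rule full_integral[OF A _ _ x])
  show "acont M (%z w. exp (W z w))" using ep.B_continuous by eventually_elim (intro continuous_intros)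
 qed (use WA in measurable)
 show "AE w in M. integral {0..x} (%z. exp (W z w)) = scale_of W w x"
  using good_path by eventually_elim (use x environment.scale_pos in "auto simp: env_path_def")
qed simp

lemma scale_meas_neg:
 assumes A: "full_alg M A" and x: "0 <= x" and WA: "!!z. 0 <= z ==> z <= x ==> W (- z) : bor A"
 shows "(%w. scale_of W w (- x)) : bor A"
proof (rule full_meas_AE[OF A])
 have "(%w. integral {0..x} (%z. exp (W (- z) w))) : bor A" proof (rule full_integral[OF A _ _ x])
  show "acont M (%z w. exp (W (- z) w))" using em.B_continuous by eventually_elim (intro continuous_intros)
 qed (use WA in measurable)
 thus "(%w. - integral {0..x} (%z. exp (W (- z) w))) : bor A" by measurable
 show "AE w in M. - integral {0..x} (%z. exp (W (- z) w)) = scale_of W w (- x)"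
  using good_path by eventually_elim (use x environment.scale_neg in "auto simp: env_path_def")
qed simp

context
 fixes A :: "'a measure"
 assumes A: "full_alg M A" and WA: "!!x. W x : bor A"
begin

lemma scale_meas: "(%w. scale_of W w x) : bor A" using scale_meas_pos[OF A _ WA, of x] scale_meas_neg[OF A _ WA, of "- x"] by (cases "0 <= x") simp_all

text \<open>For the increasing scale function, \<open>inv S (Z w) <= c\<close> is equivalent to
  \<open>Z w <= S c\<close>, which involves no inverse.\<close>

lemma inv_scale_meas:
 assumes Z: "Z : bor A"
 shows "(%w. inv (scale_of W w) (Z w)) : bor A"
proof (rule borel_measurableI_le)
 fix c
 have sp: "space A = space M" by (rule full_algD(1)[OF A])
 have "{w : space M. Z w <= scale_of W w c} : sets A" using borel_measurable_le[OF Z scale_meas[of c]] by (simp add: sp)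
 moreover have "AE w in M. Z w <= scale_of W w c \<longleftrightarrow> inv (scale_of W w) (Z w) <= c" using good_path
 proof eventually_elim case (elim w)
  then interpret environment "%x. W x w" by (simp add: env_path_def)
  show ?case using inv_less_iff[of "scale_of W w c" "Z w"] by (simp add: not_less[symmetric])
 qed
 ultimately show "{w : space A. inv (scale_of W w) (Z w) <= c} : sets A" unfolding sp by (rule full_sets_AE[OF A])
qed

lemma rate_meas:
 assumes Z: "Z : bor A"
 shows "(%w. exp (- W (inv (scale_of W w) (Z w)) w)) : bor A"
proof -
 have "(%w. W (inv (scale_of W w) (Z w)) w) : bor A" by (rule full_compose[where Y=W and S=UNIV, OF A _ _ inv_scale_meas[OF Z]]) (use WA W_cont in auto)
 thus ?thesis by measurable
qed

lemma clock_meas: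
 assumes Bm: "!!s. 0 <= s ==> s <= u ==> B s : bor A" and u: "0 <= u"
 shows "(%w. clock (%x. W x w) (%s. B s w) u) : bor A"
proof (rule full_meas_AE[OF A])
 show "(%w. integral {0..u} (%s. (exp (- W (inv (scale_of W w) (B s w)) w))^2)) : bor A"
 proof (rule full_integral[OF A _ _ u])
  show "(%w. (exp (- W (inv (scale_of W w) (B s w)) w))^2) : bor A" if "0 <= s" "s <= u" for s by (intro borel_measurable_power rate_meas Bm that)
  show "AE w in M. cont0 (%s. (exp (- W (inv (scale_of W w) (B s w)) w))^2)" using good_path
  proof eventually_elim case (elim w)
  then interpret env_path "%x. W x w" "%s. B s w" by simp
  show ?case using rate_cont by (simp add: h_def)
  qed qed
 show "AE w in M. integral {0..u} (%s. (exp (- W (inv (scale_of W w) (B s w)) w))^2) = clock (%x. W x w) (%s. B s w) u" using good_path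
 proof eventually_elim case (elim w)
  then interpret env_path "%x. W x w" "%s. B s w" by simp
  show ?case using clock_integral[OF u] by (simp add: h_def)
 qed
qed simp

end

lemma W_G: "W x : bor (G t)" by (rule meas_subalg[OF _ psigma_meas[of x UNIV W M]])
  (use augmented_bm.S_G[OF augmented, of t] full_algD(1)[OF augmented_bm.G_full[OF augmented, of t]] in "auto simp: subalgebra_def")

lemma full_G: "full_alg M (G t)" by (rule augmented_bm.G_full[OF augmented])

text \<open>The event says that the clock has reached \<open>t\<close> by time \<open>u\<close>, and
  the clock at \<open>u\<close> is built from \<open>W\<close>, known at time 0, and from
  \<open>B\<close> up to \<open>u\<close>.\<close>

lemma clock_stopping:
 assumes t: "0 <= t"
 shows "{w : space M. tau t w <= u} : sets (G u)"
proof (cases "0 <= u") case True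
 have "(%w. clock (%x. W x w) (%s. B s w) u) : bor (G u)" by (rule clock_meas[OF full_G W_G bm_facts(8)[OF dr.bmG] True])
 hence "{w : space (G u). t <= clock (%x. W x w) (%s. B s w) u} : sets (G u)" by measurable
 moreover have "AE w in M. t <= clock (%x. W x w) (%s. B s w) u \<longleftrightarrow> tau t w <= u"
  using good_path by eventually_elim (use env_path.clock_inv_le_iff t True in blast)
 ultimately show ?thesis unfolding full_algD(1)[OF full_G] by (rule full_sets_AE[OF full_G])
next case False
 have "AE w in M. ~ tau t w <= u" using good_path by eventually_elim (use env_path.clock_inv(1)[of _ _ t] t False in force)
 thus ?thesis by (rule full_subset_null[OF full_G])
qed

lemma filtration_G: "filtration (space M) G" by unfold_locales (use full_algD(1)[OF full_G] augmented_bm.G_mono[OF augmented] in auto)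

lemma sets_FF: "0 <= t ==> sets (FF t) = {A. ALL u. {w : A. tau t w <= u} : sets (G u)}" unfolding time_changed_filtration_def
 by (rule filtration.sets_pre_sigma[OF filtration_G]) (use clock_stopping full_algD(1)[OF full_G] in "auto simp: stopping_time_def pred_def")

lemma space_FF: "space (FF t) = space M" unfolding time_changed_filtration_def by (rule filtration.space_pre_sigma[OF filtration_G])

lemma clock_inv_ae: "AE w in M. cont0 (%t. tau t w) & mono_on {0..} (%t. tau t w) & tau 0 w = 0" using good_path
 by eventually_elim (blast intro: env_path.clock_inv_cont env_path.clock_inv_mono env_path.clock_inv_0)

lemma FF_cases:
 assumes t: "0 <= t" and A: "A <= space M" and u: "!!u. 0 <= u ==> {w : A. tau t w <= u} : sets (G u)"
 shows "A : sets (FF t)" unfolding sets_FF[OF t]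
proof (rule CollectI, rule allI)
 fix u show "{w : A. tau t w <= u} : sets (G u)" proof (cases "0 <= u") case False
  have "AE w in M. ~ (w : A & tau t w <= u)" using good_path by eventually_elim (use env_path.clock_inv(1)[of _ _ t] t False in force)
  from full_subset_null[OF full_G this] have "{w : space M. w : A & tau t w <= u} : sets (G u)" .
  also have "{w : space M. w : A & tau t w <= u} = {w : A. tau t w <= u}" using A by auto
  finally show ?thesis .
 qed (rule u)
qed

lemma FF_full: "0 <= t ==> full_alg M (FF t)"
proof -
 assume t: "0 <= t"
 have "A : sets M" if "A : sets (FF t)" for A proof -
  have "A = (\<Union>n::nat. {w : A. tau t w <= real n})" using real_arch_simple by auto
  moreover have "{w : A. tau t w <= real n} : sets M" for n using that full_algD(2)[OF full_G[of "real n"]] by (auto simp: sets_FF[OF t])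
  hence "(\<Union>n::nat. {w : A. tau t w <= real n}) : sets M" by (intro sets.countable_nat_UN image_subsetI)
  ultimately show ?thesis by argo
 qed
 moreover have "A : sets (FF t)" if "A : null_sets M" for A unfolding sets_FF[OF t]
 proof (rule CollectI, rule allI)
  fix u
  have "{w : A. tau t w <= u} : null_sets M" by (rule complete2[OF _ that]) auto
  thus "{w : A. tau t w <= u} : sets (G u)" using full_algD(3)[OF full_G] by blast
 qed
 ultimately show ?thesis by (auto simp: full_alg_def subalgebra_def space_FF)
qed

end

sublocale brox \<subseteq> tc: time_change M B G tau FF
proof
 show "sets (FF s) <= sets (FF t)" if st: "0 <= s" "s <= t" for s t proof
  fix A assume A: "A : sets (FF s)"
  have t: "0 <= t" using st by simp
  have As: "A <= space M" using sets.sets_into_space[OF A] by (simp add: space_FF)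
  show "A : sets (FF t)" proof (rule FF_cases[OF t As])
  fix u :: real assume u: "0 <= u"
  have "{w : A. tau s w <= u} : sets (G u)" using A by (simp add: sets_FF[OF st(1)])
  hence "{w : A. tau s w <= u} Int {w : space M. tau t w <= u} : sets (G u)" using clock_stopping[OF t, of u] by blast
  also have "{w : A. tau s w <= u} Int {w : space M. tau t w <= u} = {w : space M. w : A & tau s w <= u & tau t w <= u}" using As by auto
  finally have "{w : space M. w : A & tau t w <= u} : sets (G u)" proof (rule full_sets_AE[OF full_G])
  show "AE w in M. w : A & tau s w <= u & tau t w <= u \<longleftrightarrow> w : A & tau t w <= u" using clock_inv_ae
  proof eventually_elim case (elim w)
  hence "tau s w <= tau t w" using st by (intro mono_onD[of "{0..}" "%t. tau t w"]) auto
  thus ?case by auto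
  qed qed
  also have "{w : space M. w : A & tau t w <= u} = {w : A. tau t w <= u}" using As by auto
  finally show "{w : A. tau t w <= u} : sets (G u)" .
  qed qed
 show "{w : A. tau t w <= u} : sets (G u)" if "0 <= t" "0 <= u" "A : sets (FF t)" for t u A using that(3) by (simp add: sets_FF[OF that(1)])
qed (rule dr.bmG full_G FF_full clock_inv_ae FF_cases; assumption)+

context brox
begin

lemma W_FF: "0 <= t ==> W x : bor (FF t)"
proof -
 assume t: "0 <= t"
 show ?thesis proof (rule tc.F_measurableI[OF t])
  show "EX g:bor (G u). ALL w:space M. tau t w <= u --> W x w = g w" for u by (rule bexI[OF _ W_G[of x u]]) simp
 qed qed

lemma time_changed_eq: "tc.X = time_changed W B" by (simp add: tc.X_def time_changed_def fun_eq_iff)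

definition rate :: "real => 'a => real" where
 "rate s w = exp (- W (inv (scale_of W w) (B (tau s w) w)) w)"

lemma rate_ca: "cadapt M FF rate" unfolding ca_def
proof (intro conjI allI impI)
 show "rate t : bor (FF t)" if t: "0 <= t" for t proof -
  have "(%w. B (tau t w) w) : bor (FF t)" using tc.X_adapted[OF t] by (simp add: tc.X_def[abs_def])
  from rate_meas[OF FF_full[OF t] W_FF[OF t] this] show ?thesis by (simp add: rate_def[abs_def])
 qed
 show "acont M rate" using good_path tc.X_continuous proof eventually_elim case (elim w)
  then interpret env_path "%x. W x w" "%s. B s w" by simp
  have "cont0 (%t. h (B (tau t w) w))" by (rule cont_comp2[OF h_cont]) (use elim(2) in "auto simp: tc.X_def")
  thus ?case by (simp add: rate_def h_def)
 qed qed

lemma brox_ca: "cadapt M FF (brox_diffusion W B)" unfolding ca_def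
proof (intro conjI allI impI)
 show "brox_diffusion W B t : bor (FF t)" if t: "0 <= t" for t proof -
  have "(%w. B (tau t w) w) : bor (FF t)" using tc.X_adapted[OF t] by (simp add: tc.X_def[abs_def])
  from inv_scale_meas[OF FF_full[OF t] W_FF[OF t] this] show ?thesis by (simp add: brox_diffusion_def[abs_def])
 qed
 show "acont M (%t w. brox_diffusion W B t w)" using good_path tc.X_continuous proof eventually_elim
  case (elim w)
  then interpret env_path "%x. W x w" "%s. B s w" by simp
  show ?case unfolding brox_diffusion_def by (rule cont_comp2[OF inv_cont]) (use elim(2) in "auto simp: tc.X_def")
 qed qed

end

section \<open>The driving Brownian motion of the diffusion\<close>

lemma (in cps) brownian_motion_wrt_natural:
 assumes V: "brownian_motion_wrt M G V"
 shows "brownian_motion M V"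
proof -
 note f = bm_facts[OF V]
 have VM: "V t : bor M" if "0 <= t" for t using f(9)[OF that] .
 have sub: "subalgebra M (natural_filtration M V t)" for t unfolding natural_filtration_def by (rule psigma_subalg) (use VM in simp)
 have le: "sets (natural_filtration M V t) <= sets (G t)" if "0 <= t" for t unfolding natural_filtration_def
 proof (rule psigma_subset)
  show "space (G t) = space M" using f(1)[OF that] by (simp add: subalgebra_def)
  show "V i : bor (G t)" if "i : {0..t}" for i using f(8)[of i t] that by simp
 qed
 show ?thesis unfolding brownian_motion_def brownian_motion_wrt_def is_filtration_def ca_def
 proof (intro conjI allI impI sub f(4,5))
  show "sets (natural_filtration M V s) <= sets (natural_filtration M V t)" if "s <= t" for s t
  unfolding natural_filtration_def by (rule psigma_subset) (use that in "auto intro!: psigma_meas")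
  show "V t : bor (natural_filtration M V t)" if "0 <= t" for t unfolding natural_filtration_def by (rule psigma_meas) (use that in simp)
  show "distributed M lborel (%w. V t w - V s w) (normal_density 0 (sqrt (t - s)))" if "0 <= s" "s < t" for s t by (rule f(7)[OF that])
  show "indep_set (sets (natural_filtration M V s)) (sets (vimage_algebra (space M) (%w. V t w - V s w) borel))" if st: "0 <= s" "s < t" for s t
  using f(6)[OF st] unfolding indep_set_def by (rule indep_sets_mono_sets) (use le[OF st(1)] in "auto split: bool.split")
 qed qed

lemma (in cps) SI_0:
 assumes SI: "SI M F X H I"
 shows "AE w in M. I 0 w = 0"
proof -
 have H: "H t : bor (F t)" if "0 <= t" for t using SI that by (simp add: SI_def ca_def)
 have "pconv M (%n. eint (dyel n H) X 0) (I 0)" by (rule uconv_pconv[OF SI_dyadic[OF SI H uconv_refl]]) simp_all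
 moreover have "eint (dyel n H) X 0 = (%_. 0)" for n by (auto simp: eint_def fun_eq_iff)
 moreover have "pconv M (%n w. 0) (%_. 0::real)" by (rule subseq_ae_AE) simp
 ultimately show ?thesis using pconv_unique[of M "%n w. 0::real" "I 0" "%_. 0"] by simp
qed

context brox
begin

definition cutoff :: "nat => real => real" where "cutoff R u = max 0 (min 1 (real R - u))"

lemma cutoff_props: "0 <= cutoff R u" "cutoff R u <= 1" "real R <= u ==> cutoff R u = 0" "u + 1 <= real R ==> cutoff R u = 1"
 "continuous_on A f ==> continuous_on A (%x. cutoff R (f x))" unfolding cutoff_def by (auto intro!: continuous_intros)

text \<open>Bounded, and zero once the time of \<open>B\<close> has passed \<open>R\<close>, as the
  results on general integrals require; the cutoff is continuous so that the process remains
  continuous and adapted.\<close>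

definition cut_rate :: "nat => real => 'a => real" where
 "cut_rate R s w = trunc R (rate s w) * cutoff R (tau s w)"

lemma cut_rate_ca: "cadapt M FF (cut_rate R)" unfolding ca_def
proof (intro conjI allI impI)
 have [measurable]: "cutoff R : bor borel" unfolding cutoff_def[abs_def] by measurable
 show "cut_rate R t : bor (FF t)" if t: "0 <= t" for t proof -
  have [measurable]: "rate t : bor (FF t)" "tau t : bor (FF t)" using rate_ca tc.tau_adapted[OF t] t by (auto simp: ca_def)
  show ?thesis unfolding cut_rate_def[abs_def] by measurable
 qed
 have "acont M rate" using rate_ca by (simp add: ca_def)
 thus "acont M (cut_rate R)" using clock_inv_ae by eventually_elim (auto simp: cut_rate_def intro!: continuous_intros trunc_continuous cutoff_props)
qed

lemma cut_rate_uconv: "uconv M cut_rate rate"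
proof (rule subseq_ae_AE)
 have "acont M rate" using rate_ca by (simp add: ca_def)
 thus "AE w in M. ALL s. strict_mono s --> upath (%n u. cut_rate (s n) u w) (%u. rate u w)" using clock_inv_ae
 proof eventually_elim case (elim w)
  show ?case unfolding upath_def proof (intro allI impI)
  fix s :: "nat => nat" and t :: real assume s: "strict_mono s" and t: "0 <= t"
  have "bounded ((%u. rate u w) ` {0..t})" by (intro compact_imp_bounded compact_image cont_subset[OF elim(1)]) auto
  then obtain b where b: "ALL v:(%u. rate u w) ` {0..t}. norm v <= b" unfolding bounded_iff by blast
  define c where "c = max b (tau t w + 1)"
  have "EV n. c <= real (s n)" by (rule eventually_subseq[OF s]) real_asymp
  hence "EV n. ALL u:{0..t}. cut_rate (s n) u w = rate u w" proof eventually_elim case n: (elim n)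
  show ?case proof
  fix u assume u: "u : {0..t}"
  have "tau u w <= tau t w" by (rule mono_onD[of "{0..}" "%t. tau t w"]) (use u elim(2) in auto)
  hence "cutoff (s n) (tau u w) = 1" by (intro cutoff_props(4)) (use n in "simp add: c_def")
  moreover have "trunc (real (s n)) (rate u w) = rate u w" by (rule trunc_id) (use b u n in "force simp: c_def")
  ultimately show "cut_rate (s n) u w = rate u w" by (simp add: cut_rate_def)
  qed qed
  thus "uniform_limit {0..t} (%n u. cut_rate (s n) u w) (%u. rate u w) sequentially" unfolding uniform_limit_iff by (auto elim!: eventually_mono)
  qed qed qed

context
 fixes I :: "real => 'a => real"
 assumes I: "SI M FF (time_changed W B) rate I"
begin

lemma I_meas: "0 <= t ==> I t : bor (FF t)" using I by (simp add: SI_def ca_def)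

text \<open>In the time of \<open>B\<close> the cut integrals have bracket density at most the
  square of \<open>h\<close> along the path, and the full density integrates between
  \<open>tau s\<close> and \<open>tau t\<close> to exactly \<open>t - s\<close>, since
  \<open>tau\<close> inverts the clock. The brackets are thus bounded by \<open>t - s\<close> and
  converge to it, on \<open>D\<close>.\<close>

lemma driving_good_pair:
 assumes st: "0 <= s" "s <= t" and D: "D : sets (FF s)"
 shows "good_pair M (%w. indicator D w*(I t w - I s w)) (%w. indicator D w*(t - s))"
proof -
 have t: "0 <= t" using st by simp
 have "ALL R. EX I'. SI M FF tc.X (cut_rate R) I'" using tc.SI_exists[OF cut_rate_ca] by blast
 then obtain J where J: "!!R. SI M FF tc.X (cut_rate R) (J R)" by metis
 have "uconv M J I" by (rule SI_stable[OF I[folded time_changed_eq] J cut_rate_uconv])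
 then obtain q where q: "strict_mono q" "AE w in M. upath (%n u. J (q n) u w) (%u. I u w)"
  unfolding subseq_ae_def using strict_mono_id by (force simp: id_def comp_def)
 define k where "k R w u = (trunc R (exp (- W (inv (scale_of W w) (B u w)) w)))^2*(cutoff R u)^2" for R :: nat and w u
 define V where "V R w = indicator D w*(integral {0..tau t w} (k R w) - integral {0..tau s w} (k R w))" for R w
 have gp: "good_pair M (%w. indicator D w*(J R t w - J R s w)) (V R)" for R unfolding V_def
 proof (rule tc.good_pair_integral[OF J, where C="real R" and K=R and T=t])
  show "abs (cut_rate R u w) <= real R" for u w proof -
  have "abs (trunc R (rate u w))*abs (cutoff R (tau u w)) <= real R*1" by (intro mult_mono trunc_bound) (use cutoff_props(1,2)[of R "tau u w"] in auto)
  thus ?thesis by (simp add: cut_rate_def abs_mult)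
  qed
  have "cut_rate R u w = 0" if "~ tau u w <= real R" for u w using cutoff_props(3)[of R "tau u w"] that by (simp add: cut_rate_def)
  thus "AE w in M. ALL u:{0..t}. cut_rate R u w ~= 0 --> tau u w <= real R" by (intro AE_I2) blast
  show "AE w in M. cont0 (k R w) & (ALL u>=0. (cut_rate R u w)^2 = k R w (tau u w))" using good_path
  proof eventually_elim case (elim w)
  then interpret env_path "%x. W x w" "%s. B s w" by simp
  have "cont0 (%u. h (B u w))" by (rule cont_comp2[OF h_cont bc]) simp
  moreover have "k R w = (%u. (trunc R (h (B u w)))^2*(cutoff R u)^2)" by (simp add: k_def h_def fun_eq_iff)
  ultimately have "cont0 (k R w)" by (simp only:) (intro continuous_intros trunc_continuous cutoff_props)
  thus ?case by (simp add: k_def cut_rate_def rate_def power_mult_distrib)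
  qed
 qed (use st D in auto)
 have Y: "AE w in M. (%n. indicator D w*(J (q n) t w - J (q n) s w)) ---> indicator D w*(I t w - I s w)" using q(2)
 proof eventually_elim case (elim w)
  show ?case by (intro tendsto_mult_left tendsto_diff upathD[OF elim] st t)
 qed
 have le: "AE w in M. (ALL R. V R w <= t - s) & (%n. V (q n) w) ---> indicator D w*(t - s)" using good_path
 proof eventually_elim case (elim w)
  then interpret env_path "%x. W x w" "%s. B s w" by simp
  let ?p = "tau s w" and ?r = "tau t w"
  have pr: "0 <= ?p" "?p <= ?r" using clock_inv(1)[OF st(1)] mono_onD[OF clock_inv_mono, of s t] st by auto
  have hb: "cont0 (%u. h (B u w))" by (rule cont_comp2[OF h_cont bc]) simp
  have kc: "cont0 (k R w)" for R proof -
  have "k R w = (%u. (trunc R (h (B u w)))^2*(cutoff R u)^2)" by (simp add: k_def h_def fun_eq_iff)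
  thus ?thesis by (simp only:) (intro continuous_intros trunc_continuous cutoff_props hb)
  qed
  have int: "k R w integrable_on {u..v}" "(%u. (h (B u w))^2) integrable_on {u..v}" if "0 <= u" for u v R
  by (rule int_cont, rule cont_subset[OF kc] cont_subset[OF rate_cont], use that in auto)+
  have split: "integral {0..?r} f - integral {0..?p} f = integral {?p..?r} f" if "f integrable_on {0..?r}" for f :: "real => real"
  using Henstock_Kurzweil_Integration.integral_combine[OF pr that] by simp
  have ts: "integral {?p..?r} (%u. (h (B u w))^2) = t - s"
  using split[OF int(2)[OF order_refl]] clock_integral[of ?r] clock_integral[of ?p] clock_inv(2)[OF t] clock_inv(2)[OF st(1)] pr by simp
  have kh: "k R w u <= (h (B u w))^2" for R u proof -
  have "abs (trunc (real R) (h (B u w))) <= abs (h (B u w))" using h_pos[of "B u w"] by (simp add: trunc_def max_def min_def)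
  hence "(trunc (real R) (h (B u w)))^2 <= (h (B u w))^2" by (simp add: abs_le_square_iff)
  moreover have "(cutoff R u)^2 <= 1" using cutoff_props(1,2) by (simp add: power_le_one)
  ultimately have "(trunc (real R) (h (B u w)))^2*(cutoff R u)^2 <= (h (B u w))^2*1" by (intro mult_mono) auto
  thus ?thesis by (simp add: k_def h_def)
  qed
  have "V R w <= t - s" for R proof -
  have "integral {?p..?r} (k R w) <= integral {?p..?r} (%u. (h (B u w))^2)" by (rule integral_le) (use int[OF pr(1)] kh in auto)
  thus ?thesis using st by (auto simp: V_def split[OF int(1)[OF order_refl]] ts indicator_def)
  qed
  moreover have "(%n. V (q n) w) ---> indicator D w*(t - s)" proof (rule tendsto_eventually)
  have "bounded ((%u. h (B u w)) ` {0..?r})" by (intro compact_imp_bounded compact_image cont_subset[OF hb]) auto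
  then obtain b where b: "ALL v:(%u. h (B u w)) ` {0..?r}. norm v <= b" unfolding bounded_iff by blast
  define c where "c = max b (?r + 1)"
  have "EV n. c <= real (q n)" by (rule eventually_subseq[OF q(1)]) real_asymp
  thus "EV n. V (q n) w = indicator D w*(t - s)" proof eventually_elim case n: (elim n)
  have "integral {?p..?r} (k (q n) w) = integral {?p..?r} (%u. (h (B u w))^2)" proof (rule integral_cong)
  fix u assume u: "u : {?p..?r}"
  have "abs (h (B u w)) <= b" using b u pr by auto
  hence "trunc (real (q n)) (h (B u w)) = h (B u w)" by (intro trunc_id) (use n in "simp add: c_def")
  moreover have "cutoff (q n) u = 1" by (rule cutoff_props(4)) (use u n in "simp add: c_def")
  ultimately show "k (q n) w u = (h (B u w))^2" by (simp add: k_def h_def)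
  qed
  thus ?case by (simp add: V_def split[OF int(1)[OF order_refl]] ts)
  qed qed
  ultimately show ?case by blast
 qed
 show ?thesis proof (rule good_pair_limit[OF gp _ _ Y])
  show "(%w. indicator D w*(I t w - I s w)) : bor M" by (rule full_limit[OF full_self _ Y]) (use gp in "simp add: good_pair_def")
  show "(%w. indicator D w*(t - s)) : bor M" using D full_algD(2)[OF FF_full[OF st(1)]] by (intro borel_measurable_times borel_measurable_indicator) auto
  show "AE w in M. (%n. V (q n) w) ---> indicator D w*(t - s)" using le by eventually_elim simp
  show "AE w in M. V (q n) w <= t - s" for n using le by eventually_elim simp
 qed qed

text \<open>Off \<open>A\<close> the exponential identity contributes the constant 1, and on
  \<open>A\<close> the deterministic bracket factors out; what is left is the characteristic
  function of the increment on \<open>A\<close>.\<close>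

lemma driving_bm: "brownian_motion_wrt M FF I" unfolding brownian_motion_wrt_def
proof (intro conjI allI impI)
 show "is_filtration M FF" by (rule tc.filt)
 show "cadapt M FF I" using I by (simp add: SI_def)
 show "AE w in M. I 0 w = 0" by (rule SI_0[OF I])
 fix s t :: real assume st: "0 <= s" "s < t"
 have Im: "I s : bor M" "I t : bor M" using tc.F_meas_M[OF _ I_meas] st by auto
 have sub: "subalgebra M (FF s)" by (rule full_algD(4)[OF FF_full[OF st(1)]])
 have ch: "(CLINT w|M. indicator A w *\<^sub>R iexp (th*(I t w - I s w))) = prob A *\<^sub>R exp (- (th^2*(t - s)/2))" if A: "A : sets (FF s)" for A th
 proof -
  have AM[measurable]: "A : sets M" using A sub by (auto simp: subalgebra_def)
  have [measurable]: "I s : bor M" "I t : bor M" by (rule Im)+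
  let ?c = "exp (th^2*(t - s)/2)"
  have "(CLINT w|M. iexp (th*(indicator A w*(I t w - I s w))) * exp (th^2*(indicator A w*(t - s))/2)) = 1"
  using driving_good_pair[OF st(1) less_imp_le[OF st(2)] A] by (simp add: good_pair_def)
  also have "(CLINT w|M. iexp (th*(indicator A w*(I t w - I s w))) * exp (th^2*(indicator A w*(t - s))/2))
  = (CLINT w|M. (indicator A w *\<^sub>R iexp (th*(I t w - I s w))) * ?c + of_real (1 - indicator A w))" by (rule b_cong) (auto simp: indicator_def)
  also have "... = (CLINT w|M. (indicator A w *\<^sub>R iexp (th*(I t w - I s w))) * ?c) + (CLINT w|M. of_real (1 - indicator A w))"
  proof (rule b_add)
  show "complex_integrable M (%w. (indicator A w *\<^sub>R iexp (th*(I t w - I s w))) * ?c)"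
  by (rule integrable_const_bound[where B="?c"]) (auto simp: norm_mult indicator_def)
  show "complex_integrable M (%w. of_real (1 - indicator A w))" by (rule integrable_const_bound[where B=1]) (auto simp: indicator_def)
  qed
  also have "(CLINT w|M. of_real (1 - indicator A w)) = of_real (1 - prob A)" proof -
  have "(LINT w|M. 1 - indicator A w) = 1 - prob A" by (subst b_diff) (auto simp: prob_space emeasure_eq_measure intro!: integrable_real_indicator)
  thus ?thesis by (simp only: integral_complex_of_real)
  qed
  also have "(CLINT w|M. (indicator A w *\<^sub>R iexp (th*(I t w - I s w))) * ?c) = (CLINT w|M. indicator A w *\<^sub>R iexp (th*(I t w - I s w))) * ?c"
  by (rule integral_mult_left_zero)
  finally have "(CLINT w|M. indicator A w *\<^sub>R iexp (th*(I t w - I s w))) * ?c = 1 - of_real (1 - prob A)" by (simp only: eq_diff_eq)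
  hence "(CLINT w|M. indicator A w *\<^sub>R iexp (th*(I t w - I s w))) * ?c = of_real (prob A)" by (simp only: of_real_diff of_real_1 diff_diff_eq2) simp
  moreover have "x = p *\<^sub>R exp (- y)" if "x * exp (complex_of_real y) = of_real p" for x :: complex and y p :: real
  proof -
  have "x = x * exp (of_real y) * exp (- of_real y)" by (simp add: exp_minus)
  thus ?thesis unfolding that by (simp add: scaleR_conv_of_real exp_of_real[symmetric])
  qed
  ultimately show ?thesis by (simp only: exp_of_real)
 qed
 have v: "0 < t - s" using st by simp
 have Zm: "(%w. I t w - I s w) : bor M" using Im by measurable
 show "indep_set (sets (FF s)) (sets (vimage_algebra (space M) (%w. I t w - I s w) borel))" by (rule char_imp_indep_normal(1)[OF sub Zm v ch])
 show "distributed M lborel (%w. I t w - I s w) (normal_density 0 (sqrt (t - s)))" by (rule char_imp_indep_normal(2)[OF sub Zm v ch])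
qed

text \<open>The whole environment is measurable for \<open>FF 0\<close>, of which the later
  increments of the Brownian motion are independent; its initial value is 0 almost surely.\<close>

lemma driving_indep: "independent_processes M {0..} I UNIV W"
proof -
 have sW: "sets (psigma M UNIV W) <= sets (FF 0)" by (rule psigma_subset) (auto simp: space_FF W_FF)
 have IM: "I t : bor M" if "0 <= t" for t using tc.F_meas_M[OF that I_meas[OF that]] .
 have d: "indep_set (sets (FF 0)) (sets (psigma M {0..} (%u w. I (0 + u) w - I 0 w)))" by (rule bm_future_indep[OF driving_bm]) simp
 have "indep_set (sets (FF 0)) (sets (psigma M {0..} I))" proof (rule indep_process_sigmaI)
  show "subalgebra M (FF 0)" by (rule full_algD(4)[OF FF_full]) simp
  show "I i : bor M" if "i : {0..}" for i using IM that by simp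
  fix D :: "'a set" and J :: "real set" and C :: "real => real set" assume D: "D : sets (FF 0)" and J: "finite J" "J <= {0..}" and C: "!!a. C a : sets (borel :: real measure)"
  let ?E = "{w : space M. ALL a:J. I a w : C a}" and ?E' = "{w : space M. ALL a:J. I (0 + a) w - I 0 w : C a}"
  let ?S = "psigma M {0..} (%u w. I (0 + u) w - I 0 w)"
  have E'S: "?E' : sets ?S" proof -
  have "(%w. I (0 + a) w - I 0 w) : bor ?S" if "a : J" for a using psigma_meas[of a "{0..}" "%u w. I (0 + u) w - I 0 w" M] J that by auto
  hence "{w : space ?S. I (0 + a) w - I 0 w : C a} : sets ?S" if "a : J" for a using that C[of a] by measurable
  hence "{w : space ?S. ALL a:J. I (0 + a) w - I 0 w : C a} : sets ?S" by (intro sets.sets_Collect_finite_All J(1))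
  thus ?thesis by simp
  qed
  have DM: "D : sets M" using D full_algD(2)[OF FF_full[of 0]] by auto
  have EM: "?E' : sets M" using E'S psigma_subalg[of "{0..}" "%u w. I (0 + u) w - I 0 w" M] IM by (auto simp: subalgebra_def)
  have "{w : space M. I a w : C a} : sets M" if "a : J" for a using IM[of a] J that C[of a] by (auto intro: measurable_sets_borel simp: vimage_def Int_def conj_commute dest: measurable_sets)
  hence EM': "?E : sets M" by (intro sets.sets_Collect_finite_All J(1))
  have ae: "AE w in M. w : ?E \<longleftrightarrow> w : ?E'" using SI_0[OF I] by eventually_elim simp
  have "prob (D Int ?E) = prob (D Int ?E')" by (rule finite_measure_eq_AE) (use ae DM EM EM' in auto)
  also have "... = prob D * prob ?E'" by (rule indep_setD[OF d D E'S])
  also have "prob ?E' = prob ?E" by (rule finite_measure_eq_AE) (use ae EM EM' in auto)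
  finally show "prob (D Int ?E) = prob D * prob ?E" .
 qed
 hence c: "prob (a Int b) = prob a * prob b" if "a : sets (psigma M {0..} I)" "b : sets (psigma M UNIV W)" for a b
  using indep_setD[of "sets (FF 0)" "sets (psigma M {0..} I)" b a] that sW by (simp add: Int_commute mult.commute subset_eq)
 have sI: "subalgebra M (psigma M {0..} I)" by (rule psigma_subalg) (use IM in simp)
 show ?thesis unfolding independent_processes_def by (rule indep_setI[OF _ _ c]) (use sI sub_W in "simp_all add: subalgebra_def")
qed

end

end

section \<open>Smoothing the environment along dyadic nodes\<close>

lemma lborel_integral_supported:
 fixes g :: "real => real"
 assumes g: "continuous_on {p..q} g" and out: "!!x. x < p \<or> q < x ==> g x = 0"
 shows "(LINT x|lborel. g x) = integral {p..q} g"
proof -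
 have "(LINT x|lborel. g x) = (LINT x:{p..q}|lborel. g x)" unfolding set_lebesgue_integral_def
 proof (rule b_cong[OF refl])
  fix x show "g x = indicator {p..q} x *\<^sub>R g x" using out[of x] by (cases "x : {p..q}") auto
 qed
 also have "... = integral {p..q} g" by (rule set_borel_integral_eq_integral(2)[OF borel_integrable_atLeastAtMost'[OF g]])
 finally show ?thesis .
qed

text \<open>Smooth approximations of the Dirac mass, of the unit step and of the positive part.\<close>

definition bump :: "nat => real => real" where "bump n z = 2^n * hat (2^n * z)"
definition ramp :: "nat => real => real" where "ramp n z = hat1 (2^n * z)"
definition ramp2 :: "nat => real => real" where "ramp2 n z = hat2 (2^n * z)/2^n"

lemma ramp_derivative: "(ramp n hasD bump n z) (at z)" and ramp2_derivative: "(ramp2 n hasD ramp n z) (at z)"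
proof -
 have lin: "((%x. 2^n * x) hasD 2^n) (at z)" by (auto intro!: derivative_eq_intros)
 show "(ramp n hasD bump n z) (at z)" using DERIV_chain2[OF hat1_derivative lin] by (simp add: ramp_def[abs_def] bump_def mult.commute)
 show "(ramp2 n hasD ramp n z) (at z)" using DERIV_cdivide[OF DERIV_chain2[OF hat2_derivative lin], of "2^n"] by (simp add: ramp2_def[abs_def] ramp_def)
qed

lemma bump_props: "0 <= bump n z" "1/2^n <= abs z ==> bump n z = 0" "bump n (- z) = bump n z" and bump_cont: "continuous_on A f ==> continuous_on A (%x. bump n (f x))"
proof -
 show "bump n z = 0" if "1/2^n <= abs z" proof -
  have "1 <= abs (2^n * z)" using that by (simp add: abs_mult pos_divide_le_eq mult.commute)
  thus ?thesis by (simp add: bump_def hat_props)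
 qed
qed (auto simp: bump_def hat_props intro!: continuous_intros)

lemma ramp_props: "1/2^n <= z ==> ramp n z = 1" "z <= - (1/2^n) ==> ramp n z = 0" "0 <= ramp n z" "ramp n z <= 1" and ramp_mono: "z <= z' ==> ramp n z <= ramp n z'"
proof -
 show "ramp n z = 1" if "1/2^n <= z" unfolding ramp_def by (rule hat1_props(2)) (use that in "simp add: pos_divide_le_eq mult.commute")
 show "ramp n z = 0" if "z <= - (1/2^n)" proof -
  have "1/2^n <= - z" using that by simp
  hence "1 <= - z*2^n" by (simp only: pos_divide_le_eq[of "2^n"] zero_less_power zero_less_numeral)
  thus ?thesis unfolding ramp_def by (intro hat1_props(1)) (simp add: mult.commute)
 qed
 show "ramp n z <= ramp n z'" if "z <= z'" by (rule DERIV_nonneg_imp_nondecreasing[OF that]) (use ramp_derivative bump_props(1) in blast)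
qed (auto simp: ramp_def hat1_props)

text \<open>The occupation identity turns the time integral into a space average of the local time
  with a kernel of mass 1 and radius \<open>2^-n\<close>; uniform continuity on a slightly larger
  interval makes the convergence uniform in \<open>y\<close>.\<close>

lemma density_approx:
 assumes l: "continuous_occupation_density b l" and b: "cont0 b" and xi: "0 <= xi"
 shows "uniform_limit {-R..R} (%n y. integral {0..xi} (%u. bump n (b u - y))) (%y. l xi y) sequentially" unfolding uniform_limit_iff
proof (intro allI impI)
 fix e :: real assume e: "0 < e"
 have lc: "continuous_on UNIV (%y. l xi y)" using l xi unfolding continuous_occupation_density_def
  by (auto intro!: cont_comp2[of "{0..} \<times> UNIV" "%(t, x). l t x" UNIV "%y. (xi, y)", simplified] continuous_intros)
 have "uniformly_continuous_on {-R-1..R+1} (%y. l xi y)" by (intro compact_uniformly_continuous cont_subset[OF lc]) auto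
 then obtain d where d: "d > 0" "!!u v. u : {-R-1..R+1} ==> v : {-R-1..R+1} ==> dist u v < d ==> dist (l xi u) (l xi v) < e/2"
  unfolding uniformly_continuous_on_def using e half_gt_zero by metis
 have "(%n. 1/2^n :: real) ---> 0" by real_asymp
 hence "EV n. 1/2^n < d" using d(1) by (rule order_tendstoD)
 thus "EV n. ALL y:{-R..R}. dist (integral {0..xi} (%u. bump n (b u - y))) (l xi y) < e" proof eventually_elim
  case (elim n)
  show ?case proof
  fix y assume y: "y : {-R..R}"
  let ?h = "1/2^n :: real" and ?f = "%x. bump n (x - y)"
  have h: "0 < ?h" "?h <= 1" by auto
  have fc: "continuous_on A ?f" for A by (intro bump_cont continuous_intros)
  have "bounded (range ?f)" unfolding bounded_iff by (rule exI[of _ "2^n"]) (auto simp: bump_def hat_props abs_mult)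
  hence "(LBINT s=0..ereal xi. ?f (b s)) = (LINT x|lborel. ?f x * l xi x)" using l xi fc unfolding continuous_occupation_density_def by blast
  moreover have "(LBINT s=0..ereal xi. ?f (b s)) = integral {0..xi} (%u. ?f (b u))"
  by (rule LBINT_integral[OF bump_cont xi]) (intro continuous_intros cont_subset[OF b], auto)
  moreover have "(LINT x|lborel. ?f x * l xi x) = integral {y-?h..y+?h} (%x. ?f x * l xi x)"
  proof (rule lborel_integral_supported)
  show "continuous_on {y-?h..y+?h} (%x. ?f x * l xi x)" by (intro continuous_intros fc cont_subset[OF lc]) auto
  show "?f x * l xi x = 0" if "x < y - ?h \<or> y + ?h < x" for x using bump_props(2)[of n "x - y"] that h by (auto simp: abs_if)
  qed
  ultimately have 1: "integral {0..xi} (%u. ?f (b u)) = integral {y-?h..y+?h} (%x. ?f x * l xi x)" by simp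
  have "(?f has_integral ramp n (y + ?h - y) - ramp n (y - ?h - y)) {y-?h..y+?h}"
  proof (rule fundamental_theorem_of_calculus)
  show "y - ?h <= y + ?h" using h by simp
  have "((%x. ramp n (x - y)) hasD ?f x) (at x)" for x using DERIV_chain2[OF ramp_derivative DERIV_diff[OF DERIV_ident DERIV_const]] by simp
  thus "((%x. ramp n (x - y)) has_vector_derivative ?f x) (at x within {y-?h..y+?h})" for x
  by (auto simp: has_real_derivative_iff_has_vector_derivative[symmetric] intro: has_field_derivative_at_within)
  qed
  hence f1: "(?f has_integral 1) {y-?h..y+?h}" using ramp_props(1)[of n ?h] ramp_props(2)[of "- ?h" n] by simp
  have "integral {y-?h..y+?h} (%x. ?f x * l xi x) - l xi y = integral {y-?h..y+?h} (%x. ?f x * l xi x - ?f x * l xi y)" using integral_unique[OF f1]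
  by (subst Henstock_Kurzweil_Integration.integral_diff) (auto intro!: int_cont continuous_intros fc cont_subset[OF lc])
  also have "norm ... <= integral {y-?h..y+?h} (%x. ?f x*(e/2))" proof (rule integral_norm_bound_integral)
  show "(%x. ?f x * l xi x - ?f x * l xi y) integrable_on {y-?h..y+?h}" "(%x. ?f x*(e/2)) integrable_on {y-?h..y+?h}"
  by (auto intro!: int_cont continuous_intros fc cont_subset[OF lc])
  fix x assume x: "x : {y-?h..y+?h}"
  have "dist (l xi x) (l xi y) < e/2" proof (rule d(2))
  show "x : {-R-1..R+1}" "y : {-R-1..R+1}" using x y h unfolding atLeastAtMost_iff by linarith+
  show "dist x y < d" using x elim unfolding atLeastAtMost_iff dist_real_def by linarith
  qed
  hence "?f x*abs (l xi x - l xi y) <= ?f x*(e/2)" by (intro mult_left_mono bump_props(1)) (simp add: dist_real_def)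
  thus "norm (?f x * l xi x - ?f x * l xi y) <= ?f x*(e/2)" using bump_props(1)[of n "x - y"] by (simp add: right_diff_distrib[symmetric] abs_mult)
  qed
  also have "... = e/2" using integral_unique[OF f1] by simp
  finally show "dist (integral {0..xi} (%u. bump n (b u - y))) (l xi y) < e" using e by (simp add: 1 dist_real_def)
  qed qed qed

text \<open>Abel summation turns the sum into a convex combination of the values \<open>v i\<close>.\<close>

lemma abel_convex:
 fixes c v :: "nat => real"
 assumes c: "c 0 = 1" "c (Suc N) = 0" "!!i. i <= N ==> c (Suc i) <= c i" and near: "!!i. i <= N ==> c (Suc i) < c i ==> abs (v i - z) <= dl"
 shows "abs (v 0 + (SUM i<N. (v (Suc i) - v i) * c (Suc i)) - z) <= dl"
proof -
 have abel: "(SUM i<n. v i*(c i - c (Suc i))) + v n * c n = v 0 * c 0 + (SUM i<n. (v (Suc i) - v i) * c (Suc i))" for n by (induction n) (simp_all add: algebra_simps)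
 have one: "(SUM i<Suc N. c i - c (Suc i)) = 1" using sum_lessThan_telescope'[of c "Suc N"] c(1,2) by simp
 have "v 0 + (SUM i<N. (v (Suc i) - v i) * c (Suc i)) = (SUM i<Suc N. v i*(c i - c (Suc i)))" using abel[of N] c(1,2) by simp
 hence "v 0 + (SUM i<N. (v (Suc i) - v i) * c (Suc i)) - z = (SUM i<Suc N. v i*(c i - c (Suc i))) - z*(SUM i<Suc N. c i - c (Suc i))" unfolding one by simp
 also have "... = (SUM i<Suc N. (v i - z)*(c i - c (Suc i)))" by (simp only: sum_distrib_left sum_subtractf[symmetric] left_diff_distrib)
 also have "abs (...) <= (SUM i<Suc N. dl*(c i - c (Suc i)))" proof (rule order_trans[OF sum_abs sum_mono])
  fix i assume "i : {..<Suc N}"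
  hence i: "i <= N" by simp
  show "abs ((v i - z)*(c i - c (Suc i))) <= dl*(c i - c (Suc i))" proof (cases "c (Suc i) < c i") case True
  thus ?thesis using near[OF i True] by (simp add: abs_mult mult_right_mono)
  next case False
  hence "c i - c (Suc i) = 0" using c(3)[OF i] by simp
  thus ?thesis by simp
  qed qed
 also have "... = dl" unfolding sum_distrib_left[symmetric] one by simp
 finally show ?thesis .
qed

text \<open>Each increment of \<open>exp (- ww)\<close> is attached to its node in scale
  coordinates. With \<open>ramp\<close> this is a smoothed step function having these increments as
  jumps, with \<open>bump\<close> its derivative, a sum of smoothed Dirac masses.\<close>

definition node_sum :: "(nat => real => real) => (real => real) => nat => real => real" where
 "node_sum f ww n y = (SUM i<n*2^n. (exp (- ww (dy n (Suc i))) - exp (- ww (dy n i))) * f n (y - scale ww (dy n i)))"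

lemma node_sum_derivative:
 assumes "!!n z. (f n hasD f' n z) (at z)"
 shows "(node_sum f ww n hasD node_sum f' ww n y) (at y)"
proof -
 have "((%y. f n (y - c)) hasD f' n (y - c)) (at y)" for c using DERIV_chain2[OF assms DERIV_diff[OF DERIV_ident DERIV_const]] by simp
 thus ?thesis unfolding node_sum_def[abs_def] by (intro DERIV_sum DERIV_cmult)
qed

context environment
begin

lemma h_scale: "h (S x) = exp (- ww x)" by (simp add: h_def)

text \<open>By Abel summation the value at \<open>y\<close> is a convex combination of
  \<open>h\<close> at the nodes where the ramp weight decreases, and these lie within
  \<open>d\<close> of \<open>max y 0\<close>; for negative \<open>y\<close> only the starting value
  remains in the limit.\<close>

lemma node_sum_limit:
 assumes R: "0 <= R"
 shows "uniform_limit {-R..R} (%n y. exp (- ww 0) + node_sum ramp ww n y) (%y. h (max y 0)) sequentially" unfolding uniform_limit_iff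
proof (intro allI impI)
 fix e :: real assume e: "0 < e"
 \<comment> \<open>A margin of 2 beyond \<open>R\<close> keeps the last relevant node and its
   successor inside \<open>[0, a + 1]\<close>, where the mesh is controlled.\<close>
 obtain a :: nat where "inv S (R + 2) < real a" using reals_Archimedean2 by blast
 hence a: "R + 2 < S (real a)" using scale_less_iff[of "inv S (R + 2)" "real a"] by simp
 have "uniformly_continuous_on {0..S (real a + 1)} h" by (intro compact_uniformly_continuous cont_subset[OF h_cont]) auto
 then obtain d where d: "d > 0" "!!u v. u : {0..S (real a + 1)} ==> v : {0..S (real a + 1)} ==> dist u v < d ==> dist (h u) (h v) < e/2"
  unfolding uniformly_continuous_on_def using e half_gt_zero by metis
 have "0 < d/2" using d(1) by simp
 have mesh: "EV n. ALL i. abs (inc S (dy n) i (real a + 1)) < d/2" by (rule dyadic_mesh[OF scale_cont]) (use d in auto)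
 have "(%n. 1/2^n :: real) ---> 0" by real_asymp
 hence "EV n. 1/2^n < d/2" using \<open>0 < d/2\<close> by (rule order_tendstoD)
 thus "EV n. ALL y:{-R..R}. dist (exp (- ww 0) + node_sum ramp ww n y) (h (max y 0)) < e" using mesh eventually_ge_at_top[of "a + 1"]
 proof eventually_elim case (elim n)
  show ?case proof
  fix y assume y: "y : {-R..R}"
  let ?h = "1/2^n :: real" and ?N = "n*2^n"
  define x where "x i = dy n i" for i
  have x: "0 <= x i" "x i <= x (Suc i)" "x (Suc i) = x i + ?h" for i by (auto simp: x_def divide_right_mono add_divide_distrib)
  have h1: "0 < ?h" "?h <= 1" by auto
  have x0: "x 0 = 0" by (simp add: x_def)
  have S0: "0 <= S (x i)" for i using scale_less_iff[of "x i" 0] x(1)[of i] by (simp add: scale_0 not_less[symmetric])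
  have Sm: "S (x i) <= S (x (Suc i))" for i using scale_less_iff[of "x (Suc i)" "x i"] x(2)[of i] by linarith
  \<comment> \<open>Weights of the Abel summation, decreasing from 1 to 0. The index is shifted by
    one because the increment from node \<open>i\<close> to its successor is carried by the ramp at
    node \<open>i\<close>.\<close>
  define c where "c i = (if i = 0 then 1 else if i <= ?N then ramp n (y - S (x (i - 1))) else 0)" for i
  have eq: "exp (- ww 0) + node_sum ramp ww n y = h (S (x 0)) + (SUM i<?N. (h (S (x (Suc i))) - h (S (x i))) * c (Suc i))"
  by (simp add: node_sum_def h_scale x0 c_def) (simp add: x_def)
  have "abs (h (S (x 0)) + (SUM i<?N. (h (S (x (Suc i))) - h (S (x i))) * c (Suc i)) - h (max y 0)) <= e/2"
  proof (rule abel_convex)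
  show "c (Suc i) <= c i" if "i <= ?N" for i using that ramp_mono[of "y - S (x i)" "y - S (x (i - 1))" n] Sm[of "i - 1"] ramp_props(3,4) by (auto simp: c_def)
  fix i assume i: "i <= ?N" and less: "c (Suc i) < c i"
  have N: "0 < ?N" using elim(3) by simp
  have Sa: "S (real a) < S (real a + 1)" by (rule scale_strict) simp
  have main: "S (x i) < max y 0 + d & max y 0 - d < S (x i) & S (x i) <= S (real a + 1)" proof (cases i)
  case 0
  hence "ramp n (y - S (x 0)) < 1" using less N by (simp add: c_def)
  hence "y - S (x 0) < ?h" using ramp_props(1)[of n "y - S (x 0)"] by (cases "?h <= y - S (x 0)") auto
  thus ?thesis using 0 elim(1) d(1) S0[of 0] a Sa R by (auto simp: x0 scale_0)
  next case (Suc j)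
  have "0 < ramp n (y - S (x j))" using less i Suc ramp_props(3)[of n "y - S (x (Suc j))"] by (auto simp: c_def split: if_splits)
  hence j1: "S (x j) < y + ?h" using ramp_props(2)[of "y - S (x j)" n] by (cases "y - S (x j) <= - ?h") auto
  hence "S (x j) < S (real a)" using y h1 a unfolding atLeastAtMost_iff by linarith
  hence xj: "x j < real a" by (simp add: scale_less_iff)
  hence xi: "x i <= real a + 1" using x(3)[of j] h1 unfolding Suc by linarith
  have "abs (S (x (Suc j)) - S (x j)) < d/2" using elim(2)[rule_format, of j] xi xj Suc unfolding x_def[symmetric] by simp
  hence up: "S (x i) < y + ?h + d/2" using j1 unfolding Suc by linarith
  have "i ~= ?N" proof
  assume "i = ?N"
  hence "x i = real n" by (simp add: x_def)
  hence "real n - 1 <= x j" using x(3)[of j] h1 unfolding Suc by linarith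
  moreover have "real (a + 1) <= real n" using elim(3) by (rule of_nat_mono)
  ultimately show False using xj by simp
  qed
  hence "ramp n (y - S (x i)) < 1" using less i Suc ramp_props(4)[of n "y - S (x j)"] by (auto simp: c_def)
  hence "y - S (x i) < ?h" using ramp_props(1)[of n "y - S (x i)"] by (cases "?h <= y - S (x i)") auto
  moreover have "S (x i) <= S (real a + 1)" using xi scale_less_iff[of "real a + 1" "x i"] by linarith
  ultimately show ?thesis using up elim(1) S0[of i] d(1) by (auto simp: max_def)
  qed
  have "dist (h (S (x i))) (h (max y 0)) < e/2" by (rule d(2)) (use main S0[of i] y R a Sa in "auto simp: dist_real_def max_def abs_if")
  thus "abs (h (S (x i)) - h (max y 0)) <= e/2" by (simp add: dist_real_def)
  qed (simp_all add: c_def)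
  thus "dist (exp (- ww 0) + node_sum ramp ww n y) (h (max y 0)) < e" unfolding eq dist_real_def using e by linarith
  qed qed qed

end

abbreviation mirror :: "(real => real) => real => real" where "mirror ww \<equiv> %x. ww (- x)"

lemma (in environment) mirror_environment: "environment (mirror ww)" using wc rec_pos rec_neg by unfold_locales (auto intro!: cont_comp2[OF wc] continuous_intros)

lemma (in environment) mirror_scale: "scale (mirror ww) x = - S (- x)" using scale_neg[of x] environment.scale_pos[OF mirror_environment, of x]
  environment.scale_neg[OF mirror_environment, of "- x"] scale_pos[of "- x"] by (cases "0 <= x") auto

lemma (in environment) mirror_h: "environment.h (mirror ww) y = h (- y)"
proof -
 interpret m: environment "mirror ww" by (rule mirror_environment)
 have "m.S (- inv S (- y)) = y" by (simp add: mirror_scale)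
 hence "inv m.S y = - inv S (- y)" by (metis m.scale_inv(2))
 thus ?thesis by (simp add: m.h_def h_def)
qed

text \<open>\<open>smooth1\<close> approximates \<open>h = exp (- w \<circ> inv S)\<close>.\<close>

definition smooth2 :: "(real => real) => nat => real => real" where
 "smooth2 ww n y = exp (- ww 0) * y + node_sum ramp2 ww n y - node_sum ramp2 (mirror ww) n (- y)"
definition smooth1 :: "(real => real) => nat => real => real" where
 "smooth1 ww n y = exp (- ww 0) + node_sum ramp ww n y + node_sum ramp (mirror ww) n (- y)"
definition smooth0 :: "(real => real) => nat => real => real" where
 "smooth0 ww n y = node_sum bump ww n y - node_sum bump (mirror ww) n (- y)"

lemma smooth_derivative: "(smooth2 ww n hasD smooth1 ww n y) (at y)" "(smooth1 ww n hasD smooth0 ww n y) (at y)"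
proof -
 have neg: "((%y. f (- y)) hasD - f' (- y)) (at y)" if "!!y. (f hasD f' y) (at y)" for f f' and y :: real
  using DERIV_chain2[OF that DERIV_minus[OF DERIV_ident]] by simp
 note d2 = node_sum_derivative[of ramp2 ramp, OF ramp2_derivative] and d1 = node_sum_derivative[of ramp bump, OF ramp_derivative]
 show "(smooth2 ww n hasD smooth1 ww n y) (at y)" unfolding smooth2_def[abs_def] smooth1_def
  by (rule DERIV_cong[OF DERIV_diff[OF DERIV_add[OF DERIV_cmult[OF DERIV_ident] d2] neg[OF d2]]]) simp
 show "(smooth1 ww n hasD smooth0 ww n y) (at y)" unfolding smooth1_def[abs_def] smooth0_def
  by (rule DERIV_cong[OF DERIV_add[OF DERIV_add[OF DERIV_const d1] neg[OF d1]]]) simp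
qed

lemma smooth0_cont: "continuous_on UNIV (smooth0 ww n)" unfolding smooth0_def[abs_def] node_sum_def by (intro continuous_intros bump_cont)

text \<open>The right half contributes \<open>h\<close> on the positive axis and the constant
  \<open>h 0\<close> on the negative one, the mirrored half conversely; the constant is counted
  twice and subtracted once.\<close>

lemma (in environment) smooth1_limit:
 assumes R: "0 <= R"
 shows "uniform_limit {-R..R} (smooth1 ww) h sequentially"
proof -
 interpret m: environment "mirror ww" by (rule mirror_environment)
 have "uniform_limit {-R..R} (%n y. exp (- mirror ww 0) + node_sum ramp (mirror ww) n (- y)) (%y. m.h (max (- y) 0)) sequentially"
  by (rule uniform_limit_compose'[OF m.node_sum_limit[OF R]]) auto
 hence "uniform_limit {-R..R} (%n y. (exp (- ww 0) + node_sum ramp ww n y) + (exp (- mirror ww 0) + node_sum ramp (mirror ww) n (- y)) - exp (- ww 0))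
  (%y. h (max y 0) + m.h (max (- y) 0) - exp (- ww 0)) sequentially" by (intro uniform_limit_minus uniform_limit_add node_sum_limit[OF R] uniform_limit_const)
 moreover have "h (max y 0) + m.h (max (- y) 0) - exp (- ww 0) = h y" for y using h_scale[of 0] by (simp add: mirror_h scale_0 max_def)
 ultimately show ?thesis by (simp add: smooth1_def[abs_def] add.assoc add.left_commute)
qed

text \<open>\<open>smooth2\<close> and \<open>inv S\<close> have the derivatives
  \<open>smooth1\<close> and \<open>h\<close>, which are uniformly close on a compact interval
  around 0 containing \<open>y\<close>; the mean value inequality does the rest.\<close>

lemma (in environment) smooth2_limit: "(%n. smooth2 ww n y - smooth2 ww n 0) ---> inv S y"
proof (rule LIMSEQ_I)
 fix r :: real assume r: "0 < r"
 define e where "e = r/(abs y + 1)"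
 have e: "0 < e" using r by (simp add: e_def)
 have er: "e*abs y < r" proof -
  have "e*abs y < e*(abs y + 1)" using e by simp
  also have "... = r" by (simp add: e_def)
  finally show ?thesis .
 qed
 have "EV n. ALL z:{-abs y..abs y}. dist (smooth1 ww n z) (h z) < e" using smooth1_limit[of "abs y"] e unfolding uniform_limit_iff by simp
 hence "EV n. norm ((smooth2 ww n y - smooth2 ww n 0) - inv S y) < r" proof eventually_elim case (elim n)
  have "norm ((smooth2 ww n y - inv S y) - (smooth2 ww n 0 - inv S 0)) <= e * norm (y - 0)"
  proof (rule field_differentiable_bound[of "{-abs y..abs y}" "%z. smooth2 ww n z - inv S z" "%z. smooth1 ww n z - h z"])
  show "((%z. smooth2 ww n z - inv S z) has_field_derivative smooth1 ww n z - h z) (at z within {-abs y..abs y})" for z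
  using DERIV_diff[OF smooth_derivative(1) inv_deriv] by (simp add: h_def has_field_derivative_at_within)
  show "norm (smooth1 ww n z - h z) <= e" if "z : {-abs y..abs y}" for z using elim that by (force simp: dist_real_def)
  qed auto
  thus ?case using er by (simp add: inv_0)
 qed
 thus "EX no. ALL n>=no. norm ((smooth2 ww n y - smooth2 ww n 0) - inv S y) < r" by (simp add: ev_seq)
qed

text \<open>The left-hand side is the sum that Ito's formula in the environment, stopped at \<open>a\<close>, approximates;
  nodes beyond the range of \<open>b\<close> do not contribute.\<close>

lemma (in environment) stopped_sum_eq:
 fixes b :: "real => real"
 assumes m: "!!u. u : {0..xi} ==> b u <= m" and a: "1 <= a" "m < S (a - 1)"
 shows "EV n. (SUM i<n*2^n. integral {0..xi} (%u. bump n (b u - S (dy n i)))*(inc (%s. - exp (- ww s)) (dy n) i a)) =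
  - (SUM i<n*2^n. (exp (- ww (dy n (Suc i))) - exp (- ww (dy n i))) * integral {0..xi} (%u. bump n (b u - S (dy n i))))"
proof -
 have "0 < S (a - 1/2) - S (a - 1)" using scale_strict[of "a - 1" "a - 1/2"] by simp
 hence pos: "0 < S (a - 1/2) - m" using a by simp
 have "(%n. 1/2^n :: real) ---> 0" by real_asymp
 hence "EV n. 1/2^n < S (a - 1/2) - m" using pos by (rule order_tendstoD)
 thus ?thesis using eventually_ge_at_top[of 1] proof eventually_elim case (elim n)
  have h2: "1/2^n <= (1/2 :: real)" proof -
  have "(2::real)^1 <= 2^n" using elim(2) by (intro power_increasing) auto
  thus ?thesis by (simp add: field_simps)
  qed
  show ?case unfolding sum_negf[symmetric] proof (rule sum.cong[OF refl])
  fix i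
  let ?x = "dy n i" and ?x' = "dy n (Suc i)"
  have xx: "?x <= ?x'" "?x' = ?x + 1/2^n" by (auto simp: divide_right_mono add_divide_distrib)
  show "integral {0..xi} (%u. bump n (b u - S ?x))*(- exp (- ww (min ?x' a)) - - exp (- ww (min ?x a))) =
  - ((exp (- ww ?x') - exp (- ww ?x)) * integral {0..xi} (%u. bump n (b u - S ?x)))" proof (cases "?x' <= a")
  case True
  hence "min ?x' a = ?x'" "min ?x a = ?x" using xx(1) by auto
  thus ?thesis by (simp add: algebra_simps)
  next case False
  hence "a - 1/2 < ?x" using xx(2) h2 by linarith
  hence "S (a - 1/2) < S ?x" by (rule scale_strict)
  hence "bump n (b u - S ?x) = 0" if "u : {0..xi}" for u using m[OF that] elim(1) by (intro bump_props(2)) linarith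
  hence "integral {0..xi} (%u. bump n (b u - S ?x)) = integral {0..xi} (%_. 0)" by (intro integral_cong)
  thus ?thesis by simp
  qed qed qed qed

text \<open>The time integral of a smoothed Dirac mass at a node is an approximate local time there,
  so the Ito correction becomes a node sum, with opposite sign on the mirrored nodes.\<close>

lemma (in environment) smooth0_integral:
 fixes b :: "real => real"
 assumes b: "continuous_on {0..xi} b"
 shows "integral {0..xi} (%u. smooth0 ww n (b u)) =
  (SUM i<n*2^n. (exp (- ww (dy n (Suc i))) - exp (- ww (dy n i))) * integral {0..xi} (%u. bump n (b u - S (dy n i)))) -
  (SUM i<n*2^n. (exp (- ww (- (dy n (Suc i)))) - exp (- ww (- (dy n i)))) * integral {0..xi} (%u. bump n (b u - S (- (dy n i)))))"
proof -
 have refl: "bump n (- b u - - S (- (dy n i))) = bump n (b u - S (- (dy n i)))" for u i using bump_props(3)[of n "b u - S (- (dy n i))"] by simp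
 have int: "(%u. c * bump n (b u - y)) integrable_on {0..xi}" for c y :: real proof (rule int_cont)
  show "continuous_on {0..xi} (%u. c * bump n (b u - y))" by (intro continuous_on_mult continuous_on_const bump_cont continuous_on_diff b)
 qed
 show ?thesis unfolding smooth0_def node_sum_def mirror_scale refl by (subst Henstock_Kurzweil_Integration.integral_diff)
  (simp_all only: integrable_sum[OF finite_lessThan int] Henstock_Kurzweil_Integration.integral_sum[OF finite_lessThan int] Henstock_Kurzweil_Integration.integral_mult_right)
qed

section \<open>Identification of the environment integral\<close>

lemma integral_sgn:
 fixes F :: "real => real"
 assumes F: "continuous_on UNIV F" and a: "0 <= a"
 shows "(LBINT x=ereal (- a)..ereal a. sgn x * F x) = integral {0..a} F - integral {0..a} (%x. F (- x))"
proof -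
 have i: "integrable lborel (%x. indicator {-a..a} x *\<^sub>R F x)"
  using borel_integrable_atLeastAtMost'[of "-a" a F] cont_subset[OF F] by (simp add: set_integrable_def)
 have [measurable]: "F : bor borel" by (rule borel_measurable_continuous_onI[OF F])
 have "integrable lborel (%x. indicator {-a..a} x *\<^sub>R (sgn x * F x))" proof (rule b_int_bound[OF i])
  show "(%x. indicator {-a..a} x *\<^sub>R (sgn x * F x)) : bor lborel" by measurable
  have "abs (sgn x * F x) <= abs (F x)" for x by (simp add: abs_mult abs_sgn_eq)
  thus "AE x in lborel. norm (indicator {-a..a} x *\<^sub>R (sgn x * F x)) <= norm (indicator {-a..a} x *\<^sub>R F x)" by (intro AE_I2) (simp add: indicator_def)
 qed
 hence si: "set_integrable lborel {-a..a} (%x. sgn x * F x)" by (simp add: set_integrable_def)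
 have cong: "integral A (%x. sgn x * F x) = integral A G" "G integrable_on A ==> (%x. sgn x * F x) integrable_on A"
  if "!!x. x : A ==> x ~= 0 ==> G x = sgn x * F x" for A and G :: "real => real"
  using that integral_spike[of "{0}" A G "%x. sgn x * F x"] integrable_spike[of G A "{0}" "%x. sgn x * F x"] by auto
 have "(LBINT x=ereal (- a)..ereal a. sgn x * F x) = integral {-a..a} (%x. sgn x * F x)" by (rule interval_integral_eq_integral[OF _ si]) (use a in simp)
 also have "... = integral {-a..0} (%x. sgn x * F x) + integral {0..a} (%x. sgn x * F x)"
  by (rule Henstock_Kurzweil_Integration.integral_combine[symmetric]) (use a set_borel_integral_eq_integral(1)[OF si] in auto)
 also have "integral {0..a} (%x. sgn x * F x) = integral {0..a} F" by (rule cong(1)) (auto simp: sgn_real_def)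
 also have "integral {-a..0} (%x. sgn x * F x) = integral {-a..0} (%x. - F x)" by (rule cong(1)) (auto simp: sgn_real_def)
 also have "... = - integral {0..a} (%x. F (- x))" using Henstock_Kurzweil_Integration.integral_reflect_real[of 0 "-a" F, symmetric] by simp
 finally show ?thesis by simp
qed

lemma strat_integrand_exp: "strat_integrand (%x u. exp (- u))"
proof -
 have d: "((%u. exp (- u)) hasD - exp (- u)) (at u)" for u :: real by (auto intro!: derivative_eq_intros)
 have dd: "deriv (%u. exp (- u)) = (%u. - exp (- u :: real))" using DERIV_imp_deriv[OF d] by auto
 show ?thesis unfolding strat_integrand_def dd proof (intro conjI allI)
  show "continuous_on UNIV (%(x, u). exp (- u) :: real)" by (auto simp: case_prod_unfold intro!: continuous_intros)
  show "(%u. exp (- u)) differentiable at u" for u :: real using d by (auto simp: real_differentiable_def)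
  show "continuous_on UNIV (%u. - exp (- u :: real))" by (intro continuous_intros)
  show "EX \<mu>>1/2. EX th>0. ALL \<alpha> \<beta>. EX c1>0. EX c2>0. ALL u. (ALL x:{\<alpha>..\<beta>}. abs (exp (- u)) <= c1 * exp (th*abs u)) &
  (ALL x:{\<alpha>..\<beta>}. ALL y:{\<alpha>..\<beta>}. ALL x':{\<alpha>..\<beta>}. ALL y':{\<alpha>..\<beta>}. x ~= y --> x' ~= y' -->
  abs (exp (- u) - exp (- u))/abs (x - y) powr \<mu> + abs (- exp (- u) - - exp (- u))/abs (x' - y') powr \<mu>
  <= c2 * exp (th*abs (u :: real)))"
  \<comment> \<open>The integrand does not depend on the space variable, so the Hoelder quotients
    vanish and the exponent 1 will do.\<close>
  by (rule exI[of _ 1], rule conjI, simp, rule exI[of _ 1], rule conjI, simp, intro allI, rule exI[of _ 1], rule conjI, simp, rule exI[of _ 1]) auto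
 qed qed

context brox
begin

abbreviation "ell \<equiv> local_time_of B"
abbreviation (input) "pW w \<equiv> %x. W x w"
abbreviation (input) "ito_smooth J n t w \<equiv> smooth2 (pW w) n (tc.X t w) - smooth2 (pW w) n (tc.X 0 w) =
 J n t w + 1/2 * integral {0..tau t w} (%u. smooth0 (pW w) n (B u w))"
abbreviation (input) "wsum xi V N a \<equiv> %n w. SUM i<n*2^n. integral {0..xi} (%u. bump n (B u w - N (dy n i) w)) * inc (%s. - exp (- V s w)) (dy n) i a"
abbreviation (input) "corr xi V N I a \<equiv> %w. I a w - 1/2 * integral {0..a} (%x. exp (- V x w) * ell w xi (N x w))"

text \<open>Ito's formula for \<open>- exp (- z)\<close> along the environment, weighted by
  approximate local times at the moving level \<open>N s\<close>. The filtration \<open>E\<close>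
  knows all of \<open>B\<close> from the start, so these weights are adapted.\<close>

lemma half_line:
 fixes V N :: "real => 'a => real" and E :: "real => 'a measure"
 assumes full: "full_bm M V E" and BE: "!!u s. 0 <= u ==> 0 <= s ==> B u : bor (E s)"
  and NE: "!!s. 0 <= s ==> N s : bor (E s)" and Nc: "acont M N" and xi: "0 <= xi"
 obtains I where "SI M E V (%x w. exp (- V x w) * ell w xi (N x w)) I"
  "!!a. 0 <= a ==> pconv M (wsum xi V N a) (corr xi V N I a)"
proof -
 interpret e: full_bm M V E by (rule full)
 define phn where "phn n s w = integral {0..xi} (%u. bump n (B u w - N s w))" for n s w
 define ph where "ph s w = ell w xi (N s w)" for s w
 have [measurable]: "bump n : bor borel" for n by (rule borel_measurable_continuous_onI) (intro bump_cont continuous_on_id)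
 have phnm: "phn n s : bor (E s)" if s: "0 <= s" for n s unfolding phn_def
 proof (rule full_integral[OF e.fullG[OF s] _ _ xi])
  show "(%w. bump n (B u w - N s w)) : bor (E s)" if "0 <= u" "u <= xi" for u using BE[OF that(1) s] NE[OF s] by measurable
  show "acont M (%u w. bump n (B u w - N s w))" using dr.B_continuous by eventually_elim (intro bump_cont continuous_intros)
 qed
 have ul: "AE w in M. upath (%n u. phn n u w) (%u. ph u w)" using Nc good_path dr.B_continuous
 proof eventually_elim case (elim w)
  show ?case unfolding upath_def proof (intro allI impI)
  fix t :: real
  have "bounded ((%u. N u w) ` {0..t})" by (intro compact_imp_bounded compact_image cont_subset[OF elim(1)]) auto
  then obtain R where R: "ALL v:(%u. N u w) ` {0..t}. norm v <= R" unfolding bounded_iff by blast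
  show "uniform_limit {0..t} (%n u. phn n u w) (%u. ph u w) sequentially" unfolding phn_def ph_def
  by (rule uniform_limit_compose'[OF density_approx[where R=R and b="%s. B s w", OF _ elim(3) xi]]) (use elim(2) R in "auto simp: abs_le_iff")
  qed qed
 \<comment> \<open>\<open>local_time\<close> is a choice made path by path; its measurability comes
   from being the almost sure limit of occupation integrals.\<close>
 have phca: "cadapt M E ph" unfolding ca_def proof (intro conjI allI impI)
  show "ph t : bor (E t)" if t: "0 <= t" for t proof (rule full_limit[OF e.fullG[OF t] phnm[OF t]])
  show "AE w in M. (%n. phn n t w) ---> ph t w" using ul by eventually_elim (rule upathD[OF _ t])
  qed
  show "acont M ph" using Nc good_path proof eventually_elim case (elim w)
  hence "continuous_on ({0..} \<times> UNIV) (%(t, x). ell w t x)" by (simp add: continuous_occupation_density_def)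
  hence "cont0 (%s. (%(t, x). ell w t x) (xi, N s w))" by (rule cont_comp2) (use xi elim in "auto intro!: continuous_intros")
  thus ?case by (simp add: ph_def)
  qed qed
 have u: "uconv M phn ph" proof (rule subseq_ae_AE)
  show "AE w in M. ALL s. strict_mono s --> upath (%n u. phn (s n) u w) (%u. ph u w)"
  using ul by eventually_elim (auto simp: upath_def uniform_limit_iff intro: eventually_subseq)
 qed
 have Vm: "e.X t : bor (E t)" if "0 <= t" for t using e.X_adapted[OF that] .
 have Hca: "cadapt M E (%x w. ph x w * exp (- e.X x w))" unfolding ca_def proof (intro conjI allI impI)
  show "(%w. ph x w * exp (- e.X x w)) : bor (E x)" if "0 <= x" for x
  using phca Vm[OF that] that by (auto simp: ca_def intro!: borel_measurable_times measurable_compose[OF _ borel_measurable_exp])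
  have "acont M ph" using phca by (simp add: ca_def)
  thus "acont M (%x w. ph x w * exp (- e.X x w))" using e.X_continuous by eventually_elim (intro continuous_intros)
 qed
 then obtain I where I: "SI M E e.X (%x w. ph x w * exp (- e.X x w)) I" using e.SI_exists by blast
 show ?thesis proof (rule that)
  show "SI M E V (%x w. exp (- V x w) * ell w xi (N x w)) I" using I by (simp add: e.X_eq ph_def mult.commute)
  fix a :: real assume a: "0 <= a"
  have "pconv M (%n w. SUM i<n*2^n. phn n (dy n i) w * (inc (%s. - exp (- e.X s w)) (dy n) i a))
  (%w. I a w + 1/2 * integral {0..a} (%x. - (ph x w * exp (- V x w))))"
  proof (rule e.weighted_ito[where g="%_ z. - exp (- z)" and ?g1.0="%_ z. exp (- z)" and ?g2.0="%_ z. - exp (- z)", OF phnm phca u a _ _ _ I])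
  show "AE w in M. (ALL z. ((%z. - exp (- z)) hasD exp (- z)) (at z)) & (ALL z. ((%z. exp (- z)) hasD - exp (- z)) (at z)) & continuous_on UNIV (%z :: real. - exp (- z))"
  by (auto intro!: derivative_eq_intros continuous_intros)
  show "(%w. exp (- e.X t w)) : bor (E t)" "(%w. - exp (- e.X t w)) : bor (E t)" if "0 <= t" for t using Vm[OF that] by measurable
  have "acont M ph" using phca by (simp add: ca_def)
  thus "AE w in M. cont0 (%x. - (ph x w * exp (- V x w))) & (ALL s>=0. ph s w * - exp (- e.X s w) = - (ph s w * exp (- V s w)))"
  using e.X_continuous unfolding e.X_eq by eventually_elim (auto intro!: continuous_intros)
  qed
  thus "pconv M (wsum xi V N a) (corr xi V N I a)"
  by (simp add: e.X_eq phn_def ph_def mult.commute)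
 qed qed

lemma env_meas:
 assumes aug: "augmented_bm M V (psigma M {0..} B) E"
 shows "0 <= u ==> B u : bor (E s)" "0 <= z ==> z <= s ==> V z : bor (E s)" "full_alg M (E s)"
proof -
 show f: "full_alg M (E s)" by (rule augmented_bm.G_full[OF aug])
 show "B u : bor (E s)" if "0 <= u" by (rule meas_subalg[OF _ psigma_meas[of u "{0..}" B M]])
  (use augmented_bm.S_G[OF aug, of s] full_algD(1)[OF f] that in "auto simp: subalgebra_def")
 show "0 <= z ==> z <= s ==> V z : bor (E s)" by (rule augmented_bm.V_G[OF aug])
qed

lemma halves:
 assumes xi: "0 <= xi"
 obtains Ipos Ineg where "ito_halves M W B (%x u. exp (- u)) xi Ipos Ineg"
  "!!a. 0 <= a ==> pconv M (wsum xi W (%x w. scale_of W w x) a)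
  (corr xi W (%x w. scale_of W w x) Ipos a)"
  "!!a. 0 <= a ==> pconv M (wsum xi (%x. W (- x)) (%x w. scale_of W w (- x)) a)
  (corr xi (%x. W (- x)) (%x w. scale_of W w (- x)) Ineg a)"
proof -
 have Sc: "AE w in M. continuous_on UNIV (scale_of W w)" using good_path by eventually_elim (auto simp: env_path_def intro: environment.scale_cont)
 obtain Ipos where Ipos: "SI M (environment_filtration M W B) W (%x w. exp (- W x w) * ell w xi (scale_of W w x)) Ipos"
  "!!a. 0 <= a ==> pconv M (wsum xi W (%x w. scale_of W w x) a)
  (corr xi W (%x w. scale_of W w x) Ipos a)"
 proof (rule half_line[OF ep.full_bm_axioms _ _ _ xi, where N="%x w. scale_of W w x"])
  note m = env_meas[OF augmented_envs(1)]
  show "B u : bor (environment_filtration M W B s)" if "0 <= u" for u s by (rule m(1)[OF that])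
  show "(%w. scale_of W w s) : bor (environment_filtration M W B s)" if "0 <= s" for s by (rule scale_meas_pos[OF m(3) that m(2)])
  show "AE w in M. cont0 (scale_of W w)" using Sc by eventually_elim (rule cont_subset, auto)
 qed blast
 obtain Ineg where Ineg: "SI M (environment_filtration M (%x. W (- x)) B) (%x. W (- x)) (%x w. exp (- W (- x) w) * ell w xi (scale_of W w (- x))) Ineg"
  "!!a. 0 <= a ==> pconv M (wsum xi (%x. W (- x)) (%x w. scale_of W w (- x)) a)
  (corr xi (%x. W (- x)) (%x w. scale_of W w (- x)) Ineg a)"
 proof (rule half_line[OF em.full_bm_axioms _ _ _ xi, where N="%x w. scale_of W w (- x)"])
  note m = env_meas[OF augmented_envs(2)]
  show "B u : bor (environment_filtration M (%x. W (- x)) B s)" if "0 <= u" for u s by (rule m(1)[OF that])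
  show "(%w. scale_of W w (- s)) : bor (environment_filtration M (%x. W (- x)) B s)" if "0 <= s" for s by (rule scale_meas_neg[OF m(3) that m(2)])
  show "acont M (%s w. scale_of W w (- s))" using Sc by eventually_elim (rule cont_comp2, auto intro: continuous_intros)
 qed blast
 show ?thesis by (rule that[of Ipos Ineg]) (use Ipos Ineg in "auto simp: ito_halves_def")
qed

lemma node_sum_meas:
 assumes A: "full_alg M A" and WA: "!!x. W x : bor A" and Z: "Z : bor A" and f: "f n : bor borel"
 shows "(%w. node_sum f (pW w) n (Z w)) : bor A"
  "(%w. node_sum f (%x. W (- x) w) n (Z w)) : bor A"
proof -
 have S: "(%w. scale_of W w x) : bor A" for x by (rule scale_meas[OF A WA])
 have S': "(%w. scale (%x. W (- x) w) x) : bor A" for x proof (rule full_meas_AE[OF A])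
  show "(%w. - scale_of W w (- x)) : bor A" using S by measurable
  show "AE w in M. - scale_of W w (- x) = scale (%x. W (- x) w) x" using good_path proof eventually_elim
  case (elim w)
  hence "environment (pW w)" by (simp add: env_path_def)
  from environment.mirror_scale[OF this, of x] show ?case by simp
  qed
 qed simp
 note [measurable] = WA Z f S S'
 show "(%w. node_sum f (pW w) n (Z w)) : bor A" "(%w. node_sum f (%x. W (- x) w) n (Z w)) : bor A" unfolding node_sum_def by measurable
qed

section \<open>The whole-line integral along the diffusion\<close>

context
 fixes I :: "real => 'a => real"
 assumes I: "SI M FF (time_changed W B) rate I"
begin

text \<open>\<open>smooth2\<close> is twice continuously differentiable, so Ito's formula applies.
  Its stochastic integral tends to \<open>I\<close> by stability, and this leaves the correction
  term as the quantity to be identified.\<close>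

lemma smooth_ito:
 obtains J where "uconv M J I"
  "!!n. AE w in M. ALL t>=0. ito_smooth J n t w"
proof -
 have [measurable]: "bump n : bor borel" for n by (rule borel_measurable_continuous_onI) (intro bump_cont continuous_on_id)
 have [measurable]: "ramp n : bor borel" for n by (rule borel_measurable_continuous_onI) (use ramp_derivative DERIV_isCont isCont_cont in blast)
 have m: "(%w. smooth1 (pW w) n (tc.X t w)) : bor (FF t)" "(%w. smooth0 (pW w) n (tc.X t w)) : bor (FF t)" if t: "0 <= t" for t n
 proof -
  have [measurable]: "tc.X t : bor (FF t)" by (rule tc.X_adapted[OF t])
  note ns = node_sum_meas[OF FF_full[OF t] W_FF[OF t]]
  note [measurable] = W_FF[OF t]
  have [measurable]: "(%w. node_sum ramp (pW w) n (tc.X t w)) : bor (FF t)"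
  "(%w. node_sum ramp (%x. W (- x) w) n (- tc.X t w)) : bor (FF t)"
  "(%w. node_sum bump (pW w) n (tc.X t w)) : bor (FF t)"
  "(%w. node_sum bump (%x. W (- x) w) n (- tc.X t w)) : bor (FF t)" by (rule ns; measurable)+
  show "(%w. smooth1 (pW w) n (tc.X t w)) : bor (FF t)" "(%w. smooth0 (pW w) n (tc.X t w)) : bor (FF t)" unfolding smooth1_def smooth0_def by measurable
 qed
 have c1: "continuous_on UNIV (smooth1 ww n)" for ww n using smooth_derivative(2) by (meson DERIV_isCont isCont_cont)
 have ca: "cadapt M FF (%t w. smooth1 (pW w) n (tc.X t w))" for n unfolding ca_def
 proof (intro conjI allI impI m)
  show "acont M (%t w. smooth1 (pW w) n (tc.X t w))" using tc.X_continuous by eventually_elim (rule cont_comp2[OF c1], auto)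
 qed
 have "ALL n. EX J. SI M FF tc.X (%t w. smooth1 (pW w) n (tc.X t w)) J" by (rule allI, rule tc.SI_exists[OF ca])
 from choice[OF this] obtain J where J: "!!n. SI M FF tc.X (%t w. smooth1 (pW w) n (tc.X t w)) (J n)" by blast
 have "uconv M (%n t w. smooth1 (pW w) n (tc.X t w)) rate" proof (rule subseq_ae_AE)
  show "AE w in M. ALL s. strict_mono s --> upath (%n t. smooth1 (pW w) (s n) (tc.X t w)) (%t. rate t w)" using good_path tc.X_continuous
  proof eventually_elim case (elim w)
  then interpret environment "%x. W x w" by (simp add: env_path_def)
  have r: "rate t w = h (tc.X t w)" for t by (simp add: rate_def h_def tc.X_def)
  show ?case unfolding upath_def r proof (intro allI impI)
  fix s :: "nat => nat" and t :: real assume s: "strict_mono s"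
  have "bounded ((%u. tc.X u w) ` {0..t})" by (intro compact_imp_bounded compact_image cont_subset[OF elim(2)]) auto
  then obtain R where R: "ALL v:(%u. tc.X u w) ` {0..t}. norm v <= R" unfolding bounded_iff by blast
  have "0 <= abs R" by simp
  from smooth1_limit[OF this] have "uniform_limit {-abs R..abs R} (%n. smooth1 (pW w) (s n)) h sequentially"
  unfolding uniform_limit_iff using eventually_subseq[OF s] by blast
  thus "uniform_limit {0..t} (%n t. smooth1 (pW w) (s n) (tc.X t w)) (%t. h (tc.X t w)) sequentially" by (rule uniform_limit_compose') (use R in force)
  qed qed qed
 hence "uconv M J I" by (rule SI_stable[OF I[folded time_changed_eq] J])
 thus ?thesis proof (rule that)
  show "AE w in M. ALL t>=0. ito_smooth J n t w" for n
  proof (rule tc.ito_random[OF _ m J])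
  show "AE w in M. (ALL z. (smooth2 (pW w) n hasD smooth1 (pW w) n z) (at z)) &
  (ALL z. (smooth1 (pW w) n hasD smooth0 (pW w) n z) (at z)) & continuous_on UNIV (smooth0 (pW w) n)"
  by (intro AE_I2 conjI allI smooth_derivative smooth0_cont)
  show "AE w in M. cont0 (%u. smooth0 (pW w) n (B u w)) & (ALL s>=0. smooth0 (pW w) n (tc.X s w) = smooth0 (pW w) n (B (tau s w) w))"
  using dr.B_continuous by eventually_elim (auto simp: tc.X_def intro: cont_comp2[OF smooth0_cont])
  qed qed qed

text \<open>The equation solved for the drift, at the time \<open>xi\<close> of \<open>B\<close>:
  inserting \<open>tau t\<close> for \<open>xi\<close> returns the stochastic equation. What has to
  be proved is that it equals the Stratonovich integral.\<close>

definition lineint :: "real => 'a => real" where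
 "lineint xi w = 2*(I (clock (pW w) (%s. B s w) xi) w - inv (scale_of W w) (B xi w))"

lemma line_integral_cont: "acont M lineint"
proof -
 have "acont M I" using I by (simp add: SI_def ca_def)
 thus ?thesis using good_path dr.B_continuous proof eventually_elim case (elim w)
  then interpret env_path "%x. W x w" "%s. B s w" by simp
  show ?case unfolding lineint_def
  by (intro continuous_intros cont_comp2[OF elim(1) clock_cont] cont_comp2[OF inv_cont elim(3)]) (auto simp: clock_inv)
 qed qed

text \<open>Nonnegative, continuous in \<open>a\<close>, and positive exactly when the path up to time \<open>\<xi>\<close> stays
  strictly between the images of \<open>1 - a\<close> and \<open>a - 1\<close> under the scale function.\<close>

definition margin :: "real => real => 'a => real" where
 "margin xi a w = max 0 (min (scale_of W w (a - 1) - Sup ((%u. abs (B u w)) ` {0..xi})) (- scale_of W w (- (a - 1)) - Sup ((%u. abs (B u w)) ` {0..xi})))"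

text \<open>Along the environment the two half-line sums converge to \<open>Ap\<close> and
  \<open>Am\<close>; along the diffusion the same sums make up the correction in Ito's formula for
  \<open>smooth2\<close>. The factor \<open>margin\<close> restricts the comparison to paths whose
  range is covered by the window \<open>[-a,a]\<close>.\<close>

lemma line_integral_halves:
 fixes Ipos Ineg :: "real => 'a => real"
 assumes xi: "0 <= xi" and a: "0 <= a" and p: "pconv M (wsum xi W (%x w. scale_of W w x) a) Ap"
  and m: "pconv M (wsum xi (%x. W (- x)) (%x w. scale_of W w (- x)) a) Am"
 shows "AE w in M. (Ap w - Am w - lineint xi w) * margin xi a w = 0"
proof -
 define P where "P n w = wsum xi W (%x w. scale_of W w x) a n w" for n w
 define Q where "Q n w = wsum xi (%x. W (- x)) (%x w. scale_of W w (- x)) a n w" for n w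
 obtain J where J: "uconv M J I"
  "!!n. AE w in M. ALL t>=0. ito_smooth J n t w" by (rule smooth_ito) blast
 have "subseq_ae M (%s w. (%n. P (s n) w) ---> Ap w & (%n. Q (s n) w) ---> Am w & upath (%n u. J (s n) u w) (%u. I u w))"
 proof (rule subseq_ae_conj[OF p[folded P_def] subseq_ae_conj[OF m[folded Q_def] J(1)]])
  show "(%n. P (s n) w) ---> Ap w ==> (%n. P ((s o q) n) w) ---> Ap w" if "strict_mono q" for s q w by (rule tendsto_subseq[OF that, where f="%n. P n w"])
  show "(%n. Q (s n) w) ---> Am w ==> (%n. Q ((s o q) n) w) ---> Am w" if "strict_mono q" for s q w by (rule tendsto_subseq[OF that, where f="%n. Q n w"])
 qed
 then obtain q where q: "strict_mono q"
  "AE w in M. (%n. P (q n) w) ---> Ap w & (%n. Q (q n) w) ---> Am w & upath (%n u. J (q n) u w) (%u. I u w)"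
  unfolding subseq_ae_def using strict_mono_id by (force simp: id_def comp_def)
 have "AE w in M. ALL n. ALL t>=0. ito_smooth J n t w" unfolding AE_all_countable using J(2) by blast
 thus ?thesis using q(2) good_path proof eventually_elim case (elim w)
  then interpret env_path "%x. W x w" "%s. B s w" by simp
  interpret mi: environment "mirror (pW w)" by (rule mirror_environment)
  show ?case proof (cases "margin xi a w = 0") case False
  define k where "k = Sup ((%u. abs (B u w)) ` {0..xi})"
  have bx: "continuous_on {0..xi} (%u. B u w)" by (rule cont_subset[OF bc]) auto
  have "bdd_above ((%u. abs (B u w)) ` {0..xi})" by (intro bounded_imp_bdd_above compact_imp_bounded compact_image continuous_intros bx) auto
  hence bk: "abs (B u w) <= k" if "u : {0..xi}" for u unfolding k_def using that by (intro cSup_upper) auto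
  have k0: "0 <= k" using order_trans[OF abs_ge_zero bk[of 0]] xi by simp
  have ka: "k < S (a - 1)" "k < - S (- (a - 1))" using False by (auto simp: margin_def k_def[symmetric] max_def split: if_splits)
  have a1: "1 <= a" using scale_less_iff[of 0 "a - 1"] k0 ka(1) by (simp add: scale_0)
  define Sgp where "Sgp n = (SUM i<n*2^n. (exp (- W (dy n (Suc i)) w) - exp (- W (dy n i) w)) * integral {0..xi} (%u. bump n (B u w - S (dy n i))))" for n
  define Sgm where "Sgm n = (SUM i<n*2^n. (exp (- W (- (dy n (Suc i))) w) - exp (- W (- (dy n i)) w)) * integral {0..xi} (%u. bump n (B u w - S (- (dy n i)))))" for n
  have ev1: "EV n. P n w = - Sgp n" unfolding P_def Sgp_def by (rule stopped_sum_eq[OF _ a1 ka(1)]) (use bk in force)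
  have refl: "bump n (- B u w - - S (- (dy n i))) = bump n (B u w - S (- (dy n i)))" for n u i using bump_props(3)[of n "B u w - S (- (dy n i))"] by simp
  have ev2: "EV n. Q n w = - Sgm n"
  using mi.stopped_sum_eq[of xi "%u. - B u w" k a, OF _ a1] bk ka(2) unfolding Q_def Sgm_def mirror_scale refl by (force simp: abs_le_iff)
  have "(%n. - Sgp (q n)) ---> Ap w" by (rule Lim_transform_eventually[OF conjunct1[OF elim(2)] eventually_subseq[OF q(1) ev1]])
  moreover have "(%n. - Sgm (q n)) ---> Am w" by (rule Lim_transform_eventually[OF conjunct1[OF conjunct2[OF elim(2)]] eventually_subseq[OF q(1) ev2]])
  moreover have "(%n. J (q n) (T xi) w) ---> I (T xi) w" by (rule upathD[OF conjunct2[OF conjunct2[OF elim(2)]]]) (rule clock_inv(4)[OF xi])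
  ultimately have l1: "(%n. J (q n) (T xi) w + 1/2*(- Sgm (q n) - - Sgp (q n))) ---> I (T xi) w + 1/2*(Am w - Ap w)" by (intro tendsto_intros)
  have eq: "smooth2 (pW w) n (B xi w) - smooth2 (pW w) n 0 = J n (T xi) w + 1/2*(- Sgm n - - Sgp n)" for n
  using elim(1)[rule_format, OF clock_inv(4)[OF xi], of n] smooth0_integral[OF bx, of n] elim(3)
  unfolding Sgp_def[symmetric] Sgm_def[symmetric] by (simp add: tc.X_def clock_inv(3)[OF xi] clock_inv_0)
  have "(%n. J (q n) (T xi) w + 1/2*(- Sgm (q n) - - Sgp (q n))) ---> inv S (B xi w)"
  using LIMSEQ_subseq_LIMSEQ[OF smooth2_limit q(1), of "B xi w"] unfolding comp_def eq .
  from LIMSEQ_unique[OF this l1] have "Ap w - Am w = lineint xi w" by (simp add: lineint_def field_simps)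
  thus ?thesis by simp
  qed simp
 qed qed

text \<open>For fixed \<xi> the integrals over \<open>[-a,a]\<close> are eventually constant in
  \<open>a\<close>: once the window covers the range of \<open>B\<close> up to time \<xi>, enlarging
  it adds no local time.\<close>

lemma strat_line: "strat_line_integral M W B (%x u. exp (- u)) lineint" unfolding strat_line_integral_def
proof (intro conjI allI impI strat_integrand_exp line_integral_cont)
 fix xi :: real assume xi: "0 <= xi"
 obtain Ipos Ineg where ih: "ito_halves M W B (%x u. exp (- u)) xi Ipos Ineg"
  and p: "!!a. 0 <= a ==> pconv M (wsum xi W (%x w. scale_of W w x) a)
  (corr xi W (%x w. scale_of W w x) Ipos a)"
  and m: "!!a. 0 <= a ==> pconv M (wsum xi (%x. W (- x)) (%x w. scale_of W w (- x)) a)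
  (corr xi (%x. W (- x)) (%x w. scale_of W w (- x)) Ineg a)" by (rule halves[OF xi]) blast
 define F where "F w x = exp (- W x w) * ell w xi (scale_of W w x)" for w x
 define A where "A a w = (Ipos a w - 1/2 * integral {0..a} (F w)) - (Ineg a w - 1/2 * integral {0..a} (%x. F w (- x)))" for a w
 have Fc: "AE w in M. continuous_on UNIV (F w)" using good_path proof eventually_elim case (elim w)
  then interpret env_path "%x. W x w" "%s. B s w" by simp
  have "continuous_on ({0..} \<times> UNIV) (%(t, x). ell w t x)" using elim by (simp add: continuous_occupation_density_def)
  hence "continuous_on UNIV (%x. (%(t, x). ell w t x) (xi, S x))" by (rule cont_comp2) (use xi in "auto intro!: continuous_intros scale_cont")
  thus ?case unfolding F_def by (intro continuous_intros wc) simp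
 qed
 have Ipm: "AE w in M. cont0 (%x. Ipos x w) & cont0 (%x. Ineg x w) & Ipos 0 w = 0 & Ineg 0 w = 0" proof -
  have s: "SI M (environment_filtration M W B) W (%x w. exp (- W x w) * ell w xi (scale_of W w x)) Ipos"
  "SI M (environment_filtration M (%x. W (- x)) B) (%x. W (- x)) (%x w. exp (- W (- x) w) * ell w xi (scale_of W w (- x))) Ineg"
  using ih by (simp_all add: ito_halves_def)
  hence "acont M Ipos" "acont M Ineg" by (simp_all add: SI_def ca_def)
  thus ?thesis using SI_0[OF s(1)] SI_0[OF s(2)] by eventually_elim simp
 qed
 \<comment> \<open>The window from which equality holds is random, so an almost sure statement for
   each fixed \<open>a\<close> is not enough; the product with \<open>margin\<close> is continuous
   in \<open>a\<close>, which gives all \<open>a\<close> on one event.\<close>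
 have zero: "AE w in M. ALL a>=0. (A a w - lineint xi w) * margin xi a w = 0" proof (rule AE_continuous_eq)
  show "AE w in M. (A a w - lineint xi w) * margin xi a w = 0" if "0 <= a" for a
  using line_integral_halves[OF xi that p[OF that] m[OF that]] by (simp add: A_def F_def[abs_def])
  show "acont M (%a w. (A a w - lineint xi w) * margin xi a w)" using Fc Ipm good_path
  proof eventually_elim case (elim w)
  then interpret env_path "%x. W x w" "%s. B s w" by simp
  have ic: "cont0 (%a. integral {0..a} f)" if f: "continuous_on UNIV f" for f :: "real => real"
  by (intro cont_halfline indefinite_integral_continuous_1 int_cont cont_subset[OF f]) simp
  have "continuous_on UNIV (%x. F w (- x))" by (rule cont_comp2[OF elim(1)]) (auto intro: continuous_intros)
  note ics = ic[OF elim(1)] ic[OF this]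
  have sc: "cont0 (%a. S (a - 1))" "cont0 (%a. S (- (a - 1)))" by (rule cont_comp2[OF scale_cont[of UNIV]], auto intro!: continuous_intros)+
  show ?case unfolding A_def margin_def by (intro continuous_intros ics sc) (use elim(2) in auto)
  qed
 qed auto
 have "AE w in M. ((%a. strat_integral W B (%x u. exp (- u)) xi Ipos Ineg (- a) a w) \<longlongrightarrow> lineint xi w) at_top" using zero Fc Ipm good_path
 proof eventually_elim case (elim w)
  then interpret env_path "%x. W x w" "%s. B s w" by simp
  define k where "k = Sup ((%u. abs (B u w)) ` {0..xi})"
  have "\<forall>\<^sub>F a in at_top. max 1 (max (inv S (k + 1)) (- inv S (- (k + 1))) + 1) < a" by (rule eventually_gt_at_top)
  hence "\<forall>\<^sub>F a in at_top. strat_integral W B (%x u. exp (- u)) xi Ipos Ineg (- a) a w = lineint xi w"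
  proof eventually_elim case big: (elim a)
  hence a: "0 < a" "inv S (k + 1) < a - 1" "- (a - 1) < inv S (- (k + 1))" by auto
  have "k + 1 < S (a - 1)" "S (- (a - 1)) < - (k + 1)" using scale_strict[OF a(2)] scale_strict[OF a(3)] by simp_all
  hence "margin xi a w ~= 0" by (simp add: margin_def k_def[symmetric])
  hence Aa: "A a w = lineint xi w" using elim(1) a(1) by (metis eq_iff_diff_eq_0 less_imp_le mult_eq_0_iff)
  have "((%u. exp (- u)) hasD - exp (- u)) (at u)" for u :: real by (auto intro!: derivative_eq_intros)
  hence dd: "deriv (%u. exp (- u)) u = - exp (- u)" for u :: real by (rule DERIV_imp_deriv)
  have "continuous_on UNIV (%x. - F w x)" by (intro continuous_intros elim(2))
  from integral_sgn[OF this less_imp_le[OF a(1)]]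
  \<comment> \<open>The derivative of \<open>exp (- u)\<close> reverses the sign, so the
    \<open>sgn\<close> term subtracts the correction on the right half and adds it on the left, as
    in \<open>A\<close>.\<close>
  have li: "(LBINT x=ereal (- a)..ereal a. sgn x * deriv (%u. exp (- u)) (W x w) * ell w xi (S x)) = integral {0..a} (%x. F w (- x)) - integral {0..a} (F w)"
  by (simp add: dd F_def[abs_def] mult.assoc)
  have "strat_integral W B (%x u. exp (- u)) xi Ipos Ineg (- a) a w = A a w"
  using a(1) elim(3) unfolding strat_integral_def li by (simp add: two_sided_ito_def A_def algebra_simps)
  thus ?case using Aa by simp
  qed
  thus ?case by (rule tendsto_eventually)
 qed
 thus "EX Iplus Iminus. ito_halves M W B (%x u. exp (- u)) xi Iplus Iminus &
  (AE w in M. ((%a. strat_integral W B (%x u. exp (- u)) xi Iplus Iminus (- a) a w) \<longlongrightarrow> lineint xi w) at_top)" using ih by blast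
qed

lemma noise: "noise_integral M W B (%t w. lineint (tau t w) w)" unfolding noise_integral_def using strat_line by blast

lemma diffusion_equation: "AE w in M. ALL t>=0. brox_diffusion W B t w = I t w - 1/2 * lineint (tau t w) w" using good_path
proof eventually_elim case (elim w)
 then interpret env_path "%x. W x w" "%s. B s w" by simp
 show ?case by (simp add: brox_diffusion_def lineint_def clock_inv diff_divide_distrib)
qed

end

lemma diffusion_0: "AE w in M. brox_diffusion W B 0 w = 0" using good_path
proof eventually_elim case (elim w)
 then interpret env_path "%x. W x w" "%s. B s w" by simp
 show ?case using elim by (simp add: brox_diffusion_def clock_inv_0 inv_0)
qed

end

theorem proposition2p8:
  fixes M :: "'a measure" and W B X :: "real \<Rightarrow> 'a \<Rightarrow> real"
  assumes "prob_space M" and "complete_measure M"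
    and "two_sided_brownian_motion M W"
    and "brownian_motion M B"
    and "independent_processes M {0..} B UNIV W"
    and "\<And>t \<omega>. 0 \<le> t \<Longrightarrow> \<omega> \<in> space M \<Longrightarrow>
           X t \<omega> = inv (scale_of W \<omega>) (B (clock_inv_of W B t \<omega>) \<omega>)"
  shows "\<exists>\<B>. stochastic_integral M (time_changed_filtration M W B) (time_changed W B)
             (\<lambda>s \<omega>. exp (- W (inv (scale_of W \<omega>) (B (clock_inv_of W B s \<omega>) \<omega>)) \<omega>)) \<B> \<and>
           (\<forall>\<B>'. stochastic_integral M (time_changed_filtration M W B) (time_changed W B)
             (\<lambda>s \<omega>. exp (- W (inv (scale_of W \<omega>) (B (clock_inv_of W B s \<omega>) \<omega>)) \<omega>)) \<B>' \<longrightarrow>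
             (AE \<omega> in M. \<forall>t\<ge>0. \<B>' t \<omega> = \<B> t \<omega>)) \<and>
           brownian_motion M \<B> \<and>
           independent_processes M {0..} \<B> UNIV W \<and>
           (\<exists>F. weak_solution M F W X \<B>) \<and>
           (\<exists>D. noise_integral M W B D \<and>
              (\<forall>t\<ge>0. AE \<omega> in M. X t \<omega> = - 1 / 2 * D t \<omega> + \<B> t \<omega>)) \<and>
           (AE \<omega> in M. X 0 \<omega> = 0)"
proof -
 interpret brox M W B using assms(1-5) by (simp add: brox_def brox_axioms_def cps_def)
 have X: "X t w = brox_diffusion W B t w" if "0 <= t" "w : space M" for t w using assms(6)[OF that] by (simp add: brox_diffusion_def)
 obtain \<B> where SI: "SI M FF (time_changed W B) rate \<B>" using tc.SI_exists[OF rate_ca] unfolding time_changed_eq by blast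
 have rate: "rate = (%s w. exp (- W (inv (scale_of W w) (B (clock_inv_of W B s w) w)) w))" by (simp add: rate_def fun_eq_iff)
 let ?D = "%t w. lineint \<B> (tau t w) w"
 note bm = driving_bm[OF SI] and ind = driving_indep[OF SI]
 have Xae: "AE w in M. ALL t>=0. X t w = brox_diffusion W B t w" using AE_space by eventually_elim (simp add: X)
 have Xca: "cadapt M FF X" unfolding ca_def proof (intro conjI allI impI)
  show "X t : bor (FF t)" if t: "0 <= t" for t using brox_ca t unfolding ca_def
  by (subst measurable_cong[where g="brox_diffusion W B t"]) (auto simp: space_FF X)
  have "AE w in M. cont0 (%t. brox_diffusion W B t w)" using brox_ca by (simp add: ca_def)
  thus "AE w in M. cont0 (%t. X t w)" using Xae by eventually_elim (rule continuous_on_eq, auto)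
 qed
 have eq: "AE w in M. X t w = \<B> t w - 1/2 * ?D t w" if "0 <= t" for t using Xae diffusion_equation[OF SI] by eventually_elim (use that in simp)
 \<comment> \<open>The time-changed filtration is the witness: the diffusion is adapted to it and
   the integral is a Brownian motion for it. The Brownian motion representing \<open>X\<close> is
   \<open>B\<close> itself.\<close>
 have weak: "weak_solution M FF W X \<B>" unfolding weak_solution_def
 proof (intro conjI tc.filt Xca bm ind, rule exI[of _ B], intro conjI B BW Xae, rule exI[of _ ?D], intro conjI allI impI noise[OF SI])
  show "AE w in M. X t w = \<B> t w - 1/2 * ?D t w" if "0 <= t" for t by (rule eq[OF that])
 qed
 show ?thesis proof (rule exI[of _ \<B>], intro conjI allI impI)
  show "SI M FF (time_changed W B) (%s w. exp (- W (inv (scale_of W w) (B (clock_inv_of W B s w) w)) w)) \<B>" using SI by (simp only: rate)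
  fix \<B>' assume "SI M FF (time_changed W B) (%s w. exp (- W (inv (scale_of W w) (B (clock_inv_of W B s w) w)) w)) \<B>'"
  thus "AE w in M. ALL t>=0. \<B>' t w = \<B> t w" using SI_unique SI unfolding rate by blast
 next
  show "brownian_motion M \<B>" by (rule brownian_motion_wrt_natural[OF bm])
  show "independent_processes M {0..} \<B> UNIV W" by (rule ind)
  show "EX F. weak_solution M F W X \<B>" using weak by blast
  show "EX D. noise_integral M W B D & (ALL t>=0. AE w in M. X t w = - 1/2 * D t w + \<B> t w)"
  proof (rule exI[of _ ?D], intro conjI allI impI noise[OF SI])
  show "AE w in M. X t w = - 1/2 * ?D t w + \<B> t w" if "0 <= t" for t using eq[OF that] by eventually_elim simp
  qed
  show "AE w in M. X 0 w = 0" using Xae diffusion_0 by eventually_elim simp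
 qed qed

end
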